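(* Let $\mu$ be a finite positive Borel measure on $\overline{\mathbb D}$ with $\mu\not\equiv0$. Let $(b,a)$ be a pair and let $\phi:=b/a$. Then $\mathcal D_\mu=\mathcal H(b)$ with equality of norms (that is, the two spaces coincide as sets of functions and $\|f\|_{\mathcal D_\mu}=\|f\|_{\mathcal H(b)}$ for every $f$ in this common space) if and only if there exist $\zeta\in\overline{\mathbb D}$ and $\alpha\in\mathbb C\setminus\{0\}$ such that $$\mu=|\alpha|^2\delta_\zeta\qquad\text{and}\qquad\phi(z)=\frac{\alpha z}{1-\overline{\zeta}z},$$ where $\delta_\zeta$ denotes the Dirac measure at $\zeta$.
   Context: $\mathbb D$ is the open unit disk, $\mathbb T$ the unit circle, $dA$ the normalized area measure on $\mathbb D$ (so $A(\mathbb D)=1$), $\mathrm{Hol}(\mathbb D)$ the space of holomorphic functions on $\mathbb D$, and $H^2$ the Hardy space with norm $\|f\|_{H^2}^2=\sum_n|\hat f(n)|^2=\lim_{r\to1^-}\frac1{2\pi}\int_{\mathbb T}|f(r\lambda)|^2|d\lambda|$. Weighted Dirichlet spaces. For a finite positive Borel measure $\mu\not\equiv0$ on $\overline{\mathbb D}$, define the positive superharmonic function $$\omega(z)=\int_{\mathbb D}\log\Bigl|\frac{1-\overline{\zeta}z}{\zeta-z}\Bigr|\frac{2}{1-|\zeta|^2}\,d\mu(\zeta)+\int_{\mathbb T}\frac{1-|z|^2}{|\zeta-z|^2}\,d\mu(\zeta)\qquad(z\in\mathbb D).$$ (Every positive superharmonic function on $\mathbb D$ has this form for a unique finite positive measure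 $\mu$ on $\overline{\mathbb D}$.) For $f\in\mathrm{Hol}(\mathbb D)$ put $\mathcal D_\mu(f):=\int_{\mathbb D}|f'(z)|^2\omega(z)\,dA(z)$. The space $\mathcal D_\mu$ is the set of $f\in\mathrm{Hol}(\mathbb D)$ with $\mathcal D_\mu(f)<\infty$. It is contained in $H^2$, and is a Hilbert space with the norm $\|f\|_{\mathcal D_\mu}^2:=\|f\|_{H^2}^2+\mathcal D_\mu(f)$. De Branges--Rovnyak spaces. For $\psi\in L^\infty(\mathbb T)$, the Toeplitz operator $T_\psi:H^2\to H^2$ is $T_\psi f:=P_+(\psi f)$, where $P_+:L^2(\mathbb T)\to H^2$ is the orthogonal projection. For $b\in H^\infty$ with $\|b\|_{H^\infty}\le1$, $\mathcal H(b)$ is the image of $H^2$ under $(I-T_bT_{\overline b})^{1/2}$, with the norm making $(I-T_bT_{\overline b})^{1/2}$ a partial isometry of $H^2$ onto $\mathcal H(b)$, i.e. $\|(I-T_bT_{\overline b})^{1/2}f\|_{\mathcal H(b)}=\|f\|_{H^2}$ for $f\in H^2\ominus\ker(I-T_bT_{\overline b})^{1/2}$. Equivalently, $\mathcal H(b)$ is the reproducing kernel Hilbert space on $\mathbb D$ with kernel $(1-\overline{b(w)}b(z))/(1-\overline wz)$. Pairs. The function $b$ is called non-extreme if it is a non-extreme point of the closed unit ball of $H^\infty$, equivalently $\log(1-|b|^2)\in L^1(\mathbb T)$. In that case there is a unique outer function $a\in H^\infty$ with $a(0)>0$ and $|a|^2+|b|^2=1$ a.e. on $\mathbb T$; $(b,a)$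 is then called a pair. *)

theory Defs
  imports "HOL-Probability.Probability" "HOL-Complex_Analysis.Complex_Analysis"
begin

text \<open>
  A function on the open unit disk is represented by the function on \<^typ>\<open>complex\<close> that vanishes
  off the disk. So equality of such functions is equality on the disk, and the function spaces
  below are linear subspaces of \<^typ>\<open>complex \<Rightarrow> complex\<close>.
\<close>

definition Hol_disk :: "(complex \<Rightarrow> complex) set" where
  "Hol_disk = {f. f holomorphic_on ball 0 1 \<and> (\<forall>z. z \<notin> ball 0 1 \<longrightarrow> f z = 0)}"

definition taylor_coeff :: "(complex \<Rightarrow> complex) \<Rightarrow> nat \<Rightarrow> complex" where
  "taylor_coeff f n = (deriv ^^ n) f 0 / fact n"

definition H2 :: "(complex \<Rightarrow> complex) set" where
  "H2 = {f \<in> Hol_disk. summable (\<lambda>n. (cmod (taylor_coeff f n))\<^sup>2)}"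

definition H2_norm :: "(complex \<Rightarrow> complex) \<Rightarrow> real" where
  "H2_norm f = sqrt (\<Sum>n. (cmod (taylor_coeff f n))\<^sup>2)"

definition H2_inner :: "(complex \<Rightarrow> complex) \<Rightarrow> (complex \<Rightarrow> complex) \<Rightarrow> complex" where
  "H2_inner f g = (\<Sum>n. taylor_coeff f n * cnj (taylor_coeff g n))"

definition Hinf :: "(complex \<Rightarrow> complex) set" where
  "Hinf = {f \<in> Hol_disk. bounded (f ` ball 0 1)}"

definition Hinf_norm :: "(complex \<Rightarrow> complex) \<Rightarrow> real" where
  "Hinf_norm f = (SUP z\<in>ball 0 1. cmod (f z))"

definition Hinf_unit_ball :: "(complex \<Rightarrow> complex) set" where
  "Hinf_unit_ball = {f \<in> Hinf. Hinf_norm f \<le> 1}"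


section \<open>Weighted Dirichlet spaces\<close>

text \<open>The first kernel is \<open>\<infinity>\<close> on the diagonal; \<^const>\<open>ln\<close> and division would give 0 there.\<close>

definition omega :: "complex measure \<Rightarrow> complex \<Rightarrow> ennreal" where
  "omega \<mu> z =
     (\<integral>\<^sup>+\<zeta>\<in>ball 0 1.
        (if \<zeta> = z then \<infinity>
         else ennreal (ln (cmod ((1 - cnj \<zeta> * z) / (\<zeta> - z))) * (2 / (1 - (cmod \<zeta>)\<^sup>2)))) \<partial>\<mu>)
   + (\<integral>\<^sup>+\<zeta>\<in>sphere 0 1. ennreal ((1 - (cmod z)\<^sup>2) / (cmod (\<zeta> - z))\<^sup>2) \<partial>\<mu>)"

definition dirichlet_integral :: "complex measure \<Rightarrow> (complex \<Rightarrow> complex) \<Rightarrow> ennreal" where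
  "dirichlet_integral \<mu> f =
     (\<integral>\<^sup>+z. ennreal ((cmod (deriv f z))\<^sup>2) * omega \<mu> z \<partial>uniform_measure lborel (ball 0 1))"

definition dirichlet_space :: "complex measure \<Rightarrow> (complex \<Rightarrow> complex) set" where
  "dirichlet_space \<mu> = {f \<in> Hol_disk. dirichlet_integral \<mu> f < \<infinity>}"

definition dirichlet_norm :: "complex measure \<Rightarrow> (complex \<Rightarrow> complex) \<Rightarrow> real" where
  "dirichlet_norm \<mu> f = sqrt ((H2_norm f)\<^sup>2 + enn2real (dirichlet_integral \<mu> f))"


section \<open>Boundary values and Toeplitz operators\<close>

text \<open>Normalized arc length on the unit circle.\<close>

definition arc_measure :: "complex measure" where
  "arc_measure =
     distr (uniform_measure lborel {0..2 * pi}) (restrict_space borel (sphere 0 1)) cis"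

definition radial_limit :: "(complex \<Rightarrow> complex) \<Rightarrow> complex \<Rightarrow> complex" where
  "radial_limit f \<xi> = Lim (at_left 1) (\<lambda>r::real. f (of_real r * \<xi>))"

text \<open>
  The orthogonal projection of \<open>L\<^sup>2\<close> of the circle onto \<open>H\<^sup>2\<close>, where \<open>H\<^sup>2\<close> is embedded in
  \<open>L\<^sup>2\<close> by taking radial limits.
\<close>

definition riesz_proj :: "(complex \<Rightarrow> complex) \<Rightarrow> complex \<Rightarrow> complex" where
  "riesz_proj g =
     (THE h. h \<in> H2 \<and>
        (\<forall>k\<in>H2. (\<integral>\<xi>. (g \<xi> - radial_limit h \<xi>) * cnj (radial_limit k \<xi>) \<partial>arc_measure) = 0))"

definition toeplitz ::
    "(complex \<Rightarrow> complex) \<Rightarrow> (complex \<Rightarrow> complex) \<Rightarrow> complex \<Rightarrow> complex" where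
  "toeplitz \<psi> f = riesz_proj (\<lambda>\<xi>. \<psi> \<xi> * radial_limit f \<xi>)"


section \<open>De Branges--Rovnyak spaces\<close>

definition H2_positive_operator ::
    "((complex \<Rightarrow> complex) \<Rightarrow> complex \<Rightarrow> complex) \<Rightarrow> bool" where
  "H2_positive_operator S \<longleftrightarrow>
     (\<forall>f\<in>H2. S f \<in> H2) \<and>
     (\<forall>f\<in>H2. \<forall>g\<in>H2. \<forall>c. S (\<lambda>z. c * f z + g z) = (\<lambda>z. c * S f z + S g z)) \<and>
     (\<exists>C. \<forall>f\<in>H2. H2_norm (S f) \<le> C * H2_norm f) \<and>
     (\<forall>f\<in>H2. H2_inner (S f) f \<in> \<real>\<^sub>\<ge>\<^sub>0)"

text \<open>
  The positive square root of a positive operator is unique on \<^const>\<open>H2\<close>; the choice only affects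
  values at arguments outside \<^const>\<open>H2\<close>, which are never used.
\<close>

definition H2_sqrt ::
    "((complex \<Rightarrow> complex) \<Rightarrow> complex \<Rightarrow> complex) \<Rightarrow> (complex \<Rightarrow> complex) \<Rightarrow> complex \<Rightarrow> complex" where
  "H2_sqrt T = (SOME S. H2_positive_operator S \<and> (\<forall>f\<in>H2. S (S f) = T f))"

definition dBR_operator ::
    "(complex \<Rightarrow> complex) \<Rightarrow> (complex \<Rightarrow> complex) \<Rightarrow> complex \<Rightarrow> complex" where
  "dBR_operator b =
     H2_sqrt (\<lambda>f z. f z -
       toeplitz (radial_limit b) (toeplitz (\<lambda>\<xi>. cnj (radial_limit b \<xi>)) f) z)"

definition dBR_space :: "(complex \<Rightarrow> complex) \<Rightarrow> (complex \<Rightarrow> complex) set" where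
  "dBR_space b = dBR_operator b ` H2"

definition dBR_norm :: "(complex \<Rightarrow> complex) \<Rightarrow> (complex \<Rightarrow> complex) \<Rightarrow> real" where
  "dBR_norm b f =
     H2_norm (THE g. g \<in> H2 \<and>
       (\<forall>k\<in>H2. dBR_operator b k = (\<lambda>z. 0) \<longrightarrow> H2_inner g k = 0) \<and>
       dBR_operator b g = f)"


section \<open>Pairs\<close>

definition non_extreme :: "(complex \<Rightarrow> complex) \<Rightarrow> bool" where
  "non_extreme b \<longleftrightarrow> b \<in> Hinf_unit_ball \<and>
     (\<exists>f\<in>Hinf_unit_ball. \<exists>g\<in>Hinf_unit_ball. \<exists>t::real.
        f \<noteq> g \<and> 0 < t \<and> t < 1 \<and> b = (\<lambda>z. of_real (1 - t) * f z + of_real t * g z))"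

text \<open>
  Since \<^term>\<open>ln (0::real) = 0\<close>, integrability of the logarithm of the modulus has to be
  complemented by nonvanishing almost everywhere.
\<close>

definition outer :: "(complex \<Rightarrow> complex) \<Rightarrow> bool" where
  "outer f \<longleftrightarrow> f \<in> Hol_disk \<and>
     (AE \<xi> in arc_measure. radial_limit f \<xi> \<noteq> 0) \<and>
     integrable arc_measure (\<lambda>\<xi>. ln (cmod (radial_limit f \<xi>))) \<and>
     (\<exists>c. cmod c = 1 \<and>
       (\<forall>z\<in>ball 0 1. f z =
          c * exp (\<integral>\<xi>. (\<xi> + z) / (\<xi> - z) * of_real (ln (cmod (radial_limit f \<xi>))) \<partial>arc_measure)))"

definition is_pair :: "(complex \<Rightarrow> complex) \<Rightarrow> (complex \<Rightarrow> complex) \<Rightarrow> bool" where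
  "is_pair b a \<longleftrightarrow> non_extreme b \<and> a \<in> Hinf \<and> outer a \<and>
     a 0 \<in> \<real> \<and> 0 < Re (a 0) \<and>
     (AE \<xi> in arc_measure. (cmod (radial_limit a \<xi>))\<^sup>2 + (cmod (radial_limit b \<xi>))\<^sup>2 = 1)"

end

theory Submission imports Defs "HOL-Real_Asymp.Real_Asymp" begin

text \<open>
  For a pair \<open>(b, a)\<close>, a function \<open>f \<in> H\<^sup>2\<close> belongs to \<open>H(b)\<close> iff \<open>T\<^sub>a\<^sup>* y = T\<^sub>b\<^sup>* f\<close> for some \<open>y \<in> H\<^sup>2\<close>; this
  \<open>y\<close> is unique because the outer function \<open>a\<close> is cyclic, and the norm of \<open>f\<close> in \<open>H(b)\<close> satisfies
  \<open>\<parallel>f\<parallel>\<^sub>b\<^sup>2 = \<parallel>f\<parallel>\<^sup>2 + \<parallel>y\<parallel>\<^sup>2\<close>. On the other side \<open>D\<^sub>\<mu>(f)\<close> is the integral of the local Dirichlet integrals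
  \<open>D\<^sub>\<zeta>(f)\<close> against \<open>\<mu>\<close>, and \<open>D\<^sub>\<zeta>(f) = \<parallel>g\<parallel>\<^sup>2\<close> whenever \<open>f = const + (z - \<zeta>) g\<close>: for \<open>|\<zeta>| = 1\<close> by
  telescoping Taylor coefficients, for \<open>|\<zeta>| < 1\<close> by moving \<open>\<zeta>\<close> to the origin with a disk automorphism.

  If \<open>b/a = \<alpha> z / (1 - cnj \<zeta> z)\<close>, then the two conditions on \<open>f\<close> are equivalent via \<open>y = cnj \<alpha> g\<close>. Conversely,
  replacing \<open>f\<close> by \<open>z f\<close> increases \<open>\<parallel>y\<parallel>\<^sup>2\<close> by \<open>|\<Lambda> f|\<^sup>2\<close> for a linear functional \<open>\<Lambda>\<close>, and \<open>D\<^sub>\<zeta>(f)\<close> by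
  \<open>|f(\<zeta>)|\<^sup>2\<close>, so equality of norms gives \<open>\<integral>|f|\<^sup>2 d\<mu> = |\<Lambda> f|\<^sup>2\<close> for polynomials. Applied to
  \<open>f = z\<^sup>n - \<kappa>\<close> in the kernel of \<open>\<Lambda>\<close> it shows that \<open>\<zeta>\<^sup>n\<close> is constant \<open>\<mu>\<close>-almost everywhere. So \<open>\<mu>\<close> is a point
  mass, and the values \<open>\<Lambda>(z\<^sup>n)\<close> determine \<open>b/a\<close>.
\<close>

text \<open>The definitions use two pictures of \<open>H2\<close>: Taylor coefficients for the norm,
  radial limits on the circle for Toeplitz operators, \<open>outer\<close> and pairs. Coefficient
  sequences are made a type, so that Hilbert space arguments run inside type classes and every
  operator acts on \<open>ell2\<close>. The main obstacle is the bridge to the circle: radial limits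
  must exist almost everywhere and carry the full norm, since otherwise neither
  \<open>riesz_proj\<close> nor the identity \<open>|a|^2 + |b|^2 = 1\<close> says anything about
  operators. Existence is Fatou's theorem, which rests on an L2 bound for the radial maximal
  function. The value of \<open>D_\<zeta>\<close> needs two separate computations, because its
  kernel changes type at the circle. What makes the comparison with \<open>H(b)\<close> uniform in
  \<open>\<zeta>\<close> is that \<open>f = const + (z - \<zeta>) g\<close> reads
  \<open>bshift x = g - \<zeta> *\<^sub>C bshift g\<close> on the whole closed disk, and that
  adjoint multiplications commute with the backward shift.\<close>

section \<open>Square summable sequences as a complex Hilbert space\<close>

typedef ell2 = "{x :: nat \<Rightarrow> complex. summable (\<lambda>n. (cmod (x n))\<^sup>2)}"
  morphisms coef Abs_ell2
  by (rule exI[of _ "\<lambda>_. 0"]) simp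

setup_lifting type_definition_ell2

lemma summable_coef_sq: "summable (\<lambda>n. (cmod (coef x n))\<^sup>2)"
  using coef[of x] by simp

lemma coef_Abs_ell2: "summable (\<lambda>n. (cmod (x n))\<^sup>2) \<Longrightarrow> coef (Abs_ell2 x) = x"
  by (simp add: Abs_ell2_inverse)

lemma ell2_eqI: "(\<And>n. coef x n = coef y n) \<Longrightarrow> x = y"
  by (simp add: coef_inject[symmetric] fun_eq_iff)

lemma sq_norm_add_le: "(cmod (a + b))\<^sup>2 \<le> 2 * (cmod a)\<^sup>2 + 2 * (cmod b)\<^sup>2"
proof -
  have "(cmod (a + b))\<^sup>2 \<le> (cmod a + cmod b)\<^sup>2"
    by (intro power_mono norm_triangle_ineq) auto
  also have "\<dots> \<le> 2 * (cmod a)\<^sup>2 + 2 * (cmod b)\<^sup>2"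
    using sum_squares_bound[of "cmod a" "cmod b"] by (simp add: power2_sum)
  finally show ?thesis .
qed

lemma summable_sq_add:
  assumes "summable (\<lambda>n. (cmod (x n))\<^sup>2)" "summable (\<lambda>n. (cmod (y n))\<^sup>2)"
  shows "summable (\<lambda>n. (cmod (x n + y n))\<^sup>2)"
  by (rule summable_comparison_test'[of "\<lambda>n. 2 * (cmod (x n))\<^sup>2 + 2 * (cmod (y n))\<^sup>2" 0])
     (auto intro!: summable_add summable_mult assms sq_norm_add_le)

lemma summable_sq_mult:
  assumes "summable (\<lambda>n. (cmod (x n))\<^sup>2)"
  shows "summable (\<lambda>n. (cmod (c * x n))\<^sup>2)"
  using summable_mult[OF assms, of "(cmod c)\<^sup>2"] by (simp add: norm_mult power_mult_distrib)

lemma summable_norm_coef_prod: "summable (\<lambda>n. cmod (coef x n * cnj (coef y n)))"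
proof (rule summable_comparison_test'[of "\<lambda>n. (cmod (coef x n))\<^sup>2 + (cmod (coef y n))\<^sup>2" 0])
  show "summable (\<lambda>n. (cmod (coef x n))\<^sup>2 + (cmod (coef y n))\<^sup>2)"
    by (intro summable_add summable_coef_sq)
  fix n
  have "cmod (coef x n) * cmod (coef y n) \<le> (cmod (coef x n))\<^sup>2 + (cmod (coef y n))\<^sup>2"
    using sum_squares_bound[of "cmod (coef x n)" "cmod (coef y n)"]
      mult_nonneg_nonneg[OF norm_ge_zero norm_ge_zero, of "coef x n" "coef y n"] by linarith
  then show "norm (cmod (coef x n * cnj (coef y n))) \<le> (cmod (coef x n))\<^sup>2 + (cmod (coef y n))\<^sup>2"
    by (simp add: norm_mult)
qed

lemma summable_coef_prod: "summable (\<lambda>n. coef x n * cnj (coef y n))"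
  by (rule summable_norm_cancel[OF summable_norm_coef_prod])

instantiation ell2 :: real_vector
begin
lift_definition zero_ell2 :: ell2 is "\<lambda>_. 0" by simp
lift_definition plus_ell2 :: "ell2 \<Rightarrow> ell2 \<Rightarrow> ell2" is "\<lambda>x y n. x n + y n"
  by (rule summable_sq_add)
lift_definition uminus_ell2 :: "ell2 \<Rightarrow> ell2" is "\<lambda>x n. - x n" by simp
lift_definition minus_ell2 :: "ell2 \<Rightarrow> ell2 \<Rightarrow> ell2" is "\<lambda>x y n. x n - y n"
  subgoal for x y using summable_sq_add[of x "\<lambda>n. - y n"] by simp
  done
lift_definition scaleR_ell2 :: "real \<Rightarrow> ell2 \<Rightarrow> ell2" is "\<lambda>r x n. of_real r * x n"
  by (rule summable_sq_mult)
instance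
  by standard (transfer; auto simp: algebra_simps)+
end

lemmas coef_simps = zero_ell2.rep_eq plus_ell2.rep_eq uminus_ell2.rep_eq minus_ell2.rep_eq
  scaleR_ell2.rep_eq

text \<open>The class \<open>real_inner\<close> carries a real inner product. The complex one is a
  function of its own, linear in the first argument like \<open>H2_inner\<close>, and its real part
  becomes the inner product of the class.\<close>

definition cinner :: "ell2 \<Rightarrow> ell2 \<Rightarrow> complex" where
  "cinner x y = (\<Sum>n. coef x n * cnj (coef y n))"

lemma cinner_add_left: "cinner (x + y) z = cinner x z + cinner y z"
  by (simp add: cinner_def coef_simps distrib_right suminf_add summable_coef_prod)

lemma cinner_commute: "cinner y x = cnj (cinner x y)"
proof -
  have "(\<lambda>n. cnj (coef x n * cnj (coef y n))) sums cnj (cinner x y)"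
    unfolding sums_cnj cinner_def by (rule summable_sums[OF summable_coef_prod])
  then show ?thesis unfolding cinner_def by (simp add: sums_iff mult.commute)
qed

lemma cinner_self_suminf: "cinner x x = of_real (\<Sum>n. (cmod (coef x n))\<^sup>2)"
proof -
  have "(\<lambda>n. of_real ((cmod (coef x n))\<^sup>2) :: complex) sums of_real (\<Sum>n. (cmod (coef x n))\<^sup>2)"
    unfolding sums_of_real_iff by (rule summable_sums[OF summable_coef_sq])
  then show ?thesis
    unfolding cinner_def complex_norm_square by (rule sums_unique[symmetric])
qed

instantiation ell2 :: real_inner
begin
definition inner_ell2 :: "ell2 \<Rightarrow> ell2 \<Rightarrow> real" where "inner_ell2 x y = Re (cinner x y)"
definition norm_ell2 :: "ell2 \<Rightarrow> real" where "norm_ell2 x = sqrt (inner x x)"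
definition sgn_ell2 :: "ell2 \<Rightarrow> ell2" where "sgn_ell2 x = x /\<^sub>R norm x"
definition dist_ell2 :: "ell2 \<Rightarrow> ell2 \<Rightarrow> real" where "dist_ell2 x y = norm (x - y)"
definition uniformity_ell2 :: "(ell2 \<times> ell2) filter" where
  "uniformity_ell2 = (INF e\<in>{0 <..}. principal {(x, y). dist x y < e})"
definition open_ell2 :: "ell2 set \<Rightarrow> bool" where
  "open_ell2 U \<longleftrightarrow> (\<forall>x\<in>U. eventually (\<lambda>(x', y). x' = x \<longrightarrow> y \<in> U) uniformity)"
instance
proof
  fix x y z :: ell2 and r :: real
  show "inner x y = inner y x"
    by (simp add: inner_ell2_def cinner_commute[of y x])
  show "inner (x + y) z = inner x z + inner y z"
    by (simp add: inner_ell2_def cinner_add_left)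
  have "cinner (r *\<^sub>R x) y = of_real r * cinner x y"
    unfolding cinner_def coef_simps mult.assoc by (rule suminf_mult[OF summable_coef_prod])
  then show "inner (r *\<^sub>R x) y = r * inner x y" by (simp add: inner_ell2_def)
  have *: "inner x x = (\<Sum>n. (cmod (coef x n))\<^sup>2)" for x
    by (simp add: inner_ell2_def cinner_self_suminf)
  show "0 \<le> inner x x" unfolding * by (intro suminf_nonneg summable_coef_sq) auto
  show "inner x x = 0 \<longleftrightarrow> x = 0"
    unfolding * by (subst suminf_eq_zero_iff[OF summable_coef_sq])
      (auto intro!: ell2_eqI simp: coef_simps)
qed (simp_all add: norm_ell2_def sgn_ell2_def dist_ell2_def uniformity_ell2_def open_ell2_def)
end

lemma norm_ell2_sq: "(norm x)\<^sup>2 = (\<Sum>n. (cmod (coef x n))\<^sup>2)"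
  by (simp add: power2_norm_eq_inner inner_ell2_def cinner_self_suminf)

lemma norm_ell2_sums: "(\<lambda>n. (cmod (coef x n))\<^sup>2) sums (norm x)\<^sup>2"
  unfolding norm_ell2_sq by (rule summable_sums[OF summable_coef_sq])

lemma sum_coef_sq_le: "(\<Sum>n<N. (cmod (coef x n))\<^sup>2) \<le> (norm x)\<^sup>2"
  unfolding norm_ell2_sq by (intro sum_le_suminf summable_coef_sq) auto

lemma norm_coef_le: "cmod (coef x n) \<le> norm x"
proof -
  have "(cmod (coef x n))\<^sup>2 \<le> (\<Sum>k<Suc n. (cmod (coef x k))\<^sup>2)"
    by (rule member_le_sum) auto
  also have "\<dots> \<le> (norm x)\<^sup>2" by (rule sum_coef_sq_le)
  finally show ?thesis by (rule power2_le_imp_le) simp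
qed

lemma cinner_self: "cinner x x = of_real ((norm x)\<^sup>2)"
  by (simp add: norm_ell2_sq cinner_self_suminf)

text \<open>Coordinatewise limits exist; what remains is that the limit is square summable and that
  the norm distance tends to 0. Both follow from the Cauchy bound on finite partial sums, where the
  limit can be taken term by term.\<close>

instance ell2 :: banach
proof
  fix X :: "nat \<Rightarrow> ell2" assume "Cauchy X"
  have "Cauchy (\<lambda>m. coef (X m) n)" for n
  proof (rule metric_CauchyI)
    fix e :: real assume "e > 0"
    then obtain M where M: "\<And>m k. m \<ge> M \<Longrightarrow> k \<ge> M \<Longrightarrow> dist (X m) (X k) < e"
      using \<open>Cauchy X\<close> unfolding Cauchy_def by blast
    have "dist (coef (X m) n) (coef (X k) n) < e" if "m \<ge> M" "k \<ge> M" for m k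
      using M[OF that] norm_coef_le[of "X m - X k" n]
      by (simp add: dist_norm coef_simps)
    then show "\<exists>M. \<forall>m\<ge>M. \<forall>n'\<ge>M. dist (coef (X m) n) (coef (X n') n) < e" by blast
  qed
  then have "\<exists>l. (\<lambda>m. coef (X m) n) \<longlonglongrightarrow> l" for n
    using Cauchy_convergent_iff convergent_def by blast
  then obtain a where a: "\<And>n. (\<lambda>m. coef (X m) n) \<longlonglongrightarrow> a n" by metis
  have bound: "(\<Sum>n<N. (cmod (coef (X m) n - a n))\<^sup>2) \<le> e\<^sup>2"
    if "\<And>k. k \<ge> M \<Longrightarrow> norm (X m - X k) \<le> e" for m N e M
  proof (rule LIMSEQ_le_const2)
    show "(\<lambda>k. \<Sum>n<N. (cmod (coef (X m) n - coef (X k) n))\<^sup>2)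
        \<longlonglongrightarrow> (\<Sum>n<N. (cmod (coef (X m) n - a n))\<^sup>2)"
      by (intro tendsto_intros a)
    have "(\<Sum>n<N. (cmod (coef (X m) n - coef (X k) n))\<^sup>2) \<le> e\<^sup>2" if "k \<ge> M" for k
    proof -
      have "(\<Sum>n<N. (cmod (coef (X m - X k) n))\<^sup>2) \<le> (norm (X m - X k))\<^sup>2"
        by (rule sum_coef_sq_le)
      also have "\<dots> \<le> e\<^sup>2" using \<open>\<And>k. k \<ge> M \<Longrightarrow> norm (X m - X k) \<le> e\<close> that
        by (intro power_mono) auto
      finally show ?thesis by (simp add: coef_simps)
    qed
    then show "\<exists>M. \<forall>k\<ge>M. (\<Sum>n<N. (cmod (coef (X m) n - coef (X k) n))\<^sup>2) \<le> e\<^sup>2" by blast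
  qed
  have summ: "summable (\<lambda>n. (cmod (coef (X m) n - a n))\<^sup>2)"
    if "\<And>k. k \<ge> M \<Longrightarrow> norm (X m - X k) \<le> e" for m e M
    by (rule summableI_nonneg_bounded[of _ "e\<^sup>2"]) (use bound[OF that] in auto)
  obtain M where M: "\<And>m k. m \<ge> M \<Longrightarrow> k \<ge> M \<Longrightarrow> dist (X m) (X k) < 1"
    using \<open>Cauchy X\<close> unfolding Cauchy_def by (metis zero_less_one)
  have "summable (\<lambda>n. (cmod (coef (X M) n - a n))\<^sup>2)"
    by (rule summ[of M M 1]) (use M[of M] in \<open>simp add: dist_norm less_imp_le\<close>)
  \<comment> \<open>The limit is recovered as \<open>X M\<close> minus the difference just
    bounded.\<close>
  then have "summable (\<lambda>n. (cmod (coef (X M) n + (-1) * (coef (X M) n - a n)))\<^sup>2)"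
    by (intro summable_sq_add summable_sq_mult summable_coef_sq)
  then have suma: "summable (\<lambda>n. (cmod (a n))\<^sup>2)" by simp
  have "X \<longlonglongrightarrow> Abs_ell2 a"
  proof (rule metric_LIMSEQ_I)
    fix e :: real assume "e > 0"
    then obtain M where M: "\<And>m k. m \<ge> M \<Longrightarrow> k \<ge> M \<Longrightarrow> dist (X m) (X k) < e/2"
      using \<open>Cauchy X\<close> unfolding Cauchy_def by (metis half_gt_zero)
    have "dist (X m) (Abs_ell2 a) < e" if "m \<ge> M" for m
    proof -
      have *: "norm (X m - X k) \<le> e/2" if "k \<ge> M" for k
        using M[OF \<open>m \<ge> M\<close> that] by (simp add: dist_norm less_imp_le)
      have "(norm (X m - Abs_ell2 a))\<^sup>2 \<le> (e/2)\<^sup>2"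
        unfolding norm_ell2_sq coef_simps coef_Abs_ell2[OF suma]
        by (intro suminf_le_const summ[of M m "e/2"] bound[of M m "e/2"] *)
      then have "norm (X m - Abs_ell2 a) \<le> e/2"
        by (rule power2_le_imp_le) (use \<open>e > 0\<close> in simp)
      then show ?thesis using \<open>e > 0\<close> by (simp add: dist_norm)
    qed
    then show "\<exists>M. \<forall>m\<ge>M. dist (X m) (Abs_ell2 a) < e" by blast
  qed
  then show "convergent X" by (auto simp: convergent_def)
qed

lift_definition scaleC :: "complex \<Rightarrow> ell2 \<Rightarrow> ell2" (infixr \<open>*\<^sub>C\<close> 75) is "\<lambda>c x n. c * x n"
  by (rule summable_sq_mult)

lemma scaleC_add_right: "c *\<^sub>C (x + y) = c *\<^sub>C x + c *\<^sub>C y"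
  and scaleC_add_left: "(c + d) *\<^sub>C x = c *\<^sub>C x + d *\<^sub>C x"
  and scaleC_diff_right: "c *\<^sub>C (x - y) = c *\<^sub>C x - c *\<^sub>C y"
  and scaleC_scaleC: "c *\<^sub>C d *\<^sub>C x = (c * d) *\<^sub>C x"
  and scaleC_of_real: "of_real r *\<^sub>C x = r *\<^sub>R x"
  and scaleC_one [simp]: "1 *\<^sub>C x = x"
  and scaleC_zero [simp]: "0 *\<^sub>C x = 0" "c *\<^sub>C 0 = 0"
  by (transfer; simp add: algebra_simps)+

lemma cinner_scaleC_left: "cinner (c *\<^sub>C x) y = c * cinner x y"
  unfolding cinner_def scaleC.rep_eq mult.assoc by (rule suminf_mult[OF summable_coef_prod])

lemma cinner_scaleC_right: "cinner x (c *\<^sub>C y) = cnj c * cinner x y"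
  by (metis cinner_commute cinner_scaleC_left complex_cnj_mult)

lemma cinner_add_right: "cinner x (y + z) = cinner x y + cinner x z"
  by (metis cinner_commute cinner_add_left complex_cnj_add)

lemma cinner_uminus_left: "cinner (- x) y = - cinner x y"
  by (simp add: cinner_def coef_simps suminf_minus summable_coef_prod)

lemma cinner_diff_left: "cinner (x - y) z = cinner x z - cinner y z"
  using cinner_add_left[of x "-y" z] by (simp add: cinner_uminus_left)

lemma cinner_zero [simp]: "cinner 0 y = 0" "cinner x 0 = 0"
  by (simp_all add: cinner_def coef_simps)

lemma Re_cinner: "Re (cinner x y) = inner x y"
  by (simp add: inner_ell2_def)

lemma Im_cinner: "Im (cinner x y) = inner x (\<i> *\<^sub>C y)"
  by (simp add: inner_ell2_def cinner_scaleC_right)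

lemma norm_scaleC: "norm (c *\<^sub>C x) = cmod c * norm x"
proof -
  have "of_real ((norm (c *\<^sub>C x))\<^sup>2) = (of_real ((cmod c * norm x)\<^sup>2) :: complex)"
    by (simp only: cinner_self[symmetric] cinner_scaleC_left cinner_scaleC_right)
       (simp add: cinner_self power_mult_distrib complex_norm_square[symmetric, unfolded of_real_power] mult.commute[of "cnj c"] flip: mult.assoc)
  then show ?thesis by (simp only: of_real_eq_iff power2_eq_iff_nonneg norm_ge_zero mult_nonneg_nonneg)
qed

text \<open>A unimodular factor on \<open>x\<close> makes the inner product real and non-negative
  without changing the norm, which leaves the real Cauchy-Schwarz inequality.\<close>

lemma norm_cinner_le: "cmod (cinner x y) \<le> norm x * norm y"
proof (cases "cinner x y = 0")
  case False
  define c where "c = cnj (sgn (cinner x y))"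
  have c: "cmod c = 1" using False by (simp add: c_def norm_sgn)
  have "cinner (c *\<^sub>C x) y = of_real (cmod (cinner x y))"
    unfolding cinner_scaleC_left c_def using False
    by (simp add: sgn_div_norm scaleR_conv_of_real field_simps
        complex_norm_square[symmetric, unfolded of_real_power] power2_eq_square[of "of_real _"])
  then have "cmod (cinner x y) = inner (c *\<^sub>C x) y" by (simp flip: Re_cinner)
  also have "\<dots> \<le> norm (c *\<^sub>C x) * norm y" by (rule norm_cauchy_schwarz)
  finally show ?thesis by (simp add: norm_scaleC c)
qed (simp add: mult_nonneg_nonneg)

lemma bounded_bilinear_cinner: "bounded_bilinear cinner"
proof
  show "cinner (r *\<^sub>R a) b = r *\<^sub>R cinner a b" "cinner a (r *\<^sub>R b) = r *\<^sub>R cinner a b" for r a b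
    by (simp_all add: cinner_scaleC_left cinner_scaleC_right scaleR_conv_of_real
        flip: scaleC_of_real)
  show "\<exists>K. \<forall>a b. cmod (cinner a b) \<le> norm a * norm b * K"
    by (rule exI[of _ 1]) (simp add: norm_cinner_le)
qed (simp_all add: cinner_add_left cinner_add_right)

lemmas tendsto_cinner = bounded_bilinear.tendsto[OF bounded_bilinear_cinner]
lemmas bounded_linear_cinner_left = bounded_bilinear.bounded_linear_left[OF bounded_bilinear_cinner]

lemma bounded_linear_scaleC: "bounded_linear ((*\<^sub>C) c)"
proof (rule bounded_linear_intro[where K = "cmod c"])
  show "c *\<^sub>C (r *\<^sub>R x) = r *\<^sub>R c *\<^sub>C x" for r x
    by (simp add: scaleC_scaleC mult.commute flip: scaleC_of_real)
qed (simp_all add: scaleC_add_right norm_scaleC)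

lemma eq_if_cinner_eq: "(\<And>z. cinner x z = cinner y z) \<Longrightarrow> x = y"
  using cinner_self[of "x - y"] by (simp add: cinner_diff_left)

lemma eq_if_cinner_eq': "(\<And>z. cinner z x = cinner z y) \<Longrightarrow> x = y"
  by (metis cinner_commute eq_if_cinner_eq)

lift_definition unit_vec :: "nat \<Rightarrow> ell2" is "\<lambda>m n. if n = m then 1 else 0"
  subgoal for m
    by (rule summable_finite[of "{m}"]) auto
  done

lemma cinner_unit_vec: "cinner x (unit_vec n) = coef x n"
proof -
  have "(\<lambda>k. coef x k * cnj (coef (unit_vec n) k)) sums (\<Sum>k\<in>{n}. coef x k * cnj (coef (unit_vec n) k))"
    by (rule sums_finite) (auto simp: unit_vec.rep_eq)
  then show ?thesis by (simp add: cinner_def sums_iff unit_vec.rep_eq)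
qed

subsection \<open>Linear operators\<close>

definition clinear_op :: "(ell2 \<Rightarrow> ell2) \<Rightarrow> bool" where
  "clinear_op T \<longleftrightarrow> bounded_linear T \<and> (\<forall>c x. T (c *\<^sub>C x) = c *\<^sub>C T x)"

lemma clinear_opI:
  assumes "\<And>x y. T (x + y) = T x + T y" "\<And>c x. T (c *\<^sub>C x) = c *\<^sub>C T x"
    "\<And>x. norm (T x) \<le> K * norm x"
  shows "clinear_op T"
  unfolding clinear_op_def
proof (intro conjI allI)
  show "bounded_linear T"
    using assms(2)[of "of_real _"]
    by (intro bounded_linear_intro[where K = K]) (simp_all add: assms(1,3) scaleC_of_real mult.commute)
qed (simp add: assms(2))

lemma clinear_op_bounded_linear: "clinear_op T \<Longrightarrow> bounded_linear T"
  and clinear_op_scaleC: "clinear_op T \<Longrightarrow> T (c *\<^sub>C x) = c *\<^sub>C T x"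
  by (simp_all add: clinear_op_def)

lemma clinear_op_linear: "clinear_op T \<Longrightarrow> linear T"
  by (simp add: bounded_linear.linear clinear_op_bounded_linear)

lemmas clinear_op_add = linear_add[OF clinear_op_linear]
lemmas clinear_op_diff = linear_diff[OF clinear_op_linear]
lemmas clinear_op_zero = linear_0[OF clinear_op_linear]
lemmas clinear_op_tendsto = bounded_linear.tendsto[OF clinear_op_bounded_linear]

lemma clinear_op_compose: "clinear_op S \<Longrightarrow> clinear_op T \<Longrightarrow> clinear_op (\<lambda>x. S (T x))"
  by (simp add: clinear_op_def bounded_linear_compose)

lemma clinear_op_ident: "clinear_op (\<lambda>x. x)"
  by (simp add: clinear_op_def bounded_linear_ident)

section \<open>Representation of functionals and adjoints\<close>

text \<open>A Riesz theorem relative to an operator. The representing vector is the limit of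
  \<open>X h\<close> along a minimizing sequence of the quadratic functional \<open>q\<close>. With
  the identity for \<open>X\<close> this is the usual Riesz theorem; with other operators it serves
  as a factorization and density principle, as in \<open>ex_companion\<close>,
  \<open>in_range_S\<close> and \<open>S_dense\<close>.\<close>

lemma riesz_range_real:
  fixes X :: "'b :: real_vector \<Rightarrow> 'a :: {real_inner, banach}" and l :: "'b \<Rightarrow> real"
  assumes "linear X" "linear l" and bd: "\<And>h. \<bar>l h\<bar> \<le> C * norm (X h)" and "0 \<le> C"
  obtains g where "g \<in> closure (range X)" "\<And>h. l h = inner g (X h)" "norm g \<le> C"
proof -
  interpret X: linear X by fact
  interpret l: linear l by fact
  define q where "q h = (norm (X h))\<^sup>2 - 2 * l h" for h
  have q_ge: "q h \<ge> - C\<^sup>2" for h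
  proof -
    have "0 \<le> (norm (X h) - C)\<^sup>2" by simp
    then show ?thesis using bd[of h] by (simp add: q_def power2_diff algebra_simps abs_le_iff)
  qed
  define m where "m = Inf (range q)"
  have bdd: "bdd_below (range q)" using q_ge by (auto intro!: bdd_belowI)
  have m_le: "m \<le> q h" for h unfolding m_def by (rule cInf_lower[OF _ bdd]) simp
  have "\<exists>h. q h < m + inverse (real (Suc n))" for n
    using cInf_lessD[of "range q" "m + inverse (real (Suc n))"] by (auto simp: m_def)
  then obtain h where h: "\<And>n. q (h n) < m + inverse (real (Suc n))" by metis
  \<comment> \<open>Near-minimizers have nearby images: the midpoint of \<open>x\<close> and
    \<open>y\<close> cannot go below \<open>m\<close>, and the parallelogram law measures the
    gain.\<close>
  have parallel: "(norm (X x - X y))\<^sup>2 \<le> 2 * (q x - m) + 2 * (q y - m)" for x y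
  proof -
    have "X ((1/2) *\<^sub>R (x + y)) = (1/2) *\<^sub>R (X x + X y)" "l ((1/2) *\<^sub>R (x + y)) = (1/2) * (l x + l y)"
      by (simp_all only: X.scaleR X.add l.scaleR l.add real_scaleR_def)
    then have "q ((1/2) *\<^sub>R (x + y)) = (norm (X x + X y))\<^sup>2 / 4 - l x - l y"
      by (simp only: q_def norm_scaleR) (simp add: power_divide field_simps)
    moreover have "(norm (X x + X y))\<^sup>2 + (norm (X x - X y))\<^sup>2 = 2 * (norm (X x))\<^sup>2 + 2 * (norm (X y))\<^sup>2"
      by (simp add: power2_norm_eq_inner inner_add inner_diff inner_commute)
    ultimately show ?thesis using m_le[of "(1/2) *\<^sub>R (x + y)"] by (simp add: q_def)
  qed
  have "Cauchy (\<lambda>n. X (h n))"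
  proof (rule metric_CauchyI)
    fix e :: real assume "e > 0"
    then obtain N where N: "inverse (real (Suc N)) < e\<^sup>2 / 4"
      using reals_Archimedean[of "e\<^sup>2 / 4"] by auto
    have "dist (X (h n)) (X (h k)) < e" if "n \<ge> N" "k \<ge> N" for n k
    proof -
      have "inverse (real (Suc n)) \<le> inverse (real (Suc N))" "inverse (real (Suc k)) \<le> inverse (real (Suc N))"
        using that by simp_all
      then have "q (h n) - m < e\<^sup>2 / 4" "q (h k) - m < e\<^sup>2 / 4"
        using h[of n] h[of k] N by linarith+
      then have "(norm (X (h n) - X (h k)))\<^sup>2 < e\<^sup>2"
        using order.strict_trans1[OF parallel[of "h n" "h k"],
            OF add_strict_mono[OF mult_strict_left_mono mult_strict_left_mono], of "e\<^sup>2 / 4" "e\<^sup>2 / 4"] by simp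
      then show ?thesis using \<open>e > 0\<close> by (simp add: dist_norm power2_less_imp_less)
    qed
    then show "\<exists>M. \<forall>n\<ge>M. \<forall>k\<ge>M. dist (X (h n)) (X (h k)) < e" by blast
  qed
  then obtain g where g: "(\<lambda>n. X (h n)) \<longlonglongrightarrow> g" using Cauchy_convergent convergent_def by blast
  have gc: "g \<in> closure (range X)" by (auto simp: closure_sequential intro!: exI[of _ "\<lambda>n. X (h n)"] g)
  have qlim: "(\<lambda>n. q (h n)) \<longlonglongrightarrow> m"
  proof (rule tendsto_sandwich[of "\<lambda>n. m" _ _ "\<lambda>n. m + inverse (real (Suc n))"])
    show "(\<lambda>n. m + inverse (real (Suc n))) \<longlonglongrightarrow> m"
      using tendsto_add[OF tendsto_const LIMSEQ_inverse_real_of_nat, of m] by simp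
  qed (use m_le less_imp_le[OF h] in \<open>auto intro!: always_eventually\<close>)
  \<comment> \<open>Perturbing \<open>h n\<close> by \<open>t *\<^sub>R x\<close> changes
    \<open>q\<close> by the terms in \<open>t\<close> and cannot take it below the infimum; in the
    limit the error \<open>q (h n) - m\<close> disappears.\<close>
  have key: "0 \<le> 2 * t * (inner g (X x) - l x) + t\<^sup>2 * (norm (X x))\<^sup>2" for t x
  proof (rule LIMSEQ_le_const)
    have "(\<lambda>n. q (h n) - m + 2 * t * (inner (X (h n)) (X x) - l x) + t\<^sup>2 * (norm (X x))\<^sup>2)
      \<longlonglongrightarrow> m - m + 2 * t * (inner g (X x) - l x) + t\<^sup>2 * (norm (X x))\<^sup>2"
      by (intro tendsto_intros qlim g)
    then show "(\<lambda>n. q (h n) - m + 2 * t * (inner (X (h n)) (X x) - l x) + t\<^sup>2 * (norm (X x))\<^sup>2)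
      \<longlonglongrightarrow> 2 * t * (inner g (X x) - l x) + t\<^sup>2 * (norm (X x))\<^sup>2" by simp
    have nexp: "(norm (X y + t *\<^sub>R X x))\<^sup>2 = (norm (X y))\<^sup>2 + 2 * t * inner (X y) (X x) + t\<^sup>2 * (norm (X x))\<^sup>2" for y
      by (simp add: power2_norm_eq_inner inner_add inner_commute algebra_simps power2_eq_square[of t])
    have "q (y + t *\<^sub>R x) = q y + 2 * t * (inner (X y) (X x) - l x) + t\<^sup>2 * (norm (X x))\<^sup>2" for y
      by (simp only: q_def X.scaleR X.add l.scaleR l.add nexp) (simp add: algebra_simps)
    then have "0 \<le> q (h n) - m + 2 * t * (inner (X (h n)) (X x) - l x) + t\<^sup>2 * (norm (X x))\<^sup>2" for n
      using m_le[of "h n + t *\<^sub>R x"] by simp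
    then show "\<exists>N. \<forall>n\<ge>N. 0 \<le> q (h n) - m + 2 * t * (inner (X (h n)) (X x) - l x) + t\<^sup>2 * (norm (X x))\<^sup>2"
      by blast
  qed
  have eq: "l x = inner g (X x)" for x
  proof -
    define d where "d = inner g (X x) - l x"
    define N where "N = (norm (X x))\<^sup>2 + 1"
    have "N > 0" by (simp add: N_def add_nonneg_pos)
    \<comment> \<open>The choice \<open>t = - d / N\<close> nearly minimizes the quadratic in
      \<open>t\<close>; the 1 added in \<open>N\<close> keeps the denominator positive when
      \<open>X x = 0\<close>.\<close>
    have "0 \<le> 2 * (- d / N) * d + (- d / N)\<^sup>2 * (norm (X x))\<^sup>2"
      using key[of "- d / N" x] by (simp add: d_def)
    also have "\<dots> \<le> 2 * (- d / N) * d + (- d / N)\<^sup>2 * N"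
      by (intro add_left_mono mult_left_mono) (auto simp: N_def)
    also have "\<dots> = - (d\<^sup>2 / N)"
      using \<open>N > 0\<close> by (simp add: power2_eq_square field_simps)
    finally have "d\<^sup>2 / N \<le> 0" by simp
    then have "d = 0" using \<open>N > 0\<close> by (simp add: divide_le_0_iff)
    then show ?thesis by (simp add: d_def)
  qed
  have "norm g * norm g \<le> C * norm g"
  proof (rule LIMSEQ_le)
    show "(\<lambda>n. inner g (X (h n))) \<longlonglongrightarrow> norm g * norm g"
      using tendsto_inner[OF tendsto_const g, of g] by (simp add: power2_eq_square flip: power2_norm_eq_inner)
    show "(\<lambda>n. C * norm (X (h n))) \<longlonglongrightarrow> C * norm g" by (intro tendsto_intros g)
    show "\<exists>N. \<forall>n\<ge>N. inner g (X (h n)) \<le> C * norm (X (h n))"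
      using bd eq by (metis abs_le_iff)
  qed
  then have "norm g \<le> C" using \<open>0 \<le> C\<close> by (cases "g = 0") auto
  with gc eq show ?thesis by (intro that)
qed

text \<open>The imaginary part of a complex linear functional is minus its real part at
  \<open>\<i> *\<^sub>C h\<close>, so representing the real part represents the whole
  functional.\<close>

lemma riesz_range:
  fixes l :: "ell2 \<Rightarrow> complex"
  assumes X: "clinear_op X" and add: "\<And>x y. l (x + y) = l x + l y"
    and scale: "\<And>c x. l (c *\<^sub>C x) = c * l x"
    and bd: "\<And>h. cmod (l h) \<le> C * norm (X h)" and "0 \<le> C"
  obtains g where "g \<in> closure (range X)" "\<And>h. l h = cinner (X h) g" "norm g \<le> C"
proof -
  have "linear (\<lambda>h. Re (l h))"
    by (rule linearI) (simp_all add: add scale flip: scaleC_of_real)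
  moreover have "\<bar>Re (l h)\<bar> \<le> C * norm (X h)" for h
    using bd[of h] abs_Re_le_cmod[of "l h"] by linarith
  ultimately obtain g where g: "g \<in> closure (range X)" "\<And>h. Re (l h) = inner g (X h)" "norm g \<le> C"
    using riesz_range_real[OF clinear_op_linear[OF X] _ _ \<open>0 \<le> C\<close>] by metis
  have "l h = cinner (X h) g" for h
  proof (rule complex_eqI)
    show "Re (l h) = Re (cinner (X h) g)" by (simp add: g(2) Re_cinner inner_commute)
    have "Im (l h) = - Re (l (\<i> *\<^sub>C h))" by (simp add: scale)
    also have "\<dots> = - Re (cinner (X (\<i> *\<^sub>C h)) g)" by (simp add: g(2) Re_cinner inner_commute)
    also have "\<dots> = Im (cinner (X h) g)"
      by (simp add: clinear_op_scaleC[OF X] cinner_scaleC_left)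
    finally show "Im (l h) = Im (cinner (X h) g)" .
  qed
  with g show ?thesis by (intro that)
qed

text \<open>The choice is meaningful for bounded complex linear \<open>T\<close>, where the Riesz
  representation supplies exactly one such vector. All later facts go through
  \<open>cinner_adj\<close>.\<close>

definition adj :: "(ell2 \<Rightarrow> ell2) \<Rightarrow> ell2 \<Rightarrow> ell2" where
  "adj T y = (SOME z. \<forall>x. cinner (T x) y = cinner x z)"

lemma cinner_adj:
  assumes "clinear_op T"
  shows "cinner (T x) y = cinner x (adj T y)"
proof -
  obtain K where K: "\<And>x. norm (T x) \<le> norm x * K" "0 \<le> K"
    using bounded_linear.nonneg_bounded[OF clinear_op_bounded_linear[OF assms]] by blast
  have "\<exists>z. \<forall>x. cinner (T x) y = cinner x z"
  proof -
    have "cmod (cinner (T h) y) \<le> (K * norm y) * norm h" for h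
    proof -
      have "cmod (cinner (T h) y) \<le> norm (T h) * norm y" by (rule norm_cinner_le)
      also have "\<dots> \<le> (norm h * K) * norm y" by (intro mult_right_mono K) auto
      finally show ?thesis by (simp add: mult_ac)
    qed
    moreover have "0 \<le> K * norm y" using K by simp
    ultimately show ?thesis
    proof (rule riesz_range[OF clinear_op_ident, of "\<lambda>h. cinner (T h) y" "K * norm y", rotated 2])
      fix g assume "\<And>h. cinner (T h) y = cinner h g"
      then show ?thesis by blast
    qed (simp_all add: clinear_op_add[OF assms] clinear_op_scaleC[OF assms] cinner_add_left cinner_scaleC_left)
  qed
  then have "\<forall>x. cinner (T x) y = cinner x (adj T y)" unfolding adj_def by (rule someI_ex)
  then show ?thesis by blast
qed

lemma cinner_adj':
  assumes "clinear_op T"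
  shows "cinner (adj T y) x = cinner y (T x)"
  by (metis assms cinner_adj cinner_commute)

lemma norm_adj_le:
  assumes "clinear_op T" "\<And>x. norm (T x) \<le> K * norm x"
  shows "norm (adj T y) \<le> K * norm y"
proof -
  let ?z = "adj T y"
  have "(norm ?z)\<^sup>2 = cmod (cinner (T ?z) y)"
    by (simp add: cinner_adj[OF assms(1)] cinner_self norm_power)
  also have "\<dots> \<le> norm (T ?z) * norm y" by (rule norm_cinner_le)
  also have "\<dots> \<le> (K * norm ?z) * norm y" by (intro mult_right_mono assms) auto
  finally have "norm ?z * norm ?z \<le> norm ?z * (K * norm y)" by (simp add: power2_eq_square mult_ac)
  moreover have "0 \<le> K * norm y" by (rule order.trans[OF norm_ge_zero assms(2)])
  ultimately show ?thesis
    using mult_left_le_imp_le[of "norm ?z" "norm ?z" "K * norm y"] by (cases "?z = 0") simp_all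
qed

lemma clinear_op_adj:
  assumes "clinear_op T"
  shows "clinear_op (adj T)"
proof -
  obtain K where K: "\<And>x. norm (T x) \<le> norm x * K"
    using bounded_linear.nonneg_bounded[OF clinear_op_bounded_linear[OF assms]] by blast
  show ?thesis
  proof (rule clinear_opI)
    show "norm (adj T x) \<le> K * norm x" for x
      by (rule norm_adj_le[OF assms]) (use K in \<open>simp add: mult.commute\<close>)
    show "adj T (x + y) = adj T x + adj T y" for x y
      by (rule eq_if_cinner_eq) (simp add: cinner_adj'[OF assms] cinner_add_left)
    show "adj T (c *\<^sub>C x) = c *\<^sub>C adj T x" for c x
      by (rule eq_if_cinner_eq) (simp add: cinner_adj'[OF assms] cinner_scaleC_left)
  qed
qed

subsection \<open>Square roots of positive operators\<close>

text \<open>Taylor coefficients of \<open>sqrt (1 - t)\<close> at 0.\<close>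

definition sqrt_coeff :: "nat \<Rightarrow> real" where
  "sqrt_coeff n = (- 1) ^ n * ((1 / 2) gchoose n)"

lemma sqrt_coeff_0 [simp]: "sqrt_coeff 0 = 1"
  by (simp add: sqrt_coeff_def)

lemma sqrt_coeff_Suc: "sqrt_coeff (Suc n) = sqrt_coeff n * ((real n - 1 / 2) / (real n + 1))"
proof -
  have "real (Suc n) * ((1 / 2) gchoose (Suc n)) = (1 / 2 - real n) * ((1 / 2) gchoose n)"
    using gbinomial_mult_1[of "1/2 :: real" n] by (simp add: algebra_simps)
  then have e: "((1 / 2) gchoose (Suc n)) = (1 / 2 - real n) * ((1 / 2) gchoose n) / (real n + 1)"
    by (simp add: field_simps)
  show ?thesis by (simp only: sqrt_coeff_def e power_Suc) (simp add: field_simps)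
qed

lemma sqrt_coeff_nonpos: "sqrt_coeff (Suc n) \<le> 0"
proof (induction n)
  case 0
  then show ?case by (simp add: sqrt_coeff_Suc)
next
  case (Suc n)
  have "0 \<le> (real (Suc n) - 1 / 2) / (real (Suc n) + 1)" by simp
  then show ?case using Suc by (subst sqrt_coeff_Suc) (simp only: mult_nonpos_nonneg)
qed

text \<open>The partial sums are, up to sign, binomial coefficients of exponent -1/2; absorption
  turns them into a positive multiple of \<open>- sqrt_coeff (Suc n)\<close>, whose sign is
  known.\<close>

lemma sum_sqrt_coeff_nonneg: "0 \<le> (\<Sum>k\<le>n. sqrt_coeff k)"
proof -
  have "(\<Sum>k\<le>n. sqrt_coeff k) = (- 1) ^ n * ((1 / 2 - 1) gchoose n)"
    unfolding sqrt_coeff_def using gbinomial_sum_lower_neg[of "1/2 :: real" n]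
    by (simp add: mult.commute)
  also have e: "((1 / 2 - 1 :: real) gchoose n) = 2 * (real n + 1) * ((1 / 2) gchoose (Suc n))"
    using gbinomial_absorption[of n "1/2 :: real"] by (simp add: field_simps)
  also have "(- 1) ^ n * (2 * (real n + 1) * ((1 / 2) gchoose (Suc n))) = - sqrt_coeff (Suc n) * (2 * (real n + 1))"
    by (simp add: sqrt_coeff_def)
  also have "\<dots> \<ge> 0" using sqrt_coeff_nonpos[of n] by (intro mult_nonneg_nonneg) auto
  finally show ?thesis .
qed

text \<open>All coefficients after the first are non-positive while the partial sums stay
  non-negative, so the negative ones cannot exceed the leading 1 in total. This absolute convergence
  at the endpoint \<open>t = 1\<close> is what allows a contraction in place of
  \<open>t\<close>.\<close>

lemma sum_abs_sqrt_coeff_le: "(\<Sum>k<n. \<bar>sqrt_coeff (Suc k)\<bar>) \<le> 1"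
proof -
  have "(\<Sum>k\<le>n. sqrt_coeff k) = 1 + (\<Sum>k<n. sqrt_coeff (Suc k))"
    by (cases n) (simp_all add: sum.atMost_shift)
  also have "(\<Sum>k<n. sqrt_coeff (Suc k)) = - (\<Sum>k<n. \<bar>sqrt_coeff (Suc k)\<bar>)"
    by (simp add: abs_of_nonpos[OF sqrt_coeff_nonpos] sum_negf)
  finally show ?thesis using sum_sqrt_coeff_nonneg[of n] by linarith
qed

lemma summable_abs_sqrt_coeff: "summable (\<lambda>k. \<bar>sqrt_coeff k\<bar>)"
proof -
  have "summable (\<lambda>k. \<bar>sqrt_coeff (Suc k)\<bar>)"
    by (rule summableI_nonneg_bounded[of _ 1]) (use sum_abs_sqrt_coeff_le in auto)
  then show ?thesis by (subst (asm) summable_Suc_iff)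
qed

text \<open>The square of the series is \<open>1 - t\<close>; on coefficients this is Vandermonde's
  identity for the exponent \<open>1/2 + 1/2\<close>.\<close>

lemma sqrt_coeff_convolution:
  "(\<Sum>i\<le>n. sqrt_coeff i * sqrt_coeff (n - i)) = (if n = 0 then 1 else if n = 1 then - 1 else 0)"
proof -
  have "(\<Sum>i\<le>n. sqrt_coeff i * sqrt_coeff (n - i))
      = (\<Sum>i\<le>n. (- 1) ^ n * (((1 / 2) gchoose i) * ((1 / 2) gchoose (n - i))))"
    by (intro sum.cong refl) (simp add: sqrt_coeff_def power_add[symmetric] mult_ac flip: power_add)
  also have "\<dots> = (- 1) ^ n * ((1 / 2 + 1 / 2 :: real) gchoose n)"
    using gbinomial_Vandermonde[of "1/2 :: real" "1/2" n]
    by (simp add: atMost_atLeast0 flip: sum_distrib_left)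
  also have "((1 / 2 + 1 / 2 :: real) gchoose n) = of_nat (1 choose n)"
    using binomial_gbinomial[of 1 n, where 'a = real] by simp
  finally show ?thesis
    by (cases "n \<le> 1") (auto simp: le_Suc_eq binomial_eq_0)
qed

no_notation Infinite_Set_Sum.abs_summable_on (infix \<open>abs'_summable'_on\<close> 50)

text \<open>Provides the positive root of the identity minus \<open>Q\<close> as a norm convergent
  power series in \<open>Q\<close>. It is applied with
  \<open>Q x = mult b (adj (mult b) x)\<close>.\<close>

locale selfadjoint_contraction =
  fixes Q :: "ell2 \<Rightarrow> ell2"
  assumes Q: "clinear_op Q" and selfadj: "\<And>x y. cinner (Q x) y = cinner x (Q y)"
    and contr: "\<And>x. norm (Q x) \<le> norm x"
begin

lemma clinear_op_funpow: "clinear_op (Q ^^ n)"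
  by (induction n) (auto simp: clinear_op_ident id_def comp_def intro: clinear_op_compose[OF Q])

lemma norm_funpow_le: "norm ((Q ^^ n) x) \<le> norm x"
  by (induction n) (auto intro: order.trans[OF contr])

lemma selfadj_funpow: "cinner ((Q ^^ n) x) y = cinner x ((Q ^^ n) y)"
proof (induction n arbitrary: y)
  case (Suc n)
  then show ?case by (simp add: selfadj) (simp add: funpow_swap1)
qed simp

definition rt :: "ell2 \<Rightarrow> ell2" where
  "rt x = (\<Sum>n. sqrt_coeff n *\<^sub>R (Q ^^ n) x)"

lemma norm_term_le: "norm (sqrt_coeff n *\<^sub>R (Q ^^ n) x) \<le> \<bar>sqrt_coeff n\<bar> * norm x"
  by (simp add: mult_left_mono norm_funpow_le)

lemma summable_norm_rt: "summable (\<lambda>n. norm (sqrt_coeff n *\<^sub>R (Q ^^ n) x))"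
  by (rule summable_comparison_test'[OF summable_mult2[OF summable_abs_sqrt_coeff, of "norm x"], of 0])
     (use norm_term_le in auto)

lemma rt_sums: "(\<lambda>n. sqrt_coeff n *\<^sub>R (Q ^^ n) x) sums rt x"
  unfolding rt_def by (rule summable_sums[OF summable_norm_cancel[OF summable_norm_rt]])

lemma clinear_op_rt: "clinear_op rt"
proof (rule clinear_opI)
  fix x y c
  have "(\<lambda>n. sqrt_coeff n *\<^sub>R (Q ^^ n) x + sqrt_coeff n *\<^sub>R (Q ^^ n) y) sums (rt x + rt y)"
    by (intro sums_add rt_sums)
  then show "rt (x + y) = rt x + rt y"
    using rt_sums[of "x + y"] by (simp add: clinear_op_add[OF clinear_op_funpow] scaleR_add_right sums_iff)
  have "(\<lambda>n. c *\<^sub>C sqrt_coeff n *\<^sub>R (Q ^^ n) x) sums (c *\<^sub>C rt x)"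
    by (intro bounded_linear.sums[OF bounded_linear_scaleC] rt_sums)
  then show "rt (c *\<^sub>C x) = c *\<^sub>C rt x"
    using rt_sums[of "c *\<^sub>C x"]
    by (simp add: clinear_op_scaleC[OF clinear_op_funpow] scaleC_scaleC mult.commute sums_iff flip: scaleC_of_real)
  have "norm (rt x) \<le> (\<Sum>n. norm (sqrt_coeff n *\<^sub>R (Q ^^ n) x))"
    unfolding rt_def by (rule summable_norm[OF summable_norm_rt])
  also have "\<dots> \<le> (\<Sum>n. \<bar>sqrt_coeff n\<bar> * norm x)"
    by (intro suminf_le norm_term_le summable_norm_rt summable_mult2 summable_abs_sqrt_coeff)
  finally show "norm (rt x) \<le> (\<Sum>n. \<bar>sqrt_coeff n\<bar>) * norm x"
    by (simp add: suminf_mult2[OF summable_abs_sqrt_coeff])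
qed

lemma selfadj_rt: "cinner (rt x) y = cinner x (rt y)"
proof -
  have "(\<lambda>n. cinner (sqrt_coeff n *\<^sub>R (Q ^^ n) x) y) sums cinner (rt x) y"
    by (intro bounded_linear.sums[OF bounded_linear_cinner_left] rt_sums)
  moreover have "(\<lambda>n. cinner x (sqrt_coeff n *\<^sub>R (Q ^^ n) y)) sums cinner x (rt y)"
    by (intro bounded_linear.sums[OF bounded_bilinear.bounded_linear_right[OF bounded_bilinear_cinner]] rt_sums)
  ultimately show ?thesis
    by (simp add: cinner_scaleC_left cinner_scaleC_right selfadj_funpow sums_iff flip: scaleC_of_real)
qed

text \<open>The series without its constant term has coefficients of absolute sum at most 1, so
  \<open>rt x\<close> deviates from \<open>x\<close> by at most \<open>norm x\<close>, and
  Cauchy-Schwarz keeps the quadratic form non-negative.\<close>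

lemma inner_rt_nonneg: "0 \<le> inner (rt x) x"
proof -
  have s: "(\<lambda>n. sqrt_coeff (Suc n) *\<^sub>R (Q ^^ (Suc n)) x) sums (rt x - x)"
    using rt_sums[of x] by (subst sums_Suc_iff[of "\<lambda>n. sqrt_coeff n *\<^sub>R (Q ^^ n) x"]) simp
  have le: "norm (rt x - x) \<le> 1 * norm x"
  proof -
    have "norm (\<Sum>n<N. sqrt_coeff (Suc n) *\<^sub>R (Q ^^ (Suc n)) x) \<le> 1 * norm x" for N
    proof -
      have "norm (\<Sum>n<N. sqrt_coeff (Suc n) *\<^sub>R (Q ^^ (Suc n)) x)
          \<le> (\<Sum>n<N. \<bar>sqrt_coeff (Suc n)\<bar> * norm x)"
        by (intro sum_norm_le norm_term_le)
      also have "\<dots> \<le> 1 * norm x"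
        unfolding sum_distrib_right[symmetric] by (intro mult_right_mono sum_abs_sqrt_coeff_le) simp
      finally show ?thesis .
    qed
    then show ?thesis
      by (intro Lim_bounded[OF tendsto_norm[OF s[unfolded sums_def]], of 0]) blast
  qed
  have "\<bar>inner (rt x - x) x\<bar> \<le> norm (rt x - x) * norm x" by (rule Cauchy_Schwarz_ineq2)
  also have "\<dots> \<le> norm x * norm x" using le by (intro mult_right_mono) auto
  also have "\<dots> = inner x x" by (simp add: power2_norm_eq_inner[symmetric] power2_eq_square)
  finally have "\<bar>inner (rt x - x) x\<bar> \<le> inner x x" .
  then show ?thesis by (simp add: inner_diff_left)
qed

text \<open>Multiplying the two series gives an absolutely summable double family, which may be
  summed along antidiagonals; by \<open>sqrt_coeff_convolution\<close> only the exponents 0 and 1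
  survive.\<close>

lemma rt_rt: "rt (rt x) = x - Q x"
proof -
  define F where "F = (\<lambda>(m, n). (sqrt_coeff m * sqrt_coeff n) *\<^sub>R (Q ^^ (m + n)) x)"
  have absd: "(\<lambda>n. \<bar>sqrt_coeff n\<bar>) summable_on UNIV"
    by (rule summable_nonneg_imp_summable_on[OF summable_abs_sqrt_coeff]) simp
  have "(\<lambda>(m, n). sqrt_coeff m * sqrt_coeff n) abs_summable_on UNIV \<times> UNIV"
  proof (subst Infinite_Sum.abs_summable_on_Sigma_iff, intro conjI ballI)
    show "(\<lambda>n. case (m, n) of (m, n) \<Rightarrow> sqrt_coeff m * sqrt_coeff n) abs_summable_on UNIV" for m
      using summable_on_cmult_right[OF absd, of "\<bar>sqrt_coeff m\<bar>"] by (simp add: abs_mult)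
    have eq: "(\<Sum>\<^sub>\<infinity>n. norm (case (m, n) of (m, n) \<Rightarrow> sqrt_coeff m * sqrt_coeff n))
        = \<bar>sqrt_coeff m\<bar> * (\<Sum>\<^sub>\<infinity>n. \<bar>sqrt_coeff n\<bar>)" for m
      using infsum_cmult_right[OF absd, of "\<bar>sqrt_coeff m\<bar>"] by (simp add: abs_mult)
    show "(\<lambda>m. \<Sum>\<^sub>\<infinity>n. norm (case (m, n) of (m, n) \<Rightarrow> sqrt_coeff m * sqrt_coeff n)) abs_summable_on UNIV"
      unfolding eq using summable_on_cmult_left[OF absd, of "\<bar>\<Sum>\<^sub>\<infinity>n. \<bar>sqrt_coeff n\<bar>\<bar>"]
      by (simp add: abs_mult)
  qed
  then have "(\<lambda>p. (case p of (m, n) \<Rightarrow> \<bar>sqrt_coeff m * sqrt_coeff n\<bar>) * norm x) summable_on UNIV \<times> UNIV"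
    by (intro summable_on_cmult_left) (simp only: case_prod_unfold real_norm_def)
  then have Fs: "F abs_summable_on UNIV \<times> UNIV"
    by (rule summable_on_comparison_test)
       (auto simp: F_def abs_mult intro!: mult_left_mono norm_funpow_le)
  then have Fsum: "F summable_on UNIV \<times> UNIV" by (rule abs_summable_summable)
  have row: "(\<Sum>\<^sub>\<infinity>n. F (m, n)) = sqrt_coeff m *\<^sub>R (Q ^^ m) (rt x)" for m
  proof -
    have "((\<lambda>n. sqrt_coeff n *\<^sub>R (Q ^^ n) x) has_sum rt x) UNIV"
      by (rule norm_summable_imp_has_sum[OF summable_norm_rt rt_sums])
    then have "((\<lambda>n. sqrt_coeff m *\<^sub>R (Q ^^ m) (sqrt_coeff n *\<^sub>R (Q ^^ n) x)) has_sum
        sqrt_coeff m *\<^sub>R (Q ^^ m) (rt x)) UNIV"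
      by (intro has_sum_bounded_linear[OF bounded_linear_scaleR_right, unfolded comp_def]
          has_sum_bounded_linear[OF clinear_op_bounded_linear[OF clinear_op_funpow], unfolded comp_def])
    then show ?thesis
      by (simp add: F_def linear_scale[OF clinear_op_linear[OF clinear_op_funpow]] funpow_add
          infsumI)
  qed
  have "rt (rt x) = (\<Sum>\<^sub>\<infinity>m. sqrt_coeff m *\<^sub>R (Q ^^ m) (rt x))"
    by (rule infsumI[OF norm_summable_imp_has_sum[OF summable_norm_rt rt_sums], symmetric])
  also have "\<dots> = (\<Sum>\<^sub>\<infinity>m. \<Sum>\<^sub>\<infinity>n. F (m, n))" by (simp add: row)
  also have "\<dots> = infsum F (UNIV \<times> UNIV)" by (rule infsum_Sigma'_banach[of "\<lambda>m n. F (m, n)", simplified, OF Fsum])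
  also have "\<dots> = infsum (\<lambda>(k, i). F (i, k - i)) (SIGMA k:UNIV. {..k})"
    by (rule infsum_reindex_bij_witness[of _ "\<lambda>(k, i). (i, k - i)" "\<lambda>(m, n). (m + n, m)"]) auto
  also have "\<dots> = (\<Sum>\<^sub>\<infinity>k. \<Sum>\<^sub>\<infinity>i\<in>{..k}. F (i, k - i))"
  proof (rule infsum_Sigma'_banach[symmetric])
    have "(\<lambda>(k, i). F (i, k - i)) summable_on (SIGMA k:UNIV. {..k}) \<longleftrightarrow> F summable_on UNIV \<times> UNIV"
      by (rule summable_on_reindex_bij_witness[of _ "\<lambda>(m, n). (m + n, m)" "\<lambda>(k, i). (i, k - i)"]) auto
    then show "(\<lambda>(k, i). F (i, k - i)) summable_on (SIGMA k:UNIV. {..k})" using Fsum by simp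
  qed
  also have "\<dots> = (\<Sum>\<^sub>\<infinity>k. (\<Sum>i\<le>k. sqrt_coeff i * sqrt_coeff (k - i)) *\<^sub>R (Q ^^ k) x)"
    by (simp add: F_def scaleR_sum_left)
  also have "\<dots> = (\<Sum>\<^sub>\<infinity>k\<in>{0,1}. (\<Sum>i\<le>k. sqrt_coeff i * sqrt_coeff (k - i)) *\<^sub>R (Q ^^ k) x)"
    by (rule infsum_cong_neutral) (auto simp: sqrt_coeff_convolution)
  also have "\<dots> = x - Q x" by (simp add: sqrt_coeff_convolution)
  finally show ?thesis .
qed

end

subsection \<open>The Hardy space\<close>

lemma taylor_coeff_sums:
  assumes "f holomorphic_on ball 0 1" "cmod z < 1"
  shows "(\<lambda>n. taylor_coeff f n * z ^ n) sums f z"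
  using holomorphic_power_series[OF assms(1), of z] assms(2) by (simp add: taylor_coeff_def)

lemma taylor_coeff_unique:
  assumes "r > 0" "\<And>z. cmod z < r \<Longrightarrow> (\<lambda>n. a n * z ^ n) sums f z"
  shows "taylor_coeff f = a"
proof -
  have "f has_fps_expansion Abs_fps a"
    by (rule has_fps_expansionI) (use assms in \<open>auto simp: eventually_nhds_metric dist_norm intro!: exI[of _ r]\<close>)
  then have "a n = (deriv ^^ n) f 0 / fact n" for n
    using fps_nth_fps_expansion[of f "Abs_fps a" n] by simp
  then show ?thesis by (simp add: taylor_coeff_def fun_eq_iff)
qed

lemma taylor_coeff_0: "taylor_coeff f 0 = f 0"
  by (simp add: taylor_coeff_def)

lemma summable_geometric_coeff:
  fixes a :: "nat \<Rightarrow> complex"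
  assumes "\<And>n. cmod (a n) \<le> B" "0 \<le> r" "r < 1"
  shows "summable (\<lambda>n. cmod (a n) * r ^ n)"
  by (rule summable_comparison_test'[OF summable_mult[OF summable_geometric[of r], of B], of 0])
     (use assms in \<open>auto intro!: mult_right_mono\<close>)

lemma summable_coef_power:
  assumes "cmod z < 1"
  shows "summable (\<lambda>n. coef x n * z ^ n)"
  by (rule summable_norm_cancel)
     (use summable_geometric_coeff[of "coef x" "norm x" "cmod z"] assms
       in \<open>simp add: norm_coef_le norm_mult norm_power\<close>)

text \<open>The value 0 off the disk matches the convention of \<open>Hol_disk\<close>, which makes
  \<open>to_fun\<close> a bijection of \<open>ell2\<close> onto \<open>H2\<close>.\<close>

definition to_fun :: "ell2 \<Rightarrow> complex \<Rightarrow> complex" where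
  "to_fun x z = (if cmod z < 1 then \<Sum>n. coef x n * z ^ n else 0)"

lemma to_fun_sums: "cmod z < 1 \<Longrightarrow> (\<lambda>n. coef x n * z ^ n) sums to_fun x z"
  using summable_sums[OF summable_coef_power] by (simp add: to_fun_def)

lemma to_fun_holomorphic: "to_fun x holomorphic_on ball 0 1"
  by (rule power_series_holomorphic[of 0 1 "coef x"]) (simp add: to_fun_sums)

lemma to_fun_Hol_disk: "to_fun x \<in> Hol_disk"
  by (simp add: Hol_disk_def to_fun_holomorphic) (simp add: to_fun_def)

lemma taylor_coeff_to_fun [simp]: "taylor_coeff (to_fun x) = coef x"
  by (rule taylor_coeff_unique[of 1]) (auto intro: to_fun_sums)

lemma to_fun_H2: "to_fun x \<in> H2"
  by (simp add: H2_def to_fun_Hol_disk summable_coef_sq)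

definition of_fun :: "(complex \<Rightarrow> complex) \<Rightarrow> ell2" where
  "of_fun f = Abs_ell2 (taylor_coeff f)"

lemma H2_Hol_disk: "f \<in> H2 \<Longrightarrow> f \<in> Hol_disk"
  by (simp add: H2_def)

lemma coef_of_fun: "f \<in> H2 \<Longrightarrow> coef (of_fun f) = taylor_coeff f"
  by (simp add: of_fun_def H2_def coef_Abs_ell2)

lemma of_fun_to_fun [simp]: "of_fun (to_fun x) = x"
  by (rule ell2_eqI) (simp add: coef_of_fun to_fun_H2)

lemma Hol_disk_eqI:
  assumes "f \<in> Hol_disk" "g \<in> Hol_disk" "\<And>z. cmod z < 1 \<Longrightarrow> f z = g z"
  shows "f = g"
proof (rule ext)
  fix z
  show "f z = g z" using assms by (cases "cmod z < 1") (auto simp: Hol_disk_def)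
qed

lemma Hol_disk_eq_taylor:
  assumes "f \<in> Hol_disk" "g \<in> Hol_disk" "taylor_coeff f = taylor_coeff g"
  shows "f = g"
proof (rule Hol_disk_eqI[OF assms(1,2)])
  fix z :: complex assume "cmod z < 1"
  then show "f z = g z"
    using taylor_coeff_sums[of f z] taylor_coeff_sums[of g z] assms
    by (simp add: Hol_disk_def sums_unique2)
qed

lemma to_fun_of_fun [simp]: "f \<in> H2 \<Longrightarrow> to_fun (of_fun f) = f"
  by (rule Hol_disk_eq_taylor) (simp_all add: to_fun_Hol_disk H2_Hol_disk coef_of_fun)

lemma to_fun_eq_iff [simp]: "to_fun x = to_fun y \<longleftrightarrow> x = y"
  by (metis of_fun_to_fun)

lemma to_fun_lincomb: "to_fun (c *\<^sub>C x + y) z = c * to_fun x z + to_fun y z"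
proof (cases "cmod z < 1")
  case True
  have "(\<lambda>n. c * (coef x n * z ^ n) + coef y n * z ^ n) sums (c * to_fun x z + to_fun y z)"
    by (intro sums_add sums_mult to_fun_sums True)
  with to_fun_sums[OF True, of "c *\<^sub>C x + y"] show ?thesis
    by (simp add: coef_simps scaleC.rep_eq algebra_simps sums_iff)
qed (simp add: to_fun_def)

lemma to_fun_zero [simp]: "to_fun 0 = (\<lambda>z. 0)"
  by (simp add: to_fun_def coef_simps fun_eq_iff)

lemma to_fun_add: "to_fun (x + y) z = to_fun x z + to_fun y z"
  using to_fun_lincomb[of 1 x y z] by simp

lemma to_fun_scaleC: "to_fun (c *\<^sub>C x) z = c * to_fun x z"
  using to_fun_lincomb[of c x 0 z] by simp

lemma to_fun_diff: "to_fun (x - y) z = to_fun x z - to_fun y z"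
  using to_fun_add[of "x - y" y z] by simp

lemma H2_norm_to_fun [simp]: "H2_norm (to_fun x) = norm x"
  by (simp add: H2_norm_def flip: norm_ell2_sq)

lemma H2_inner_to_fun [simp]: "H2_inner (to_fun x) (to_fun y) = cinner x y"
  by (simp add: H2_inner_def cinner_def)

lemma H2_cases:
  assumes "f \<in> H2" obtains x where "f = to_fun x"
  using to_fun_of_fun[OF assms] by metis

subsection \<open>The arc length measure\<close>

lemma space_arc_measure [simp]: "space arc_measure = sphere 0 1"
  by (simp add: arc_measure_def space_restrict_space)

lemma sets_arc_measure: "sets arc_measure = sets (restrict_space borel (sphere 0 1))"
  by (simp add: arc_measure_def)

lemma measurable_cis_sphere:
  "cis \<in> measurable (uniform_measure lborel {0..2 * pi}) (restrict_space borel (sphere 0 1))"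
proof -
  have "cis \<in> borel_measurable borel"
    by (intro borel_measurable_continuous_onI continuous_intros)
  then have "cis \<in> measurable borel (restrict_space borel (sphere 0 1))"
    by (intro measurable_restrict_space2) auto
  moreover have "sets (uniform_measure lborel {0..2 * pi}) = sets borel" by simp
  ultimately show ?thesis using measurable_cong_sets by blast
qed

lemma prob_space_arc_measure: "prob_space arc_measure"
  unfolding arc_measure_def
  by (intro prob_space.prob_space_distr measurable_cis_sphere prob_space_uniform_measure) simp_all

interpretation arc: prob_space arc_measure by (rule prob_space_arc_measure)

lemma measure_arc_sphere [simp]: "measure arc_measure (sphere 0 1) = 1"
  using arc.prob_space by simp

lemma uniform_2pi_eq_density:
  "uniform_measure lborel {0..2 * pi} = density lborel (\<lambda>t. ennreal (indicator {0..2 * pi} t / (2 * pi)))"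
  unfolding uniform_measure_def
  by (intro arg_cong[where f = "density lborel"] ext) (simp add: indicator_def divide_ennreal flip: ennreal_1 del: ennreal_1)

lemma integral_arc_measure:
  fixes F :: "complex \<Rightarrow> 'a :: {banach, second_countable_topology}"
  assumes F: "F \<in> borel_measurable arc_measure"
  shows "(\<integral>\<xi>. F \<xi> \<partial>arc_measure) = (\<integral>t. (indicator {0..2 * pi} t / (2 * pi)) *\<^sub>R F (cis t) \<partial>lborel)"
proof -
  have F': "F \<in> borel_measurable (restrict_space borel (sphere 0 1))"
    using F by (simp add: measurable_cong_sets[OF sets_arc_measure])
  have "(\<integral>\<xi>. F \<xi> \<partial>arc_measure) = (\<integral>t. F (cis t) \<partial>uniform_measure lborel {0..2 * pi})"
    unfolding arc_measure_def by (rule integral_distr[OF measurable_cis_sphere F'])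
  also have "\<dots> = (\<integral>t. (indicator {0..2 * pi} t / (2 * pi)) *\<^sub>R F (cis t) \<partial>lborel)"
    unfolding uniform_2pi_eq_density
  proof (rule integral_density)
    show "(\<lambda>t. F (cis t)) \<in> borel_measurable lborel"
      using measurable_compose[OF measurable_cis_sphere F']
      by (simp add: measurable_cong_sets[of "uniform_measure lborel {0..2 * pi}" lborel])
  qed auto
  finally show ?thesis .
qed

lemma measurable_arc_continuous:
  "continuous_on (sphere 0 1) F \<Longrightarrow> F \<in> borel_measurable arc_measure"
  using borel_measurable_continuous_on_restrict[of "sphere 0 1" F]
  by (simp add: measurable_cong_sets[OF sets_arc_measure])

lemma integral_arc_power:
  assumes "n > 0"
  shows "(\<integral>\<xi>. \<xi> ^ n \<partial>arc_measure) = 0"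
proof -
  let ?F = "\<lambda>t. cis (real n * t) / (\<i> * of_nat n)"
  have "(\<integral>\<xi>. \<xi> ^ n \<partial>arc_measure) = (\<integral>t. (indicator {0..2 * pi} t / (2 * pi)) *\<^sub>R (cis t ^ n) \<partial>lborel)"
    by (intro integral_arc_measure measurable_arc_continuous continuous_intros)
  also have "\<dots> = (\<integral>t. (1 / (2 * pi)) *\<^sub>R (indicator {0..2 * pi} t *\<^sub>R cis (real n * t)) \<partial>lborel)"
    by (intro Bochner_Integration.integral_cong) (simp_all only: Complex.DeMoivre mult_scaleR_left[symmetric] scaleR_scaleR divide_inverse mult_1 mult.commute[of "indicator _ _"])
  also have "\<dots> = (1 / (2 * pi)) *\<^sub>R (\<integral>t. indicator {0..2 * pi} t *\<^sub>R cis (real n * t) \<partial>lborel)"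
    by (rule integral_scaleR_right)
  also have "(\<integral>t. indicator {0..2 * pi} t *\<^sub>R cis (real n * t) \<partial>lborel) = ?F (2 * pi) - ?F 0"
  proof (rule integral_FTC_atLeastAtMost)
    show "continuous_on {0..2 * pi} (\<lambda>t. cis (real n * t))" by (intro continuous_intros)
    show "(?F has_vector_derivative cis (real n * t)) (at t within {0..2 * pi})" for t
    proof -
      have "((\<lambda>t. exp (\<i> * of_nat n * complex_of_real t) / (\<i> * of_nat n)) has_vector_derivative
         exp (\<i> * of_nat n * complex_of_real t)) (at t within {0..2 * pi})"
        by (rule has_vector_derivative_real_field)
           (use assms in \<open>auto intro!: derivative_eq_intros\<close>)
      then show ?thesis by (simp add: cis_conv_exp mult_ac)
    qed
  qed simp
  also have "?F (2 * pi) - ?F 0 = 0"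
    using cis_multiple_2pi[of "real n"] by (simp add: mult_ac)
  finally show ?thesis by simp
qed

lemma integral_arc_power_cnj:
  "(\<integral>\<xi>. \<xi> ^ j * cnj \<xi> ^ k \<partial>arc_measure) = (if j = k then 1 else 0)"
proof -
  have unit: "\<xi> ^ m * cnj \<xi> ^ m = 1" if "cmod \<xi> = 1" for \<xi> m
    using that by (simp add: complex_norm_square[symmetric, unfolded of_real_power] flip: power_mult_distrib)
  have less: "(\<integral>\<xi>. \<xi> ^ j * cnj \<xi> ^ k \<partial>arc_measure) = 0" if "k < j" for j k
  proof -
    have "(\<integral>\<xi>. \<xi> ^ j * cnj \<xi> ^ k \<partial>arc_measure) = (\<integral>\<xi>. \<xi> ^ (j - k) \<partial>arc_measure)"
    proof (intro Bochner_Integration.integral_cong refl)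
      fix \<xi> assume "\<xi> \<in> space arc_measure"
      then have "\<xi> ^ (j - k) * (\<xi> ^ k * cnj \<xi> ^ k) = \<xi> ^ (j - k)" by (simp add: unit)
      then show "\<xi> ^ j * cnj \<xi> ^ k = \<xi> ^ (j - k)"
        using that by (simp add: mult.assoc[symmetric] flip: power_add)
    qed
    with that show ?thesis by (simp add: integral_arc_power)
  qed
  consider "j = k" | "k < j" | "j < k" by linarith
  then show ?thesis
  proof cases
    case 1
    have "(\<integral>\<xi>. \<xi> ^ j * cnj \<xi> ^ k \<partial>arc_measure) = (\<integral>\<xi>. 1 \<partial>arc_measure)"
      by (intro Bochner_Integration.integral_cong refl) (simp add: unit 1)
    then show ?thesis using 1 by (simp add: arc.prob_space)
  next
    case 2
    then show ?thesis by (simp add: less)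
  next
    case 3
    have "(\<integral>\<xi>. \<xi> ^ j * cnj \<xi> ^ k \<partial>arc_measure) = cnj (\<integral>\<xi>. \<xi> ^ k * cnj \<xi> ^ j \<partial>arc_measure)"
      using Bochner_Integration.integral_cnj[of arc_measure "\<lambda>\<xi>. \<xi> ^ k * cnj \<xi> ^ j"] by (simp add: mult.commute)
    then show ?thesis using less[OF 3] 3 by simp
  qed
qed

lemma integrable_arc_bounded:
  fixes F :: "complex \<Rightarrow> 'a :: {banach, second_countable_topology}"
  assumes "F \<in> borel_measurable arc_measure" "\<And>\<xi>. cmod \<xi> = 1 \<Longrightarrow> norm (F \<xi>) \<le> B"
  shows "integrable arc_measure F"
  by (rule arc.integrable_const_bound[of _ B]) (use assms in auto)

lemma measurable_arc_power_cnj [measurable]: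
  "(\<lambda>\<xi>. \<xi> ^ j) \<in> borel_measurable arc_measure" "(\<lambda>\<xi>. cnj \<xi> ^ j) \<in> borel_measurable arc_measure"
  by (intro measurable_arc_continuous continuous_intros)+

text \<open>Absolute summability permits termwise integration. Integrating the first series against
  \<open>cnj \<xi> ^ k\<close> isolates \<open>c k\<close>; integrating it against the conjugate of
  the second series then yields the pairing.\<close>

lemma circle_parseval:
  fixes c d :: "nat \<Rightarrow> complex"
  assumes c: "summable (\<lambda>n. cmod (c n))" and d: "summable (\<lambda>n. cmod (d n))"
  shows "(\<lambda>n. c n * cnj (d n)) sums (\<integral>\<xi>. (\<Sum>n. c n * \<xi> ^ n) * cnj (\<Sum>n. d n * \<xi> ^ n) \<partial>arc_measure)"
proof -
  let ?C = "\<lambda>\<xi>. \<Sum>n. c n * \<xi> ^ n" and ?D = "\<lambda>\<xi>. \<Sum>n. d n * \<xi> ^ n"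
  have Cm [measurable]: "?C \<in> borel_measurable arc_measure" by measurable
  have Cle: "cmod (?C \<xi>) \<le> (\<Sum>n. cmod (c n))" if "cmod \<xi> = 1" for \<xi>
  proof -
    have "cmod (?C \<xi>) \<le> (\<Sum>n. cmod (c n * \<xi> ^ n))"
      by (rule summable_norm) (use c that in \<open>simp add: norm_mult norm_power\<close>)
    then show ?thesis using that by (simp add: norm_mult norm_power)
  qed
  have 1: "(\<integral>\<xi>. ?C \<xi> * cnj \<xi> ^ k \<partial>arc_measure) = c k" for k
  proof -
    have "(\<lambda>n. \<integral>\<xi>. c n * \<xi> ^ n * cnj \<xi> ^ k \<partial>arc_measure) sums (\<integral>\<xi>. (\<Sum>n. c n * \<xi> ^ n * cnj \<xi> ^ k) \<partial>arc_measure)"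
    proof (rule sums_integral)
      show "integrable arc_measure (\<lambda>\<xi>. c n * \<xi> ^ n * cnj \<xi> ^ k)" for n
        by (rule integrable_arc_bounded[of _ "cmod (c n)"]) (auto simp: norm_mult norm_power)
      show "AE \<xi> in arc_measure. summable (\<lambda>n. norm (c n * \<xi> ^ n * cnj \<xi> ^ k))"
        using c by (intro AE_I2) (simp add: norm_mult norm_power)
      have "(\<integral>\<xi>. norm (c n * \<xi> ^ n * cnj \<xi> ^ k) \<partial>arc_measure) = (\<integral>\<xi>. cmod (c n) \<partial>arc_measure)" for n
        by (intro Bochner_Integration.integral_cong refl) (simp add: norm_mult norm_power)
      then show "summable (\<lambda>n. \<integral>\<xi>. norm (c n * \<xi> ^ n * cnj \<xi> ^ k) \<partial>arc_measure)"
        using c by (simp add: arc.prob_space)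
    qed
    moreover have "(\<integral>\<xi>. c n * \<xi> ^ n * cnj \<xi> ^ k \<partial>arc_measure) = (if n = k then c k else 0)" for n
    proof -
      have "(\<integral>\<xi>. c n * \<xi> ^ n * cnj \<xi> ^ k \<partial>arc_measure) = c n * (\<integral>\<xi>. \<xi> ^ n * cnj \<xi> ^ k \<partial>arc_measure)"
        unfolding mult.assoc by (rule integral_mult_right_zero)
      then show ?thesis by (simp add: integral_arc_power_cnj)
    qed
    ultimately have "(\<lambda>n. if n = k then c k else 0) sums (\<integral>\<xi>. (\<Sum>n. c n * \<xi> ^ n * cnj \<xi> ^ k) \<partial>arc_measure)"
      by simp
    from sums_unique2[OF this sums_single]
    have "(\<integral>\<xi>. (\<Sum>n. c n * \<xi> ^ n * cnj \<xi> ^ k) \<partial>arc_measure) = c k" .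
    moreover have "(\<integral>\<xi>. (\<Sum>n. c n * \<xi> ^ n * cnj \<xi> ^ k) \<partial>arc_measure) = (\<integral>\<xi>. ?C \<xi> * cnj \<xi> ^ k \<partial>arc_measure)"
    proof (intro Bochner_Integration.integral_cong refl)
      fix \<xi> assume "\<xi> \<in> space arc_measure"
      then have "summable (\<lambda>n. c n * \<xi> ^ n)"
        by - (rule summable_norm_cancel, use c in \<open>simp add: norm_mult norm_power\<close>)
      then show "(\<Sum>n. c n * \<xi> ^ n * cnj \<xi> ^ k) = ?C \<xi> * cnj \<xi> ^ k" by (rule suminf_mult2[symmetric])
    qed
    ultimately show ?thesis by simp
  qed
  have "(\<lambda>n. \<integral>\<xi>. ?C \<xi> * cnj (d n * \<xi> ^ n) \<partial>arc_measure) sums (\<integral>\<xi>. (\<Sum>n. ?C \<xi> * cnj (d n * \<xi> ^ n)) \<partial>arc_measure)"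
  proof (rule sums_integral)
    have bd: "norm (?C \<xi> * cnj (d n * \<xi> ^ n)) \<le> (\<Sum>n. cmod (c n)) * cmod (d n)" if "cmod \<xi> = 1" for n \<xi>
      using Cle[OF that] that by (simp add: norm_mult norm_power mult_right_mono)
    have "(\<lambda>\<xi>. ?C \<xi> * cnj (d n * \<xi> ^ n)) \<in> borel_measurable arc_measure" for n
      unfolding complex_cnj_mult complex_cnj_power by measurable
    then show int: "integrable arc_measure (\<lambda>\<xi>. ?C \<xi> * cnj (d n * \<xi> ^ n))" for n
      using bd by (rule integrable_arc_bounded)
    show "AE \<xi> in arc_measure. summable (\<lambda>n. norm (?C \<xi> * cnj (d n * \<xi> ^ n)))"
      using d by (intro AE_I2) (simp add: norm_mult norm_power summable_mult)
    show "summable (\<lambda>n. \<integral>\<xi>. norm (?C \<xi> * cnj (d n * \<xi> ^ n)) \<partial>arc_measure)"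
    proof (rule summable_comparison_test'[OF summable_mult[OF d, of "\<Sum>n. cmod (c n)"], of 0])
      fix n
      have "(\<integral>\<xi>. norm (?C \<xi> * cnj (d n * \<xi> ^ n)) \<partial>arc_measure) \<le> (\<Sum>n. cmod (c n)) * cmod (d n)"
        by (rule arc.integral_le_const) (use int bd in auto)
      then show "norm (\<integral>\<xi>. norm (?C \<xi> * cnj (d n * \<xi> ^ n)) \<partial>arc_measure) \<le> (\<Sum>n. cmod (c n)) * cmod (d n)"
        by (simp del: complex_cnj_mult)
    qed
  qed
  moreover have "(\<integral>\<xi>. ?C \<xi> * cnj (d n * \<xi> ^ n) \<partial>arc_measure) = c n * cnj (d n)" for n
  proof -
    have "(\<integral>\<xi>. ?C \<xi> * cnj (d n * \<xi> ^ n) \<partial>arc_measure) = (\<integral>\<xi>. cnj (d n) * (?C \<xi> * cnj \<xi> ^ n) \<partial>arc_measure)"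
      by (intro Bochner_Integration.integral_cong) (auto simp: mult_ac)
    also have "\<dots> = cnj (d n) * (\<integral>\<xi>. ?C \<xi> * cnj \<xi> ^ n \<partial>arc_measure)"
      by (rule integral_mult_right_zero)
    also have "\<dots> = c n * cnj (d n)" unfolding 1 by (rule mult.commute)
    finally show ?thesis .
  qed
  moreover have "(\<integral>\<xi>. (\<Sum>n. ?C \<xi> * cnj (d n * \<xi> ^ n)) \<partial>arc_measure) = (\<integral>\<xi>. ?C \<xi> * cnj (?D \<xi>) \<partial>arc_measure)"
  proof (intro Bochner_Integration.integral_cong refl)
    fix \<xi> assume "\<xi> \<in> space arc_measure"
    then have "summable (\<lambda>n. d n * \<xi> ^ n)"
      by - (rule summable_norm_cancel, use d in \<open>simp add: norm_mult norm_power\<close>)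
    then have "(\<lambda>n. ?C \<xi> * cnj (d n * \<xi> ^ n)) sums (?C \<xi> * cnj (?D \<xi>))"
      by (intro sums_mult sums_cnj[THEN iffD2] summable_sums)
    then show "(\<Sum>n. ?C \<xi> * cnj (d n * \<xi> ^ n)) = ?C \<xi> * cnj (?D \<xi>)" by (rule sums_unique[symmetric])
  qed
  ultimately show ?thesis by simp
qed

lemma summable_taylor_coeff:
  assumes "f holomorphic_on ball 0 1" "0 \<le> r" "r < 1"
  shows "summable (\<lambda>n. cmod (taylor_coeff f n * of_real r ^ n))"
proof -
  define s where "s = (1 + r) / 2"
  have s: "r < s" "s < 1" using assms by (auto simp: s_def)
  have "summable (\<lambda>n. taylor_coeff f n * of_real s ^ n)"
    using taylor_coeff_sums[OF assms(1), of "of_real s"] s assms(2) by (auto simp: sums_iff)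
  then show ?thesis
    by (rule powser_insidea) (use s assms in auto)
qed

lemma disc_parseval:
  assumes f: "f holomorphic_on ball 0 1" and r: "0 \<le> r" "r < 1"
  shows "(\<lambda>n. (cmod (taylor_coeff f n))\<^sup>2 * r ^ (2 * n)) sums (\<integral>\<xi>. (cmod (f (of_real r * \<xi>)))\<^sup>2 \<partial>arc_measure)"
proof -
  let ?c = "\<lambda>n. taylor_coeff f n * of_real r ^ n"
  have eq: "(\<Sum>n. ?c n * \<xi> ^ n) = f (of_real r * \<xi>)" if "cmod \<xi> = 1" for \<xi>
    using taylor_coeff_sums[OF f, of "of_real r * \<xi>"] r that
    by (simp add: norm_mult power_mult_distrib mult_ac sums_iff)
  have "(\<lambda>n. ?c n * cnj (?c n)) sums (\<integral>\<xi>. (\<Sum>n. ?c n * \<xi> ^ n) * cnj (\<Sum>n. ?c n * \<xi> ^ n) \<partial>arc_measure)"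
    by (intro circle_parseval summable_taylor_coeff assms)
  also have "(\<integral>\<xi>. (\<Sum>n. ?c n * \<xi> ^ n) * cnj (\<Sum>n. ?c n * \<xi> ^ n) \<partial>arc_measure)
      = (\<integral>\<xi>. of_real ((cmod (f (of_real r * \<xi>)))\<^sup>2) \<partial>arc_measure)"
    by (intro Bochner_Integration.integral_cong refl) (simp add: eq complex_norm_square del: of_real_power)
  finally have "(\<lambda>n. ?c n * cnj (?c n)) sums of_real (\<integral>\<xi>. (cmod (f (of_real r * \<xi>)))\<^sup>2 \<partial>arc_measure)"
    unfolding integral_complex_of_real .
  then have "(\<lambda>n. of_real ((cmod (?c n))\<^sup>2) :: complex) sums of_real (\<integral>\<xi>. (cmod (f (of_real r * \<xi>)))\<^sup>2 \<partial>arc_measure)"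
    by (simp only: complex_norm_square)
  then have "(\<lambda>n. (cmod (?c n))\<^sup>2) sums (\<integral>\<xi>. (cmod (f (of_real r * \<xi>)))\<^sup>2 \<partial>arc_measure)"
    by (simp only: sums_of_real_iff)
  then show ?thesis using r by (simp add: norm_mult norm_power power_mult_distrib power_even_eq)
qed

lemma integrable_arc_dilation:
  assumes f: "f holomorphic_on ball 0 1" and r: "0 \<le> r" "r < 1"
  shows "(\<lambda>\<xi>. f (of_real r * \<xi>)) \<in> borel_measurable arc_measure"
    and "integrable arc_measure (\<lambda>\<xi>. (cmod (f (of_real r * \<xi>)))\<^sup>2)"
proof -
  have c: "continuous_on (sphere 0 1) (\<lambda>\<xi>. f (of_real r * \<xi>))"
    by (rule continuous_on_compose2[OF holomorphic_on_imp_continuous_on[OF f]])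
       (use r in \<open>auto intro!: continuous_intros simp: norm_mult\<close>)
  then show "(\<lambda>\<xi>. f (of_real r * \<xi>)) \<in> borel_measurable arc_measure" by (rule measurable_arc_continuous)
  have "bounded ((\<lambda>\<xi>. (cmod (f (of_real r * \<xi>)))\<^sup>2) ` sphere 0 1)"
    by (intro compact_imp_bounded compact_continuous_image continuous_intros c) simp
  then obtain B where "\<And>\<xi>. cmod \<xi> = 1 \<Longrightarrow> norm ((cmod (f (of_real r * \<xi>)))\<^sup>2) \<le> B"
    by (force simp: bounded_iff)
  then show "integrable arc_measure (\<lambda>\<xi>. (cmod (f (of_real r * \<xi>)))\<^sup>2)"
    by (intro integrable_arc_bounded measurable_arc_continuous continuous_intros c)
qed

text \<open>Pointwise domination passes to mean squares over circles of radius \<open>r < 1\<close>,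
  hence by Parseval to weighted coefficient sums; then \<open>r\<close> tends to 1 in finitely many
  terms. This is what makes multiplication by a bounded function a bounded operator.\<close>

lemma sum_taylor_coeff_sq_le:
  assumes f: "f holomorphic_on ball 0 1" and g: "g holomorphic_on ball 0 1"
    and le: "\<And>z. cmod z < 1 \<Longrightarrow> cmod (f z) \<le> K * cmod (g z)"
    and sg: "\<And>N. (\<Sum>n<N. (cmod (taylor_coeff g n))\<^sup>2) \<le> S" and K: "0 \<le> K"
  shows "(\<Sum>n<N. (cmod (taylor_coeff f n))\<^sup>2) \<le> K\<^sup>2 * S"
proof (rule tendsto_upperbound[where F = "at_left (1::real)"])
  show "((\<lambda>r. \<Sum>n<N. (cmod (taylor_coeff f n))\<^sup>2 * r ^ (2 * n)) \<longlongrightarrow> (\<Sum>n<N. (cmod (taylor_coeff f n))\<^sup>2)) (at_left 1)"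
    by (auto intro!: tendsto_eq_intros)
  show "\<forall>\<^sub>F r in at_left (1::real). (\<Sum>n<N. (cmod (taylor_coeff f n))\<^sup>2 * r ^ (2 * n)) \<le> K\<^sup>2 * S"
    unfolding eventually_at_left_field
  proof (intro exI[of _ 0] conjI allI impI)
    fix r :: real assume "0 < r" "r < 1"
    then have r: "0 \<le> r" "r < 1" by auto
    have "(\<Sum>n<N. (cmod (taylor_coeff f n))\<^sup>2 * r ^ (2 * n)) \<le> (\<integral>\<xi>. (cmod (f (of_real r * \<xi>)))\<^sup>2 \<partial>arc_measure)"
      using sum_le_suminf[OF sums_summable[OF disc_parseval[OF f r]], of "{..<N}"]
        sums_unique[OF disc_parseval[OF f r]] r by simp
    also have "\<dots> \<le> (\<integral>\<xi>. K\<^sup>2 * (cmod (g (of_real r * \<xi>)))\<^sup>2 \<partial>arc_measure)"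
    proof (rule integral_mono)
      fix \<xi> assume "\<xi> \<in> space arc_measure"
      then have "cmod (f (of_real r * \<xi>)) \<le> K * cmod (g (of_real r * \<xi>))"
        by (intro le) (use r in \<open>simp add: norm_mult\<close>)
      from power_mono[OF this norm_ge_zero, of 2]
      show "(cmod (f (of_real r * \<xi>)))\<^sup>2 \<le> K\<^sup>2 * (cmod (g (of_real r * \<xi>)))\<^sup>2"
        by (simp add: power_mult_distrib)
    qed (intro integrable_arc_dilation integrable_mult_right f g r)+
    also have "\<dots> = K\<^sup>2 * (\<integral>\<xi>. (cmod (g (of_real r * \<xi>)))\<^sup>2 \<partial>arc_measure)" by simp
    also have "(\<integral>\<xi>. (cmod (g (of_real r * \<xi>)))\<^sup>2 \<partial>arc_measure) \<le> S"
    proof -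
      have "(\<Sum>n<M. (cmod (taylor_coeff g n))\<^sup>2 * r ^ (2 * n)) \<le> S" for M
        by (rule order.trans[OF sum_mono sg[of M]]) (use r in \<open>auto intro!: mult_left_le power_le_one\<close>)
      then show ?thesis
        using disc_parseval[OF g r] suminf_le_const[of "\<lambda>n. (cmod (taylor_coeff g n))\<^sup>2 * r ^ (2 * n)" S]
        by (simp add: sums_iff)
    qed
    finally show "(\<Sum>n<N. (cmod (taylor_coeff f n))\<^sup>2 * r ^ (2 * n)) \<le> K\<^sup>2 * S"
      by (simp add: mult_left_mono)
  qed simp
qed simp

section \<open>Multiplication by bounded holomorphic functions\<close>

lemma Hol_disk_mult:
  assumes "f \<in> Hol_disk" "g \<in> Hol_disk"
  shows "(\<lambda>z. f z * g z) \<in> Hol_disk"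
  using assms by (auto simp: Hol_disk_def intro!: holomorphic_intros)

lemma H2_if_bounded_sums:
  assumes "f \<in> Hol_disk" "\<And>N. (\<Sum>n<N. (cmod (taylor_coeff f n))\<^sup>2) \<le> S\<^sup>2" "0 \<le> S"
  shows "f \<in> H2" "norm (of_fun f) \<le> S"
proof -
  have s: "summable (\<lambda>n. (cmod (taylor_coeff f n))\<^sup>2)"
    by (rule summableI_nonneg_bounded[of _ "S\<^sup>2"]) (use assms in auto)
  then show H2: "f \<in> H2" using assms(1) by (simp add: H2_def)
  have "(norm (of_fun f))\<^sup>2 \<le> S\<^sup>2"
    unfolding norm_ell2_sq coef_of_fun[OF H2] by (intro suminf_le_const s assms)
  then show "norm (of_fun f) \<le> S" using assms(3) by (rule power2_le_imp_le)
qed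

definition mult :: "(complex \<Rightarrow> complex) \<Rightarrow> ell2 \<Rightarrow> ell2" where
  "mult b x = of_fun (\<lambda>z. b z * to_fun x z)"

lemma mult_H2:
  assumes b: "b \<in> Hol_disk" and K: "\<And>z. cmod z < 1 \<Longrightarrow> cmod (b z) \<le> K"
  shows "(\<lambda>z. b z * to_fun x z) \<in> H2" "norm (mult b x) \<le> K * norm x"
proof -
  have "0 \<le> K" using K[of 0] norm_ge_zero[of "b 0"] by (simp del: norm_ge_zero)
  have h: "(\<lambda>z. b z * to_fun x z) \<in> Hol_disk" by (intro Hol_disk_mult b to_fun_Hol_disk)
  have "(\<Sum>n<N. (cmod (taylor_coeff (\<lambda>z. b z * to_fun x z) n))\<^sup>2) \<le> K\<^sup>2 * (norm x)\<^sup>2" for N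
  proof (rule sum_taylor_coeff_sq_le[OF _ to_fun_holomorphic[of x]])
    show "(\<lambda>z. b z * to_fun x z) holomorphic_on ball 0 1" using h by (simp add: Hol_disk_def)
    show "cmod (b z * to_fun x z) \<le> K * cmod (to_fun x z)" if "cmod z < 1" for z
      using K[OF that] by (simp add: norm_mult mult_right_mono)
    show "(\<Sum>n<N. (cmod (taylor_coeff (to_fun x) n))\<^sup>2) \<le> (norm x)\<^sup>2" for N
      by (simp add: sum_coef_sq_le)
  qed fact
  then have *: "(\<Sum>n<N. (cmod (taylor_coeff (\<lambda>z. b z * to_fun x z) n))\<^sup>2) \<le> (K * norm x)\<^sup>2" for N
    by (simp add: power_mult_distrib)
  show "(\<lambda>z. b z * to_fun x z) \<in> H2" "norm (mult b x) \<le> K * norm x"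
    using H2_if_bounded_sums[OF h *] \<open>0 \<le> K\<close> by (simp_all add: mult_def)
qed

lemma Hinf_bound:
  assumes "b \<in> Hinf" obtains K where "\<And>z. cmod z < 1 \<Longrightarrow> cmod (b z) \<le> K"
  using assms by (force simp: Hinf_def bounded_iff)

lemma to_fun_mult:
  assumes "b \<in> Hinf"
  shows "to_fun (mult b x) = (\<lambda>z. b z * to_fun x z)"
proof -
  obtain K where "\<And>z. cmod z < 1 \<Longrightarrow> cmod (b z) \<le> K" using Hinf_bound[OF assms] by blast
  then show ?thesis using assms unfolding mult_def
    by (intro to_fun_of_fun mult_H2(1)[of b K]) (auto simp: Hinf_def)
qed

lemma clinear_op_mult:
  assumes "b \<in> Hinf"
  shows "clinear_op (mult b)"
proof -
  obtain K where K: "\<And>z. cmod z < 1 \<Longrightarrow> cmod (b z) \<le> K" using Hinf_bound[OF assms] by blast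
  show ?thesis
  proof (rule clinear_opI)
    show "norm (mult b x) \<le> K * norm x" for x
      using mult_H2(2)[of b K x] K assms by (simp add: Hinf_def)
    show "mult b (x + y) = mult b x + mult b y" for x y
      unfolding to_fun_eq_iff[symmetric] by (rule ext) (simp add: to_fun_mult[OF assms] to_fun_add algebra_simps)
    show "mult b (c *\<^sub>C x) = c *\<^sub>C mult b x" for c x
      unfolding to_fun_eq_iff[symmetric] by (rule ext) (simp add: to_fun_mult[OF assms] to_fun_scaleC algebra_simps)
  qed
qed

lemma mult_commute:
  assumes "a \<in> Hinf" "b \<in> Hinf"
  shows "mult a (mult b x) = mult b (mult a x)"
  unfolding to_fun_eq_iff[symmetric] by (rule ext) (simp add: to_fun_mult assms mult_ac)

subsection \<open>The Poisson kernel and the radial maximal function\<close>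

text \<open>Holomorphy past the unit circle makes the coefficients absolutely summable, so Parseval
  applies on the circle itself.\<close>

lemma arc_parseval_disc:
  assumes f: "f holomorphic_on ball 0 R" and g: "g holomorphic_on ball 0 R" and R: "R > 1"
  shows "(\<lambda>n. taylor_coeff f n * cnj (taylor_coeff g n)) sums (\<integral>\<xi>. f \<xi> * cnj (g \<xi>) \<partial>arc_measure)"
proof -
  have *: "(\<lambda>n. taylor_coeff h n * z ^ n) sums h z" if "h holomorphic_on ball 0 R" "cmod z < R" for h z
    using holomorphic_power_series[OF that(1), of z] that(2) by (simp add: taylor_coeff_def)
  have s: "summable (\<lambda>n. cmod (taylor_coeff h n))" if "h holomorphic_on ball 0 R" for h
  proof -
    define r where "r = (1 + R) / 2"
    have r: "1 < r" "r < R" using R by (auto simp: r_def)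
    have "summable (\<lambda>n. taylor_coeff h n * of_real r ^ n)"
      using *[OF that, of "of_real r"] r by (auto simp: sums_iff)
    from powser_insidea[OF this, of 1] show ?thesis using r by simp
  qed
  have eq: "(\<Sum>n. taylor_coeff h n * \<xi> ^ n) = h \<xi>" if "h holomorphic_on ball 0 R" "cmod \<xi> = 1" for h \<xi>
    using *[OF that(1), of \<xi>] that(2) R by (simp add: sums_iff)
  have "(\<integral>\<xi>. (\<Sum>n. taylor_coeff f n * \<xi> ^ n) * cnj (\<Sum>n. taylor_coeff g n * \<xi> ^ n) \<partial>arc_measure)
      = (\<integral>\<xi>. f \<xi> * cnj (g \<xi>) \<partial>arc_measure)"
    by (intro Bochner_Integration.integral_cong refl) (simp add: eq f g)
  then show ?thesis using circle_parseval[OF s[OF f] s[OF g]] by simp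
qed

lemma arc_mean_value:
  assumes f: "f holomorphic_on ball 0 R" and R: "R > 1"
  shows "(\<integral>\<xi>. f \<xi> \<partial>arc_measure) = f 0"
proof -
  have t: "taylor_coeff (\<lambda>z. 1) = (\<lambda>n. if n = 0 then 1 else 0)"
  proof (rule taylor_coeff_unique[of 1])
    fix z :: complex
    have "(\<lambda>n. (if n = 0 then 1 else 0) * z ^ n) = (\<lambda>n. if n = 0 then z ^ n else 0)" by auto
    then show "(\<lambda>n. (if n = 0 then 1 else 0) * z ^ n) sums 1"
      using sums_single[of 0 "\<lambda>n. z ^ n"] by simp
  qed simp
  have "(\<lambda>n. taylor_coeff f n * cnj (taylor_coeff (\<lambda>z. 1) n)) sums (\<integral>\<xi>. f \<xi> * cnj 1 \<partial>arc_measure)"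
    by (rule arc_parseval_disc[OF f _ R]) (intro holomorphic_intros)
  moreover have "(\<lambda>n. taylor_coeff f n * cnj (taylor_coeff (\<lambda>z. 1) n)) sums f 0"
    using sums_single[of 0 "\<lambda>n. taylor_coeff f n"]
    by (simp add: t taylor_coeff_0 if_distrib cong: if_cong)
  ultimately show ?thesis using sums_unique2 by fastforce
qed

text \<open>Written as a function of one variable: the Poisson kernel of \<open>z\<close> at a
  boundary point \<open>\<eta>\<close> is \<open>poisson (z * cnj \<eta>)\<close>.\<close>

definition poisson :: "complex \<Rightarrow> real" where
  "poisson w = (1 - (cmod w)\<^sup>2) / (cmod (1 - w))\<^sup>2"

lemma poisson_nonneg: "cmod w \<le> 1 \<Longrightarrow> 0 \<le> poisson w"
  by (simp add: poisson_def power_le_one)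

lemma poisson_cnj [simp]: "poisson (cnj w) = poisson w"
proof -
  have "cmod (1 - cnj w) = cmod (1 - w)" by (metis complex_cnj_diff complex_cnj_one complex_mod_cnj)
  then show ?thesis by (simp add: poisson_def)
qed

lemma poisson_eq_Re: "cmod w < 1 \<Longrightarrow> poisson w = Re ((1 + w) / (1 - w))"
proof -
  assume w: "cmod w < 1"
  have "(1 + w) / (1 - w) = (1 + w) * cnj (1 - w) / of_real ((cmod (1 - w))\<^sup>2)"
    using w by (subst complex_norm_square) auto
  also have "Re \<dots> = Re ((1 + w) * cnj (1 - w)) / (cmod (1 - w))\<^sup>2" by (rule Re_divide_of_real)
  also have "Re ((1 + w) * cnj (1 - w)) = 1 - (cmod w)\<^sup>2"
    by (simp add: algebra_simps cmod_power2) (simp add: power2_eq_square)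
  finally show ?thesis by (simp add: poisson_def)
qed

lemma poisson_eq_sum: "cmod w < 1 \<Longrightarrow> of_real (poisson w) = 1 / (1 - w) + cnj (1 / (1 - w)) - 1"
proof -
  assume w: "cmod w < 1"
  then have "1 - w \<noteq> 0" by auto
  then have "(1 + w) / (1 - w) = 2 * (1 / (1 - w)) - 1" by (simp add: field_simps)
  then have "poisson w = Re (2 * (1 / (1 - w)) - 1)" by (simp only: poisson_eq_Re[OF w])
  then have "poisson w = 2 * Re (1 / (1 - w)) - 1" by (simp del: times_divide_eq_right)
  moreover have "1 / (1 - w) + cnj (1 / (1 - w)) = of_real (2 * Re (1 / (1 - w)))" by (rule complex_add_cnj)
  ultimately show ?thesis by simp
qed

lemma poisson_le:
  assumes "cmod w \<le> \<rho>" "\<rho> < 1"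
  shows "poisson w \<le> 2 / (1 - \<rho>)"
proof -
  have a: "1 - cmod w \<le> cmod (1 - w)" using norm_triangle_ineq2[of 1 w] by simp
  have pos: "0 < 1 - cmod w" using assms by simp
  have "poisson w \<le> (1 - (cmod w)\<^sup>2) / (1 - cmod w)\<^sup>2"
    unfolding poisson_def using a pos assms
    by (intro divide_left_mono power_mono mult_pos_pos zero_less_power) (auto simp: power_le_one)
  also have "\<dots> = (1 + cmod w) / (1 - cmod w)"
    using pos square_diff_square_factored[of 1 "cmod w"] by (simp add: power2_eq_square)
  also have "\<dots> \<le> 2 / (1 - \<rho>)" using assms pos by (intro frac_le) auto
  finally show ?thesis .
qed

text \<open>Because \<open>s \<le> t\<close>, the radius \<open>s * t\<close> is at least
  \<open>s^2\<close>, so passing from \<open>s\<close> to \<open>s * t\<close> changes the distance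
  to the circle only by a bounded factor. The constant is 2 from the numerator times 4 from the
  squared denominator.\<close>

lemma poisson_compare:
  assumes w: "cmod \<omega> = 1" and st: "0 \<le> s" "s \<le> t" "t < 1"
  shows "poisson (of_real (s * t) * \<omega>) \<le> 8 * poisson (of_real s * \<omega>)"
proof -
  let ?p = "s * t"
  have p: "s\<^sup>2 \<le> ?p" "?p \<le> s" "0 \<le> ?p" using st by (auto simp: power2_eq_square mult_left_mono mult_left_le)
  have s1: "s < 1" using st by simp
  have np: "cmod (of_real ?p * \<omega>) = ?p" "cmod (of_real s * \<omega>) = s" using w st by (simp_all add: norm_mult abs_mult)
  have "1 - ?p \<le> cmod (1 - of_real ?p * \<omega>)" using norm_triangle_ineq2[of 1 "of_real ?p * \<omega>"] np by simp
  moreover have "s - ?p \<le> 1 - ?p" using s1 by simp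
  \<comment> \<open>The detour along the radius costs \<open>s - ?p\<close>, which is at most
    \<open>1 - ?p\<close> and hence at most the first distance.\<close>
  moreover have "cmod (1 - of_real s * \<omega>) \<le> cmod (1 - of_real ?p * \<omega>) + (s - ?p)"
  proof -
    have "1 - of_real s * \<omega> = (1 - of_real ?p * \<omega>) - of_real (s - ?p) * \<omega>" by (simp add: algebra_simps)
    then have "cmod (1 - of_real s * \<omega>) \<le> cmod (1 - of_real ?p * \<omega>) + cmod (of_real (s - ?p) * \<omega>)"
      using norm_triangle_ineq4 by metis
    also have "cmod (of_real (s - ?p) * \<omega>) = s - ?p" using p w by (simp add: norm_mult del: of_real_diff of_real_mult)
    finally show ?thesis .
  qed
  ultimately have d: "cmod (1 - of_real s * \<omega>) \<le> 2 * cmod (1 - of_real ?p * \<omega>)" by linarith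
  have pos: "0 < cmod (1 - of_real s * \<omega>)"
  proof -
    have "1 - s \<le> cmod (1 - of_real s * \<omega>)" using norm_triangle_ineq2[of 1 "of_real s * \<omega>"] np by simp
    then show ?thesis using s1 by linarith
  qed
  have num: "1 - ?p\<^sup>2 \<le> 2 * (1 - s\<^sup>2)"
  proof -
    have "(s\<^sup>2)\<^sup>2 \<le> ?p\<^sup>2" using p by (intro power_mono) auto
    moreover have "(1 - s\<^sup>2) * (1 - s\<^sup>2) \<ge> 0" by simp
    ultimately show ?thesis by (simp add: power2_eq_square algebra_simps)
  qed
  have d2: "(cmod (1 - of_real s * \<omega>))\<^sup>2 / 4 \<le> (cmod (1 - of_real ?p * \<omega>))\<^sup>2"
    using power_mono[OF d norm_ge_zero, of 2] by (simp add: power_mult_distrib)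
  have "poisson (of_real ?p * \<omega>) = (1 - ?p\<^sup>2) / (cmod (1 - of_real ?p * \<omega>))\<^sup>2"
    unfolding poisson_def np ..
  also have "\<dots> \<le> (2 * (1 - s\<^sup>2)) / ((cmod (1 - of_real s * \<omega>))\<^sup>2 / 4)"
    using num d2 pos s1 st by (intro frac_le) (auto simp: power_le_one)
  also have "\<dots> = 8 * poisson (of_real s * \<omega>)"
    unfolding poisson_def np by simp
  finally show ?thesis .
qed

text \<open>On the circle the Poisson kernel is \<open>cnj (a \<eta>) + a \<eta> - 1\<close> with
  the Cauchy kernel \<open>a\<close>. Parseval reproduces \<open>F z\<close> from the first term; by
  the mean value property the other two contribute \<open>F 0 * a 0 - F 0\<close>, which vanishes
  because \<open>a 0 = 1\<close>.\<close>

lemma poisson_formula: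
  assumes F: "F holomorphic_on ball 0 R" and R: "R > 1" and z: "cmod z < 1"
  shows "(\<integral>\<eta>. of_real (poisson (z * cnj \<eta>)) * F \<eta> \<partial>arc_measure) = F z"
    and "integrable arc_measure (\<lambda>\<eta>. of_real (poisson (z * cnj \<eta>)) * F \<eta>)"
proof -
  \<comment> \<open>If \<open>z\<close> is not 0, the pole of \<open>a\<close> lies at distance
    \<open>1 / cmod z > 1\<close>, so both functions are holomorphic on a common disk beyond the
    unit circle.\<close>
  define R' where "R' = (if z = 0 then R else min R (1 / cmod z))"
  have R': "R' > 1" "R' \<le> R" using R z by (auto simp: R'_def)
  define a where "a = (\<lambda>\<eta>. 1 / (1 - cnj z * \<eta>))"
  have ne: "1 - cnj z * \<eta> \<noteq> 0" if "cmod \<eta> < R'" for \<eta>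
  proof
    assume "1 - cnj z * \<eta> = 0"
    then have "cmod (cnj z * \<eta>) = cmod 1" by (metis eq_iff_diff_eq_0)
    then have "cmod z * cmod \<eta> = 1" by (simp add: norm_mult)
    moreover from this have "z \<noteq> 0" by auto
    ultimately show False using that by (simp add: R'_def field_simps split: if_splits)
  qed
  have a: "a holomorphic_on ball 0 R'" unfolding a_def by (intro holomorphic_intros) (use ne in auto)
  have F': "F holomorphic_on ball 0 R'" by (rule holomorphic_on_subset[OF F]) (use R' in auto)
  have ta: "taylor_coeff a n = cnj z ^ n" for n
  proof -
    have "taylor_coeff a = (\<lambda>n. cnj z ^ n)"
    proof (rule taylor_coeff_unique[of 1])
      fix w :: complex assume "cmod w < 1"
      then have "cmod (cnj z * w) < 1"
        using z mult_strict_mono[of "cmod z" 1 "cmod w" 1] by (simp add: norm_mult)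
      from geometric_sums[OF this] show "(\<lambda>n. cnj z ^ n * w ^ n) sums a w"
        by (simp add: a_def power_mult_distrib)
    qed simp
    then show ?thesis by simp
  qed
  have contF: "continuous_on (sphere 0 1) F" "continuous_on (sphere 0 1) a"
    by (rule continuous_on_subset[OF holomorphic_on_imp_continuous_on]; use F' a R' in force)+
  have bnd: "\<exists>B. \<forall>\<xi>. cmod \<xi> = 1 \<longrightarrow> norm (h \<xi>) \<le> B" if "continuous_on (sphere 0 1) h" for h :: "complex \<Rightarrow> complex"
    using compact_imp_bounded[OF compact_continuous_image[OF that]] by (force simp: bounded_iff)
  have int: "integrable arc_measure h" if "continuous_on (sphere 0 1) h" for h :: "complex \<Rightarrow> complex"
    using bnd[OF that] measurable_arc_continuous[OF that] integrable_arc_bounded by blast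
  have i1: "integrable arc_measure (\<lambda>\<eta>. F \<eta> * cnj (a \<eta>))" "integrable arc_measure (\<lambda>\<eta>. F \<eta> * a \<eta>)"
    "integrable arc_measure F"
    by (intro int continuous_intros contF)+
  have "(\<integral>\<eta>. F \<eta> * cnj (a \<eta>) \<partial>arc_measure) = F z"
  proof -
    have "(\<lambda>n. taylor_coeff F n * z ^ n) sums (\<integral>\<eta>. F \<eta> * cnj (a \<eta>) \<partial>arc_measure)"
      using arc_parseval_disc[OF F' a R'(1)] by (simp add: ta)
    moreover have "(\<lambda>n. taylor_coeff F n * z ^ n) sums F z"
      by (rule taylor_coeff_sums[OF holomorphic_on_subset[OF F]]) (use R z in auto)
    ultimately show ?thesis by (rule sums_unique2)
  qed
  moreover have "(\<integral>\<eta>. F \<eta> * a \<eta> \<partial>arc_measure) = F 0 * a 0"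
    by (rule arc_mean_value[OF _ R'(1)]) (intro holomorphic_intros F' a)
  moreover have "(\<integral>\<eta>. F \<eta> \<partial>arc_measure) = F 0" by (rule arc_mean_value[OF F R])
  moreover have eq: "of_real (poisson (z * cnj \<eta>)) * F \<eta> = F \<eta> * cnj (a \<eta>) + F \<eta> * a \<eta> - F \<eta>"
    if "cmod \<eta> = 1" for \<eta>
  proof -
    have "of_real (poisson (z * cnj \<eta>)) = cnj (a \<eta>) + a \<eta> - 1"
      using poisson_eq_sum[of "z * cnj \<eta>"] z that by (simp add: a_def norm_mult mult.commute)
    then show ?thesis by (simp only: ring_distribs) (simp add: mult.commute)
  qed
  moreover have "(\<integral>\<eta>. of_real (poisson (z * cnj \<eta>)) * F \<eta> \<partial>arc_measure)
      = (\<integral>\<eta>. F \<eta> * cnj (a \<eta>) + F \<eta> * a \<eta> - F \<eta> \<partial>arc_measure)"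
    by (intro Bochner_Integration.integral_cong refl eq) simp
  moreover have "\<dots> = (\<integral>\<eta>. F \<eta> * cnj (a \<eta>) \<partial>arc_measure) + (\<integral>\<eta>. F \<eta> * a \<eta> \<partial>arc_measure) - (\<integral>\<eta>. F \<eta> \<partial>arc_measure)"
    by (simp add: i1)
  ultimately show "(\<integral>\<eta>. of_real (poisson (z * cnj \<eta>)) * F \<eta> \<partial>arc_measure) = F z"
    by (simp add: a_def)
  have "integrable arc_measure (\<lambda>\<eta>. F \<eta> * cnj (a \<eta>) + F \<eta> * a \<eta> - F \<eta>)" by (intro Bochner_Integration.integrable_add Bochner_Integration.integrable_diff i1)
  then show "integrable arc_measure (\<lambda>\<eta>. of_real (poisson (z * cnj \<eta>)) * F \<eta>)"
    by (subst Bochner_Integration.integrable_cong[OF refl eq]) auto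
qed

lemma measurable_arc_ident [measurable]: "(\<lambda>\<xi>. \<xi>) \<in> borel_measurable arc_measure"
  by (intro measurable_arc_continuous continuous_intros)

lemma measurable_poisson [measurable]: "poisson \<in> borel_measurable borel"
  unfolding poisson_def by measurable

text \<open>The Poisson formula at \<open>z\<close> is applied to \<open>H\<close>, whose real part
  on the circle is the Poisson kernel of \<open>w\<close>; the real part of \<open>H z\<close> is
  the kernel at \<open>z * cnj w\<close>.\<close>

lemma poisson_convolution:
  assumes z: "cmod z < 1" and w: "cmod w < 1"
  shows "(\<integral>\<^sup>+\<eta>. ennreal (poisson (z * cnj \<eta>)) * ennreal (poisson (w * cnj \<eta>)) \<partial>arc_measure) = ennreal (poisson (z * cnj w))"
proof -
  define R where "R = (if w = 0 then 2 else 1 / cmod w)"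
  have R: "R > 1" using w by (auto simp: R_def)
  define H where "H = (\<lambda>\<eta>. (1 + cnj w * \<eta>) / (1 - cnj w * \<eta>))"
  have ne: "1 - cnj w * \<eta> \<noteq> 0" if "cmod \<eta> < R" for \<eta>
  proof
    assume "1 - cnj w * \<eta> = 0"
    then have "cmod (cnj w * \<eta>) = cmod 1" by (metis eq_iff_diff_eq_0)
    then have "cmod w * cmod \<eta> = 1" by (simp add: norm_mult)
    moreover from this have "w \<noteq> 0" by auto
    ultimately show False using that by (simp add: R_def field_simps split: if_splits)
  qed
  have H: "H holomorphic_on ball 0 R" unfolding H_def by (intro holomorphic_intros) (use ne in auto)
  have le1: "cmod (u * cnj \<eta>) < 1" if "cmod u < 1" "cmod \<eta> = 1" for u \<eta> using that by (simp add: norm_mult)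
  have ReH: "Re (H \<eta>) = poisson (w * cnj \<eta>)" if "cmod \<eta> = 1" for \<eta>
  proof -
    have "poisson (w * cnj \<eta>) = poisson (cnj (w * cnj \<eta>))" by (simp only: poisson_cnj)
    also have "\<dots> = Re (H \<eta>)" unfolding H_def
      using poisson_eq_Re[of "cnj (w * cnj \<eta>)"] le1[OF w that] by (simp add: mult.commute norm_mult)
    finally show ?thesis by simp
  qed
  have int: "integrable arc_measure (\<lambda>\<eta>. Re (of_real (poisson (z * cnj \<eta>)) * H \<eta>))"
    by (intro integrable_Re poisson_formula(2)[OF H R z])
  have "(\<integral>\<^sup>+\<eta>. ennreal (poisson (z * cnj \<eta>)) * ennreal (poisson (w * cnj \<eta>)) \<partial>arc_measure)
      = (\<integral>\<^sup>+\<eta>. ennreal (Re (of_real (poisson (z * cnj \<eta>)) * H \<eta>)) \<partial>arc_measure)"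
    by (intro nn_integral_cong) (simp add: ReH ennreal_mult' poisson_nonneg less_imp_le[OF le1[OF z]])
  also have "\<dots> = ennreal (\<integral>\<eta>. Re (of_real (poisson (z * cnj \<eta>)) * H \<eta>) \<partial>arc_measure)"
    by (intro nn_integral_eq_integral int AE_I2)
       (simp add: ReH poisson_nonneg less_imp_le[OF le1[OF z]] less_imp_le[OF le1[OF w]])
  also have "(\<integral>\<eta>. Re (of_real (poisson (z * cnj \<eta>)) * H \<eta>) \<partial>arc_measure) = Re (H z)"
    by (subst integral_Re[OF poisson_formula(2)[OF H R z]]) (simp add: poisson_formula(1)[OF H R z])
  also have "Re (H z) = poisson (z * cnj w)"
  proof -
    have "cmod (z * cnj w) < 1" using z w mult_strict_mono[of "cmod z" 1 "cmod w" 1] by (simp add: norm_mult)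
    then show ?thesis by (simp add: poisson_eq_Re H_def mult.commute)
  qed
  finally show ?thesis .
qed

section \<open>The radial maximal function is bounded on L2\<close>

interpretation arc2: pair_sigma_finite arc_measure arc_measure ..

text \<open>
  A \<open>TT\<^sup>*\<close> argument bounds the linearized maximal operator \<open>L\<close>, with norm independent of the choice
  \<open>r\<close> of radii: the kernel of \<open>L L\<^sup>*\<close> is a Poisson kernel again, and it is dominated by a multiple of the
  sum of the kernels of \<open>L\<close> and \<open>L\<^sup>*\<close>.
\<close>

locale radius_choice =
  fixes r :: "complex \<Rightarrow> real" and R :: real
  assumes r_meas [measurable]: "r \<in> borel_measurable arc_measure"
    and r_nonneg: "\<And>\<xi>. 0 \<le> r \<xi>" and r_le: "\<And>\<xi>. r \<xi> \<le> R" and R_less: "R < 1"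
begin

lemma r_less: "r \<xi> < 1"
  using r_le[of \<xi>] R_less by simp

definition L :: "complex \<Rightarrow> complex \<Rightarrow> ennreal" where
  "L \<xi> \<eta> = ennreal (poisson (of_real (r \<xi>) * \<xi> * cnj \<eta>))"

lemma L_meas [measurable]: "(\<lambda>p. L (fst p) (snd p)) \<in> borel_measurable (arc_measure \<Otimes>\<^sub>M arc_measure)"
proof -
  note [measurable] = measurable_compose[OF measurable_fst measurable_arc_ident]
    measurable_compose[OF measurable_snd measurable_arc_ident]
  have [measurable]: "(\<lambda>p. cnj (snd p)) \<in> borel_measurable (arc_measure \<Otimes>\<^sub>M arc_measure)"
    using measurable_compose[OF measurable_snd[of arc_measure arc_measure] measurable_arc_power_cnj(2)[of 1]] by simp
  show ?thesis unfolding L_def by measurable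
qed

lemma L_meas' [measurable (raw)]:
  "f \<in> measurable M arc_measure \<Longrightarrow> g \<in> measurable M arc_measure \<Longrightarrow> (\<lambda>x. L (f x) (g x)) \<in> borel_measurable M"
  using measurable_compose[OF measurable_Pair L_meas, of f M g] by simp

text \<open>By \<open>poisson_convolution\<close> the integral is a Poisson kernel at the product of
  the two radii, which \<open>poisson_compare\<close> bounds by the kernel at the smaller radius.
  Either point may have the smaller radius, hence the sum on the right.\<close>

lemma L_product:
  assumes "cmod \<xi> = 1" "cmod \<xi>' = 1"
  shows "(\<integral>\<^sup>+\<eta>. L \<xi> \<eta> * L \<xi>' \<eta> \<partial>arc_measure) \<le> 8 * (L \<xi> \<xi>' + L \<xi>' \<xi>)"
proof -
  have main: "poisson (of_real (r a) * a * cnj (of_real (r b) * b)) \<le> 8 * poisson (of_real (r a) * a * cnj b)"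
    if "cmod a = 1" "cmod b = 1" "r a \<le> r b" for a b
    using poisson_compare[of "a * cnj b" "r a" "r b"] that r_nonneg r_less by (simp add: norm_mult mult_ac)
  have nn: "0 \<le> poisson (of_real (r a) * a * cnj b)" if "cmod a = 1" "cmod b = 1" for a b
    using that r_nonneg[of a] r_less[of a] by (intro poisson_nonneg) (simp add: norm_mult)
  have "(\<integral>\<^sup>+\<eta>. L \<xi> \<eta> * L \<xi>' \<eta> \<partial>arc_measure) = ennreal (poisson (of_real (r \<xi>) * \<xi> * cnj (of_real (r \<xi>') * \<xi>')))"
    unfolding L_def by (rule poisson_convolution) (use assms r_nonneg r_less in \<open>simp_all add: norm_mult\<close>)
  also have "\<dots> \<le> ennreal (8 * (poisson (of_real (r \<xi>) * \<xi> * cnj \<xi>') + poisson (of_real (r \<xi>') * \<xi>' * cnj \<xi>)))"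
  proof (rule ennreal_leI, cases "r \<xi> \<le> r \<xi>'")
    case True
    then show "poisson (of_real (r \<xi>) * \<xi> * cnj (of_real (r \<xi>') * \<xi>')) \<le> 8 * (poisson (of_real (r \<xi>) * \<xi> * cnj \<xi>') + poisson (of_real (r \<xi>') * \<xi>' * cnj \<xi>))"
      using main[OF assms True] nn[OF assms(2,1)] by simp
  next
    case False
    then have le: "r \<xi>' \<le> r \<xi>" by simp
    have "poisson (of_real (r \<xi>) * \<xi> * cnj (of_real (r \<xi>') * \<xi>')) = poisson (cnj (of_real (r \<xi>) * \<xi> * cnj (of_real (r \<xi>') * \<xi>')))"
      by (simp only: poisson_cnj)
    also have "\<dots> = poisson (of_real (r \<xi>') * \<xi>' * cnj (of_real (r \<xi>) * \<xi>))" by (simp add: mult_ac)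
    finally show "poisson (of_real (r \<xi>) * \<xi> * cnj (of_real (r \<xi>') * \<xi>')) \<le> 8 * (poisson (of_real (r \<xi>) * \<xi> * cnj \<xi>') + poisson (of_real (r \<xi>') * \<xi>' * cnj \<xi>))"
      using main[OF assms(2,1) le] nn[OF assms] by simp
  qed
  also have "\<dots> = 8 * (L \<xi> \<xi>' + L \<xi>' \<xi>)"
    unfolding L_def using nn[OF assms] nn[OF assms(2,1)] by (simp add: ennreal_mult' ennreal_plus)
  finally show ?thesis .
qed

text \<open>\<open>N\<close> is the squared L2 norm; \<open>LL\<close> and \<open>LT\<close>
  integrate against the kernel and against its transpose. Extended non-negative values reduce every
  exchange of integrals to measurability.\<close>

definition N :: "(complex \<Rightarrow> ennreal) \<Rightarrow> ennreal" where "N u = (\<integral>\<^sup>+\<xi>. (u \<xi>)\<^sup>2 \<partial>arc_measure)"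
definition LL :: "(complex \<Rightarrow> ennreal) \<Rightarrow> complex \<Rightarrow> ennreal" where "LL u \<xi> = (\<integral>\<^sup>+\<eta>. L \<xi> \<eta> * u \<eta> \<partial>arc_measure)"
definition LT :: "(complex \<Rightarrow> ennreal) \<Rightarrow> complex \<Rightarrow> ennreal" where "LT u \<eta> = (\<integral>\<^sup>+\<xi>. L \<xi> \<eta> * u \<xi> \<partial>arc_measure)"

lemma LL_meas [measurable (raw)]:
  assumes [measurable]: "u \<in> borel_measurable arc_measure"
  shows "LL u \<in> borel_measurable arc_measure"
  unfolding LL_def[abs_def] by measurable

lemma LT_meas [measurable (raw)]:
  assumes [measurable]: "u \<in> borel_measurable arc_measure"
  shows "LT u \<in> borel_measurable arc_measure"
  unfolding LT_def[abs_def] by measurable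

lemma duality:
  assumes [measurable]: "u \<in> borel_measurable arc_measure" "v \<in> borel_measurable arc_measure"
  shows "(\<integral>\<^sup>+\<xi>. v \<xi> * LL u \<xi> \<partial>arc_measure) = (\<integral>\<^sup>+\<eta>. u \<eta> * LT v \<eta> \<partial>arc_measure)"
proof -
  have "(\<integral>\<^sup>+\<xi>. v \<xi> * LL u \<xi> \<partial>arc_measure) = (\<integral>\<^sup>+\<xi>. \<integral>\<^sup>+\<eta>. v \<xi> * (L \<xi> \<eta> * u \<eta>) \<partial>arc_measure \<partial>arc_measure)"
    unfolding LL_def by (intro nn_integral_cong nn_integral_cmult[symmetric]) measurable
  also have "\<dots> = (\<integral>\<^sup>+\<eta>. \<integral>\<^sup>+\<xi>. v \<xi> * (L \<xi> \<eta> * u \<eta>) \<partial>arc_measure \<partial>arc_measure)"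
    by (rule arc2.Fubini'[symmetric]) measurable
  also have "\<dots> = (\<integral>\<^sup>+\<eta>. \<integral>\<^sup>+\<xi>. u \<eta> * (L \<xi> \<eta> * v \<xi>) \<partial>arc_measure \<partial>arc_measure)"
    by (simp add: mult_ac)
  also have "\<dots> = (\<integral>\<^sup>+\<eta>. u \<eta> * LT v \<eta> \<partial>arc_measure)"
    unfolding LT_def by (intro nn_integral_cong nn_integral_cmult) measurable
  finally show ?thesis .
qed

text \<open>Expanding the square gives the quadratic form of the composed kernel. It is dominated by
  8 times the sum of \<open>L\<close> and its transpose, and both have the same quadratic form,
  whence the factor 16.\<close>

lemma N_LT_le:
  assumes v [measurable]: "v \<in> borel_measurable arc_measure"
  shows "N (LT v) \<le> 16 * (\<integral>\<^sup>+\<xi>. v \<xi> * LL v \<xi> \<partial>arc_measure)"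
proof -
  let ?I = "\<integral>\<^sup>+\<xi>. v \<xi> * LL v \<xi> \<partial>arc_measure"
  have "N (LT v) = (\<integral>\<^sup>+\<eta>. \<integral>\<^sup>+\<xi>. \<integral>\<^sup>+\<xi>'. (L \<xi> \<eta> * v \<xi>) * (L \<xi>' \<eta> * v \<xi>') \<partial>arc_measure \<partial>arc_measure \<partial>arc_measure)"
  proof -
    have "(LT v \<eta>)\<^sup>2 = (\<integral>\<^sup>+\<xi>. \<integral>\<^sup>+\<xi>'. (L \<xi> \<eta> * v \<xi>) * (L \<xi>' \<eta> * v \<xi>') \<partial>arc_measure \<partial>arc_measure)" if [measurable]: "\<eta> \<in> space arc_measure" for \<eta>
    proof -
      have "(LT v \<eta>)\<^sup>2 = (\<integral>\<^sup>+\<xi>. L \<xi> \<eta> * v \<xi> \<partial>arc_measure) * LT v \<eta>" by (simp add: LT_def power2_eq_square)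
      also have "\<dots> = (\<integral>\<^sup>+\<xi>. (L \<xi> \<eta> * v \<xi>) * LT v \<eta> \<partial>arc_measure)" by (rule nn_integral_multc[symmetric]) measurable
      also have "\<dots> = (\<integral>\<^sup>+\<xi>. \<integral>\<^sup>+\<xi>'. (L \<xi> \<eta> * v \<xi>) * (L \<xi>' \<eta> * v \<xi>') \<partial>arc_measure \<partial>arc_measure)"
        unfolding LT_def by (intro nn_integral_cong nn_integral_cmult[symmetric]) measurable
      finally show ?thesis .
    qed
    then show ?thesis unfolding N_def by (intro nn_integral_cong)
  qed
  also have "\<dots> = (\<integral>\<^sup>+\<xi>. \<integral>\<^sup>+\<eta>. \<integral>\<^sup>+\<xi>'. (L \<xi> \<eta> * v \<xi>) * (L \<xi>' \<eta> * v \<xi>') \<partial>arc_measure \<partial>arc_measure \<partial>arc_measure)"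
    by (rule arc2.Fubini') measurable
  also have "\<dots> = (\<integral>\<^sup>+\<xi>. \<integral>\<^sup>+\<xi>'. \<integral>\<^sup>+\<eta>. (L \<xi> \<eta> * v \<xi>) * (L \<xi>' \<eta> * v \<xi>') \<partial>arc_measure \<partial>arc_measure \<partial>arc_measure)"
    by (intro nn_integral_cong arc2.Fubini'[symmetric]) measurable
  also have "\<dots> = (\<integral>\<^sup>+\<xi>. \<integral>\<^sup>+\<xi>'. (v \<xi> * v \<xi>') * (\<integral>\<^sup>+\<eta>. L \<xi> \<eta> * L \<xi>' \<eta> \<partial>arc_measure) \<partial>arc_measure \<partial>arc_measure)"
  proof (intro nn_integral_cong)
    fix \<xi> \<xi>' assume [measurable]: "\<xi> \<in> space arc_measure" "\<xi>' \<in> space arc_measure"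
    have "(\<integral>\<^sup>+\<eta>. (L \<xi> \<eta> * v \<xi>) * (L \<xi>' \<eta> * v \<xi>') \<partial>arc_measure) = (\<integral>\<^sup>+\<eta>. (v \<xi> * v \<xi>') * (L \<xi> \<eta> * L \<xi>' \<eta>) \<partial>arc_measure)"
      by (simp add: mult_ac)
    also have "\<dots> = (v \<xi> * v \<xi>') * (\<integral>\<^sup>+\<eta>. L \<xi> \<eta> * L \<xi>' \<eta> \<partial>arc_measure)"
      by (rule nn_integral_cmult) measurable
    finally show "(\<integral>\<^sup>+\<eta>. (L \<xi> \<eta> * v \<xi>) * (L \<xi>' \<eta> * v \<xi>') \<partial>arc_measure) = (v \<xi> * v \<xi>') * (\<integral>\<^sup>+\<eta>. L \<xi> \<eta> * L \<xi>' \<eta> \<partial>arc_measure)" .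
  qed
  also have "\<dots> \<le> (\<integral>\<^sup>+\<xi>. \<integral>\<^sup>+\<xi>'. (v \<xi> * v \<xi>') * (8 * (L \<xi> \<xi>' + L \<xi>' \<xi>)) \<partial>arc_measure \<partial>arc_measure)"
    by (intro nn_integral_mono mult_left_mono L_product) auto
  also have "\<dots> = (\<integral>\<^sup>+\<xi>. (\<integral>\<^sup>+\<xi>'. 8 * (v \<xi> * (L \<xi> \<xi>' * v \<xi>')) \<partial>arc_measure) + (\<integral>\<^sup>+\<xi>'. 8 * (v \<xi>' * (L \<xi>' \<xi> * v \<xi>)) \<partial>arc_measure) \<partial>arc_measure)"
  proof (intro nn_integral_cong)
    fix \<xi> assume [measurable]: "\<xi> \<in> space arc_measure"
    have "(\<integral>\<^sup>+\<xi>'. (v \<xi> * v \<xi>') * (8 * (L \<xi> \<xi>' + L \<xi>' \<xi>)) \<partial>arc_measure)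
        = (\<integral>\<^sup>+\<xi>'. 8 * (v \<xi> * (L \<xi> \<xi>' * v \<xi>')) + 8 * (v \<xi>' * (L \<xi>' \<xi> * v \<xi>)) \<partial>arc_measure)"
      by (intro nn_integral_cong) (simp add: distrib_left mult_ac)
    also have "\<dots> = (\<integral>\<^sup>+\<xi>'. 8 * (v \<xi> * (L \<xi> \<xi>' * v \<xi>')) \<partial>arc_measure) + (\<integral>\<^sup>+\<xi>'. 8 * (v \<xi>' * (L \<xi>' \<xi> * v \<xi>)) \<partial>arc_measure)"
      by (rule nn_integral_add) measurable
    finally show "(\<integral>\<^sup>+\<xi>'. (v \<xi> * v \<xi>') * (8 * (L \<xi> \<xi>' + L \<xi>' \<xi>)) \<partial>arc_measure)
      = (\<integral>\<^sup>+\<xi>'. 8 * (v \<xi> * (L \<xi> \<xi>' * v \<xi>')) \<partial>arc_measure) + (\<integral>\<^sup>+\<xi>'. 8 * (v \<xi>' * (L \<xi>' \<xi> * v \<xi>)) \<partial>arc_measure)" .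
  qed
  also have "\<dots> = (\<integral>\<^sup>+\<xi>. \<integral>\<^sup>+\<xi>'. 8 * (v \<xi> * (L \<xi> \<xi>' * v \<xi>')) \<partial>arc_measure \<partial>arc_measure) + (\<integral>\<^sup>+\<xi>. \<integral>\<^sup>+\<xi>'. 8 * (v \<xi>' * (L \<xi>' \<xi> * v \<xi>)) \<partial>arc_measure \<partial>arc_measure)"
    by (rule nn_integral_add) measurable
  also have "(\<integral>\<^sup>+\<xi>. \<integral>\<^sup>+\<xi>'. 8 * (v \<xi>' * (L \<xi>' \<xi> * v \<xi>)) \<partial>arc_measure \<partial>arc_measure)
      = (\<integral>\<^sup>+\<xi>. \<integral>\<^sup>+\<xi>'. 8 * (v \<xi> * (L \<xi> \<xi>' * v \<xi>')) \<partial>arc_measure \<partial>arc_measure)"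
    by (rule arc2.Fubini') measurable
  also have "(\<integral>\<^sup>+\<xi>. \<integral>\<^sup>+\<xi>'. 8 * (v \<xi> * (L \<xi> \<xi>' * v \<xi>')) \<partial>arc_measure \<partial>arc_measure) = 8 * ?I"
  proof -
    have "(\<integral>\<^sup>+\<xi>'. 8 * (v \<xi> * (L \<xi> \<xi>' * v \<xi>')) \<partial>arc_measure) = 8 * (v \<xi> * LL v \<xi>)" if [measurable]: "\<xi> \<in> space arc_measure" for \<xi>
    proof -
      have m: "(\<lambda>\<xi>'. v \<xi> * (L \<xi> \<xi>' * v \<xi>')) \<in> borel_measurable arc_measure" by measurable
      have "(\<integral>\<^sup>+\<xi>'. v \<xi> * (L \<xi> \<xi>' * v \<xi>') \<partial>arc_measure) = v \<xi> * LL v \<xi>"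
        unfolding LL_def by (rule nn_integral_cmult) measurable
      then show ?thesis by (simp add: nn_integral_cmult[OF m])
    qed
    then have "(\<integral>\<^sup>+\<xi>. \<integral>\<^sup>+\<xi>'. 8 * (v \<xi> * (L \<xi> \<xi>' * v \<xi>')) \<partial>arc_measure \<partial>arc_measure) = (\<integral>\<^sup>+\<xi>. 8 * (v \<xi> * LL v \<xi>) \<partial>arc_measure)"
      by (intro nn_integral_cong)
    then show ?thesis by (subst (asm) nn_integral_cmult) measurable
  qed
  also have "8 * ?I + 8 * ?I = 16 * ?I"
    by (simp flip: distrib_right)
  finally show ?thesis .
qed

text \<open>A crude bound that degenerates as \<open>R\<close> tends to 1. It guarantees that some
  bound exists, so that the infimum of \<open>bounds\<close> makes sense.\<close>

lemma N_LL_le_bound: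
  assumes [measurable]: "u \<in> borel_measurable arc_measure"
  shows "N (LL u) \<le> ennreal ((2 / (1 - R))\<^sup>2) * N u"
proof -
  have Lle: "L \<xi> \<eta> \<le> ennreal (2 / (1 - R))" if "cmod \<xi> = 1" "cmod \<eta> = 1" for \<xi> \<eta>
    unfolding L_def by (intro ennreal_leI poisson_le) (use that r_le r_nonneg R_less in \<open>auto simp: norm_mult\<close>)
  have "(LL u \<xi>)\<^sup>2 \<le> ennreal ((2 / (1 - R))\<^sup>2) * N u" if [measurable]: "\<xi> \<in> space arc_measure" for \<xi>
  proof -
    have "(LL u \<xi>)\<^sup>2 \<le> (\<integral>\<^sup>+\<eta>. (L \<xi> \<eta>)\<^sup>2 \<partial>arc_measure) * N u"
      unfolding LL_def N_def by (rule Cauchy_Schwarz_nn_integral) measurable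
    also have "(\<integral>\<^sup>+\<eta>. (L \<xi> \<eta>)\<^sup>2 \<partial>arc_measure) \<le> (\<integral>\<^sup>+\<eta>. (ennreal (2 / (1 - R)))\<^sup>2 \<partial>arc_measure)"
      using Lle that by (intro nn_integral_mono power_mono) auto
    also have "\<dots> = ennreal ((2 / (1 - R))\<^sup>2)" using R_less arc.emeasure_space_1 by (simp add: ennreal_power)
    finally show ?thesis by (simp add: mult_right_mono)
  qed
  then have "N (LL u) \<le> (\<integral>\<^sup>+\<xi>. ennreal ((2 / (1 - R))\<^sup>2) * N u \<partial>arc_measure)"
    unfolding N_def[of "LL u"] by (intro nn_integral_mono)
  then show ?thesis using arc.emeasure_space_1 by simp
qed

text \<open>If \<open>\<Lambda>\<close> bounds the squared norm, so does \<open>16 * sqrt \<Lambda>\<close>; hence the least bound is at most \<open>256\<close>.\<close>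

definition bounds :: "real set" where
  "bounds = {\<Lambda>. 0 \<le> \<Lambda> \<and> (\<forall>u\<in>borel_measurable arc_measure. N u < \<infinity> \<longrightarrow> N (LL u) \<le> ennreal \<Lambda> * N u)}"

text \<open>With \<open>v = LL u\<close>, duality and Cauchy-Schwarz give
  \<open>(N v)^2 \<le> N u * N (LT v)\<close>; the last factor is at most 16 times the integral of
  \<open>v * LL v\<close>, and that integral is at most \<open>sqrt \<Lambda> * N v\<close>.
  Dividing by \<open>N v\<close>, which the old bound shows to be finite, leaves the new
  bound.\<close>

lemma bound_improve:
  assumes "\<Lambda> \<in> bounds"
  shows "16 * sqrt \<Lambda> \<in> bounds"
proof -
  have L0: "0 \<le> \<Lambda>" and bd: "\<And>u. u \<in> borel_measurable arc_measure \<Longrightarrow> N u < \<infinity> \<Longrightarrow> N (LL u) \<le> ennreal \<Lambda> * N u"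
    using assms by (auto simp: bounds_def)
  have "N (LL u) \<le> ennreal (16 * sqrt \<Lambda>) * N u"
    if [measurable]: "u \<in> borel_measurable arc_measure" and fin: "N u < \<infinity>" for u
  proof -
    let ?v = "LL u"
    have vm [measurable]: "?v \<in> borel_measurable arc_measure" by measurable
    obtain nu where nu: "N u = ennreal nu" "0 \<le> nu" using fin by (cases "N u") auto
    have "N ?v \<le> ennreal (\<Lambda> * nu)" using bd[of u] fin nu L0 by (simp add: ennreal_mult)
    then obtain nv where nv: "N ?v = ennreal nv" "0 \<le> nv" by (cases "N ?v") (auto simp: top_unique)
    have "N (LL ?v) \<le> ennreal (\<Lambda> * nv)" using bd[of ?v] nv L0 by (simp add: ennreal_mult)
    then obtain nw where nw: "N (LL ?v) = ennreal nw" "0 \<le> nw" "nw \<le> \<Lambda> * nv"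
      using L0 nv by (cases "N (LL ?v)") (auto simp: top_unique)
    define X where "X = (\<integral>\<^sup>+\<xi>. ?v \<xi> * LL ?v \<xi> \<partial>arc_measure)"
    have "X\<^sup>2 \<le> N ?v * N (LL ?v)" unfolding X_def N_def by (rule Cauchy_Schwarz_nn_integral) measurable
    then have X2: "X\<^sup>2 \<le> ennreal (nv * nw)" using nv nw by (simp add: ennreal_mult)
    then obtain x where x: "X = ennreal x" "0 \<le> x" by (cases X) (auto simp: top_unique power2_eq_square ennreal_mult_top)
    have "x\<^sup>2 \<le> nv * nw" using X2 x nv nw by (simp add: ennreal_power)
    also have "\<dots> \<le> \<Lambda> * nv\<^sup>2" using mult_left_mono[OF nw(3) nv(2)] by (simp add: power2_eq_square mult_ac)
    finally have xle: "x \<le> sqrt \<Lambda> * nv" using real_le_rsqrt[of x "\<Lambda> * nv\<^sup>2"] nv by (simp add: real_sqrt_mult)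
    have "N (LT ?v) \<le> 16 * X" unfolding X_def by (rule N_LT_le[OF vm])
    then have "N (LT ?v) \<le> ennreal (16 * x)" using x by (simp add: ennreal_mult)
    then obtain y where y: "N (LT ?v) = ennreal y" "0 \<le> y" "y \<le> 16 * x"
      using x by (cases "N (LT ?v)") (auto simp: top_unique)
    have "(N ?v)\<^sup>2 \<le> N u * N (LT ?v)"
    proof -
      have "N ?v = (\<integral>\<^sup>+\<xi>. ?v \<xi> * LL u \<xi> \<partial>arc_measure)" by (simp add: N_def power2_eq_square)
      also have "\<dots> = (\<integral>\<^sup>+\<eta>. u \<eta> * LT ?v \<eta> \<partial>arc_measure)" by (rule duality) measurable
      finally show ?thesis unfolding N_def[of u] N_def[of "LT ?v"] by (simp only:) (rule Cauchy_Schwarz_nn_integral; measurable)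
    qed
    then have "nv\<^sup>2 \<le> nu * y" using nu nv y by (simp add: ennreal_power ennreal_mult[symmetric])
    also have "\<dots> \<le> nu * (16 * (sqrt \<Lambda> * nv))" using nu y xle by (intro mult_left_mono) auto
    finally have "nv * nv \<le> (16 * sqrt \<Lambda> * nu) * nv" by (simp add: power2_eq_square mult_ac)
    then have "nv \<le> 16 * sqrt \<Lambda> * nu" using nv nu L0 by (cases "nv = 0") auto
    then show ?thesis using nu nv L0 by (simp add: ennreal_mult[symmetric])
  qed
  then show ?thesis using L0 by (simp add: bounds_def)
qed

text \<open>The infimum of all bounds is itself a bound, so improving it cannot go lower:
  \<open>\<Lambda> \<le> 16 * sqrt \<Lambda>\<close>, that is,
  \<open>\<Lambda> \<le> 16^2\<close>.\<close>

lemma bound_256: "256 \<in> bounds"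
proof -
  define \<Lambda> where "\<Lambda> = Inf bounds"
  have "(2 / (1 - R))\<^sup>2 \<in> bounds" unfolding bounds_def mem_Collect_eq using N_LL_le_bound zero_le_power2 by blast
  then have ne: "bounds \<noteq> {}" by blast
  have bdd: "bdd_below bounds" by (auto simp: bounds_def intro!: bdd_belowI)
  have L0: "0 \<le> \<Lambda>" unfolding \<Lambda>_def using ne by (intro cInf_greatest) (auto simp: bounds_def)
  have "\<Lambda> \<in> bounds" unfolding bounds_def
  proof (intro CollectI conjI ballI L0)
    fix u :: "complex \<Rightarrow> ennreal"
    assume um: "u \<in> borel_measurable arc_measure"
    show "N u < \<infinity> \<longrightarrow> N (LL u) \<le> ennreal \<Lambda> * N u"
    proof
      assume fin: "N u < \<infinity>"
      have le: "N (LL u) \<le> ennreal (\<Lambda> + inverse (Suc n)) * N u" for n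
      proof -
        obtain g where g: "g \<in> bounds" "g < \<Lambda> + inverse (Suc n)"
          using cInf_lessD[OF ne, of "\<Lambda> + inverse (Suc n)"] by (auto simp: \<Lambda>_def)
        then have "N (LL u) \<le> ennreal g * N u" using um fin by (auto simp: bounds_def)
        also have "\<dots> \<le> ennreal (\<Lambda> + inverse (Suc n)) * N u" using g by (intro mult_right_mono ennreal_leI) auto
        finally show ?thesis .
      qed
      obtain nu where nu: "N u = ennreal nu" "0 \<le> nu" using fin by (cases "N u") auto
      have "(\<lambda>n. ennreal ((\<Lambda> + inverse (real (Suc n))) * nu)) \<longlonglongrightarrow> ennreal ((\<Lambda> + 0) * nu)"
        by (intro tendsto_ennrealI tendsto_intros LIMSEQ_inverse_real_of_nat)
      moreover have "N (LL u) \<le> ennreal ((\<Lambda> + inverse (real (Suc n))) * nu)" for n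
        using le[of n] nu L0 by (simp add: ennreal_mult)
      ultimately have "N (LL u) \<le> ennreal ((\<Lambda> + 0) * nu)" by (intro LIMSEQ_le_const) auto
      then show "N (LL u) \<le> ennreal \<Lambda> * N u" using nu L0 by (simp add: ennreal_mult)
    qed
  qed
  then have "\<Lambda> \<le> 16 * sqrt \<Lambda>" using cInf_lower[OF bound_improve bdd, of \<Lambda>] by (simp flip: \<Lambda>_def)
  then have "sqrt \<Lambda> * sqrt \<Lambda> \<le> 16 * sqrt \<Lambda>" using L0 by simp
  then have "sqrt \<Lambda> \<le> 16"
    using mult_right_le_imp_le[of "sqrt \<Lambda>" "sqrt \<Lambda>" 16] real_sqrt_ge_zero[OF L0]
    by (cases "sqrt \<Lambda> = 0") (simp, linarith)
  then have "\<Lambda> \<le> 16\<^sup>2" by (rule sqrt_le_D)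
  then have le: "\<Lambda> \<le> 256" by simp
  show ?thesis unfolding bounds_def
  proof (intro CollectI conjI ballI)
    fix u :: "complex \<Rightarrow> ennreal"
    assume u: "u \<in> borel_measurable arc_measure"
    show "N u < \<infinity> \<longrightarrow> N (LL u) \<le> ennreal 256 * N u"
    proof
      assume "N u < \<infinity>"
      then have "N (LL u) \<le> ennreal \<Lambda> * N u" using u \<open>\<Lambda> \<in> bounds\<close> by (auto simp: bounds_def)
      also have "\<dots> \<le> ennreal 256 * N u" using le by (intro mult_right_mono ennreal_leI) auto
      finally show "N (LL u) \<le> ennreal 256 * N u" .
    qed
  qed simp
qed

end

text \<open>The value of \<open>f\<close> at an interior point is a Poisson average of its boundary
  values, so its modulus is at most \<open>LL\<close> applied to the modulus of \<open>f\<close> on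
  the circle.\<close>

lemma (in radius_choice) maximal_holomorphic:
  assumes f: "f holomorphic_on ball 0 \<rho>" and \<rho>: "\<rho> > 1"
  shows "(\<integral>\<^sup>+\<xi>. ennreal ((cmod (f (of_real (r \<xi>) * \<xi>)))\<^sup>2) \<partial>arc_measure)
       \<le> 256 * (\<integral>\<^sup>+\<xi>. ennreal ((cmod (f \<xi>))\<^sup>2) \<partial>arc_measure)"
proof -
  have c: "continuous_on (sphere 0 1) f"
    by (rule continuous_on_subset[OF holomorphic_on_imp_continuous_on[OF f]]) (use \<rho> in auto)
  have [measurable]: "f \<in> borel_measurable arc_measure" by (rule measurable_arc_continuous[OF c])
  let ?u = "\<lambda>\<eta>. ennreal (cmod (f \<eta>))"
  have um: "?u \<in> borel_measurable arc_measure" by measurable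
  obtain B where B: "\<And>\<xi>. cmod \<xi> = 1 \<Longrightarrow> cmod (f \<xi>) \<le> B"
    using compact_imp_bounded[OF compact_continuous_image[OF c]] by (force simp: bounded_iff)
  have sq: "ennreal (t\<^sup>2) = (ennreal t)\<^sup>2" if "0 \<le> t" for t using that by (simp add: ennreal_power)
  have "N ?u \<le> (\<integral>\<^sup>+\<xi>. ennreal (B\<^sup>2) \<partial>arc_measure)"
    unfolding N_def by (intro nn_integral_mono) (auto simp: ennreal_power intro!: ennreal_leI power_mono B)
  also have "\<dots> < \<infinity>" using arc.emeasure_space_1 by simp
  finally have fin: "N ?u < \<infinity>" .
  have ptw: "ennreal (cmod (f (of_real (r \<xi>) * \<xi>))) \<le> LL ?u \<xi>" if \<xi>: "cmod \<xi> = 1" for \<xi>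
  proof -
    let ?z = "of_real (r \<xi>) * \<xi>"
    have z: "cmod ?z < 1" using \<xi> r_nonneg[of \<xi>] r_less[of \<xi>] by (simp add: norm_mult)
    have "ennreal (cmod (f ?z)) = ennreal (norm (\<integral>\<eta>. of_real (poisson (?z * cnj \<eta>)) * f \<eta> \<partial>arc_measure))"
      by (simp add: poisson_formula(1)[OF f \<rho> z])
    also have "\<dots> \<le> (\<integral>\<^sup>+\<eta>. ennreal (norm (of_real (poisson (?z * cnj \<eta>)) * f \<eta>)) \<partial>arc_measure)"
      by (rule integral_norm_bound_ennreal[OF poisson_formula(2)[OF f \<rho> z]])
    also have "\<dots> = LL ?u \<xi>"
      unfolding LL_def L_def
    proof (intro nn_integral_cong)
      fix \<eta> assume "\<eta> \<in> space arc_measure"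
      then have "0 \<le> poisson (?z * cnj \<eta>)" using z by (intro poisson_nonneg) (simp add: norm_mult)
      then show "ennreal (norm (of_real (poisson (?z * cnj \<eta>)) * f \<eta>)) = ennreal (poisson (?z * cnj \<eta>)) * ennreal (cmod (f \<eta>))"
        by (simp add: norm_mult ennreal_mult)
    qed
    finally show ?thesis .
  qed
  have "(\<integral>\<^sup>+\<xi>. ennreal ((cmod (f (of_real (r \<xi>) * \<xi>)))\<^sup>2) \<partial>arc_measure) \<le> N (LL ?u)"
    unfolding N_def by (intro nn_integral_mono) (simp add: sq ptw power_mono)
  also have "\<dots> \<le> ennreal 256 * N ?u" using bound_256 um fin by (auto simp: bounds_def)
  also have "N ?u = (\<integral>\<^sup>+\<xi>. ennreal ((cmod (f \<xi>))\<^sup>2) \<partial>arc_measure)" by (simp add: N_def sq)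
  finally show ?thesis by simp
qed

lemma to_fun_measurable [measurable]: "to_fun x \<in> borel_measurable borel"
  unfolding to_fun_def[abs_def] by measurable

lemma nn_integral_dilation_le:
  assumes s: "0 \<le> s" "s < 1"
  shows "(\<integral>\<^sup>+\<xi>. ennreal ((cmod (to_fun x (of_real s * \<xi>)))\<^sup>2) \<partial>arc_measure) \<le> ennreal ((norm x)\<^sup>2)"
proof -
  note int = integrable_arc_dilation(2)[OF to_fun_holomorphic s]
  have "(\<integral>\<^sup>+\<xi>. ennreal ((cmod (to_fun x (of_real s * \<xi>)))\<^sup>2) \<partial>arc_measure)
      = ennreal (\<integral>\<xi>. (cmod (to_fun x (of_real s * \<xi>)))\<^sup>2 \<partial>arc_measure)"
    by (rule nn_integral_eq_integral[OF int]) simp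
  also have "(\<integral>\<xi>. (cmod (to_fun x (of_real s * \<xi>)))\<^sup>2 \<partial>arc_measure) = (\<Sum>n. (cmod (coef x n))\<^sup>2 * s ^ (2 * n))"
    using disc_parseval[OF to_fun_holomorphic[of x] s] by (simp add: sums_iff)
  also have "\<dots> \<le> (norm x)\<^sup>2" unfolding norm_ell2_sq
    using disc_parseval[OF to_fun_holomorphic[of x] s] s
    by (intro suminf_le summable_coef_sq) (auto simp: sums_iff intro!: mult_left_le power_le_one)
  finally show ?thesis by (simp add: ennreal_leI)
qed

text \<open>Dilating by some \<open>s\<close> strictly between \<open>R\<close> and 1 makes the
  function holomorphic past the circle; dividing the radii by \<open>s\<close> compensates and keeps
  them below 1.\<close>

lemma (in radius_choice) maximal_H2:
  "(\<integral>\<^sup>+\<xi>. ennreal ((cmod (to_fun x (of_real (r \<xi>) * \<xi>)))\<^sup>2) \<partial>arc_measure) \<le> 256 * ennreal ((norm x)\<^sup>2)"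
proof -
  define s where "s = (1 + R) / 2"
  have R0: "0 \<le> R" using r_nonneg[of 0] r_le[of 0] by simp
  have s: "0 < s" "R < s" "s < 1" using R0 R_less by (auto simp: s_def)
  interpret rs: radius_choice "\<lambda>\<xi>. r \<xi> / s" "R / s"
    by unfold_locales (use s R0 r_nonneg r_le in \<open>auto simp: divide_right_mono\<close>)
  let ?f = "\<lambda>z. to_fun x (of_real s * z)"
  have hol: "?f holomorphic_on ball 0 (1 / s)"
    by (rule holomorphic_on_compose_gen[OF _ to_fun_holomorphic, of "\<lambda>z. of_real s * z", unfolded o_def])
       (use s in \<open>auto intro!: holomorphic_intros simp: norm_mult field_simps\<close>)
  have "(\<integral>\<^sup>+\<xi>. ennreal ((cmod (to_fun x (of_real (r \<xi>) * \<xi>)))\<^sup>2) \<partial>arc_measure)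
      = (\<integral>\<^sup>+\<xi>. ennreal ((cmod (?f (of_real (r \<xi> / s) * \<xi>)))\<^sup>2) \<partial>arc_measure)"
    using s by simp
  also have "\<dots> \<le> 256 * (\<integral>\<^sup>+\<xi>. ennreal ((cmod (?f \<xi>))\<^sup>2) \<partial>arc_measure)"
    by (rule rs.maximal_holomorphic[OF hol]) (use s in simp)
  also have "\<dots> \<le> 256 * ennreal ((norm x)\<^sup>2)"
    by (intro mult_left_mono nn_integral_dilation_le) (use s in auto)
  finally show ?thesis .
qed

text \<open>An enumeration of the rational radii in \<open>[0, 1)\<close>, with all other rationals
  sent to 0. Countability keeps suprema and convergence sets measurable.\<close>

definition rat_radius :: "nat \<Rightarrow> real" where
  "rat_radius k = (let p = of_rat (from_nat k :: rat) in if 0 \<le> p \<and> p < 1 then p else 0)"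

lemma rat_radius_bounds: "0 \<le> rat_radius k" "rat_radius k < 1"
  by (auto simp: rat_radius_def Let_def)

lemma rat_radius_dense:
  assumes "0 \<le> a" "a < b" "b \<le> 1"
  obtains k where "a < rat_radius k" "rat_radius k < b"
proof -
  obtain p where p: "a < of_rat p" "of_rat p < b" using of_rat_dense[OF assms(2)] by blast
  have "0 \<le> (of_rat p :: real)" "of_rat p < (1 :: real)" using p assms by linarith+
  then have "rat_radius (to_nat p) = of_rat p" by (simp add: rat_radius_def)
  with p that show ?thesis by metis
qed

text \<open>Picks, for each boundary point, a radius among the first \<open>Suc K\<close> rational
  ones where the modulus of \<open>h\<close> is largest. Having finitely many values gives a common
  bound below 1, as \<open>radius_choice\<close> asks.\<close>

primrec max_radius :: "(complex \<Rightarrow> complex) \<Rightarrow> nat \<Rightarrow> complex \<Rightarrow> real" where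
  "max_radius h 0 \<xi> = rat_radius 0"
| "max_radius h (Suc K) \<xi> =
     (if cmod (h (of_real (max_radius h K \<xi>) * \<xi>)) < cmod (h (of_real (rat_radius (Suc K)) * \<xi>))
      then rat_radius (Suc K) else max_radius h K \<xi>)"

text \<open>The running maxima over finitely many radii increase to the supremum, each is covered by
  \<open>maximal_H2\<close> with the same constant, and monotone convergence passes to the
  limit.\<close>

lemma radial_maximal_inequality:
  "(\<integral>\<^sup>+\<xi>. (SUP k. ennreal ((cmod (to_fun x (of_real (rat_radius k) * \<xi>)))\<^sup>2)) \<partial>arc_measure) \<le> 256 * ennreal ((norm x)\<^sup>2)"
proof -
  let ?h = "to_fun x"
  let ?m = "\<lambda>K \<xi>. ennreal ((cmod (?h (of_real (max_radius ?h K \<xi>) * \<xi>)))\<^sup>2)"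
  have meas [measurable]: "max_radius ?h K \<in> borel_measurable arc_measure" for K
  proof (induction K)
    case (Suc K)
    then have [measurable]: "max_radius ?h K \<in> borel_measurable arc_measure" .
    show ?case by (simp add: max_radius.simps(2)[abs_def] del: max_radius.simps) measurable
  qed simp
  have bounds: "\<exists>k\<le>K. max_radius ?h K \<xi> = rat_radius k" for K \<xi>
  proof (induction K)
    case (Suc K)
    then obtain k where "k \<le> K" "max_radius ?h K \<xi> = rat_radius k" by blast
    then show ?case by (cases "max_radius ?h (Suc K) \<xi> = rat_radius (Suc K)") (auto intro: exI[of _ k] split: if_splits)
  qed simp
  have mono: "cmod (?h (of_real (max_radius ?h K \<xi>) * \<xi>)) \<le> cmod (?h (of_real (max_radius ?h (Suc K) \<xi>) * \<xi>))" for K \<xi>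
    by simp
  have inc: "incseq ?m"
    by (rule incseq_SucI, rule le_funI, rule ennreal_leI, rule power_mono[OF mono norm_ge_zero])
  have top: "cmod (?h (of_real (rat_radius K) * \<xi>)) \<le> cmod (?h (of_real (max_radius ?h K \<xi>) * \<xi>))" for K \<xi>
    by (cases K) auto
  have le: "integral\<^sup>N arc_measure (?m K) \<le> 256 * ennreal ((norm x)\<^sup>2)" for K
  proof -
    interpret radius_choice "max_radius ?h K" "Max (rat_radius ` {..K})"
    proof
      show "0 \<le> max_radius ?h K \<xi>" "max_radius ?h K \<xi> \<le> Max (rat_radius ` {..K})" for \<xi>
        using bounds[of K \<xi>] rat_radius_bounds by (auto intro!: Max_ge)
      show "Max (rat_radius ` {..K}) < 1" using rat_radius_bounds by (subst Max_less_iff) auto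
    qed measurable
    show ?thesis by (rule maximal_H2)
  qed
  have "(\<integral>\<^sup>+\<xi>. (SUP k. ennreal ((cmod (?h (of_real (rat_radius k) * \<xi>)))\<^sup>2)) \<partial>arc_measure)
      \<le> (\<integral>\<^sup>+\<xi>. (SUP K. ?m K \<xi>) \<partial>arc_measure)"
    by (intro nn_integral_mono SUP_mono) (auto intro!: exI[of _ "_ :: nat"] ennreal_leI power_mono top)
  also have "\<dots> = (SUP K. integral\<^sup>N arc_measure (?m K))"
    by (rule nn_integral_monotone_convergence_SUP[OF inc]) measurable
  also have "\<dots> \<le> 256 * ennreal ((norm x)\<^sup>2)" by (rule SUP_least) (rule le)
  finally show ?thesis .
qed

subsection \<open>Radial limits\<close>

text \<open>Cauchy's criterion restricted to rational radii, extended to all radii by continuity.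
  The right side consists of countably many conditions, which makes the set of boundary points with
  a radial limit measurable.\<close>

lemma ex_radial_limit_iff:
  fixes g :: "real \<Rightarrow> complex"
  assumes cont: "continuous_on {0..<1} g"
  shows "(\<exists>l. (g \<longlongrightarrow> l) (at_left 1)) \<longleftrightarrow>
    (\<forall>m::nat. \<exists>k::nat. \<forall>i j. 1 - inverse (Suc k) < rat_radius i \<longrightarrow> 1 - inverse (Suc k) < rat_radius j \<longrightarrow>
       dist (g (rat_radius i)) (g (rat_radius j)) \<le> inverse (Suc m))" (is "?A \<longleftrightarrow> ?B")
proof
  assume ?A
  then obtain l where l: "(g \<longlongrightarrow> l) (at_left 1)" by blast
  show ?B
  proof
    fix m :: nat
    have "eventually (\<lambda>r. dist (g r) l < inverse (Suc m) / 2) (at_left 1)"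
      by (rule tendstoD[OF l]) simp
    then obtain d where d: "d < 1" "\<And>r. d < r \<Longrightarrow> r < 1 \<Longrightarrow> dist (g r) l < inverse (Suc m) / 2"
      unfolding eventually_at_left_field by blast
    obtain k where k: "inverse (Suc k) < 1 - d" using reals_Archimedean[of "1 - d"] d(1) by auto
    have "dist (g (rat_radius i)) (g (rat_radius j)) \<le> inverse (Suc m)"
      if "1 - inverse (Suc k) < rat_radius i" "1 - inverse (Suc k) < rat_radius j" for i j
    proof -
      have "dist (g (rat_radius i)) l < inverse (Suc m) / 2" "dist (g (rat_radius j)) l < inverse (Suc m) / 2"
        using that k rat_radius_bounds[of i] rat_radius_bounds[of j] by (intro d(2); linarith)+
      then show ?thesis using dist_triangle2[of "g (rat_radius i)" "g (rat_radius j)" l] by linarith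
    qed
    then show "\<exists>k::nat. \<forall>i j. 1 - inverse (Suc k) < rat_radius i \<longrightarrow> 1 - inverse (Suc k) < rat_radius j \<longrightarrow>
       dist (g (rat_radius i)) (g (rat_radius j)) \<le> inverse (Suc m)" by blast
  qed
next
  assume B: ?B
  \<comment> \<open>Each radius is a limit of larger rational radii, which therefore stay beyond
    \<open>a\<close>.\<close>
  have approx: "\<exists>u. (\<forall>n. a < rat_radius (u n)) \<and> (\<lambda>n. g (rat_radius (u n))) \<longlonglongrightarrow> g r"
    if "0 \<le> a" "a < r" "r < 1" for a r
  proof -
    have "\<exists>k. r < rat_radius k \<and> rat_radius k < min 1 (r + inverse (Suc n))" for n
      using rat_radius_dense[of r "min 1 (r + inverse (Suc n))"] that by auto
    then obtain u where u: "\<And>n. r < rat_radius (u n)" "\<And>n. rat_radius (u n) < min 1 (r + inverse (Suc n))" by metis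
    have "(\<lambda>n. rat_radius (u n)) \<longlonglongrightarrow> r"
    proof (rule tendsto_sandwich[OF _ _ tendsto_const])
      show "(\<lambda>n. r + inverse (Suc n)) \<longlonglongrightarrow> r"
        using tendsto_add[OF tendsto_const LIMSEQ_inverse_real_of_nat, of r] by simp
      show "\<forall>\<^sub>F n in sequentially. r \<le> rat_radius (u n)" "\<forall>\<^sub>F n in sequentially. rat_radius (u n) \<le> r + inverse (Suc n)"
        using u by (auto intro!: always_eventually less_imp_le simp: min_less_iff_conj)
    qed
    then have "(\<lambda>n. g (rat_radius (u n))) \<longlonglongrightarrow> g r"
      by (rule continuous_on_tendsto_compose[OF cont]) (use that rat_radius_bounds in \<open>auto intro!: always_eventually\<close>)
    then show ?thesis using u(1) that by (intro exI[of _ u]) (auto intro: less_trans)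
  qed
  have B': "\<exists>k::nat. \<forall>r s. 1 - inverse (Suc k) < r \<longrightarrow> r < 1 \<longrightarrow> 1 - inverse (Suc k) < s \<longrightarrow> s < 1 \<longrightarrow>
       dist (g r) (g s) \<le> inverse (Suc m)" for m
  proof -
    obtain k where k: "\<And>i j. 1 - inverse (Suc k) < rat_radius i \<Longrightarrow> 1 - inverse (Suc k) < rat_radius j \<Longrightarrow>
       dist (g (rat_radius i)) (g (rat_radius j)) \<le> inverse (Suc m)" using B by blast
    have a0: "0 \<le> 1 - inverse (real (Suc k))" by (simp add: inverse_le_1_iff)
    have "dist (g r) (g s) \<le> inverse (Suc m)"
      if rs: "1 - inverse (Suc k) < r" "r < 1" "1 - inverse (Suc k) < s" "s < 1" for r s
    proof -
      obtain u v where u: "\<And>n. 1 - inverse (Suc k) < rat_radius (u n)" "(\<lambda>n. g (rat_radius (u n))) \<longlonglongrightarrow> g r"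
        and v: "\<And>n. 1 - inverse (Suc k) < rat_radius (v n)" "(\<lambda>n. g (rat_radius (v n))) \<longlonglongrightarrow> g s"
        using approx[OF a0 rs(1,2)] approx[OF a0 rs(3,4)] by blast
      show ?thesis
        by (rule LIMSEQ_le_const2[OF tendsto_dist[OF u(2) v(2)]]) (use k[OF u(1) v(1)] in blast)
    qed
    then show ?thesis by blast
  qed
  define r where "r n = 1 - inverse (real (Suc (Suc n)))" for n
  have r1: "r n < 1" for n by (simp add: r_def)
  have rk: "1 - inverse (real (Suc k)) < r n" if "k \<le> n" for k n
    using that by (simp add: r_def less_imp_inverse_less)
  have "Cauchy (\<lambda>n. g (r n))"
  proof (rule metric_CauchyI)
    fix e :: real assume "e > 0"
    then obtain m where m: "inverse (Suc m) < e" using reals_Archimedean by blast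
    obtain k where "\<And>r s. 1 - inverse (Suc k) < r \<Longrightarrow> r < 1 \<Longrightarrow> 1 - inverse (Suc k) < s \<Longrightarrow> s < 1 \<Longrightarrow>
       dist (g r) (g s) \<le> inverse (Suc m)" using B' by blast
    then have "dist (g (r i)) (g (r j)) < e" if "i \<ge> k" "j \<ge> k" for i j
      using rk that r1 m by (meson order.strict_trans1)
    then show "\<exists>M. \<forall>i\<ge>M. \<forall>j\<ge>M. dist (g (r i)) (g (r j)) < e" by blast
  qed
  then obtain l where l: "(\<lambda>n. g (r n)) \<longlonglongrightarrow> l" using Cauchy_convergent convergent_def by blast
  have "(g \<longlongrightarrow> l) (at_left 1)"
  proof (rule tendstoI)
    fix e :: real assume "e > 0"
    then obtain m where m: "inverse (Suc m) < e" using reals_Archimedean by blast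
    obtain k where k: "\<And>r s. 1 - inverse (Suc k) < r \<Longrightarrow> r < 1 \<Longrightarrow> 1 - inverse (Suc k) < s \<Longrightarrow> s < 1 \<Longrightarrow>
       dist (g r) (g s) \<le> inverse (Suc m)" using B' by blast
    have "dist (g t) l < e" if "1 - inverse (Suc k) < t" "t < 1" for t
    proof -
      have "dist (g t) l \<le> inverse (Suc m)"
        by (rule LIMSEQ_le_const2[OF tendsto_dist[OF tendsto_const l]]) (use k[OF that rk r1] in blast)
      with m show ?thesis by simp
    qed
    then show "eventually (\<lambda>t. dist (g t) l < e) (at_left 1)"
      unfolding eventually_at_left_field by (intro exI[of _ "1 - inverse (Suc k)"]) auto
  qed
  then show ?A by blast
qed

lift_definition trunc :: "nat \<Rightarrow> ell2 \<Rightarrow> ell2" is "\<lambda>N x n. if n < N then x n else 0"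
  subgoal for N x by (rule summable_comparison_test'[of "\<lambda>n. (cmod (x n))\<^sup>2" 0]) auto
  done

lemma norm_trunc_sq: "(norm (trunc N x))\<^sup>2 = (\<Sum>n<N. (cmod (coef x n))\<^sup>2)"
proof -
  have "(\<lambda>n. (cmod (coef (trunc N x) n))\<^sup>2) sums (\<Sum>n<N. (cmod (coef (trunc N x) n))\<^sup>2)"
    by (rule sums_finite) (auto simp: trunc.rep_eq)
  then show ?thesis unfolding norm_ell2_sq by (simp add: sums_iff trunc.rep_eq)
qed

lemma norm_diff_trunc_sq: "(norm (x - trunc N x))\<^sup>2 = (norm x)\<^sup>2 - (\<Sum>n<N. (cmod (coef x n))\<^sup>2)"
proof -
  have "(norm (x - trunc N x))\<^sup>2 = (\<Sum>n. (cmod (coef x n))\<^sup>2 - (cmod (coef (trunc N x) n))\<^sup>2)"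
    unfolding norm_ell2_sq by (intro suminf_cong) (simp add: coef_simps trunc.rep_eq)
  also have "\<dots> = (norm x)\<^sup>2 - (norm (trunc N x))\<^sup>2"
    unfolding norm_ell2_sq by (intro suminf_diff[symmetric] summable_coef_sq)
  finally show ?thesis by (simp add: norm_trunc_sq)
qed

lemma norm_diff_trunc_tendsto: "(\<lambda>N. (norm (x - trunc N x))\<^sup>2) \<longlonglongrightarrow> 0"
  unfolding norm_diff_trunc_sq
  using tendsto_diff[OF tendsto_const norm_ell2_sums[of x, unfolded sums_def], of "(norm x)\<^sup>2"] by simp

lemma trunc_tendsto: "(\<lambda>N. trunc N x) \<longlonglongrightarrow> x"
proof -
  have "(\<lambda>N. sqrt ((norm (x - trunc N x))\<^sup>2)) \<longlonglongrightarrow> sqrt 0"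
    by (intro tendsto_real_sqrt norm_diff_trunc_tendsto)
  then have "(\<lambda>N. trunc N x - x) \<longlonglongrightarrow> 0"
    by (subst tendsto_norm_zero_iff[symmetric]) (simp add: norm_minus_commute)
  then show ?thesis by (rule LIM_zero_cancel)
qed

lemma to_fun_trunc: "cmod z < 1 \<Longrightarrow> to_fun (trunc N x) z = (\<Sum>n<N. coef x n * z ^ n)"
proof -
  assume z: "cmod z < 1"
  have "(\<lambda>n. coef (trunc N x) n * z ^ n) sums (\<Sum>n<N. coef (trunc N x) n * z ^ n)"
    by (rule sums_finite) (auto simp: trunc.rep_eq)
  then show ?thesis using to_fun_sums[OF z, of "trunc N x"] by (simp add: sums_iff trunc.rep_eq)
qed

lemma continuous_on_radius:
  assumes "cmod \<xi> = 1"
  shows "continuous_on {0..<1} (\<lambda>r. to_fun x (of_real r * \<xi>))"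
  by (rule continuous_on_compose2[OF holomorphic_on_imp_continuous_on[OF to_fun_holomorphic]])
     (use assms in \<open>auto intro!: continuous_intros simp: norm_mult\<close>)

text \<open>Fatou's theorem. Polynomials have radial limits, and the maximal function of the tail
  \<open>x - trunc N x\<close> has integral tending to 0, so at almost every point its infimum over
  \<open>N\<close> vanishes and the oscillation near the circle becomes arbitrarily small.\<close>

theorem AE_ex_radial_limit:
  "AE \<xi> in arc_measure. \<exists>l. ((\<lambda>r. to_fun x (of_real r * \<xi>)) \<longlongrightarrow> l) (at_left 1)"
proof -
  define M where "M N \<xi> = (SUP k. ennreal ((cmod (to_fun (x - trunc N x) (of_real (rat_radius k) * \<xi>)))\<^sup>2))" for N \<xi>
  have [measurable]: "M N \<in> borel_measurable arc_measure" for N unfolding M_def[abs_def] by measurable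
  have "(\<integral>\<^sup>+\<xi>. (INF N. M N \<xi>) \<partial>arc_measure) \<le> 256 * ennreal ((norm (x - trunc N x))\<^sup>2)" for N
  proof -
    have "(\<integral>\<^sup>+\<xi>. (INF N. M N \<xi>) \<partial>arc_measure) \<le> (\<integral>\<^sup>+\<xi>. M N \<xi> \<partial>arc_measure)"
      by (intro nn_integral_mono INF_lower) simp
    also have "\<dots> \<le> 256 * ennreal ((norm (x - trunc N x))\<^sup>2)"
      unfolding M_def by (rule radial_maximal_inequality)
    finally show ?thesis .
  qed
  moreover have "(\<lambda>N. ennreal (256 * (norm (x - trunc N x))\<^sup>2)) \<longlonglongrightarrow> ennreal (256 * 0)"
    by (intro tendsto_ennrealI tendsto_intros norm_diff_trunc_tendsto)
  ultimately have "(\<integral>\<^sup>+\<xi>. (INF N. M N \<xi>) \<partial>arc_measure) \<le> ennreal (256 * 0)"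
    by (intro LIMSEQ_le_const) (auto simp: ennreal_mult)
  then have "(\<integral>\<^sup>+\<xi>. (INF N. M N \<xi>) \<partial>arc_measure) = 0" by simp
  then have "AE \<xi> in arc_measure. (INF N. M N \<xi>) = 0"
    by (subst (asm) nn_integral_0_iff_AE) measurable
  then show ?thesis
  proof (rule AE_mp, intro AE_I2 impI)
    fix \<xi> assume "\<xi> \<in> space arc_measure" and inf0: "(INF N. M N \<xi>) = 0"
    then have \<xi>: "cmod \<xi> = 1" by simp
    show "\<exists>l. ((\<lambda>r. to_fun x (of_real r * \<xi>)) \<longlongrightarrow> l) (at_left 1)"
      unfolding ex_radial_limit_iff[OF continuous_on_radius[OF \<xi>]]
    proof
      fix m :: nat
      \<comment> \<open>One third is for the polynomial part, one third for the tail at each of the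
        two radii.\<close>
      define e where "e = inverse (real (Suc m)) / 3"
      have e: "e > 0" by (simp add: e_def)
      have "(INF N. M N \<xi>) < ennreal (e\<^sup>2)" using inf0 e by simp
      then obtain N where N: "M N \<xi> < ennreal (e\<^sup>2)" by (auto simp: INF_less_iff)
      have h: "cmod (to_fun (x - trunc N x) (of_real (rat_radius k) * \<xi>)) < e" for k
      proof -
        have "ennreal ((cmod (to_fun (x - trunc N x) (of_real (rat_radius k) * \<xi>)))\<^sup>2) < ennreal (e\<^sup>2)"
          by (rule le_less_trans[OF _ N]) (auto simp: M_def intro: SUP_upper)
        then show ?thesis using e by (simp add: ennreal_less_iff power2_less_imp_less)
      qed
      let ?p = "\<lambda>r. \<Sum>n<N. coef x n * (of_real r * \<xi>) ^ n"
      have "(?p \<longlongrightarrow> ?p 1) (at_left 1)" by (auto intro!: tendsto_eq_intros)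
      then have "eventually (\<lambda>r. dist (?p r) (?p 1) < e / 2) (at_left 1)" using e by (intro tendstoD) auto
      then obtain d where d: "d < 1" "\<And>r. d < r \<Longrightarrow> r < 1 \<Longrightarrow> dist (?p r) (?p 1) < e / 2"
        unfolding eventually_at_left_field by blast
      obtain k where k: "inverse (Suc k) < 1 - d" using reals_Archimedean[of "1 - d"] d(1) by auto
      have "dist (to_fun x (of_real (rat_radius i) * \<xi>)) (to_fun x (of_real (rat_radius j) * \<xi>)) \<le> inverse (Suc m)"
        if ij: "1 - inverse (Suc k) < rat_radius i" "1 - inverse (Suc k) < rat_radius j" for i j
      proof -
        have split: "to_fun x (of_real (rat_radius i) * \<xi>)
            = ?p (rat_radius i) + to_fun (x - trunc N x) (of_real (rat_radius i) * \<xi>)" for i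
          using to_fun_trunc[of "of_real (rat_radius i) * \<xi>" N x] \<xi> rat_radius_bounds[of i]
          by (simp add: to_fun_diff norm_mult)
        have "dist (?p (rat_radius i)) (?p 1) < e / 2" "dist (?p (rat_radius j)) (?p 1) < e / 2"
          using ij k rat_radius_bounds[of i] rat_radius_bounds[of j] by (intro d(2); linarith)+
        then have "dist (?p (rat_radius i)) (?p (rat_radius j)) < e"
          using dist_triangle2[of "?p (rat_radius i)" "?p (rat_radius j)" "?p 1"] by linarith
        moreover have "dist (to_fun x (of_real (rat_radius i) * \<xi>)) (to_fun x (of_real (rat_radius j) * \<xi>))
          \<le> dist (?p (rat_radius i)) (?p (rat_radius j)) + cmod (to_fun (x - trunc N x) (of_real (rat_radius i) * \<xi>))
            + cmod (to_fun (x - trunc N x) (of_real (rat_radius j) * \<xi>))"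
        proof -
          have "dist (a + u) (b + v) \<le> dist a b + cmod u + cmod v" for a b u v :: complex
            using norm_diff_triangle_ineq[of a u b v] norm_triangle_ineq4[of u v] by (simp add: dist_norm)
          then show ?thesis unfolding split .
        qed
        moreover have "3 * e = inverse (real (Suc m))" by (simp add: e_def)
        ultimately show ?thesis using h[of i] h[of j] by linarith
      qed
      then show "\<exists>k::nat. \<forall>i j. 1 - inverse (Suc k) < rat_radius i \<longrightarrow> 1 - inverse (Suc k) < rat_radius j \<longrightarrow>
         dist (to_fun x (of_real (rat_radius i) * \<xi>)) (to_fun x (of_real (rat_radius j) * \<xi>)) \<le> inverse (Suc m)" by blast
    qed
  qed
qed

section \<open>Boundary functions and the isometry of \<open>H2\<close> into L2 of the
  circle\<close>

lemma borel_measurable_cnj [measurable (raw)]: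
  "f \<in> borel_measurable M \<Longrightarrow> (\<lambda>x. cnj (f x)) \<in> borel_measurable M"
  by (rule borel_measurable_continuous_on[of cnj]) (intro continuous_intros)

definition bv :: "ell2 \<Rightarrow> complex \<Rightarrow> complex" where
  "bv x = radial_limit (to_fun x)"

lemma radial_limit_eqI:
  assumes "((\<lambda>r. f (of_real r * \<xi>)) \<longlongrightarrow> l) (at_left (1::real))"
  shows "radial_limit f \<xi> = l"
  unfolding radial_limit_def by (rule tendsto_Lim[OF _ assms]) simp

lemma AE_bv_tendsto:
  "AE \<xi> in arc_measure. ((\<lambda>r. to_fun x (of_real r * \<xi>)) \<longlongrightarrow> bv x \<xi>) (at_left 1)"
  using AE_ex_radial_limit[of x]
proof (rule AE_mp, intro AE_I2 impI)
  fix \<xi> assume "\<exists>l. ((\<lambda>r. to_fun x (of_real r * \<xi>)) \<longlongrightarrow> l) (at_left 1)"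
  then obtain l where l: "((\<lambda>r. to_fun x (of_real r * \<xi>)) \<longlongrightarrow> l) (at_left 1)" by blast
  then show "((\<lambda>r. to_fun x (of_real r * \<xi>)) \<longlongrightarrow> bv x \<xi>) (at_left 1)"
    using radial_limit_eqI[OF l] by (simp add: bv_def)
qed

lemma filterlim_radii: "filterlim (\<lambda>n. 1 - inverse (real (Suc n))) (at_left 1) sequentially"
  unfolding filterlim_at
proof (intro conjI)
  show "(\<lambda>n. 1 - inverse (real (Suc n))) \<longlonglongrightarrow> 1"
    using tendsto_diff[OF tendsto_const LIMSEQ_inverse_real_of_nat, of 1] by simp
qed simp

text \<open>On the measurable convergence set the value is the limit along one sequence of radii.
  Elsewhere no limit exists, and \<open>Lim\<close> takes one fixed default value, here
  \<open>THE l. False\<close>.\<close>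

lemma bv_measurable [measurable]: "bv x \<in> borel_measurable arc_measure"
proof -
  let ?C = "\<lambda>\<xi>. \<forall>m::nat. \<exists>k::nat. \<forall>i j. 1 - inverse (Suc k) < rat_radius i \<longrightarrow> 1 - inverse (Suc k) < rat_radius j \<longrightarrow>
       dist (to_fun x (of_real (rat_radius i) * \<xi>)) (to_fun x (of_real (rat_radius j) * \<xi>)) \<le> inverse (Suc m)"
  have eq: "bv x \<xi> = (if ?C \<xi> then lim (\<lambda>n. to_fun x (of_real (1 - inverse (real (Suc n))) * \<xi>)) else (THE l. False))"
    if "\<xi> \<in> space arc_measure" for \<xi>
  proof -
    have \<xi>: "cmod \<xi> = 1" using that by simp
    let ?g = "\<lambda>r. to_fun x (of_real r * \<xi>)"
    note iff = ex_radial_limit_iff[OF continuous_on_radius[OF \<xi>, of x]]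
    show ?thesis
    proof (cases "?C \<xi>")
      case True
      then obtain l where l: "(?g \<longlongrightarrow> l) (at_left 1)" using iff by blast
      then have "(\<lambda>n. ?g (1 - inverse (real (Suc n)))) \<longlonglongrightarrow> l"
        by (rule filterlim_compose[OF _ filterlim_radii])
      then show ?thesis using True radial_limit_eqI[OF l] by (simp add: bv_def limI)
    next
      case False
      then have "(?g \<longlongrightarrow> l) (at_left 1) \<longleftrightarrow> False" for l using iff by blast
      then have "bv x \<xi> = (THE l. False)" by (simp add: bv_def radial_limit_def Topological_Spaces.Lim_def)
      then show ?thesis using False by (simp only: if_False)
    qed
  qed
  have "(\<lambda>\<xi>. if ?C \<xi> then lim (\<lambda>n. to_fun x (of_real (1 - inverse (real (Suc n))) * \<xi>)) else (THE l. False)) \<in> borel_measurable arc_measure"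
    by measurable
  then show ?thesis by (subst measurable_cong[OF eq]) auto
qed

lemma AE_bv_lincomb: "AE \<xi> in arc_measure. bv (c *\<^sub>C x + y) \<xi> = c * bv x \<xi> + bv y \<xi>"
  using AE_bv_tendsto[of x] AE_bv_tendsto[of y]
proof (eventually_elim)
  case (elim \<xi>)
  then have "((\<lambda>r. c * to_fun x (of_real r * \<xi>) + to_fun y (of_real r * \<xi>)) \<longlongrightarrow> c * bv x \<xi> + bv y \<xi>) (at_left 1)"
    by (intro tendsto_intros)
  then show ?case unfolding bv_def[of "c *\<^sub>C x + y"] by (intro radial_limit_eqI) (simp add: to_fun_lincomb)
qed

lemma AE_bv_add: "AE \<xi> in arc_measure. bv (x + y) \<xi> = bv x \<xi> + bv y \<xi>"
  using AE_bv_lincomb[of 1 x y] by simp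

lemma AE_bv_diff: "AE \<xi> in arc_measure. bv (x - y) \<xi> = bv x \<xi> - bv y \<xi>"
  using AE_bv_add[of "x - y" y] by (auto elim: AE_mp)

lemma bv_zero: "bv 0 \<xi> = 0"
  unfolding bv_def by (rule radial_limit_eqI) simp

lemma AE_bv_scaleC: "AE \<xi> in arc_measure. bv (c *\<^sub>C x) \<xi> = c * bv x \<xi>"
  using AE_bv_lincomb[of c x 0] by (simp add: bv_zero)

text \<open>Fatou's lemma along radii tending to 1; the reverse inequality comes with
  \<open>integral_bv_sq\<close>.\<close>

lemma nn_integral_bv_le: "(\<integral>\<^sup>+\<xi>. ennreal ((cmod (bv x \<xi>))\<^sup>2) \<partial>arc_measure) \<le> ennreal ((norm x)\<^sup>2)"
proof -
  let ?r = "\<lambda>n. 1 - inverse (real (Suc n))"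
  let ?u = "\<lambda>n \<xi>. ennreal ((cmod (to_fun x (of_real (?r n) * \<xi>)))\<^sup>2)"
  have r: "0 \<le> ?r n" "?r n < 1" for n by (simp_all add: inverse_le_1_iff)
  have "AE \<xi> in arc_measure. liminf (\<lambda>n. ?u n \<xi>) = ennreal ((cmod (bv x \<xi>))\<^sup>2)"
    using AE_bv_tendsto[of x]
  proof eventually_elim
    case (elim \<xi>)
    have "(\<lambda>n. ?u n \<xi>) \<longlonglongrightarrow> ennreal ((cmod (bv x \<xi>))\<^sup>2)"
      by (intro tendsto_ennrealI tendsto_intros filterlim_compose[OF elim filterlim_radii])
    then show ?case by (rule lim_imp_Liminf[OF sequentially_bot])
  qed
  then have "(\<integral>\<^sup>+\<xi>. ennreal ((cmod (bv x \<xi>))\<^sup>2) \<partial>arc_measure) = (\<integral>\<^sup>+\<xi>. liminf (\<lambda>n. ?u n \<xi>) \<partial>arc_measure)"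
    by (intro nn_integral_cong_AE) auto
  also have "\<dots> \<le> liminf (\<lambda>n. integral\<^sup>N arc_measure (?u n))"
    by (rule nn_integral_liminf) measurable
  also have "\<dots> \<le> liminf (\<lambda>n. ennreal ((norm x)\<^sup>2))"
    by (intro Liminf_mono always_eventually allI nn_integral_dilation_le r)
  also have "\<dots> = ennreal ((norm x)\<^sup>2)" by (simp add: Liminf_const)
  finally show ?thesis .
qed

lemma integrable_bv_sq: "integrable arc_measure (\<lambda>\<xi>. (cmod (bv x \<xi>))\<^sup>2)"
proof (rule integrableI_nonneg)
  show "(\<integral>\<^sup>+\<xi>. ennreal ((cmod (bv x \<xi>))\<^sup>2) \<partial>arc_measure) < \<infinity>"
    by (rule le_less_trans[OF nn_integral_bv_le]) simp
qed auto

lemma integral_bv_sq_le: "(\<integral>\<xi>. (cmod (bv x \<xi>))\<^sup>2 \<partial>arc_measure) \<le> (norm x)\<^sup>2"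
  using nn_integral_bv_le[of x] nn_integral_eq_integral[OF integrable_bv_sq[of x]]
  by (simp add: ennreal_le_iff)

lemma integral_bv_trunc_sq: "(\<integral>\<xi>. (cmod (bv (trunc N x) \<xi>))\<^sup>2 \<partial>arc_measure) = (norm (trunc N x))\<^sup>2"
proof -
  let ?c = "coef (trunc N x)"
  have fin: "(\<lambda>n. a n) sums (\<Sum>n<N. a n)" if "\<And>n. ?c n = 0 \<Longrightarrow> a n = 0" for a :: "nat \<Rightarrow> complex"
    by (rule sums_finite) (use that in \<open>auto simp: trunc.rep_eq\<close>)
  have s: "summable (\<lambda>n. cmod (?c n))"
    by (rule summable_finite[of "{..<N}"]) (auto simp: trunc.rep_eq)
  have bvp: "bv (trunc N x) \<xi> = (\<Sum>n. ?c n * \<xi> ^ n)" if "cmod \<xi> = 1" for \<xi>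
  proof -
    have "((\<lambda>r. \<Sum>n<N. coef x n * (of_real r * \<xi>) ^ n) \<longlongrightarrow> (\<Sum>n<N. coef x n * \<xi> ^ n)) (at_left (1::real))"
      by (auto intro!: tendsto_eq_intros)
    moreover have "eventually (\<lambda>r. (\<Sum>n<N. coef x n * (of_real r * \<xi>) ^ n) = to_fun (trunc N x) (of_real r * \<xi>)) (at_left (1::real))"
      unfolding eventually_at_left_field using that
      by (intro exI[of _ 0]) (auto simp: to_fun_trunc norm_mult)
    ultimately have "((\<lambda>r. to_fun (trunc N x) (of_real r * \<xi>)) \<longlongrightarrow> (\<Sum>n<N. coef x n * \<xi> ^ n)) (at_left (1::real))"
      by (rule Lim_transform_eventually)
    then have "bv (trunc N x) \<xi> = (\<Sum>n<N. coef x n * \<xi> ^ n)"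
      unfolding bv_def by (rule radial_limit_eqI)
    moreover have "(\<Sum>n. ?c n * \<xi> ^ n) = (\<Sum>n<N. coef x n * \<xi> ^ n)"
      using fin[of "\<lambda>n. ?c n * \<xi> ^ n"] by (simp add: sums_iff trunc.rep_eq)
    ultimately show ?thesis by simp
  qed
  have "complex_of_real (\<integral>\<xi>. (cmod (bv (trunc N x) \<xi>))\<^sup>2 \<partial>arc_measure)
      = (\<integral>\<xi>. of_real ((cmod (bv (trunc N x) \<xi>))\<^sup>2) \<partial>arc_measure)"
    by (rule integral_complex_of_real[symmetric])
  also have "\<dots> = (\<integral>\<xi>. (\<Sum>n. ?c n * \<xi> ^ n) * cnj (\<Sum>n. ?c n * \<xi> ^ n) \<partial>arc_measure)"
    unfolding complex_norm_square by (intro Bochner_Integration.integral_cong refl) (simp add: bvp)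
  also have "\<dots> = cinner (trunc N x) (trunc N x)"
    unfolding cinner_def using circle_parseval[OF s s] by (simp add: sums_iff)
  finally show ?thesis by (simp only: cinner_self of_real_eq_iff)
qed

lemma parallelogram_complex:
  "(cmod (a + b))\<^sup>2 + (cmod (a - b))\<^sup>2 = 2 * (cmod a)\<^sup>2 + 2 * (cmod b)\<^sup>2"
  by (simp add: cmod_power2 power2_sum power2_diff)

text \<open>The upper bound holds for all vectors, and equality for truncations. The parallelogram
  law for \<open>trunc N x\<close> and the tail turns these two facts into a lower bound that tends
  to the squared norm.\<close>

theorem integral_bv_sq: "(\<integral>\<xi>. (cmod (bv x \<xi>))\<^sup>2 \<partial>arc_measure) = (norm x)\<^sup>2"
proof (rule antisym[OF integral_bv_sq_le])
  let ?I = "\<lambda>x. \<integral>\<xi>. (cmod (bv x \<xi>))\<^sup>2 \<partial>arc_measure"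
  have "2 * (norm (trunc N x))\<^sup>2 - (norm (trunc N x - (x - trunc N x)))\<^sup>2 \<le> ?I x" for N
  proof -
    let ?p = "trunc N x" let ?q = "x - trunc N x"
    have "?I (?p + ?q) + ?I (?p - ?q) = (\<integral>\<xi>. (cmod (bv (?p + ?q) \<xi>))\<^sup>2 + (cmod (bv (?p - ?q) \<xi>))\<^sup>2 \<partial>arc_measure)"
      by (rule Bochner_Integration.integral_add[symmetric]) (rule integrable_bv_sq)+
    also have "\<dots> = (\<integral>\<xi>. 2 * (cmod (bv ?p \<xi>))\<^sup>2 + 2 * (cmod (bv ?q \<xi>))\<^sup>2 \<partial>arc_measure)"
    proof (rule integral_cong_AE)
      show "AE \<xi> in arc_measure. (cmod (bv (?p + ?q) \<xi>))\<^sup>2 + (cmod (bv (?p - ?q) \<xi>))\<^sup>2 = 2 * (cmod (bv ?p \<xi>))\<^sup>2 + 2 * (cmod (bv ?q \<xi>))\<^sup>2"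
        using AE_bv_add[of ?p ?q] AE_bv_diff[of ?p ?q]
        by eventually_elim (simp only: parallelogram_complex)
    qed measurable
    also have "\<dots> = 2 * ?I ?p + 2 * ?I ?q" by (simp add: integrable_bv_sq)
    finally have "?I x + ?I (?p - ?q) = 2 * ?I ?p + 2 * ?I ?q" by simp
    moreover have "?I ?p = (norm ?p)\<^sup>2" by (rule integral_bv_trunc_sq)
    moreover have "0 \<le> ?I ?q" by (rule integral_nonneg_AE) simp
    moreover have "?I (?p - ?q) \<le> (norm (?p - ?q))\<^sup>2" by (rule integral_bv_sq_le)
    ultimately show ?thesis by linarith
  qed
  moreover have "(\<lambda>N. 2 * (norm (trunc N x))\<^sup>2 - (norm (trunc N x - (x - trunc N x)))\<^sup>2) \<longlonglongrightarrow> 2 * (norm x)\<^sup>2 - (norm (x - (x - x)))\<^sup>2"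
    by (intro tendsto_intros trunc_tendsto)
  ultimately have "2 * (norm x)\<^sup>2 - (norm (x - (x - x)))\<^sup>2 \<le> ?I x"
    by (intro LIMSEQ_le_const2[where X = "\<lambda>N. 2 * (norm (trunc N x))\<^sup>2 - (norm (trunc N x - (x - trunc N x)))\<^sup>2"]) auto
  then show "(norm x)\<^sup>2 \<le> ?I x" by simp
qed

lemma integrable_bv_prod: "integrable arc_measure (\<lambda>\<xi>. bv x \<xi> * cnj (bv y \<xi>))"
proof (rule Bochner_Integration.integrable_bound)
  show "integrable arc_measure (\<lambda>\<xi>. (cmod (bv x \<xi>))\<^sup>2 + (cmod (bv y \<xi>))\<^sup>2)"
    by (intro Bochner_Integration.integrable_add integrable_bv_sq)
  have "cmod a * cmod b \<le> (cmod a)\<^sup>2 + (cmod b)\<^sup>2" for a b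
    using sum_squares_bound[of "cmod a" "cmod b"] mult_nonneg_nonneg[OF norm_ge_zero norm_ge_zero, of a b] by linarith
  then show "AE \<xi> in arc_measure. norm (bv x \<xi> * cnj (bv y \<xi>)) \<le> norm ((cmod (bv x \<xi>))\<^sup>2 + (cmod (bv y \<xi>))\<^sup>2)"
    by (intro AE_I2) (simp add: norm_mult)
qed measurable

lemma integral_Re_bv_prod: "(\<integral>\<xi>. Re (bv x \<xi> * cnj (bv y \<xi>)) \<partial>arc_measure) = inner x y"
proof -
  have int: "integrable arc_measure (\<lambda>\<xi>. Re (bv x \<xi> * cnj (bv y \<xi>)))" by (intro integrable_Re integrable_bv_prod)
  have sq: "(cmod (a + b))\<^sup>2 = (cmod a)\<^sup>2 + (cmod b)\<^sup>2 + 2 * Re (a * cnj b)" for a b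
    by (simp add: cmod_power2 power2_sum)
  have "(norm (x + y))\<^sup>2 = (\<integral>\<xi>. (cmod (bv (x + y) \<xi>))\<^sup>2 \<partial>arc_measure)" by (rule integral_bv_sq[symmetric])
  also have "\<dots> = (\<integral>\<xi>. (cmod (bv x \<xi>))\<^sup>2 + (cmod (bv y \<xi>))\<^sup>2 + 2 * Re (bv x \<xi> * cnj (bv y \<xi>)) \<partial>arc_measure)"
  proof (rule integral_cong_AE)
    show "AE \<xi> in arc_measure. (cmod (bv (x + y) \<xi>))\<^sup>2 = (cmod (bv x \<xi>))\<^sup>2 + (cmod (bv y \<xi>))\<^sup>2 + 2 * Re (bv x \<xi> * cnj (bv y \<xi>))"
      using AE_bv_add[of x y] by eventually_elim (simp only: sq)
  qed measurable
  also have "\<dots> = (norm x)\<^sup>2 + (norm y)\<^sup>2 + 2 * (\<integral>\<xi>. Re (bv x \<xi> * cnj (bv y \<xi>)) \<partial>arc_measure)"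
    by (simp only: Bochner_Integration.integral_add[OF Bochner_Integration.integrable_add[OF integrable_bv_sq integrable_bv_sq]
        integrable_mult_right[OF int]] Bochner_Integration.integral_add[OF integrable_bv_sq integrable_bv_sq]
        integral_bv_sq integral_mult_right_zero)
  finally show ?thesis
    by (simp add: power2_norm_eq_inner inner_add inner_commute)
qed

text \<open>Polarization: the real part comes from the norm of \<open>x + y\<close>, the imaginary
  part from replacing \<open>y\<close> by \<open>\<i> *\<^sub>C y\<close>.\<close>

theorem integral_bv_prod: "(\<integral>\<xi>. bv x \<xi> * cnj (bv y \<xi>) \<partial>arc_measure) = cinner x y"
proof (rule complex_eqI)
  note int = integrable_bv_prod
  show "Re (\<integral>\<xi>. bv x \<xi> * cnj (bv y \<xi>) \<partial>arc_measure) = Re (cinner x y)"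
    by (simp only: integral_Re[OF int, symmetric] integral_Re_bv_prod Re_cinner)
  have "Im (\<integral>\<xi>. bv x \<xi> * cnj (bv y \<xi>) \<partial>arc_measure) = (\<integral>\<xi>. Im (bv x \<xi> * cnj (bv y \<xi>)) \<partial>arc_measure)"
    by (rule integral_Im[OF int, symmetric])
  also have "\<dots> = (\<integral>\<xi>. Re (bv x \<xi> * cnj (bv (\<i> *\<^sub>C y) \<xi>)) \<partial>arc_measure)"
  proof (rule integral_cong_AE)
    show "AE \<xi> in arc_measure. Im (bv x \<xi> * cnj (bv y \<xi>)) = Re (bv x \<xi> * cnj (bv (\<i> *\<^sub>C y) \<xi>))"
      using AE_bv_scaleC[of \<i> y] by eventually_elim (simp add: algebra_simps)
  qed measurable
  also have "\<dots> = Im (cinner x y)" by (simp only: integral_Re_bv_prod Im_cinner)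
  finally show "Im (\<integral>\<xi>. bv x \<xi> * cnj (bv y \<xi>) \<partial>arc_measure) = Im (cinner x y)" .
qed

subsection \<open>Toeplitz operators\<close>

text \<open>Evaluates the definite description in \<open>riesz_proj\<close>. Testing against all of
  \<open>H2\<close> determines the projection, since boundary pairings are inner products in
  \<open>ell2\<close>.\<close>

lemma riesz_proj_eqI:
  assumes int: "\<And>k. integrable arc_measure (\<lambda>\<xi>. g \<xi> * cnj (bv k \<xi>))"
    and eq: "\<And>k. (\<integral>\<xi>. g \<xi> * cnj (bv k \<xi>) \<partial>arc_measure) = cinner h k"
  shows "riesz_proj g = to_fun h"
proof -
  have val: "(\<integral>\<xi>. (g \<xi> - bv h' \<xi>) * cnj (bv k \<xi>) \<partial>arc_measure) = cinner (h - h') k" for h' k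
  proof -
    have "(\<integral>\<xi>. (g \<xi> - bv h' \<xi>) * cnj (bv k \<xi>) \<partial>arc_measure)
        = (\<integral>\<xi>. g \<xi> * cnj (bv k \<xi>) - bv h' \<xi> * cnj (bv k \<xi>) \<partial>arc_measure)"
      by (simp only: left_diff_distrib)
    also have "\<dots> = cinner h k - cinner h' k"
      by (simp only: Bochner_Integration.integral_diff[OF int integrable_bv_prod] eq integral_bv_prod)
    finally show ?thesis by (simp add: cinner_diff_left)
  qed
  show ?thesis unfolding riesz_proj_def
  proof (rule the_equality)
    show "to_fun h \<in> H2 \<and> (\<forall>k\<in>H2. (\<integral>\<xi>. (g \<xi> - radial_limit (to_fun h) \<xi>) * cnj (radial_limit k \<xi>) \<partial>arc_measure) = 0)"
    proof (intro conjI ballI to_fun_H2)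
      fix k assume "k \<in> H2"
      then obtain k' where "k = to_fun k'" by (rule H2_cases)
      then show "(\<integral>\<xi>. (g \<xi> - radial_limit (to_fun h) \<xi>) * cnj (radial_limit k \<xi>) \<partial>arc_measure) = 0"
        using val[of h k'] by (simp add: bv_def)
    qed
    fix f assume f: "f \<in> H2 \<and> (\<forall>k\<in>H2. (\<integral>\<xi>. (g \<xi> - radial_limit f \<xi>) * cnj (radial_limit k \<xi>) \<partial>arc_measure) = 0)"
    then obtain h' where h': "f = to_fun h'" using H2_cases by blast
    have "cinner (h - h') k = 0" for k
      using f to_fun_H2[of k] val[of h' k] by (simp add: h' bv_def)
    then have "h = h'" using eq_if_cinner_eq[of h h'] by (simp add: cinner_diff_left)
    then show "f = to_fun h" by (simp add: h')
  qed
qed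

lemma Hinf_H2: "b \<in> Hinf \<Longrightarrow> b \<in> H2"
proof -
  assume b: "b \<in> Hinf"
  then have "b \<in> Hol_disk" by (simp add: Hinf_def)
  have "to_fun (unit_vec 0) z = 1" if "cmod z < 1" for z
  proof -
    have "(\<lambda>n. coef (unit_vec 0) n * z ^ n) sums (\<Sum>n\<in>{0}. coef (unit_vec 0) n * z ^ n)"
      by (rule sums_finite) (auto simp: unit_vec.rep_eq)
    then show ?thesis using to_fun_sums[OF that, of "unit_vec 0"] by (simp add: sums_iff unit_vec.rep_eq)
  qed
  then have "to_fun (mult b (unit_vec 0)) = b"
    by (intro Hol_disk_eqI[OF to_fun_Hol_disk \<open>b \<in> Hol_disk\<close>]) (simp add: to_fun_mult[OF b])
  then show ?thesis using to_fun_H2 by metis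
qed

lemma AE_radial_limit_Hinf:
  assumes "b \<in> Hinf"
  shows "AE \<xi> in arc_measure. ((\<lambda>r. b (of_real r * \<xi>)) \<longlongrightarrow> radial_limit b \<xi>) (at_left 1)"
  using AE_bv_tendsto[of "of_fun b"] by (simp add: bv_def Hinf_H2[OF assms])

lemma radial_limit_measurable:
  assumes "b \<in> Hinf"
  shows "radial_limit b \<in> borel_measurable arc_measure"
  using bv_measurable[of "of_fun b"] by (simp add: bv_def Hinf_H2[OF assms])

lemma AE_bv_mult:
  assumes "b \<in> Hinf"
  shows "AE \<xi> in arc_measure. bv (mult b x) \<xi> = radial_limit b \<xi> * bv x \<xi>"
  using AE_radial_limit_Hinf[OF assms] AE_bv_tendsto[of x]
proof eventually_elim
  case (elim \<xi>)
  from tendsto_mult[OF elim] show ?case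
    unfolding bv_def[of "mult b x"] to_fun_mult[OF assms] by (rule radial_limit_eqI)
qed

lemma toeplitz_analytic:
  assumes b: "b \<in> Hinf"
  shows "toeplitz (radial_limit b) (to_fun x) = to_fun (mult b x)"
proof -
  note [measurable] = radial_limit_measurable[OF b]
  have ae: "AE \<xi> in arc_measure. bv (mult b x) \<xi> * cnj (bv k \<xi>) = radial_limit b \<xi> * radial_limit (to_fun x) \<xi> * cnj (bv k \<xi>)" for k
    using AE_bv_mult[OF b, of x] by eventually_elim (simp add: bv_def)
  have [measurable]: "radial_limit (to_fun x) \<in> borel_measurable arc_measure" using bv_measurable[of x] by (simp add: bv_def)
  show ?thesis unfolding toeplitz_def
  proof (rule riesz_proj_eqI)
    fix k
    show "integrable arc_measure (\<lambda>\<xi>. radial_limit b \<xi> * radial_limit (to_fun x) \<xi> * cnj (bv k \<xi>))"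
      by (subst integrable_cong_AE[OF _ _ ae[of k], symmetric]) (simp_all add: integrable_bv_prod, measurable, measurable)
    show "(\<integral>\<xi>. radial_limit b \<xi> * radial_limit (to_fun x) \<xi> * cnj (bv k \<xi>) \<partial>arc_measure) = cinner (mult b x) k"
      by (subst integral_cong_AE[OF _ _ ae[of k], symmetric]) (simp_all add: integral_bv_prod, measurable, measurable)
  qed
qed

text \<open>Moving the conjugated symbol to the test function turns the boundary pairing into
  \<open>cinner x (mult b k)\<close>, which defines the adjoint of multiplication by
  \<open>b\<close>.\<close>

lemma toeplitz_coanalytic:
  assumes b: "b \<in> Hinf"
  shows "toeplitz (\<lambda>\<xi>. cnj (radial_limit b \<xi>)) (to_fun x) = to_fun (adj (mult b) x)"
proof -
  note [measurable] = radial_limit_measurable[OF b]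
  have ae: "AE \<xi> in arc_measure. bv x \<xi> * cnj (bv (mult b k) \<xi>) = cnj (radial_limit b \<xi>) * radial_limit (to_fun x) \<xi> * cnj (bv k \<xi>)" for k
    using AE_bv_mult[OF b, of k] by eventually_elim (simp add: bv_def)
  have [measurable]: "radial_limit (to_fun x) \<in> borel_measurable arc_measure" using bv_measurable[of x] by (simp add: bv_def)
  show ?thesis unfolding toeplitz_def
  proof (rule riesz_proj_eqI)
    fix k
    show "integrable arc_measure (\<lambda>\<xi>. cnj (radial_limit b \<xi>) * radial_limit (to_fun x) \<xi> * cnj (bv k \<xi>))"
      by (subst integrable_cong_AE[OF _ _ ae[of k], symmetric]) (simp_all add: integrable_bv_prod, measurable, measurable)
    have "(\<integral>\<xi>. cnj (radial_limit b \<xi>) * radial_limit (to_fun x) \<xi> * cnj (bv k \<xi>) \<partial>arc_measure) = cinner x (mult b k)"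
      by (subst integral_cong_AE[OF _ _ ae[of k], symmetric]) (simp_all add: integral_bv_prod, measurable, measurable)
    then show "(\<integral>\<xi>. cnj (radial_limit b \<xi>) * radial_limit (to_fun x) \<xi> * cnj (bv k \<xi>) \<partial>arc_measure) = cinner (adj (mult b) x) k"
      by (simp add: cinner_adj'[OF clinear_op_mult[OF b]])
  qed
qed

subsection \<open>Outer functions are cyclic\<close>

text \<open>The exponent in the definition of \<open>outer\<close>, for a general real
  weight.\<close>

definition herglotz :: "(complex \<Rightarrow> real) \<Rightarrow> complex \<Rightarrow> complex" where
  "herglotz w z = (\<integral>\<xi>. (\<xi> + z) / (\<xi> - z) * of_real (w \<xi>) \<partial>arc_measure)"

lemma herglotz_kernel_sums:
  assumes "cmod z < 1" "cmod \<xi> = 1"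
  shows "(\<lambda>n. (if n = 0 then 1 else 2) * (z * cnj \<xi>) ^ n) sums ((\<xi> + z) / (\<xi> - z))"
proof -
  let ?q = "z * cnj \<xi>"
  have q: "cmod ?q < 1" using assms by (simp add: norm_mult)
  then have q1: "1 - ?q \<noteq> 0" by auto
  have "(\<lambda>n. 2 * ?q ^ n - (if n = 0 then ?q ^ n else 0)) sums (2 * (1 / (1 - ?q)) - ?q ^ 0)"
    by (intro sums_diff sums_mult geometric_sums q sums_single)
  moreover have "2 * ?q ^ n - (if n = 0 then ?q ^ n else 0) = (if n = 0 then 1 else 2) * ?q ^ n" for n by simp
  moreover have "2 * (1 / (1 - ?q)) - ?q ^ 0 = (\<xi> + z) / (\<xi> - z)"
  proof -
    have u: "\<xi> * cnj \<xi> = 1" using assms(2) by (simp add: complex_norm_square[symmetric, unfolded of_real_power])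
    have \<xi>0: "\<xi> \<noteq> 0" using assms(2) by auto
    have "\<xi> - z = \<xi> * (1 - ?q)" "\<xi> + z = \<xi> * (1 + ?q)" using u by (simp_all add: algebra_simps)
    then have "(\<xi> + z) / (\<xi> - z) = (1 + ?q) / (1 - ?q)" using \<xi>0 by simp
    then show ?thesis using q1 by (simp add: field_simps)
  qed
  ultimately show ?thesis by simp
qed

text \<open>Termwise integration of the geometric expansion of the kernel; the resulting power
  series is how holomorphy of \<open>herglotz\<close> is obtained.\<close>

lemma herglotz_sums:
  assumes w: "integrable arc_measure w" and z: "cmod z < 1"
  shows "(\<lambda>n. (\<integral>\<xi>. (if n = 0 then 1 else 2) * cnj \<xi> ^ n * of_real (w \<xi>) \<partial>arc_measure) * z ^ n) sums herglotz w z"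
    and "integrable arc_measure (\<lambda>\<xi>. (\<xi> + z) / (\<xi> - z) * of_real (w \<xi>))"
proof -
  let ?f = "\<lambda>n \<xi>. (if n = 0 then 1 else 2) * (z * cnj \<xi>) ^ n * of_real (w \<xi>) :: complex"
  have wm [measurable]: "w \<in> borel_measurable arc_measure" using w by simp
  have bd: "norm (?f n \<xi>) \<le> 2 * cmod z ^ n * \<bar>w \<xi>\<bar>" if "cmod \<xi> = 1" for n \<xi>
    using that by (simp add: norm_mult norm_power power_mult_distrib mult_right_mono)
  have int: "integrable arc_measure (?f n)" for n
  proof (rule Bochner_Integration.integrable_bound[of _ "\<lambda>\<xi>. 2 * cmod z ^ n * \<bar>w \<xi>\<bar>"])
    show "AE \<xi> in arc_measure. norm (?f n \<xi>) \<le> norm (2 * cmod z ^ n * \<bar>w \<xi>\<bar>)"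
      using bd by (intro AE_I2) (simp add: abs_mult)
  qed (use w in \<open>simp, measurable\<close>)
  have geo: "summable (\<lambda>n. 2 * cmod z ^ n * t)" for t
    by (intro summable_mult summable_mult2 summable_geometric) (use z in simp)
  have s1: "AE \<xi> in arc_measure. summable (\<lambda>n. norm (?f n \<xi>))"
  proof (intro AE_I2)
    fix \<xi> assume "\<xi> \<in> space arc_measure"
    then show "summable (\<lambda>n. norm (?f n \<xi>))"
      using bd[of \<xi>] by (intro summable_comparison_test'[OF geo[of "\<bar>w \<xi>\<bar>"], of 0]) (simp del: norm_mult)
  qed
  have s2: "summable (\<lambda>n. \<integral>\<xi>. norm (?f n \<xi>) \<partial>arc_measure)"
  proof (rule summable_comparison_test'[OF geo[of "\<integral>\<xi>. \<bar>w \<xi>\<bar> \<partial>arc_measure"], of 0])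
    fix n
    have "(\<integral>\<xi>. norm (?f n \<xi>) \<partial>arc_measure) \<le> (\<integral>\<xi>. 2 * cmod z ^ n * \<bar>w \<xi>\<bar> \<partial>arc_measure)"
      by (rule integral_mono) (use int bd w in auto)
    then show "norm (\<integral>\<xi>. norm (?f n \<xi>) \<partial>arc_measure) \<le> 2 * cmod z ^ n * (\<integral>\<xi>. \<bar>w \<xi>\<bar> \<partial>arc_measure)"
      by simp
  qed
  have lim: "(\<Sum>n. ?f n \<xi>) = (\<xi> + z) / (\<xi> - z) * of_real (w \<xi>)" if "cmod \<xi> = 1" for \<xi>
    using sums_mult2[OF herglotz_kernel_sums[OF z that], of "of_real (w \<xi>)"] by (simp add: sums_iff)
  have "(\<lambda>n. \<integral>\<xi>. ?f n \<xi> \<partial>arc_measure) sums (\<integral>\<xi>. (\<Sum>n. ?f n \<xi>) \<partial>arc_measure)"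
    by (rule sums_integral[OF int s1 s2])
  also have "(\<integral>\<xi>. (\<Sum>n. ?f n \<xi>) \<partial>arc_measure) = herglotz w z"
    unfolding herglotz_def by (intro Bochner_Integration.integral_cong refl lim) simp
  also have "(\<lambda>n. \<integral>\<xi>. ?f n \<xi> \<partial>arc_measure)
      = (\<lambda>n. (\<integral>\<xi>. (if n = 0 then 1 else 2) * cnj \<xi> ^ n * of_real (w \<xi>) \<partial>arc_measure) * z ^ n)"
  proof
    fix n
    have "(\<integral>\<xi>. ?f n \<xi> \<partial>arc_measure) = (\<integral>\<xi>. (if n = 0 then 1 else 2) * cnj \<xi> ^ n * of_real (w \<xi>) * z ^ n \<partial>arc_measure)"
      by (intro Bochner_Integration.integral_cong refl) (simp add: power_mult_distrib mult_ac)
    then show "(\<integral>\<xi>. ?f n \<xi> \<partial>arc_measure)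
      = (\<integral>\<xi>. (if n = 0 then 1 else 2) * cnj \<xi> ^ n * of_real (w \<xi>) \<partial>arc_measure) * z ^ n"
      by (simp only: integral_mult_left_zero)
  qed
  finally show "(\<lambda>n. (\<integral>\<xi>. (if n = 0 then 1 else 2) * cnj \<xi> ^ n * of_real (w \<xi>) \<partial>arc_measure) * z ^ n) sums herglotz w z" .
  have "integrable arc_measure (\<lambda>\<xi>. \<Sum>n. ?f n \<xi>)" by (rule integrable_suminf[OF int s1 s2])
  then show "integrable arc_measure (\<lambda>\<xi>. (\<xi> + z) / (\<xi> - z) * of_real (w \<xi>))"
    by (subst (asm) Bochner_Integration.integrable_cong[OF refl lim]) simp_all
qed

lemma herglotz_holomorphic:
  assumes "integrable arc_measure w"
  shows "herglotz w holomorphic_on ball 0 1"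
  by (rule power_series_holomorphic[of 0 1 "\<lambda>n. \<integral>\<xi>. (if n = 0 then 1 else 2) * cnj \<xi> ^ n * of_real (w \<xi>) \<partial>arc_measure"])
     (use herglotz_sums(1)[OF assms] in simp)

lemma herglotz_add:
  assumes "integrable arc_measure v" "integrable arc_measure w" "cmod z < 1"
  shows "herglotz (\<lambda>\<xi>. v \<xi> + w \<xi>) z = herglotz v z + herglotz w z"
  using Bochner_Integration.integral_add[OF herglotz_sums(2)[OF assms(1,3)] herglotz_sums(2)[OF assms(2,3)]]
  by (simp add: herglotz_def distrib_left)

lemma herglotz_0: "herglotz w 0 = of_real (\<integral>\<xi>. w \<xi> \<partial>arc_measure)"
proof -
  have "herglotz w 0 = (\<integral>\<xi>. of_real (w \<xi>) \<partial>arc_measure)"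
    unfolding herglotz_def by (intro Bochner_Integration.integral_cong refl) auto
  then show ?thesis by simp
qed

text \<open>The real part is the Poisson average of \<open>w\<close>, and the Poisson kernel has
  total mass 1.\<close>

lemma Re_herglotz_le:
  assumes w: "integrable arc_measure w" and z: "cmod z < 1" and le: "AE \<xi> in arc_measure. w \<xi> \<le> t"
  shows "Re (herglotz w z) \<le> t"
proof -
  have ker: "Re ((\<xi> + z) / (\<xi> - z) * of_real (w \<xi>)) = poisson (z * cnj \<xi>) * w \<xi>" if "cmod \<xi> = 1" for \<xi>
  proof -
    let ?q = "z * cnj \<xi>"
    have q: "cmod ?q < 1" using z that by (simp add: norm_mult)
    have u: "\<xi> * cnj \<xi> = 1" using that by (simp add: complex_norm_square[symmetric, unfolded of_real_power])
    have "\<xi> - z = \<xi> * (1 - ?q)" "\<xi> + z = \<xi> * (1 + ?q)" using u by (simp_all add: algebra_simps)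
    then have "(\<xi> + z) / (\<xi> - z) = (1 + ?q) / (1 - ?q)" using that by auto
    then show ?thesis by (simp add: poisson_eq_Re[OF q] del: times_divide_eq_left)
  qed
  note i = herglotz_sums(2)[OF w z]
  have Re1: "Re (herglotz w z) = (\<integral>\<xi>. Re ((\<xi> + z) / (\<xi> - z) * of_real (w \<xi>)) \<partial>arc_measure)"
    unfolding herglotz_def by (rule integral_Re[OF i, symmetric])
  have P1: "(\<integral>\<xi>. of_real (poisson (z * cnj \<xi>)) * (\<lambda>_. 1 :: complex) \<xi> \<partial>arc_measure) = 1"
    and P2: "integrable arc_measure (\<lambda>\<xi>. of_real (poisson (z * cnj \<xi>)) * (\<lambda>_. 1 :: complex) \<xi>)"
    using poisson_formula[of "\<lambda>_. 1" 2 z] z by auto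
  have P2': "integrable arc_measure (\<lambda>\<xi>. poisson (z * cnj \<xi>))"
    using integrable_Re[OF P2] by simp
  have P1': "(\<integral>\<xi>. poisson (z * cnj \<xi>) \<partial>arc_measure) = 1"
    using P1 by simp
  have "(\<integral>\<xi>. Re ((\<xi> + z) / (\<xi> - z) * of_real (w \<xi>)) \<partial>arc_measure) \<le> (\<integral>\<xi>. poisson (z * cnj \<xi>) * t \<partial>arc_measure)"
  proof (rule integral_mono_AE)
    show "integrable arc_measure (\<lambda>\<xi>. Re ((\<xi> + z) / (\<xi> - z) * of_real (w \<xi>)))" by (rule integrable_Re[OF i])
    show "integrable arc_measure (\<lambda>\<xi>. poisson (z * cnj \<xi>) * t)" by (rule integrable_mult_left) (rule P2')
    show "AE \<xi> in arc_measure. Re ((\<xi> + z) / (\<xi> - z) * of_real (w \<xi>)) \<le> poisson (z * cnj \<xi>) * t"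
      using le AE_space
    proof eventually_elim
      case (elim \<xi>)
      then have "cmod \<xi> = 1" by simp
      moreover have "0 \<le> poisson (z * cnj \<xi>)" by (rule poisson_nonneg) (use z \<open>cmod \<xi> = 1\<close> in \<open>simp add: norm_mult\<close>)
      ultimately show ?case unfolding ker[OF \<open>cmod \<xi> = 1\<close>] using elim by (intro mult_left_mono) auto
    qed
  qed
  also have "\<dots> = t" by (simp add: P1')
  finally show ?thesis by (simp add: Re1)
qed

lemma closure_range_approx:
  fixes X :: "'b \<Rightarrow> 'a :: first_countable_topology"
  assumes "x \<in> closure (range X)" obtains h where "(\<lambda>n. X (h n)) \<longlonglongrightarrow> x"
proof -
  obtain y where y: "\<forall>n. y n \<in> range X" "y \<longlonglongrightarrow> x"
    using assms closure_sequential[of x "range X"] by auto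
  then have "\<forall>n. \<exists>h. y n = X h" by (simp add: image_iff)
  then obtain h where "\<forall>n. y n = X (h n)" using choice by metis
  then have "y = (\<lambda>n. X (h n))" by auto
  with y(2) have "(\<lambda>n. X (h n)) \<longlonglongrightarrow> x" by simp
  then show ?thesis by (rule that)
qed

lemma HinfI:
  assumes "f \<in> Hol_disk" "\<And>z. cmod z < 1 \<Longrightarrow> cmod (f z) \<le> K"
  shows "f \<in> Hinf"
proof -
  have "bounded (f ` ball 0 1)" unfolding bounded_iff using assms(2) by (intro exI[of _ K]) auto
  then show ?thesis using assms(1) by (simp add: Hinf_def)
qed

definition zpow :: "nat \<Rightarrow> complex \<Rightarrow> complex" where
  "zpow k z = (if cmod z < 1 then z ^ k else 0)"

lemma zpow_Hinf: "zpow k \<in> Hinf"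
proof -
  have "zpow k holomorphic_on ball 0 1"
    by (rule holomorphic_transform[of "\<lambda>z. z ^ k"]) (auto simp: zpow_def intro!: holomorphic_intros)
  then have "zpow k \<in> Hol_disk" by (simp add: Hol_disk_def zpow_def)
  moreover have "cmod (zpow k z) \<le> 1" if "cmod z < 1" for z
    using that by (simp add: zpow_def norm_power power_le_one)
  ultimately show ?thesis by (rule HinfI)
qed

lemma to_fun_unit_vec: "to_fun (unit_vec k) = zpow k"
proof (rule Hol_disk_eqI[OF to_fun_Hol_disk])
  show "zpow k \<in> Hol_disk" using zpow_Hinf by (simp add: Hinf_def)
  fix z :: complex assume z: "cmod z < 1"
  have "(\<lambda>n. coef (unit_vec k) n * z ^ n) sums (\<Sum>n\<in>{k}. coef (unit_vec k) n * z ^ n)"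
    by (rule sums_finite) (auto simp: unit_vec.rep_eq)
  then show "to_fun (unit_vec k) z = zpow k z"
    using to_fun_sums[OF z, of "unit_vec k"] z by (simp add: sums_iff unit_vec.rep_eq zpow_def)
qed

lemma mult_zpow_unit_vec: "mult (zpow k) (unit_vec n) = unit_vec (k + n)"
  unfolding to_fun_eq_iff[symmetric] to_fun_mult[OF zpow_Hinf] to_fun_unit_vec
  by (rule ext) (simp add: zpow_def power_add)

lemma norm_unit_vec [simp]: "norm (unit_vec k) = 1"
proof -
  have "of_real ((norm (unit_vec k))\<^sup>2) = (1 :: complex)"
    unfolding cinner_self[symmetric] cinner_unit_vec by (simp add: unit_vec.rep_eq)
  then have "(norm (unit_vec k))\<^sup>2 = 1" using of_real_eq_1_iff by blast
  then show ?thesis using norm_ge_zero[of "unit_vec k"] by (simp add: power2_eq_1_iff)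
qed

text \<open>
  With \<open>h\<^sub>n = exp (herglotz (min n (- ln |a|)))\<close> one has \<open>|a h\<^sub>n| \<le> 1\<close> and \<open>(a h\<^sub>n)(0) \<rightarrow> 1\<close> up to a
  unimodular factor, which forces \<open>a h\<^sub>n \<rightarrow> 1\<close> in \<open>H\<^sup>2\<close>.
\<close>

lemma outer_one_in_closure:
  assumes a: "a \<in> Hinf" and o: "outer a" and le1: "AE \<xi> in arc_measure. cmod (radial_limit a \<xi>) \<le> 1"
  obtains y where "(\<lambda>n. mult a (y n)) \<longlonglongrightarrow> unit_vec 0"
proof -
  define u where "u \<xi> = ln (cmod (radial_limit a \<xi>))" for \<xi>
  have u: "integrable arc_measure u" using o by (simp add: outer_def u_def[abs_def])
  obtain c where c: "cmod c = 1" "\<And>z. cmod z < 1 \<Longrightarrow> a z = c * exp (herglotz u z)"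
    using o by (auto simp: outer_def herglotz_def u_def)
  have u0: "AE \<xi> in arc_measure. u \<xi> \<le> 0"
  proof -
    have "AE \<xi> in arc_measure. radial_limit a \<xi> \<noteq> 0" using o by (simp add: outer_def)
    then show ?thesis using le1 by eventually_elim (simp add: u_def)
  qed
  \<comment> \<open>Truncating \<open>- u\<close> at height \<open>n\<close> keeps the exponential
    bounded, while \<open>u + v n = w n\<close> is at most 0 and increases to 0 almost everywhere,
    the exponent of the constant function 1.\<close>
  define v where "v n \<xi> = min (real n) (- u \<xi>)" for n \<xi>
  define w where "w n \<xi> = min (u \<xi> + real n) 0" for n \<xi>
  have v: "integrable arc_measure (v n)" for n
    unfolding v_def[abs_def] by (intro Bochner_Integration.integrable_min) (use u in auto)
  have w: "integrable arc_measure (w n)" for n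
    unfolding w_def[abs_def] by (intro Bochner_Integration.integrable_min Bochner_Integration.integrable_add) (use u in auto)
  have uvw: "u \<xi> + v n \<xi> = w n \<xi>" for n \<xi> by (simp add: v_def w_def min_def)
  define h where "h n z = (if cmod z < 1 then exp (herglotz (v n) z) / c else 0)" for n z
  have hhol: "h n holomorphic_on ball 0 1" for n
    by (rule holomorphic_transform[of "\<lambda>z. exp (herglotz (v n) z) / c"])
       (use c in \<open>auto simp: h_def intro!: holomorphic_intros herglotz_holomorphic v\<close>)
  have hbd: "cmod (h n z) \<le> exp (real n)" if "cmod z < 1" for n z
  proof -
    have "Re (herglotz (v n) z) \<le> real n" by (rule Re_herglotz_le[OF v that]) (simp add: v_def)
    then show ?thesis using that c by (simp add: h_def norm_divide)
  qed
  have hInf: "h n \<in> Hinf" for n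
    by (rule HinfI[of _ "exp (real n)"]) (use hhol[of n] hbd[of _ n] in \<open>auto simp: Hol_disk_def h_def\<close>)
  define y where "y n = of_fun (h n)" for n
  have F: "to_fun (mult a (y n)) z = (if cmod z < 1 then exp (herglotz (w n) z) else 0)" for n z
    using herglotz_add[OF u v, of z n] c
    by (auto simp: to_fun_mult[OF a] y_def Hinf_H2[OF hInf] h_def uvw exp_add)
  have Fle: "norm (mult a (y n)) \<le> 1" for n
  proof -
    let ?F = "to_fun (mult a (y n))"
    have le: "cmod (?F z) \<le> 1" if "cmod z < 1" for z
      using Re_herglotz_le[OF w[of n] that, of 0] that by (simp add: F w_def)
    have FI: "?F \<in> Hinf" by (rule HinfI[OF to_fun_Hol_disk le])
    \<comment> \<open>The norm bound for multiplication operators, applied to the constant 1, bounds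
      the \<open>H2\<close> norm of a function by its supremum.\<close>
    have "mult ?F (unit_vec 0) = mult a (y n)"
      unfolding to_fun_eq_iff[symmetric] to_fun_mult[OF FI] to_fun_unit_vec
      by (rule ext) (simp add: zpow_def F)
    then show ?thesis using mult_H2(2)[OF to_fun_Hol_disk le, of "unit_vec 0"] by simp
  qed
  have F0: "coef (mult a (y n)) 0 = of_real (exp (\<integral>\<xi>. w n \<xi> \<partial>arc_measure))" for n
    using taylor_coeff_0[of "to_fun (mult a (y n))"] by (simp add: F herglotz_0 exp_of_real)
  have "(\<lambda>n. \<integral>\<xi>. w n \<xi> \<partial>arc_measure) \<longlonglongrightarrow> (\<integral>\<xi>. 0 \<partial>arc_measure)"
  proof (rule integral_dominated_convergence[where w = "\<lambda>\<xi>. \<bar>u \<xi>\<bar>"])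
    show "AE \<xi> in arc_measure. (\<lambda>n. w n \<xi>) \<longlonglongrightarrow> 0"
    proof (rule AE_I2)
      fix \<xi>
      obtain N where N: "- u \<xi> \<le> real N" using real_arch_simple by blast
      have "eventually (\<lambda>n. 0 = w n \<xi>) sequentially"
        unfolding eventually_sequentially by (rule exI[of _ N]) (use N in \<open>auto simp: w_def\<close>)
      then show "(\<lambda>n. w n \<xi>) \<longlonglongrightarrow> 0" by (rule Lim_transform_eventually[OF tendsto_const])
    qed
    show "AE \<xi> in arc_measure. norm (w n \<xi>) \<le> \<bar>u \<xi>\<bar>" for n
      using u0 by eventually_elim (auto simp: w_def min_def)
  qed (use u w in auto)
  then have lim: "(\<lambda>n. exp (\<integral>\<xi>. w n \<xi> \<partial>arc_measure)) \<longlonglongrightarrow> exp 0" by (intro tendsto_exp) simp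
  \<comment> \<open>A vector of norm at most 1 whose inner product with a unit vector approaches 1
    converges to that unit vector.\<close>
  have sq: "(norm (mult a (y n) - unit_vec 0))\<^sup>2 \<le> 2 - 2 * exp (\<integral>\<xi>. w n \<xi> \<partial>arc_measure)" for n
  proof -
    have "inner (mult a (y n)) (unit_vec 0) = exp (\<integral>\<xi>. w n \<xi> \<partial>arc_measure)"
      by (simp add: cinner_unit_vec F0 flip: Re_cinner)
    moreover have "(norm (mult a (y n)))\<^sup>2 \<le> 1" using Fle[of n] by (simp add: power_le_one)
    moreover have "(norm (mult a (y n) - unit_vec 0))\<^sup>2 = (norm (mult a (y n)))\<^sup>2 - 2 * inner (mult a (y n)) (unit_vec 0) + (norm (unit_vec 0))\<^sup>2"
      unfolding power2_norm_eq_inner by (simp add: inner_diff inner_commute)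
    ultimately show ?thesis by simp
  qed
  have "(\<lambda>n. (norm (mult a (y n) - unit_vec 0))\<^sup>2) \<longlonglongrightarrow> 0"
  proof (rule tendsto_sandwich[OF _ _ tendsto_const])
    show "(\<lambda>n. 2 - 2 * exp (\<integral>\<xi>. w n \<xi> \<partial>arc_measure)) \<longlonglongrightarrow> 0"
      using tendsto_diff[OF tendsto_const tendsto_mult[OF tendsto_const lim], of 2 2] by simp
  qed (use sq in auto)
  then have "(\<lambda>n. sqrt ((norm (mult a (y n) - unit_vec 0))\<^sup>2)) \<longlonglongrightarrow> sqrt 0" by (rule tendsto_real_sqrt)
  then have "(\<lambda>n. mult a (y n) - unit_vec 0) \<longlonglongrightarrow> 0" by (subst tendsto_norm_zero_iff[symmetric]) simp
  then have "(\<lambda>n. mult a (y n)) \<longlonglongrightarrow> unit_vec 0" by (rule LIM_zero_cancel)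
  then show ?thesis by (rule that)
qed

text \<open>A vector annihilated by the adjoint is orthogonal to all multiples of \<open>a\<close>.
  These include \<open>zpow k\<close> times the approximants of 1, so it is orthogonal to every
  monomial.\<close>

theorem outer_cyclic:
  assumes a: "a \<in> Hinf" and o: "outer a" and le1: "AE \<xi> in arc_measure. cmod (radial_limit a \<xi>) \<le> 1"
    and x: "adj (mult a) x = 0"
  shows "x = 0"
proof (rule ell2_eqI)
  fix k
  obtain y where y: "(\<lambda>n. mult a (y n)) \<longlonglongrightarrow> unit_vec 0" using outer_one_in_closure[OF a o le1] .
  have "(\<lambda>n. cinner x (mult (zpow k) (mult a (y n)))) \<longlonglongrightarrow> cinner x (mult (zpow k) (unit_vec 0))"
    by (intro tendsto_cinner tendsto_const clinear_op_tendsto[OF clinear_op_mult[OF zpow_Hinf]] y)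
  moreover have "cinner x (mult (zpow k) (mult a (y n))) = 0" for n
    unfolding mult_commute[OF zpow_Hinf a] cinner_adj'[OF clinear_op_mult[OF a], symmetric] by (simp add: x)
  ultimately have "cinner x (mult (zpow k) (unit_vec 0)) = 0" by (simp add: LIMSEQ_const_iff)
  then show "coef x k = coef 0 k" by (simp add: mult_zpow_unit_vec cinner_unit_vec coef_simps)
qed

subsection \<open>The space \<open>H(b)\<close> of a pair\<close>

text \<open>As to symmetry, \<open>H2_positive_operator\<close> constrains the quadratic form alone.
  Polarization with \<open>x + y\<close> and \<open>x + \<i> *\<^sub>C y\<close> recovers symmetry
  from real values.\<close>

lemma self_adjoint_if_real:
  assumes T: "clinear_op T" and re: "\<And>x. Im (cinner (T x) x) = 0"
  shows "cinner (T x) y = cinner x (T y)"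
proof -
  have "Im (cinner (T x) y) + Im (cinner (T y) x) = 0"
    using re[of "x + y"] re[of x] re[of y] by (simp add: clinear_op_add[OF T] cinner_add_left cinner_add_right)
  moreover have "Re (cinner (T y) x) - Re (cinner (T x) y) = 0"
    using re[of "x + \<i> *\<^sub>C y"] re[of x] re[of y]
    by (simp add: clinear_op_add[OF T] clinear_op_scaleC[OF T] cinner_add_left cinner_add_right
        cinner_scaleC_left cinner_scaleC_right)
  ultimately have "cinner (T x) y = cnj (cinner (T y) x)" by (simp add: complex_eq_iff)
  then show ?thesis by (metis cinner_commute)
qed

text \<open>
  In this locale \<open>S\<close> plays the role of \<open>(I - T\<^sub>b T\<^sub>b\<^sup>*)\<^sup>1\<^sup>/\<^sup>2\<close>. A vector \<open>S g\<close> corresponds to the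
  pair \<open>(S g, y)\<close> with \<open>T\<^sub>a\<^sup>* y = T\<^sub>b\<^sup>* (S g)\<close>, and \<open>g \<mapsto> (S g, y)\<close> is isometric: on \<open>g = S h\<close> one has
  \<open>y = T\<^sub>a T\<^sub>b\<^sup>* h\<close>.
\<close>

locale pair_operators =
  fixes A B S :: "ell2 \<Rightarrow> ell2"
  assumes A: "clinear_op A" and B: "clinear_op B" and S: "clinear_op S"
    and comm: "\<And>x. A (B x) = B (A x)"
    and pythagoras: "\<And>x y. cinner (A x) (A y) + cinner (B x) (B y) = cinner x y"
    and A_inj: "\<And>x. A x = 0 \<Longrightarrow> x = 0" and adjA_inj: "\<And>x. adj A x = 0 \<Longrightarrow> x = 0"
    and S_selfadj: "\<And>x y. cinner (S x) y = cinner x (S y)"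
    and S_sq: "\<And>x. S (S x) = x - B (adj B x)"
begin

lemmas adjA = clinear_op_adj[OF A] and adjB = clinear_op_adj[OF B]

lemma norm_pythagoras: "(norm (A x))\<^sup>2 + (norm (B x))\<^sup>2 = (norm x)\<^sup>2"
proof -
  have "of_real ((norm (A x))\<^sup>2 + (norm (B x))\<^sup>2) = (of_real ((norm x)\<^sup>2) :: complex)"
    using pythagoras[of x x] by (simp only: cinner_self of_real_add)
  then show ?thesis by (simp only: of_real_eq_iff)
qed

lemma adj_sum: "adj A (A x) + adj B (B x) = x"
  by (rule eq_if_cinner_eq) (simp add: cinner_add_left cinner_adj'[OF A] cinner_adj'[OF B] pythagoras)

lemma norm_S_sq: "(norm (S x))\<^sup>2 = (norm x)\<^sup>2 - (norm (adj B x))\<^sup>2"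
proof -
  have "of_real ((norm (S x))\<^sup>2) = cinner (S (S x)) x" by (simp only: cinner_self[symmetric] S_selfadj[of "S x"])
  also have "\<dots> = cinner x x - cinner (adj B x) (adj B x)"
    by (simp add: S_sq cinner_diff_left cinner_adj[OF B])
  also have "\<dots> = of_real ((norm x)\<^sup>2 - (norm (adj B x))\<^sup>2)" by (simp add: cinner_self)
  finally show ?thesis by (simp only: of_real_eq_iff)
qed

text \<open>If \<open>S x = 0\<close>, then \<open>x = B (adj B x)\<close>, and \<open>x\<close> has
  the same norm as \<open>adj B x\<close>. So \<open>B\<close> loses no norm on
  \<open>adj B x\<close>, and the Pythagorean identity leaves
  \<open>A (adj B x) = 0\<close>.\<close>

lemma S_inj:
  assumes "S x = 0" shows "x = 0"
proof -
  have x: "x = B (adj B x)" using S_sq[of x] assms by (simp add: clinear_op_zero[OF S])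
  have "(norm (A (adj B x)))\<^sup>2 = 0"
    using norm_S_sq[of x] norm_pythagoras[of "adj B x"] assms x by simp
  then have "adj B x = 0" using A_inj by simp
  then show ?thesis using x by (simp add: clinear_op_zero[OF B])
qed

lemma S_eq_iff: "S x = S y \<longleftrightarrow> x = y"
  using S_inj[of "x - y"] by (auto simp: clinear_op_diff[OF S])

text \<open>The relative Riesz theorem for \<open>S\<close> yields a vector of the closed range with
  the same image under \<open>S\<close> as \<open>x\<close>; by injectivity it is
  \<open>x\<close>.\<close>

lemma S_dense:
  obtains h where "(\<lambda>n. S (h n)) \<longlonglongrightarrow> x"
proof -
  have "cmod (cinner (S h) x) \<le> norm x * norm (S h)" for h using norm_cinner_le[of "S h" x] by (simp add: mult.commute)
  then obtain g where g: "g \<in> closure (range S)" "\<And>h. cinner (S h) x = cinner (S h) g"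
    by (rule riesz_range[OF S, of "\<lambda>h. cinner (S h) x" "norm x", rotated 2])
       (auto simp: clinear_op_add[OF S] clinear_op_scaleC[OF S] cinner_add_left cinner_scaleC_left)
  have "S x = S g" by (rule eq_if_cinner_eq') (simp add: S_selfadj[symmetric] g(2))
  then have "x = g" by (simp add: S_eq_iff)
  with g(1) show ?thesis using closure_range_approx that by blast
qed

text \<open>Since \<open>adj B (B k) = k - adj A (A k)\<close>, the norm of \<open>S (B k)\<close>
  can be computed exactly: its square is that of \<open>A k\<close> minus that of
  \<open>adj A (A k)\<close>. The bound is what permits factoring through \<open>A\<close>.\<close>

lemma norm_SB_le: "norm (S (B k)) \<le> norm (A k)"
proof -
  have "adj B (B k) = k - adj A (A k)" using adj_sum[of k] by (simp add: algebra_simps)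
  then have "(norm (adj B (B k)))\<^sup>2 = (norm k)\<^sup>2 - 2 * inner k (adj A (A k)) + (norm (adj A (A k)))\<^sup>2"
    by (simp add: power2_norm_eq_inner inner_diff inner_commute)
  also have "inner k (adj A (A k)) = (norm (A k))\<^sup>2"
    by (simp add: cinner_adj[OF A, symmetric] cinner_self flip: Re_cinner)
  finally have "(norm (S (B k)))\<^sup>2 = (norm (A k))\<^sup>2 - (norm (adj A (A k)))\<^sup>2"
    using norm_S_sq[of "B k"] norm_pythagoras[of k] by simp
  then have "(norm (S (B k)))\<^sup>2 \<le> (norm (A k))\<^sup>2" by simp
  then show ?thesis by (rule power2_le_imp_le) simp
qed

text \<open>The functional taking \<open>k\<close> to \<open>cinner (S (B k)) g\<close> is
  controlled by \<open>norm (A k)\<close>, hence is represented through \<open>A\<close>. The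
  representing vector is the companion, and its norm bound is that of the representation.\<close>

lemma ex_companion:
  obtains y where "adj A y = adj B (S g)" "norm y \<le> norm g"
proof -
  have "cmod (cinner (S (B k)) g) \<le> norm g * norm (A k)" for k
    using norm_cinner_le[of "S (B k)" g] mult_right_mono[OF norm_SB_le[of k] norm_ge_zero[of g]]
    by (simp add: mult.commute)
  then obtain y where y: "\<And>k. cinner (S (B k)) g = cinner (A k) y" "norm y \<le> norm g"
    by (rule riesz_range[OF A, of "\<lambda>k. cinner (S (B k)) g" "norm g", rotated 2])
       (auto simp: clinear_op_add[OF S] clinear_op_add[OF B] clinear_op_scaleC[OF S] clinear_op_scaleC[OF B]
          cinner_add_left cinner_scaleC_left)
  have "adj A y = adj B (S g)"
    by (rule eq_if_cinner_eq') (simp add: cinner_adj[OF A, symmetric] cinner_adj[OF B, symmetric] y(1)[symmetric] S_selfadj)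
  then show ?thesis using y(2) by (rule that)
qed

lemma companion_unique: "adj A y = adj A y' \<Longrightarrow> y = y'"
  using adjA_inj[of "y - y'"] by (simp add: clinear_op_diff[OF adjA])

lemma companion_SS: "adj A (A (adj B h)) = adj B (S (S h))"
  using adj_sum[of "adj B h"] by (simp add: S_sq clinear_op_diff[OF adjB] algebra_simps)

lemma norm_companion_SS: "(norm (S h))\<^sup>2 = (norm (S (S h)))\<^sup>2 + (norm (A (adj B h)))\<^sup>2"
proof -
  have "(norm (S (S h)))\<^sup>2 = (norm h)\<^sup>2 - 2 * inner h (B (adj B h)) + (norm (B (adj B h)))\<^sup>2"
    by (simp add: S_sq power2_norm_eq_inner inner_diff inner_commute)
  also have "inner h (B (adj B h)) = (norm (adj B h))\<^sup>2"
    by (simp add: cinner_adj'[OF B, symmetric] cinner_self flip: Re_cinner)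
  finally show ?thesis using norm_pythagoras[of "adj B h"] norm_S_sq[of h] by simp
qed

text \<open>The identity is a computation when \<open>g\<close> lies in the range of
  \<open>S\<close>. Such vectors are dense, and the contraction bound of \<open>ex_companion\<close>
  makes companions converge along with them.\<close>

lemma norm_companion:
  assumes y: "adj A y = adj B (S g)"
  shows "(norm g)\<^sup>2 = (norm (S g))\<^sup>2 + (norm y)\<^sup>2"
proof -
  obtain h where h: "(\<lambda>n. S (h n)) \<longlonglongrightarrow> g" by (rule S_dense)
  have le: "norm (A (adj B (h n)) - y) \<le> norm (S (h n) - g)" for n
  proof -
    obtain y' where y': "adj A y' = adj B (S (S (h n) - g))" "norm y' \<le> norm (S (h n) - g)" by (rule ex_companion)
    have "adj A (A (adj B (h n)) - y) = adj B (S (S (h n) - g))"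
      by (simp add: clinear_op_diff[OF adjA] clinear_op_diff[OF adjB] clinear_op_diff[OF S] companion_SS y)
    then have "A (adj B (h n)) - y = y'" using y'(1) companion_unique by metis
    with y'(2) show ?thesis by simp
  qed
  have "(\<lambda>n. A (adj B (h n)) - y) \<longlonglongrightarrow> 0"
  proof (rule Lim_null_comparison)
    show "\<forall>\<^sub>F n in sequentially. norm (A (adj B (h n)) - y) \<le> norm (S (h n) - g)" using le by simp
    show "(\<lambda>n. norm (S (h n) - g)) \<longlonglongrightarrow> 0" using h by (simp add: LIM_zero tendsto_norm_zero)
  qed
  then have yl: "(\<lambda>n. A (adj B (h n))) \<longlonglongrightarrow> y" by (rule LIM_zero_cancel)
  have "(\<lambda>n. (norm (S (h n)))\<^sup>2) \<longlonglongrightarrow> (norm g)\<^sup>2" by (intro tendsto_intros h)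
  moreover have "(\<lambda>n. (norm (S (S (h n))))\<^sup>2 + (norm (A (adj B (h n))))\<^sup>2) \<longlonglongrightarrow> (norm (S g))\<^sup>2 + (norm y)\<^sup>2"
    by (intro tendsto_intros yl clinear_op_tendsto[OF S] h)
  then have "(\<lambda>n. (norm (S (h n)))\<^sup>2) \<longlonglongrightarrow> (norm (S g))\<^sup>2 + (norm y)\<^sup>2"
    by (simp only: norm_companion_SS[symmetric])
  ultimately show ?thesis by (rule LIMSEQ_unique)
qed

text \<open>Range membership is again a bound on a functional. With
  \<open>h = S (S h) + B (adj B h)\<close>, the companion rewrites the second contribution as a
  pairing of \<open>A (adj B h)\<close> with \<open>y\<close>; both parts are then controlled by
  \<open>norm (S h)\<close>.\<close>

lemma in_range_S:
  assumes y: "adj A y = adj B x"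
  shows "x \<in> range S"
proof -
  have "cmod (cinner h x) \<le> (norm x + norm y) * norm (S h)" for h
  proof -
    have "cinner h x = cinner (S (S h)) x + cinner (adj B h) (adj B x)"
      by (simp add: S_sq cinner_diff_left cinner_adj[OF B])
    also have "cinner (adj B h) (adj B x) = cinner (A (adj B h)) y"
      by (simp add: y[symmetric] cinner_adj[OF A])
    finally have "cmod (cinner h x) \<le> cmod (cinner (S (S h)) x) + cmod (cinner (A (adj B h)) y)"
      by (simp add: norm_triangle_ineq)
    also have "\<dots> \<le> norm (S (S h)) * norm x + norm (A (adj B h)) * norm y"
      by (intro add_mono norm_cinner_le)
    also have "\<dots> \<le> norm (S h) * norm x + norm (S h) * norm y"
    proof (intro add_mono mult_right_mono)
      have "(norm (S (S h)))\<^sup>2 \<le> (norm (S h))\<^sup>2" "(norm (A (adj B h)))\<^sup>2 \<le> (norm (S h))\<^sup>2"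
        using norm_companion_SS[of h] by simp_all
      then show "norm (S (S h)) \<le> norm (S h)" "norm (A (adj B h)) \<le> norm (S h)"
        by (auto intro: power2_le_imp_le)
    qed auto
    finally show ?thesis by (simp add: algebra_simps)
  qed
  moreover have "0 \<le> norm x + norm y" by simp
  ultimately obtain g where g: "\<And>h. cinner h x = cinner (S h) g"
    by (rule riesz_range[OF S, of "\<lambda>h. cinner h x" "norm x + norm y", rotated 2])
       (auto simp: cinner_add_left cinner_scaleC_left)
  have "x = S g" by (rule eq_if_cinner_eq') (simp add: g S_selfadj)
  then show ?thesis by simp
qed

end

section \<open>The abstract operators realized by a pair\<close>

lemma pair_bounds:
  assumes "is_pair b a"
  shows "a \<in> Hinf" "b \<in> Hinf" "\<And>z. cmod z < 1 \<Longrightarrow> cmod (b z) \<le> 1" "\<And>z. cmod z < 1 \<Longrightarrow> a z \<noteq> 0"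
proof -
  show a: "a \<in> Hinf" using assms by (simp add: is_pair_def)
  have b: "b \<in> Hinf_unit_ball" using assms by (simp add: is_pair_def non_extreme_def)
  then show bI: "b \<in> Hinf" by (simp add: Hinf_unit_ball_def)
  show "cmod (b z) \<le> 1" if "cmod z < 1" for z
  proof -
    have "bdd_above ((\<lambda>z. cmod (b z)) ` ball 0 1)"
      using bI by (force simp: Hinf_def bounded_iff bdd_above_def)
    then have "cmod (b z) \<le> Hinf_norm b"
      unfolding Hinf_norm_def by (rule cSUP_upper[rotated]) (use that in simp)
    then show ?thesis using b by (simp add: Hinf_unit_ball_def)
  qed
  show "a z \<noteq> 0" if "cmod z < 1" for z
  proof -
    obtain c where "cmod c = 1" "\<forall>z\<in>ball 0 1. a z =
          c * exp (\<integral>\<xi>. (\<xi> + z) / (\<xi> - z) * of_real (ln (cmod (radial_limit a \<xi>))) \<partial>arc_measure)"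
      using assms by (auto simp: is_pair_def outer_def)
    then show ?thesis using that by auto
  qed
qed

text \<open>\<open>dBR_operator\<close> is specified through \<open>SOME\<close>. The series
  \<open>Q.rt\<close> shows that the specification is satisfiable, and the listed properties are
  then read off from the specification, so they hold for whichever root is chosen.\<close>

lemma dBR_operator_props:
  assumes b: "b \<in> Hinf" and b1: "\<And>z. cmod z < 1 \<Longrightarrow> cmod (b z) \<le> 1"
  obtains S where "clinear_op S" "\<And>x. dBR_operator b (to_fun x) = to_fun (S x)"
    "\<And>x y. cinner (S x) y = cinner x (S y)" "\<And>x. S (S x) = x - mult b (adj (mult b) x)"
proof -
  note Bop = clinear_op_mult[OF b]
  have bH: "b \<in> Hol_disk" using b by (simp add: Hinf_def)
  have B1: "norm (mult b x) \<le> 1 * norm x" for x using mult_H2(2)[OF bH b1] by simp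
  define Q where "Q x = mult b (adj (mult b) x)" for x
  interpret Q: selfadjoint_contraction Q
  proof
    show "clinear_op Q" unfolding Q_def[abs_def] by (rule clinear_op_compose[OF Bop clinear_op_adj[OF Bop]])
    show "cinner (Q x) y = cinner x (Q y)" for x y
      by (simp add: Q_def cinner_adj[OF Bop] cinner_adj'[OF Bop, symmetric])
    show "norm (Q x) \<le> norm x" for x
      unfolding Q_def using B1[of "adj (mult b) x"] norm_adj_le[OF Bop B1, of x] by simp
  qed
  define T where "T f z = f z - toeplitz (radial_limit b) (toeplitz (\<lambda>\<xi>. cnj (radial_limit b \<xi>)) f) z" for f z
  have T: "T (to_fun x) = to_fun (x - Q x)" for x
    by (rule ext) (simp add: T_def toeplitz_coanalytic[OF b] toeplitz_analytic[OF b] Q_def to_fun_diff)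
  let ?P = "\<lambda>S. H2_positive_operator S \<and> (\<forall>f\<in>H2. S (S f) = T f)"
  have "?P (\<lambda>f. to_fun (Q.rt (of_fun f)))"
  proof (intro conjI ballI)
    show "H2_positive_operator (\<lambda>f. to_fun (Q.rt (of_fun f)))"
      unfolding H2_positive_operator_def
    proof (intro conjI ballI allI)
      show "to_fun (Q.rt (of_fun f)) \<in> H2" for f by (rule to_fun_H2)
      fix f g c assume "f \<in> H2" "g \<in> H2"
      then obtain x y where xy: "f = to_fun x" "g = to_fun y" using H2_cases by metis
      have e: "(\<lambda>z. c * f z + g z) = to_fun (c *\<^sub>C x + y)" by (simp add: xy to_fun_lincomb fun_eq_iff)
      show "to_fun (Q.rt (of_fun (\<lambda>z. c * f z + g z))) = (\<lambda>z. c * to_fun (Q.rt (of_fun f)) z + to_fun (Q.rt (of_fun g)) z)"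
        unfolding e by (simp add: xy clinear_op_add[OF Q.clinear_op_rt] clinear_op_scaleC[OF Q.clinear_op_rt] to_fun_lincomb fun_eq_iff)
    next
      obtain K where K: "\<And>x. norm (Q.rt x) \<le> norm x * K"
        using bounded_linear.nonneg_bounded[OF clinear_op_bounded_linear[OF Q.clinear_op_rt]] by blast
      have "H2_norm (to_fun (Q.rt (of_fun f))) \<le> K * H2_norm f" if "f \<in> H2" for f
        using H2_cases[OF that] K by (metis H2_norm_to_fun mult.commute of_fun_to_fun)
      then show "\<exists>C. \<forall>f\<in>H2. H2_norm (to_fun (Q.rt (of_fun f))) \<le> C * H2_norm f" by blast
    next
      fix f assume "f \<in> H2"
      then obtain x where x: "f = to_fun x" by (rule H2_cases)
      have "Im (cinner (Q.rt x) x) = 0"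
        using cinner_commute[of "Q.rt x" x] Q.selfadj_rt[of x x] by (simp add: complex_eq_iff)
      moreover have "0 \<le> Re (cinner (Q.rt x) x)" using Q.inner_rt_nonneg by (simp add: Re_cinner)
      ultimately show "H2_inner (to_fun (Q.rt (of_fun f))) f \<in> \<real>\<^sub>\<ge>\<^sub>0"
        by (simp add: x complex_nonneg_Reals_iff)
    qed
    fix f assume "f \<in> H2"
    then obtain x where x: "f = to_fun x" by (rule H2_cases)
    show "to_fun (Q.rt (of_fun (to_fun (Q.rt (of_fun f))))) = T f"
      by (simp add: x T Q.rt_rt)
  qed
  then have "?P (SOME S. ?P S)" by (rule someI[of ?P])
  then have P: "?P (dBR_operator b)" unfolding dBR_operator_def H2_sqrt_def T_def[abs_def] .
  define S where "S x = of_fun (dBR_operator b (to_fun x))" for x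
  have H: "dBR_operator b (to_fun x) \<in> H2" for x
    using P to_fun_H2 unfolding H2_positive_operator_def by blast
  have dS: "dBR_operator b (to_fun x) = to_fun (S x)" for x by (simp add: S_def H)
  have lin: "S (c *\<^sub>C x + y) = c *\<^sub>C S x + S y" for c x y
  proof -
    have "dBR_operator b (\<lambda>z. c * to_fun x z + to_fun y z) = (\<lambda>z. c * dBR_operator b (to_fun x) z + dBR_operator b (to_fun y) z)"
      using P to_fun_H2 unfolding H2_positive_operator_def by blast
    then have "to_fun (S (c *\<^sub>C x + y)) = to_fun (c *\<^sub>C S x + S y)"
      by (simp add: dS[symmetric] to_fun_lincomb[abs_def])
    then show ?thesis by simp
  qed
  have add: "S (x + y) = S x + S y" for x y using lin[of 1 x y] by simp
  then have zero: "S 0 = 0" by (metis add_cancel_right_right)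
  obtain C where C: "\<And>f. f \<in> H2 \<Longrightarrow> H2_norm (dBR_operator b f) \<le> C * H2_norm f"
    using P unfolding H2_positive_operator_def by blast
  have Sop: "clinear_op S"
  proof (rule clinear_opI[OF add])
    show "S (c *\<^sub>C x) = c *\<^sub>C S x" for c x using lin[of c x 0] zero by simp
    show "norm (S x) \<le> C * norm x" for x using C[OF to_fun_H2, of x] by (simp add: dS)
  qed
  have "Im (cinner (S x) x) = 0" for x
  proof -
    have "H2_inner (dBR_operator b (to_fun x)) (to_fun x) \<in> \<real>\<^sub>\<ge>\<^sub>0"
      using P to_fun_H2 unfolding H2_positive_operator_def by blast
    then show ?thesis by (simp add: dS complex_nonneg_Reals_iff)
  qed
  then have sa: "cinner (S x) y = cinner x (S y)" for x y by (rule self_adjoint_if_real[OF Sop])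
  have "S (S x) = x - Q x" for x
  proof -
    have "dBR_operator b (dBR_operator b (to_fun x)) = T (to_fun x)" using P to_fun_H2 by blast
    then show ?thesis by (simp add: dS T)
  qed
  then show ?thesis using that[OF Sop dS sa] by (simp add: Q_def)
qed

lemma pair_adj_inj:
  assumes p: "is_pair b a" and x: "adj (mult a) x = 0"
  shows "x = 0"
proof -
  have "AE \<xi> in arc_measure. (cmod (radial_limit a \<xi>))\<^sup>2 + (cmod (radial_limit b \<xi>))\<^sup>2 = 1"
    using p by (simp add: is_pair_def)
  then have le1: "AE \<xi> in arc_measure. cmod (radial_limit a \<xi>) \<le> 1"
  proof eventually_elim
    case (elim \<xi>)
    then have "(cmod (radial_limit a \<xi>))\<^sup>2 \<le> 1\<^sup>2"
      using zero_le_power2[of "cmod (radial_limit b \<xi>)"] unfolding one_power2 by linarith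
    then show ?case by (rule power2_le_imp_le) simp
  qed
  show ?thesis
    by (rule outer_cyclic[OF pair_bounds(1)[OF p] _ le1 x]) (use p in \<open>simp add: is_pair_def\<close>)
qed

text \<open>Trades the square root in the definition of \<open>H(b)\<close> for an equation between
  adjoint multiplications; the norm takes the shape of a sum, matching
  \<open>dirichlet_norm\<close>.\<close>

theorem dBR_characterization:
  assumes p: "is_pair b a"
  shows "f \<in> dBR_space b \<longleftrightarrow> (\<exists>x y. f = to_fun x \<and> adj (mult a) y = adj (mult b) x)"
    and "adj (mult a) y = adj (mult b) x \<Longrightarrow> dBR_norm b (to_fun x) = sqrt ((norm x)\<^sup>2 + (norm y)\<^sup>2)"
proof -
  note pb = pair_bounds[OF p]
  note Aop = clinear_op_mult[OF pb(1)] and Bop = clinear_op_mult[OF pb(2)]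
  have sum1: "AE \<xi> in arc_measure. (cmod (radial_limit a \<xi>))\<^sup>2 + (cmod (radial_limit b \<xi>))\<^sup>2 = 1"
    using p by (simp add: is_pair_def)
  \<comment> \<open>Integrated over the circle, the almost everywhere identity for the moduli says
    that the multiplications by \<open>a\<close> and \<open>b\<close> together preserve inner
    products.\<close>
  have pyth: "cinner (mult a x) (mult a y) + cinner (mult b x) (mult b y) = cinner x y" for x y
  proof -
    have "cinner (mult a x) (mult a y) + cinner (mult b x) (mult b y)
        = (\<integral>\<xi>. bv (mult a x) \<xi> * cnj (bv (mult a y) \<xi>) + bv (mult b x) \<xi> * cnj (bv (mult b y) \<xi>) \<partial>arc_measure)"
      by (simp only: Bochner_Integration.integral_add[OF integrable_bv_prod integrable_bv_prod] integral_bv_prod)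
    also have "\<dots> = (\<integral>\<xi>. bv x \<xi> * cnj (bv y \<xi>) \<partial>arc_measure)"
    proof (rule integral_cong_AE)
      show "AE \<xi> in arc_measure. bv (mult a x) \<xi> * cnj (bv (mult a y) \<xi>) + bv (mult b x) \<xi> * cnj (bv (mult b y) \<xi>) = bv x \<xi> * cnj (bv y \<xi>)"
        using AE_bv_mult[OF pb(1), of x] AE_bv_mult[OF pb(1), of y] AE_bv_mult[OF pb(2), of x] AE_bv_mult[OF pb(2), of y] sum1
      proof eventually_elim
        case (elim \<xi>)
        have "of_real ((cmod (radial_limit a \<xi>))\<^sup>2) + of_real ((cmod (radial_limit b \<xi>))\<^sup>2) = (1 :: complex)"
          using elim(5) by (metis of_real_1 of_real_add)
        then have one: "radial_limit a \<xi> * cnj (radial_limit a \<xi>) + radial_limit b \<xi> * cnj (radial_limit b \<xi>) = 1"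
          by (simp only: complex_norm_square)
        have "bv (mult a x) \<xi> * cnj (bv (mult a y) \<xi>) + bv (mult b x) \<xi> * cnj (bv (mult b y) \<xi>)
            = (radial_limit a \<xi> * cnj (radial_limit a \<xi>) + radial_limit b \<xi> * cnj (radial_limit b \<xi>)) * (bv x \<xi> * cnj (bv y \<xi>))"
          by (simp add: elim algebra_simps)
        then show ?case by (simp only: one mult_1)
      qed
    qed measurable
    finally show ?thesis by (simp only: integral_bv_prod)
  qed
  obtain S where S_props: "clinear_op S" "\<And>x. dBR_operator b (to_fun x) = to_fun (S x)"
    "\<And>x y. cinner (S x) y = cinner x (S y)" "\<And>x. S (S x) = x - mult b (adj (mult b) x)"
    using dBR_operator_props[OF pb(2,3)] by blast
  interpret pair_operators "mult a" "mult b" S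
  proof
    show "mult a (mult b x) = mult b (mult a x)" for x by (rule mult_commute[OF pb(1,2)])
    show "x = 0" if "mult a x = 0" for x
    proof -
      have "to_fun x = to_fun 0"
      proof (rule Hol_disk_eqI[OF to_fun_Hol_disk to_fun_Hol_disk])
        fix z :: complex assume "cmod z < 1"
        then show "to_fun x z = to_fun 0 z"
          using that fun_cong[OF to_fun_mult[OF pb(1), of x], of z] pb(4)[of z] by simp
      qed
      then show ?thesis by (simp only: to_fun_eq_iff)
    qed
    show "x = 0" if "adj (mult a) x = 0" for x
      by (rule pair_adj_inj[OF p that])
  qed (fact Aop Bop S_props pyth)+
  show "f \<in> dBR_space b \<longleftrightarrow> (\<exists>x y. f = to_fun x \<and> adj (mult a) y = adj (mult b) x)"
  proof
    assume "f \<in> dBR_space b"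
    then obtain g where g: "g \<in> H2" "f = dBR_operator b g" by (auto simp: dBR_space_def)
    then obtain g' where "g = to_fun g'" using H2_cases by blast
    with g(2) have "f = to_fun (S g')" by (simp add: S_props(2))
    moreover obtain y where "adj (mult a) y = adj (mult b) (S g')" by (rule ex_companion)
    ultimately show "\<exists>x y. f = to_fun x \<and> adj (mult a) y = adj (mult b) x" by blast
  next
    assume "\<exists>x y. f = to_fun x \<and> adj (mult a) y = adj (mult b) x"
    then obtain x y where "f = to_fun x" "adj (mult a) y = adj (mult b) x" by blast
    moreover from this(2) obtain g where "x = S g" using in_range_S by blast
    ultimately have "f = dBR_operator b (to_fun g)" by (simp add: S_props(2))
    then show "f \<in> dBR_space b" unfolding dBR_space_def using to_fun_H2 by blast
  qed
  assume y: "adj (mult a) y = adj (mult b) x"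
  then obtain g where g: "x = S g" using in_range_S by blast
  \<comment> \<open>Injectivity of \<open>S\<close> makes the preimage of \<open>x\<close> unique,
    so the definite description in \<open>dBR_norm\<close> picks it.\<close>
  have "(THE k. k \<in> H2 \<and> (\<forall>l\<in>H2. dBR_operator b l = (\<lambda>z. 0) \<longrightarrow> H2_inner k l = 0) \<and> dBR_operator b k = to_fun x) = to_fun g"
  proof (rule the_equality)
    have "H2_inner (to_fun g) l = 0" if l: "l \<in> H2" "dBR_operator b l = (\<lambda>z. 0)" for l
    proof -
      obtain l' where l': "l = to_fun l'" using H2_cases[OF l(1)] by blast
      have "to_fun (S l') = to_fun 0" using l(2) by (simp add: l' S_props(2))
      then have "l' = 0" using S_inj by (simp only: to_fun_eq_iff)
      then show ?thesis by (simp add: l' del: to_fun_zero)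
    qed
    then show "to_fun g \<in> H2 \<and> (\<forall>l\<in>H2. dBR_operator b l = (\<lambda>z. 0) \<longrightarrow> H2_inner (to_fun g) l = 0) \<and> dBR_operator b (to_fun g) = to_fun x"
      by (simp add: to_fun_H2 S_props(2) g)
    fix k assume k: "k \<in> H2 \<and> (\<forall>l\<in>H2. dBR_operator b l = (\<lambda>z. 0) \<longrightarrow> H2_inner k l = 0) \<and> dBR_operator b k = to_fun x"
    then obtain k' where k': "k = to_fun k'" using H2_cases by blast
    with k have "S k' = S g" by (simp add: S_props(2) g)
    then show "k = to_fun g" by (simp add: S_eq_iff k')
  qed
  then have "dBR_norm b (to_fun x) = norm g" by (simp add: dBR_norm_def)
  also have "\<dots> = sqrt ((norm x)\<^sup>2 + (norm y)\<^sup>2)"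
    using norm_companion[of y g] y g by (metis norm_ge_zero real_sqrt_unique)
  finally show "dBR_norm b (to_fun x) = sqrt ((norm x)\<^sup>2 + (norm y)\<^sup>2)" .
qed

subsection \<open>Holomorphic change of variables\<close>

text \<open>A measure preserving identification with \<open>real^2\<close>, where the Jacobian is
  the determinant of a matrix.\<close>

definition complex_of_vec :: "real^2 \<Rightarrow> complex" where
  "complex_of_vec v = Complex (v $ 1) (v $ 2)"

definition vec_of_complex :: "complex \<Rightarrow> real^2" where
  "vec_of_complex z = vector [Re z, Im z]"

lemma complex_of_vec_inverse [simp]: "complex_of_vec (vec_of_complex z) = z"
  "vec_of_complex (complex_of_vec v) = v"
  by (simp_all add: complex_of_vec_def vec_of_complex_def complex_eq_iff vec_eq_iff forall_2)

lemma bounded_linear_complex_of_vec: "bounded_linear complex_of_vec"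
  by (intro linear_conv_bounded_linear[THEN iffD1] linearI)
     (simp_all add: complex_of_vec_def complex_eq_iff)

lemma bounded_linear_vec_of_complex: "bounded_linear vec_of_complex"
  by (intro linear_conv_bounded_linear[THEN iffD1] linearI)
     (simp_all add: vec_of_complex_def vec_eq_iff forall_2)

lemma measurable_complex_of_vec [measurable]: "complex_of_vec \<in> borel_measurable borel"
  by (intro borel_measurable_continuous_onI linear_continuous_on bounded_linear_complex_of_vec)

lemma lborel_complex_eq_distr: "lborel = distr lborel borel complex_of_vec"
proof (rule lborel_eqI)
  fix l u :: complex
  assume le: "\<And>b. b \<in> Basis \<Longrightarrow> l \<bullet> b \<le> u \<bullet> b"
  have "complex_of_vec -` box l u \<inter> space lborel = box (vec_of_complex l) (vec_of_complex u)"
    by (auto simp: complex_of_vec_def vec_of_complex_def mem_box_cart forall_2 in_box_complex_iff)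
  then have "emeasure (distr lborel borel complex_of_vec) (box l u) = emeasure lborel (box (vec_of_complex l) (vec_of_complex u))"
    by (subst emeasure_distr) auto
  also have "\<dots> = (\<Prod>b\<in>Basis. (vec_of_complex u - vec_of_complex l) \<bullet> b)"
    by (rule emeasure_lborel_box)
       (use le[of 1] le[of \<i>] in \<open>auto simp: Basis_vec_def inner_axis vec_of_complex_def Basis_complex_def exhaust_2 intro: forall_2[THEN iffD2, rule_format]\<close>)
  also have "(\<Prod>b\<in>Basis. (vec_of_complex u - vec_of_complex l) \<bullet> b) = (Re u - Re l) * (Im u - Im l)"
  proof -
    have B: "(Basis :: (real^2) set) = {axis 1 1, axis 2 1}" by (auto simp: Basis_vec_def UNIV_2)
    have "axis 1 1 \<noteq> (axis 2 1 :: real^2)" by (simp add: axis_eq_axis)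
    then show ?thesis by (simp add: B inner_axis vec_of_complex_def)
  qed
  also have "\<dots> = (\<Prod>b\<in>Basis. (u - l) \<bullet> b)" by (simp add: Basis_complex_def)
  finally show "emeasure (distr lborel borel complex_of_vec) (box l u) = (\<Prod>b\<in>Basis. (u - l) \<bullet> b)" .
qed simp

lemma emeasure_lborel_complex:
  assumes "X \<in> sets borel"
  shows "emeasure lborel X = emeasure lborel (vec_of_complex ` X)"
proof -
  have "complex_of_vec -` X = vec_of_complex ` X"
    by (auto simp: image_iff) (metis complex_of_vec_inverse(2))
  then show ?thesis using assms by (subst lborel_complex_eq_distr) (simp add: emeasure_distr)
qed

lemma nn_integral_lborel_complex:
  assumes [measurable]: "F \<in> borel_measurable borel"
  shows "(\<integral>\<^sup>+z. F z \<partial>lborel) = (\<integral>\<^sup>+v. F (complex_of_vec v) \<partial>lborel)"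
  by (subst lborel_complex_eq_distr) (simp add: nn_integral_distr)

text \<open>The Jacobian of a holomorphic map: its derivative acts as a rotation combined with a
  dilation.\<close>

lemma det_complex_mult:
  "det (matrix (\<lambda>h. vec_of_complex (c * complex_of_vec h))) = (cmod c)\<^sup>2"
  by (simp add: det_2 matrix_def vec_of_complex_def complex_of_vec_def axis_def cmod_power2 flip: power2_eq_square)

text \<open>Within a compact subset of the domain the image is bounded, hence of finite measure, as
  the differentiable change of variables demands.\<close>

lemma emeasure_holomorphic_image_compact:
  assumes S: "open S" and g: "g holomorphic_on S" and inj: "inj_on g S"
    and K: "compact K" "K \<subseteq> S" and B: "B \<in> sets borel" "B \<subseteq> K" and gB: "g ` B \<in> sets borel"
  shows "emeasure lborel (g ` B) = (\<integral>\<^sup>+z. ennreal ((cmod (deriv g z))\<^sup>2 * indicator B z) \<partial>lborel)"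
proof -
  define G where "G v = vec_of_complex (g (complex_of_vec v))" for v
  define G' where "G' v h = vec_of_complex (deriv g (complex_of_vec v) * complex_of_vec h)" for v h
  let ?B = "vec_of_complex ` B"
  have vB: "?B = complex_of_vec -` B" by (auto simp: image_iff) (metis complex_of_vec_inverse(2))
  have Bm: "?B \<in> sets borel" unfolding vB using measurable_sets[OF measurable_complex_of_vec B(1)] by simp
  have der: "(G has_derivative G' v) (at v within ?B)" if "v \<in> ?B" for v
  proof -
    have "complex_of_vec v \<in> S" using that B K by auto
    then have "(g has_field_derivative deriv g (complex_of_vec v)) (at (complex_of_vec v))"
      using holomorphic_derivI[OF g S] by blast
    then have "(g has_derivative (\<lambda>h. deriv g (complex_of_vec v) * h)) (at (complex_of_vec v))"
      by (simp add: has_field_derivative_def)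
    from has_derivative_compose[OF bounded_linear_imp_has_derivative[OF bounded_linear_complex_of_vec] this]
    have "((\<lambda>v. g (complex_of_vec v)) has_derivative (\<lambda>h. deriv g (complex_of_vec v) * complex_of_vec h)) (at v within ?B)" .
    from bounded_linear.has_derivative[OF bounded_linear_vec_of_complex this]
    show ?thesis by (simp add: G_def[abs_def] G'_def[abs_def])
  qed
  have injG: "inj_on G ?B"
  proof (rule inj_onI)
    fix v w assume vw: "v \<in> ?B" "w \<in> ?B" "G v = G w"
    then have "g (complex_of_vec v) = g (complex_of_vec w)" unfolding G_def by (metis complex_of_vec_inverse(1))
    moreover have "complex_of_vec v \<in> S" "complex_of_vec w \<in> S" using vw B K by auto
    ultimately have "complex_of_vec v = complex_of_vec w" using inj by (simp add: inj_on_eq_iff)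
    then show "v = w" by (metis complex_of_vec_inverse(2))
  qed
  have GB: "G ` ?B = vec_of_complex ` (g ` B)" by (auto simp: G_def image_iff)
  have "vec_of_complex ` (g ` B) = complex_of_vec -` (g ` B)" by (auto simp: image_iff) (metis complex_of_vec_inverse(2))
  then have GBm: "G ` ?B \<in> sets borel" unfolding GB using measurable_sets[OF measurable_complex_of_vec gB] by simp
  have "bounded (G ` ?B)"
  proof (rule bounded_subset)
    have "continuous_on K g" using K g holomorphic_on_imp_continuous_on holomorphic_on_subset by blast
    then show "bounded (vec_of_complex ` (g ` K))"
      by (intro bounded_linear_image bounded_linear_vec_of_complex compact_imp_bounded compact_continuous_image K)
    show "G ` ?B \<subseteq> vec_of_complex ` (g ` K)" unfolding GB using B by blast
  qed
  then have lm: "G ` ?B \<in> lmeasurable" and fin: "emeasure lborel (G ` ?B) \<noteq> \<infinity>"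
    using GBm emeasure_bounded_finite[of "G ` ?B"] by (auto intro!: bounded_set_imp_lmeasurable)
  have "((\<lambda>v. \<bar>det (matrix (G' v))\<bar>) has_integral (measure lebesgue (G ` ?B))) ?B"
    using has_measure_differentiable_image[OF _ der injG, of "measure lebesgue (G ` ?B)"] lm Bm by auto
  then have hi: "((\<lambda>v. (cmod (deriv g (complex_of_vec v)))\<^sup>2) has_integral (measure lebesgue (G ` ?B))) ?B"
    by (simp add: G'_def[abs_def] det_complex_mult)
  have "emeasure lborel (g ` B) = emeasure lborel (G ` ?B)" using emeasure_lborel_complex[OF gB] GB by simp
  also have "\<dots> = ennreal (measure lebesgue (G ` ?B))"
    using fin GBm by (simp add: emeasure_eq_ennreal_measure)
  also have "\<dots> = (\<integral>\<^sup>+v. ennreal (indicator ?B v * (cmod (deriv g (complex_of_vec v)))\<^sup>2) \<partial>lborel)"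
    by (rule nn_integral_has_integral_lebesgue[OF _ hi, symmetric]) simp
  also have "\<dots> = (\<integral>\<^sup>+v. ennreal ((cmod (deriv g (complex_of_vec v)))\<^sup>2 * indicator B (complex_of_vec v)) \<partial>lborel)"
    unfolding vB by (intro nn_integral_cong) (simp add: indicator_def)
  also have "\<dots> = (\<integral>\<^sup>+z. ennreal ((cmod (deriv g z))\<^sup>2 * indicator B z) \<partial>lborel)"
  proof (rule nn_integral_lborel_complex[symmetric])
    have "continuous_on B (\<lambda>z. (cmod (deriv g z))\<^sup>2)"
      using B K by (intro continuous_intros continuous_on_subset[OF holomorphic_on_imp_continuous_on[OF holomorphic_deriv[OF g S]]]) auto
    from borel_measurable_continuous_on_indicator[OF B(1) this]
    show "(\<lambda>z. ennreal ((cmod (deriv g z))\<^sup>2 * indicator B z)) \<in> borel_measurable borel"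
      by (intro measurable_compose[OF _ measurable_ennreal]) (simp add: mult.commute)
  qed
  finally show ?thesis .
qed

theorem nn_integral_holomorphic_image:
  assumes S: "open S" and g: "g holomorphic_on S" and inj: "inj_on g S"
    and F [measurable]: "F \<in> borel_measurable borel"
  shows "(\<integral>\<^sup>+z\<in>g ` S. F z \<partial>lborel) = (\<integral>\<^sup>+z\<in>S. F (g z) * ennreal ((cmod (deriv g z))\<^sup>2) \<partial>lborel)"
proof -
  define w where "w z = ennreal ((cmod (deriv g z))\<^sup>2 * indicator S z)" for z
  \<comment> \<open>\<open>distr\<close> is used with a total Borel function; outside
    \<open>S\<close> the density \<open>w\<close> vanishes.\<close>
  define g' where "g' z = (if z \<in> S then g z else 0)" for z
  have Sm [measurable]: "S \<in> sets borel" using S by simp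
  have gS: "open (g ` S)" by (rule open_mapping_thm3[OF g S inj])
  have "continuous_on S (\<lambda>z. (cmod (deriv g z))\<^sup>2)"
    by (intro continuous_intros holomorphic_on_imp_continuous_on holomorphic_deriv[OF g S])
  from borel_measurable_continuous_on_indicator[OF Sm this]
  have wm [measurable]: "w \<in> borel_measurable borel"
    unfolding w_def[abs_def] by (intro measurable_compose[OF _ measurable_ennreal]) (simp add: mult.commute)
  have gm [measurable]: "g' \<in> borel_measurable borel"
    using borel_measurable_continuous_on_indicator[OF Sm holomorphic_on_imp_continuous_on[OF g]]
    by (rule measurable_cong[THEN iffD1, rotated]) (simp add: g'_def)
  obtain h where h: "h holomorphic_on g ` S" "\<And>z. z \<in> S \<Longrightarrow> h (g z) = z"
    using holomorphic_has_inverse[OF g S inj] by metis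
  \<comment> \<open>The image is a preimage under the holomorphic inverse \<open>h\<close>, which
    makes it Borel.\<close>
  have img: "g ` B \<in> sets borel" if B: "B \<in> sets borel" "B \<subseteq> S" for B
  proof -
    have "h \<in> borel_measurable (restrict_space borel (g ` S))"
      by (intro borel_measurable_continuous_on_restrict holomorphic_on_imp_continuous_on h)
    from measurable_sets[OF this B(1)]
    have "h -` B \<inter> g ` S \<in> sets (restrict_space borel (g ` S))" by (simp add: space_restrict_space)
    then have "h -` B \<inter> g ` S \<in> sets borel"
      using gS by (subst (asm) sets_restrict_space_iff) auto
    moreover have "h -` B \<inter> g ` S = g ` B" using B(2) h(2) by force
    ultimately show ?thesis by simp
  qed
  obtain C :: "nat \<Rightarrow> complex set" where C: "\<And>n. compact (C n)" "\<And>n. C n \<subseteq> S" "\<And>n. C n \<subseteq> interior (C (Suc n))" "\<Union>(range C) = S"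
    using open_Union_compact_subsets[OF S] by metis
  have Cinc: "C n \<subseteq> C (Suc n)" for n using C(3) interior_subset by blast
  have em: "emeasure lborel (g ` B) = emeasure (density lborel w) B" if B: "B \<in> sets borel" "B \<subseteq> S" for B
  proof -
    have Bn: "B \<inter> C n \<in> sets borel" for n by (intro sets.Int B borel_closed compact_imp_closed C(1))
    have inc: "incseq (\<lambda>n. B \<inter> C n)" by (rule incseq_SucI) (use Cinc in blast)
    have un: "(\<Union>n. B \<inter> C n) = B" using C(4) B(2) by blast
    have "emeasure lborel (g ` (B \<inter> C n)) = emeasure (density lborel w) (B \<inter> C n)" for n
    proof -
      have "emeasure lborel (g ` (B \<inter> C n)) = (\<integral>\<^sup>+z. ennreal ((cmod (deriv g z))\<^sup>2 * indicator (B \<inter> C n) z) \<partial>lborel)"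
        by (rule emeasure_holomorphic_image_compact[OF S g inj C(1,2) Bn _ img[OF Bn]]) (use C(2) in auto)
      also have "\<dots> = (\<integral>\<^sup>+z. w z * indicator (B \<inter> C n) z \<partial>lborel)"
        by (intro nn_integral_cong) (use B(2) in \<open>auto simp: w_def indicator_def\<close>)
      also have "\<dots> = emeasure (density lborel w) (B \<inter> C n)" using Bn by (subst emeasure_density) auto
      finally show ?thesis .
    qed
    moreover have "(SUP n. emeasure lborel (g ` (B \<inter> C n))) = emeasure lborel (\<Union>n. g ` (B \<inter> C n))"
    proof (rule SUP_emeasure_incseq)
      show "range (\<lambda>n. g ` (B \<inter> C n)) \<subseteq> sets lborel" using img[OF Bn] B(2) by auto
      show "incseq (\<lambda>n. g ` (B \<inter> C n))" by (rule incseq_SucI) (use Cinc in blast)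
    qed
    moreover have "(\<Union>n. g ` (B \<inter> C n)) = g ` B" unfolding image_UN[symmetric] un ..
    moreover have "(SUP n. emeasure (density lborel w) (B \<inter> C n)) = emeasure (density lborel w) (\<Union>n. B \<inter> C n)"
      using Bn inc by (intro SUP_emeasure_incseq) auto
    ultimately show ?thesis by (simp only: un)
  qed
  have eq: "distr (density lborel w) borel g' = density lborel (indicator (g ` S))"
  proof (rule measure_eqI)
    fix X assume "X \<in> sets (distr (density lborel w) borel g')"
    then have X [measurable]: "X \<in> sets borel" by simp
    have pre: "g' -` X \<inter> S \<in> sets borel" using measurable_sets[OF gm X] by auto
    have "emeasure (distr (density lborel w) borel g') X = emeasure (density lborel w) (g' -` X)"
      by (subst emeasure_distr) auto
    also have "\<dots> = (\<integral>\<^sup>+z. w z * indicator (g' -` X) z \<partial>lborel)"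
      using measurable_sets[OF gm X] by (subst emeasure_density) auto
    also have "\<dots> = (\<integral>\<^sup>+z. w z * indicator (g' -` X \<inter> S) z \<partial>lborel)"
      by (intro nn_integral_cong) (auto simp: w_def indicator_def)
    also have "\<dots> = emeasure (density lborel w) (g' -` X \<inter> S)" using pre by (subst emeasure_density) auto
    also have "\<dots> = emeasure lborel (g ` (g' -` X \<inter> S))" using pre by (subst em) auto
    also have "g ` (g' -` X \<inter> S) = X \<inter> g ` S" by (auto simp: g'_def)
    also have "emeasure lborel (X \<inter> g ` S) = emeasure (density lborel (indicator (g ` S))) X"
      using gS by (subst emeasure_density) (auto simp: nn_integral_indicator[symmetric] indicator_inter_arith mult.commute simp del: nn_integral_indicator)
    finally show "emeasure (distr (density lborel w) borel g') X = emeasure (density lborel (indicator (g ` S))) X" .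
  qed simp
  have "(\<integral>\<^sup>+z\<in>g ` S. F z \<partial>lborel) = (\<integral>\<^sup>+z. F z \<partial>density lborel (indicator (g ` S)))"
    using gS by (subst nn_integral_density) (auto simp: mult.commute)
  also have "\<dots> = (\<integral>\<^sup>+z. F z \<partial>distr (density lborel w) borel g')" by (simp only: eq)
  also have "\<dots> = (\<integral>\<^sup>+z. F (g' z) \<partial>density lborel w)" by (subst nn_integral_distr) auto
  also have "\<dots> = (\<integral>\<^sup>+z. w z * F (g' z) \<partial>lborel)" by (subst nn_integral_density) auto
  also have "\<dots> = (\<integral>\<^sup>+z\<in>S. F (g z) * ennreal ((cmod (deriv g z))\<^sup>2) \<partial>lborel)"
    by (intro nn_integral_cong) (auto simp: w_def g'_def indicator_def mult.commute)
  finally show ?thesis .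
qed

subsection \<open>Polar coordinates\<close>

lemma lborel_complex_eq_pair: "lborel = distr (lborel \<Otimes>\<^sub>M lborel) borel (\<lambda>(x, y). Complex x y)"
proof (rule lborel_eqI)
  fix l u :: complex
  assume "\<And>b. b \<in> Basis \<Longrightarrow> l \<bullet> b \<le> u \<bullet> b"
  from this[of 1] this[of \<i>] have le: "Re l \<le> Re u" "Im l \<le> Im u" by (simp_all add: Basis_complex_def)
  have m: "(\<lambda>(x, y). Complex x y) \<in> measurable (lborel \<Otimes>\<^sub>M lborel) borel"
  proof -
    have "(\<lambda>p :: real \<times> real. Complex (fst p) (snd p)) \<in> borel_measurable borel"
      by (intro borel_measurable_continuous_onI continuous_on_Complex continuous_intros)
    then show ?thesis by (simp add: lborel_prod case_prod_unfold)
  qed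
  have "(\<lambda>(x, y). Complex x y) -` box l u \<inter> space (lborel \<Otimes>\<^sub>M lborel) = {Re l<..<Re u} \<times> {Im l<..<Im u}"
    by (auto simp: in_box_complex_iff space_pair_measure)
  then have "emeasure (distr (lborel \<Otimes>\<^sub>M lborel) borel (\<lambda>(x, y). Complex x y)) (box l u)
      = emeasure (lborel \<Otimes>\<^sub>M lborel) ({Re l<..<Re u} \<times> {Im l<..<Im u})"
    by (subst emeasure_distr[OF m]) auto
  also have "\<dots> = ennreal (Re u - Re l) * ennreal (Im u - Im l)"
    using le by (subst lborel.emeasure_pair_measure_Times) auto
  also have "\<dots> = (\<Prod>b\<in>Basis. (u - l) \<bullet> b)"
    using le by (simp add: Basis_complex_def ennreal_mult)
  finally show "emeasure (distr (lborel \<Otimes>\<^sub>M lborel) borel (\<lambda>(x, y). Complex x y)) (box l u) = (\<Prod>b\<in>Basis. (u - l) \<bullet> b)" .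
qed simp

lemma measurable_Complex [measurable]: "(\<lambda>(x, y). Complex x y) \<in> measurable (lborel \<Otimes>\<^sub>M lborel) borel"
proof -
  have "(\<lambda>p :: real \<times> real. Complex (fst p) (snd p)) \<in> borel_measurable borel"
    by (intro borel_measurable_continuous_onI continuous_on_Complex continuous_intros)
  then show ?thesis by (simp add: lborel_prod case_prod_unfold)
qed

lemma nn_integral_complex_iterated:
  assumes F: "F \<in> borel_measurable borel"
  shows "(\<integral>\<^sup>+z. F z \<partial>lborel) = (\<integral>\<^sup>+x. \<integral>\<^sup>+y. F (Complex x y) \<partial>lborel \<partial>lborel)"
proof -
  have "(\<integral>\<^sup>+z. F z \<partial>lborel) = (\<integral>\<^sup>+p. F (case p of (x, y) \<Rightarrow> Complex x y) \<partial>(lborel \<Otimes>\<^sub>M lborel))"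
    by (subst lborel_complex_eq_pair) (rule nn_integral_distr[OF measurable_Complex], simp add: F)
  also have "\<dots> = (\<integral>\<^sup>+x. \<integral>\<^sup>+y. F (Complex x y) \<partial>lborel \<partial>lborel)"
    using lborel.nn_integral_fst[of "\<lambda>p. F (case p of (x, y) \<Rightarrow> Complex x y)" lborel]
      measurable_compose[OF measurable_Complex F] by simp
  finally show ?thesis .
qed

lemma AE_Im_nonzero: "AE z in lborel. Im z \<noteq> 0"
proof -
  have m: "{z. Im z = 0} \<in> sets borel" by (intro borel_closed closed_Collect_eq continuous_intros)
  have "emeasure lborel {z. Im z = 0} = (\<integral>\<^sup>+z. indicator {z. Im z = 0} z \<partial>lborel)" using m by simp
  also have "\<dots> = (\<integral>\<^sup>+x. \<integral>\<^sup>+y. indicator {z. Im z = 0} (Complex x y) \<partial>lborel \<partial>lborel)"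
    by (rule nn_integral_complex_iterated) (use m in simp)
  also have "\<dots> = (\<integral>\<^sup>+x. \<integral>\<^sup>+y. indicator {0 :: real} y \<partial>lborel \<partial>(lborel :: real measure))"
    by (intro nn_integral_cong) (simp add: indicator_def)
  also have "\<dots> = 0" by simp
  finally have "{z. Im z = 0} \<in> null_sets lborel" using m by (simp add: null_sets_def)
  then show ?thesis by (rule AE_I') auto
qed

lemma nn_integral_arc_measure:
  assumes F: "(\<lambda>t. F (cis t)) \<in> borel_measurable borel" "F \<in> borel_measurable arc_measure"
  shows "(\<integral>\<^sup>+\<xi>. F \<xi> \<partial>arc_measure) = (\<integral>\<^sup>+t\<in>{0<..<2 * pi}. F (cis t) \<partial>lborel) / ennreal (2 * pi)"
proof -
  have F': "F \<in> borel_measurable (restrict_space borel (sphere 0 1))"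
    using F(2) by (simp add: measurable_cong_sets[OF sets_arc_measure])
  have "(\<integral>\<^sup>+\<xi>. F \<xi> \<partial>arc_measure) = (\<integral>\<^sup>+t. F (cis t) \<partial>uniform_measure lborel {0..2 * pi})"
    unfolding arc_measure_def by (rule nn_integral_distr[OF measurable_cis_sphere]) (simp add: F')
  also have "\<dots> = (\<integral>\<^sup>+t\<in>{0..2 * pi}. F (cis t) \<partial>lborel) / emeasure lborel {0..2 * pi}"
    by (rule nn_integral_uniform_measure) (use F in auto)
  also have "(\<integral>\<^sup>+t\<in>{0..2 * pi}. F (cis t) \<partial>lborel) = (\<integral>\<^sup>+t\<in>{0<..<2 * pi}. F (cis t) \<partial>lborel)"
  proof (rule nn_integral_cong_AE)
    show "AE t in lborel. F (cis t) * indicator {0..2 * pi} t = F (cis t) * indicator {0<..<2 * pi} t"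
      using AE_lborel_singleton[of 0] AE_lborel_singleton[of "2 * pi"]
      by eventually_elim (auto simp: indicator_def)
  qed
  finally show ?thesis by simp
qed

text \<open>Onto the disk slit along a null set, the exponential turns polar coordinates into a
  holomorphic change of variables.\<close>

lemma exp_image_strip:
  "exp ` {w. Re w < 0 \<and> 0 < Im w \<and> Im w < 2 * pi} = {z. cmod z < 1 \<and> \<not> (z \<in> \<real> \<and> 0 \<le> Re z)}"
proof (intro equalityI subsetI)
  fix z assume "z \<in> exp ` {w. Re w < 0 \<and> 0 < Im w \<and> Im w < 2 * pi}"
  then obtain w where w: "z = exp w" "Re w < 0" "0 < Im w" "Im w < 2 * pi" by auto
  have "\<not> (z \<in> \<real> \<and> 0 \<le> Re z)"
  proof
    assume z: "z \<in> \<real> \<and> 0 \<le> Re z"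
    then have "z = of_real (cmod z)" by (metis Re_complex_of_real abs_of_nonneg norm_of_real Reals_cases)
    then have "exp w = exp (of_real (Re w))" using w(1) by (simp add: exp_of_real)
    then have "w = of_real (Re w)" by (rule exp_complex_eqI[rotated]) (use w(3,4) in simp)
    then show False using w(3) by (metis Im_complex_of_real less_irrefl)
  qed
  then show "z \<in> {z. cmod z < 1 \<and> \<not> (z \<in> \<real> \<and> 0 \<le> Re z)}" using w by simp
next
  fix z assume z: "z \<in> {z. cmod z < 1 \<and> \<not> (z \<in> \<real> \<and> 0 \<le> Re z)}"
  then have z0: "z \<noteq> 0" by auto
  have "Arg2pi z \<noteq> 0" using z Arg2pi_eq_0 by auto
  then have arg: "0 < Arg2pi z" "Arg2pi z < 2 * pi" using Arg2pi[of z] by auto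
  let ?w = "Complex (ln (cmod z)) (Arg2pi z)"
  have "exp ?w = of_real (exp (ln (cmod z))) * exp (\<i> * of_real (Arg2pi z))"
    by (simp add: Complex_eq exp_add exp_of_real)
  also have "\<dots> = z" using Arg2pi_eq[of z] z0 by simp
  finally have "z = exp ?w" by simp
  moreover have "ln (cmod z) < 0" using z z0 by simp
  ultimately show "z \<in> exp ` {w. Re w < 0 \<and> 0 < Im w \<and> Im w < 2 * pi}"
    using arg by (intro image_eqI[of _ _ ?w]) auto
qed

abbreviation area_measure :: "complex measure" where
  "area_measure \<equiv> uniform_measure lborel (ball 0 1)"

lemma emeasure_unit_disk: "emeasure lborel (ball 0 1 :: complex set) = ennreal pi"
proof -
  have "emeasure lborel (ball 0 1 :: complex set) \<noteq> \<infinity>" using emeasure_bounded_finite[of "ball 0 1 :: complex set"] by simp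
  then have "emeasure lborel (ball 0 1 :: complex set) = ennreal (measure lborel (ball 0 1 :: complex set))"
    by (simp add: emeasure_eq_ennreal_measure)
  then show ?thesis using content_ball[of 1 "0 :: complex"] by (simp add: unit_ball_vol_2)
qed

lemma ennreal_mult_divide_cancel: "c > 0 \<Longrightarrow> ennreal c * (X / ennreal c) = X"
  by (simp add: ennreal_times_divide mult.commute[of "ennreal c" X] mult_divide_eq_ennreal)

text \<open>The radius is written as \<open>exp (- t)\<close>. The factor 2 is \<open>2 * pi\<close>
  from the normalized arc length divided by \<open>pi\<close> from the normalized area, and
  \<open>exp (- 2 * t)\<close> is the Jacobian of the exponential.\<close>

theorem nn_integral_area_polar:
  assumes F [measurable]: "F \<in> borel_measurable borel"
  shows "(\<integral>\<^sup>+z. F z \<partial>area_measure)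
    = (\<integral>\<^sup>+t\<in>{0<..}. ennreal (2 * exp (- 2 * t)) * (\<integral>\<^sup>+\<xi>. F (of_real (exp (- t)) * \<xi>) \<partial>arc_measure) \<partial>lborel)"
proof -
  let ?S = "{w. Re w < 0 \<and> 0 < Im w \<and> Im w < 2 * pi}"
  have Sopen: "open ?S"
    by (intro open_Collect_conj open_Collect_less continuous_intros)
  have Sm [measurable]: "?S \<in> sets borel" using Sopen by simp
  have inj: "inj_on exp ?S"
  proof (rule inj_onI)
    fix v w assume "v \<in> ?S" "w \<in> ?S" and e: "exp v = exp w"
    then have "\<bar>Im v - Im w\<bar> < 2 * pi" by (simp add: abs_less_iff)
    then show "v = w" using e by (rule exp_complex_eqI)
  qed
  define J where "J x = (\<integral>\<^sup>+\<xi>. F (of_real (exp x) * \<xi>) \<partial>arc_measure)" for x :: real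
  have Jm [measurable]: "J \<in> borel_measurable borel"
  proof -
    have "(\<lambda>p. F (of_real (exp (fst p)) * snd p)) \<in> borel_measurable (borel \<Otimes>\<^sub>M arc_measure)"
    proof -
      have [measurable]: "(\<lambda>p. snd p) \<in> borel_measurable (borel \<Otimes>\<^sub>M arc_measure :: (real \<times> complex) measure)"
        using measurable_compose[OF measurable_snd measurable_arc_ident] .
      show ?thesis by measurable
    qed
    then have "case_prod (\<lambda>x \<xi>. F (of_real (exp x) * \<xi>)) \<in> borel_measurable (borel \<Otimes>\<^sub>M arc_measure)"
      by (simp add: case_prod_unfold)
    from arc.borel_measurable_nn_integral[OF this] show ?thesis by (simp add: J_def[abs_def])
  qed
  have "(\<integral>\<^sup>+z\<in>ball 0 1. F z \<partial>lborel) = (\<integral>\<^sup>+z\<in>exp ` ?S. F z \<partial>lborel)"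
  proof (rule nn_integral_cong_AE)
    show "AE z in lborel. F z * indicator (ball 0 1) z = F z * indicator (exp ` ?S) z"
      using AE_Im_nonzero by eventually_elim (auto simp: exp_image_strip indicator_def complex_is_Real_iff)
  qed
  also have "\<dots> = (\<integral>\<^sup>+w\<in>?S. F (exp w) * ennreal ((cmod (deriv exp w))\<^sup>2) \<partial>lborel)"
    by (rule nn_integral_holomorphic_image[OF Sopen _ inj F]) (rule holomorphic_on_exp)
  also have "\<dots> = (\<integral>\<^sup>+w. F (exp w) * ennreal (exp (2 * Re w)) * indicator ?S w \<partial>lborel)"
  proof -
    have "deriv exp w = exp w" for w :: complex by (rule DERIV_imp_deriv) (rule DERIV_exp)
    then show ?thesis by (simp add: exp_double)
  qed
  also have "\<dots> = (\<integral>\<^sup>+x. \<integral>\<^sup>+y. F (exp (Complex x y)) * ennreal (exp (2 * Re (Complex x y))) * indicator ?S (Complex x y) \<partial>lborel \<partial>lborel)"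
    by (rule nn_integral_complex_iterated) measurable
  also have "\<dots> = (\<integral>\<^sup>+x. ennreal (2 * pi * exp (2 * x)) * J x * indicator {..<0} x \<partial>lborel)"
  proof (intro nn_integral_cong)
    fix x :: real
    have Fm: "(\<lambda>t. F (of_real (exp x) * cis t)) \<in> borel_measurable borel"
      by (intro measurable_compose[OF _ F] borel_measurable_continuous_onI continuous_intros)
    have Fa: "(\<lambda>\<xi>. F (of_real (exp x) * \<xi>)) \<in> borel_measurable arc_measure" by measurable
    have "(\<integral>\<^sup>+y. F (exp (Complex x y)) * ennreal (exp (2 * Re (Complex x y))) * indicator ?S (Complex x y) \<partial>lborel)
        = (\<integral>\<^sup>+y. (ennreal (exp (2 * x)) * indicator {..<0} x) * (F (of_real (exp x) * cis y) * indicator {0<..<2 * pi} y) \<partial>lborel)"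
      by (intro nn_integral_cong) (auto simp: indicator_def exp_eq_polar mult_ac exp_of_real)
    also have "\<dots> = (ennreal (exp (2 * x)) * indicator {..<0} x) * (\<integral>\<^sup>+y. F (of_real (exp x) * cis y) * indicator {0<..<2 * pi} y \<partial>lborel)"
      by (rule nn_integral_cmult) (use Fm in measurable)
    also have "(\<integral>\<^sup>+y. F (of_real (exp x) * cis y) * indicator {0<..<2 * pi} y \<partial>lborel) = ennreal (2 * pi) * J x"
      unfolding J_def nn_integral_arc_measure[OF Fm Fa] by (rule ennreal_mult_divide_cancel[symmetric]) simp
    finally show "(\<integral>\<^sup>+y. F (exp (Complex x y)) * ennreal (exp (2 * Re (Complex x y))) * indicator ?S (Complex x y) \<partial>lborel)
        = ennreal (2 * pi * exp (2 * x)) * J x * indicator {..<0} x"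
      by (simp add: ennreal_mult mult_ac)
  qed
  also have "\<dots> = (\<integral>\<^sup>+t. ennreal (2 * pi * exp (- 2 * t)) * J (- t) * indicator {0<..} t \<partial>lborel)"
    by (subst nn_integral_real_affine[where c = "-1" and t = 0]) (auto simp: indicator_def intro!: nn_integral_cong)
  also have "\<dots> = (\<integral>\<^sup>+t. ennreal pi * (ennreal (2 * exp (- 2 * t)) * J (- t) * indicator {0<..} t) \<partial>lborel)"
    by (intro nn_integral_cong) (simp add: ennreal_mult mult_ac)
  also have "\<dots> = ennreal pi * (\<integral>\<^sup>+t\<in>{0<..}. ennreal (2 * exp (- 2 * t)) * J (- t) \<partial>lborel)"
    by (rule nn_integral_cmult) measurable
  finally have *: "(\<integral>\<^sup>+z\<in>ball 0 1. F z \<partial>lborel) = ennreal pi * (\<integral>\<^sup>+t\<in>{0<..}. ennreal (2 * exp (- 2 * t)) * J (- t) \<partial>lborel)" .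
  have "(\<integral>\<^sup>+z. F z \<partial>area_measure) = (\<integral>\<^sup>+z\<in>ball 0 1. F z \<partial>lborel) / ennreal pi"
    using nn_integral_uniform_measure[of F lborel "ball 0 1"] by (simp add: emeasure_unit_disk)
  also have "\<dots> = (\<integral>\<^sup>+t\<in>{0<..}. ennreal (2 * exp (- 2 * t)) * J (- t) \<partial>lborel)"
    unfolding * by (simp add: mult.commute[of "ennreal pi"] mult_divide_eq_ennreal)
  finally show ?thesis by (simp add: J_def)
qed

lemma Hol_disk_measurable:
  assumes "h \<in> Hol_disk" shows "h \<in> borel_measurable borel"
proof -
  have "(\<lambda>z. indicator (ball 0 1) z *\<^sub>R h z) \<in> borel_measurable borel"
    by (rule borel_measurable_continuous_on_indicator) (use assms in \<open>auto simp: Hol_disk_def intro: holomorphic_on_imp_continuous_on\<close>)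
  then show ?thesis
    by (rule measurable_cong[THEN iffD1, rotated]) (use assms in \<open>auto simp: Hol_disk_def indicator_def\<close>)
qed

text \<open>Under a radial weight different powers of \<open>z\<close> are orthogonal on each
  circle, so only squared coefficients remain. In the variable \<open>t\<close> each power of the
  radius is an exponential, and the two weights used below integrate in closed form.\<close>

theorem nn_integral_area_radial_weight:
  assumes h: "h \<in> Hol_disk" and W [measurable]: "W \<in> borel_measurable borel"
  shows "(\<integral>\<^sup>+z. ennreal ((cmod (h z))\<^sup>2) * W (cmod z) \<partial>area_measure)
    = (\<Sum>n. ennreal ((cmod (taylor_coeff h n))\<^sup>2) * (\<integral>\<^sup>+t\<in>{0<..}. ennreal (2 * exp (- (2 * real n + 2) * t)) * W (exp (- t)) \<partial>lborel))"
proof -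
  note [measurable] = Hol_disk_measurable[OF h]
  have hol: "h holomorphic_on ball 0 1" using h by (simp add: Hol_disk_def)
  have "(\<integral>\<^sup>+z. ennreal ((cmod (h z))\<^sup>2) * W (cmod z) \<partial>area_measure)
      = (\<integral>\<^sup>+t\<in>{0<..}. ennreal (2 * exp (- 2 * t)) * (\<integral>\<^sup>+\<xi>. ennreal ((cmod (h (of_real (exp (- t)) * \<xi>)))\<^sup>2) * W (cmod (of_real (exp (- t)) * \<xi>)) \<partial>arc_measure) \<partial>lborel)"
    by (rule nn_integral_area_polar) measurable
  also have "\<dots> = (\<integral>\<^sup>+t. (\<Sum>n. ennreal ((cmod (taylor_coeff h n))\<^sup>2) * (ennreal (2 * exp (- (2 * real n + 2) * t)) * W (exp (- t)) * indicator {0<..} t)) \<partial>lborel)"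
  proof (intro nn_integral_cong)
    fix t :: real
    show "ennreal (2 * exp (- 2 * t)) * (\<integral>\<^sup>+\<xi>. ennreal ((cmod (h (of_real (exp (- t)) * \<xi>)))\<^sup>2) * W (cmod (of_real (exp (- t)) * \<xi>)) \<partial>arc_measure) * indicator {0<..} t
      = (\<Sum>n. ennreal ((cmod (taylor_coeff h n))\<^sup>2) * (ennreal (2 * exp (- (2 * real n + 2) * t)) * W (exp (- t)) * indicator {0<..} t))"
    proof (cases "t > 0")
      case True
      let ?r = "exp (- t)"
      have r: "0 \<le> ?r" "?r < 1" using True by auto
      have "(\<integral>\<^sup>+\<xi>. ennreal ((cmod (h (of_real ?r * \<xi>)))\<^sup>2) * W (cmod (of_real ?r * \<xi>)) \<partial>arc_measure)
          = (\<integral>\<^sup>+\<xi>. W ?r * ennreal ((cmod (h (of_real ?r * \<xi>)))\<^sup>2) \<partial>arc_measure)"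
        by (intro nn_integral_cong) (simp add: norm_mult mult.commute)
      also have "\<dots> = W ?r * (\<integral>\<^sup>+\<xi>. ennreal ((cmod (h (of_real ?r * \<xi>)))\<^sup>2) \<partial>arc_measure)"
        by (rule nn_integral_cmult) measurable
      also have "(\<integral>\<^sup>+\<xi>. ennreal ((cmod (h (of_real ?r * \<xi>)))\<^sup>2) \<partial>arc_measure) = ennreal (\<integral>\<xi>. (cmod (h (of_real ?r * \<xi>)))\<^sup>2 \<partial>arc_measure)"
        by (rule nn_integral_eq_integral[OF integrable_arc_dilation(2)[OF hol r]]) simp
      also have "\<dots> = (\<Sum>n. ennreal ((cmod (taylor_coeff h n))\<^sup>2 * ?r ^ (2 * n)))"
        using disc_parseval[OF hol r] by (subst suminf_ennreal2) (auto simp: sums_iff)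
      finally have "ennreal (2 * exp (- 2 * t)) * (\<integral>\<^sup>+\<xi>. ennreal ((cmod (h (of_real ?r * \<xi>)))\<^sup>2) * W (cmod (of_real ?r * \<xi>)) \<partial>arc_measure)
          = (ennreal (2 * exp (- 2 * t)) * W ?r) * (\<Sum>n. ennreal ((cmod (taylor_coeff h n))\<^sup>2 * ?r ^ (2 * n)))"
        by (simp add: mult.assoc)
      also have "\<dots> = (\<Sum>n. (ennreal (2 * exp (- 2 * t)) * W ?r) * ennreal ((cmod (taylor_coeff h n))\<^sup>2 * ?r ^ (2 * n)))"
        by simp
      also have "\<dots> = (\<Sum>n. ennreal ((cmod (taylor_coeff h n))\<^sup>2) * (ennreal (2 * exp (- (2 * real n + 2) * t)) * W ?r))"
      proof (intro suminf_cong)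
        fix n
        have "exp (- (2 * real n + 2) * t) = exp (- 2 * t) * ?r ^ (2 * n)"
          by (simp add: exp_of_nat_mult[symmetric] exp_add[symmetric] algebra_simps)
        then show "(ennreal (2 * exp (- 2 * t)) * W ?r) * ennreal ((cmod (taylor_coeff h n))\<^sup>2 * ?r ^ (2 * n))
          = ennreal ((cmod (taylor_coeff h n))\<^sup>2) * (ennreal (2 * exp (- (2 * real n + 2) * t)) * W ?r)"
          by (simp add: ennreal_mult mult_ac)
      qed
      finally show ?thesis using True by simp
    qed simp
  qed
  also have "\<dots> = (\<Sum>n. \<integral>\<^sup>+t. ennreal ((cmod (taylor_coeff h n))\<^sup>2) * (ennreal (2 * exp (- (2 * real n + 2) * t)) * W (exp (- t)) * indicator {0<..} t) \<partial>lborel)"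
    by (rule nn_integral_suminf) measurable
  also have "\<dots> = (\<Sum>n. ennreal ((cmod (taylor_coeff h n))\<^sup>2) * (\<integral>\<^sup>+t\<in>{0<..}. ennreal (2 * exp (- (2 * real n + 2) * t)) * W (exp (- t)) \<partial>lborel))"
    by (intro suminf_cong nn_integral_cmult) measurable
  finally show ?thesis .
qed

lemma nn_integral_half_line:
  "(\<integral>\<^sup>+t\<in>{0<..}. f t \<partial>lborel) = (\<integral>\<^sup>+t\<in>{0..}. f t \<partial>(lborel :: real measure))"
proof (rule nn_integral_cong_AE)
  show "AE t in lborel. f t * indicator {0<..} t = f t * indicator {0..} t"
    using AE_lborel_singleton[of 0] by eventually_elim (auto simp: indicator_def)
qed

theorem nn_integral_area_boundary_weight:
  assumes h: "h \<in> Hol_disk"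
  shows "(\<integral>\<^sup>+z. ennreal ((cmod (h z))\<^sup>2) * ennreal (1 - (cmod z)\<^sup>2) \<partial>area_measure)
    = (\<Sum>n. ennreal ((cmod (taylor_coeff h n))\<^sup>2 / ((real n + 1) * (real n + 2))))"
proof -
  have int: "(\<integral>\<^sup>+t\<in>{0<..}. ennreal (2 * exp (- (2 * real n + 2) * t)) * ennreal (1 - (exp (- t))\<^sup>2) \<partial>lborel)
      = ennreal (1 / ((real n + 1) * (real n + 2)))" for n
  proof -
    let ?a = "2 * real n + 2"
    \<comment> \<open>An antiderivative that vanishes at infinity; its value at 0 produces the
      difference \<open>1 / (n + 1) - 1 / (n + 2)\<close>.\<close>
    let ?F = "\<lambda>t. - 2 * exp (- ?a * t) / ?a + 2 * exp (- (?a + 2) * t) / (?a + 2)"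
    have "(\<integral>\<^sup>+t\<in>{0<..}. ennreal (2 * exp (- ?a * t)) * ennreal (1 - (exp (- t))\<^sup>2) \<partial>lborel)
        = (\<integral>\<^sup>+t\<in>{0..}. ennreal (2 * exp (- ?a * t) - 2 * exp (- (?a + 2) * t)) \<partial>lborel)"
      unfolding nn_integral_half_line
    proof (intro nn_integral_cong)
      fix t :: real
      have "2 * exp (- ?a * t) * (1 - (exp (- t))\<^sup>2) = 2 * exp (- ?a * t) - 2 * exp (- (?a + 2) * t)"
      proof -
        have "exp (- (?a + 2) * t) = exp (- ?a * t) * (exp (- t))\<^sup>2"
          by (simp add: exp_double[symmetric] exp_add[symmetric] algebra_simps)
        then show ?thesis by (simp add: algebra_simps)
      qed
      then show "ennreal (2 * exp (- ?a * t)) * ennreal (1 - (exp (- t))\<^sup>2) * indicator {0..} t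
        = ennreal (2 * exp (- ?a * t) - 2 * exp (- (?a + 2) * t)) * indicator {0..} t"
        by (simp add: ennreal_mult'[symmetric])
    qed
    also have "\<dots> = ennreal (0 - ?F 0)"
    proof (rule nn_integral_FTC_atLeast)
      fix t :: real assume t: "0 \<le> t"
      have "((\<lambda>t. - 2 * exp (- a * t) / a + 2 * exp (- c * t) / c) has_real_derivative 2 * exp (- a * t) - 2 * exp (- c * t)) (at t)"
        if "a > 0" "c > 0" for a c :: real
        using that by (auto intro!: derivative_eq_intros)
      from this[of ?a "?a + 2"]
      show "(?F has_real_derivative 2 * exp (- ?a * t) - 2 * exp (- (?a + 2) * t)) (at t)" by simp
      have "exp (- (?a + 2) * t) \<le> exp (- ?a * t)" using t by (simp add: mult_right_mono)
      then show "0 \<le> 2 * exp (- ?a * t) - 2 * exp (- (?a + 2) * t)" by simp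
    next
      have lim: "((\<lambda>t. exp (- c * t)) \<longlongrightarrow> 0) at_top" if "c > 0" for c :: real
        using that by real_asymp
      have "(?F \<longlongrightarrow> - 2 * 0 / ?a + 2 * 0 / (?a + 2)) at_top"
        by (intro tendsto_intros lim) auto
      then show "(?F \<longlongrightarrow> 0) at_top" by simp
    qed measurable
    also have "0 - ?F 0 = 1 / ((real n + 1) * (real n + 2))"
    proof -
      have "2 / ?a = 1 / (real n + 1)" "2 / (?a + 2) = 1 / (real n + 2)" by (simp_all add: frac_eq_eq)
      then have "0 - ?F 0 = 1 / (real n + 1) - 1 / (real n + 2)" by simp
      also have "\<dots> = 1 / ((real n + 1) * (real n + 2))" by (simp add: divide_simps)
      finally show ?thesis .
    qed
    finally show ?thesis .
  qed
  have "(\<integral>\<^sup>+z. ennreal ((cmod (h z))\<^sup>2) * ennreal (1 - (cmod z)\<^sup>2) \<partial>area_measure)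
    = (\<Sum>n. ennreal ((cmod (taylor_coeff h n))\<^sup>2) * ennreal (1 / ((real n + 1) * (real n + 2))))"
    unfolding int[symmetric] by (rule nn_integral_area_radial_weight[OF h, of "\<lambda>r. ennreal (1 - r\<^sup>2)"]) measurable
  also have "\<dots> = (\<Sum>n. ennreal ((cmod (taylor_coeff h n))\<^sup>2 / ((real n + 1) * (real n + 2))))"
    by (intro suminf_cong) (simp add: ennreal_mult[symmetric])
  finally show ?thesis .
qed

theorem nn_integral_area_log_weight:
  assumes h: "h \<in> Hol_disk"
  shows "(\<integral>\<^sup>+z. ennreal ((cmod (h z))\<^sup>2) * ennreal (ln (1 / cmod z)) \<partial>area_measure)
    = (\<Sum>n. ennreal ((cmod (taylor_coeff h n))\<^sup>2 / (2 * (real n + 1)\<^sup>2)))"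
proof -
  have int: "(\<integral>\<^sup>+t\<in>{0<..}. ennreal (2 * exp (- (2 * real n + 2) * t)) * ennreal (ln (1 / exp (- t))) \<partial>lborel)
      = ennreal (1 / (2 * (real n + 1)\<^sup>2))" for n
  proof -
    let ?a = "2 * real n + 2"
    let ?F = "\<lambda>t. - 2 * (t / ?a + 1 / ?a\<^sup>2) * exp (- ?a * t)"
    have "(\<integral>\<^sup>+t\<in>{0<..}. ennreal (2 * exp (- ?a * t)) * ennreal (ln (1 / exp (- t))) \<partial>lborel)
        = (\<integral>\<^sup>+t\<in>{0..}. ennreal (2 * t * exp (- ?a * t)) \<partial>lborel)"
      unfolding nn_integral_half_line
    proof (intro nn_integral_cong)
      fix t :: real
      \<comment> \<open>In the variable \<open>t\<close> the logarithmic weight is \<open>t\<close>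
        itself.\<close>
      have e: "ln (1 / exp (- t)) = t" by (simp add: ln_div)
      show "ennreal (2 * exp (- ?a * t)) * ennreal (ln (1 / exp (- t))) * indicator {0..} t = ennreal (2 * t * exp (- ?a * t)) * indicator {0..} t"
        unfolding e by (auto simp: indicator_def ennreal_mult'[symmetric] mult_ac)
    qed
    also have "\<dots> = ennreal (0 - ?F 0)"
    proof (rule nn_integral_FTC_atLeast)
      fix t :: real assume t: "0 \<le> t"
      have "((\<lambda>t. - 2 * (t / a + 1 / a\<^sup>2) * exp (- a * t)) has_real_derivative 2 * t * exp (- a * t)) (at t)"
        if "a > 0" for a :: real
        using that by (auto intro!: derivative_eq_intros simp: field_simps power2_eq_square)
      from this[of ?a]
      show "(?F has_real_derivative 2 * t * exp (- ?a * t)) (at t)" by simp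
      show "0 \<le> 2 * t * exp (- ?a * t)" using t by simp
    next
      have "((\<lambda>t. - 2 * (t / a + 1 / a\<^sup>2) * exp (- a * t)) \<longlongrightarrow> 0) at_top" if "a > 0" for a :: real
        using that by real_asymp
      from this[of ?a] show "(?F \<longlongrightarrow> 0) at_top" by simp
    qed measurable
    also have "0 - ?F 0 = 1 / (2 * (real n + 1)\<^sup>2)"
    proof -
      have "?a\<^sup>2 = 4 * (real n + 1)\<^sup>2" by (simp add: power2_eq_square algebra_simps)
      then have "2 / ?a\<^sup>2 = 1 / (2 * (real n + 1)\<^sup>2)" by simp
      then show ?thesis by simp
    qed
    finally show ?thesis .
  qed
  have "(\<integral>\<^sup>+z. ennreal ((cmod (h z))\<^sup>2) * ennreal (ln (1 / cmod z)) \<partial>area_measure)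
    = (\<Sum>n. ennreal ((cmod (taylor_coeff h n))\<^sup>2) * ennreal (1 / (2 * (real n + 1)\<^sup>2)))"
    unfolding int[symmetric] by (rule nn_integral_area_radial_weight[OF h, of "\<lambda>r. ennreal (ln (1 / r))"]) measurable
  also have "\<dots> = (\<Sum>n. ennreal ((cmod (taylor_coeff h n))\<^sup>2 / (2 * (real n + 1)\<^sup>2)))"
    by (intro suminf_cong) (simp add: ennreal_mult[symmetric])
  finally show ?thesis .
qed

subsection \<open>Local Dirichlet integrals at boundary points\<close>

text \<open>
  The recursion in the assumptions below is the coefficient form of \<open>F' = (z - 1) h\<close> with
  \<open>F = const + (z - 1) g\<close>; the partial sums telescope.
\<close>

lemma telescoping_identity:
  fixes \<gamma> \<eta> :: "nat \<Rightarrow> complex"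
  assumes "\<eta> 0 = \<gamma> 1 - \<gamma> 0"
    and "\<And>n. of_nat (n + 2) * (\<gamma> (n + 1) - \<gamma> (n + 2)) = \<eta> n - \<eta> (n + 1)"
  defines "\<Gamma> \<equiv> \<lambda>n. \<Sum>k\<le>n. \<gamma> k"
  shows "\<eta> n = of_nat (n + 1) * \<gamma> (n + 1) - \<Gamma> n"
    and "(\<Sum>n<N. (cmod (\<eta> n))\<^sup>2 / ((real n + 1) * (real n + 2)))
       = (\<Sum>n\<le>N. (cmod (\<gamma> n))\<^sup>2) - (cmod (\<Gamma> N))\<^sup>2 / (real N + 1)"
proof -
  show \<eta>: "\<eta> n = of_nat (n + 1) * \<gamma> (n + 1) - \<Gamma> n" for n
  proof (induction n)
    case 0
    then show ?case using assms(1) by (simp add: \<Gamma>_def)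
  next
    case (Suc n)
    have "\<eta> (Suc n) = \<eta> n - of_nat (n + 2) * (\<gamma> (n + 1) - \<gamma> (n + 2))"
      using assms(2)[of n] by simp
    then show ?case unfolding Suc by (simp add: \<Gamma>_def algebra_simps)
  qed
  \<comment> \<open>With \<open>p = n + 1\<close>, \<open>g = \<gamma> (n + 1)\<close> and
    \<open>G = \<Gamma> n\<close>, this rewrites one summand as a squared modulus of
    \<open>\<gamma>\<close> plus a telescoping difference.\<close>
  have step: "(cmod (of_real p * g - G))\<^sup>2 / (p * (p + 1)) = (cmod g)\<^sup>2 + (cmod G)\<^sup>2 / p - (cmod (G + g))\<^sup>2 / (p + 1)"
    if "p > 0" for p :: real and g G :: complex
  proof -
    have "(cmod (of_real p * g - G))\<^sup>2 = p * (p + 1) * (cmod g)\<^sup>2 + (p + 1) * (cmod G)\<^sup>2 - p * (cmod (G + g))\<^sup>2"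
      unfolding cmod_power2 by (simp add: power2_eq_square algebra_simps)
    then show ?thesis using that by (simp add: field_simps)
  qed
  show "(\<Sum>n<N. (cmod (\<eta> n))\<^sup>2 / ((real n + 1) * (real n + 2)))
       = (\<Sum>n\<le>N. (cmod (\<gamma> n))\<^sup>2) - (cmod (\<Gamma> N))\<^sup>2 / (real N + 1)"
  proof (induction N)
    case 0
    then show ?case by (simp add: \<Gamma>_def)
  next
    case (Suc N)
    have "(cmod (\<eta> N))\<^sup>2 / ((real N + 1) * (real N + 2))
        = (cmod (\<gamma> (N + 1)))\<^sup>2 + (cmod (\<Gamma> N))\<^sup>2 / (real N + 1) - (cmod (\<Gamma> (N + 1)))\<^sup>2 / (real N + 2)"
      using step[of "real N + 1" "\<gamma> (N + 1)" "\<Gamma> N"] by (simp add: \<eta> \<Gamma>_def add.commute add.left_commute)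
    then show ?case using Suc by (simp add: add.commute)
  qed
qed

lemma norm_of_nat_plus_1: "cmod (of_nat (N + 1)) = real N + 1"
  by (subst norm_of_nat) simp

lemma norm_of_nat_prod: "cmod (of_nat ((n + 1) * (n + 2))) = (real n + 1) * (real n + 2)"
  by (subst norm_of_nat, subst of_nat_mult) (simp add: add.commute)

text \<open>The telescoped sum leaves the boundary term
  \<open>(cmod (\<Gamma> N))^2 / (N + 1)\<close>, which is governed by the means of
  \<open>\<gamma>\<close>. Consecutive means differ by
  \<open>\<eta> n / ((n + 1) * (n + 2))\<close>, so Cauchy-Schwarz against the telescoping series of
  \<open>1 / ((n + 1) * (n + 2))\<close> gives convergence, with a rate just good enough for that
  term once \<open>l\<close> is subtracted.\<close>

lemma means_convergence:
  fixes \<gamma> \<eta> :: "nat \<Rightarrow> complex"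
  assumes rec: "\<eta> 0 = \<gamma> 1 - \<gamma> 0"
    "\<And>n. of_nat (n + 2) * (\<gamma> (n + 1) - \<gamma> (n + 2)) = \<eta> n - \<eta> (n + 1)"
    and summ: "summable (\<lambda>n. (cmod (\<eta> n))\<^sup>2 / ((real n + 1) * (real n + 2)))"
  obtains l where "(\<lambda>N. (\<Sum>k\<le>N. \<gamma> k) / of_nat (N + 1)) \<longlonglongrightarrow> l"
    "(\<lambda>N. (real N + 1) * (cmod ((\<Sum>k\<le>N. \<gamma> k) / of_nat (N + 1) - l))\<^sup>2) \<longlonglongrightarrow> 0"
proof -
  define \<Gamma> where "\<Gamma> N = (\<Sum>k\<le>N. \<gamma> k)" for N
  define m where "m N = \<Gamma> N / of_nat (N + 1)" for N
  define q where "q n = (cmod (\<eta> n))\<^sup>2 / ((real n + 1) * (real n + 2))" for n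
  define Q where "Q N = (\<Sum>n<N. q n)" for N
  have eta: "\<eta> n = of_nat (n + 1) * \<gamma> (n + 1) - \<Gamma> n" for n
    using telescoping_identity(1)[of \<eta> \<gamma>, OF rec] by (simp add: \<Gamma>_def)
  have diff: "m (n + 1) - m n = \<eta> n / of_nat ((n + 1) * (n + 2))" for n
  proof -
    have "(of_nat n + 1 :: complex) \<noteq> 0" "(of_nat n + 2 :: complex) \<noteq> 0"
      by (metis of_nat_Suc of_nat_neq_0 add.commute) (metis of_nat_Suc of_nat_neq_0 add_2_eq_Suc' of_nat_add of_nat_numeral)
    then show ?thesis unfolding m_def eta by (simp add: \<Gamma>_def field_simps)
  qed
  have tele: "(\<Sum>n=N..<M. 1 / ((real n + 1) * (real n + 2))) \<le> 1 / (real N + 1)" if "N \<le> M" for N M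
  proof -
    have "(\<Sum>n=N..<M. 1 / ((real n + 1) * (real n + 2))) = 1 / (real N + 1) - 1 / (real M + 1)" using that
    proof (induction M rule: dec_induct)
      case (step k)
      have "1 / ((real k + 1) * (real k + 2)) = 1 / (real k + 1) - 1 / (real k + 2)" by (simp add: divide_simps)
      with step show ?case by (simp add: add.commute)
    qed simp
    then show ?thesis by simp
  qed
  have est: "(cmod (m M - m N))\<^sup>2 \<le> (Q M - Q N) / (real N + 1)" if "N \<le> M" for N M
  proof -
    have "m M - m N = (\<Sum>n=N..<M. m (n + 1) - m n)" using sum_Suc_diff'[OF that, of m] by simp
    also have "cmod \<dots> \<le> (\<Sum>n=N..<M. cmod (\<eta> n) / ((real n + 1) * (real n + 2)))"
      unfolding diff by (rule sum_norm_le) (simp only: norm_divide norm_of_nat_prod order_refl)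
    finally have "(cmod (m M - m N))\<^sup>2 \<le> (\<Sum>n=N..<M. cmod (\<eta> n) / ((real n + 1) * (real n + 2)))\<^sup>2"
      by (intro power_mono) auto
    also have "(\<Sum>n=N..<M. cmod (\<eta> n) / ((real n + 1) * (real n + 2)))
        = (\<Sum>n=N..<M. (cmod (\<eta> n) / sqrt ((real n + 1) * (real n + 2))) * (1 / sqrt ((real n + 1) * (real n + 2))))"
      by (intro sum.cong refl) (simp add: real_sqrt_mult_self)
    also have "\<dots>\<^sup>2 \<le> (\<Sum>n=N..<M. (cmod (\<eta> n) / sqrt ((real n + 1) * (real n + 2)))\<^sup>2) * (\<Sum>n=N..<M. (1 / sqrt ((real n + 1) * (real n + 2)))\<^sup>2)"
      by (rule Cauchy_Schwarz_ineq_sum)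
    also have "\<dots> = (\<Sum>n=N..<M. q n) * (\<Sum>n=N..<M. 1 / ((real n + 1) * (real n + 2)))"
      by (simp add: q_def power_divide)
    also have "\<dots> \<le> (\<Sum>n=N..<M. q n) * (1 / (real N + 1))"
      by (intro mult_left_mono tele that sum_nonneg) (simp add: q_def)
    also have "(\<Sum>n=N..<M. q n) = Q M - Q N"
      unfolding Q_def using that sum_diff_nat_ivl[of 0 N M q] by (simp add: lessThan_atLeast0)
    finally show ?thesis by simp
  qed
  have Qlim: "Q \<longlonglongrightarrow> suminf q" using summable_LIMSEQ[OF summ] by (simp add: Q_def[abs_def] q_def[abs_def])
  have Qle: "Q N \<le> suminf q" for N
    unfolding Q_def using summ by (intro sum_le_suminf) (auto simp: q_def[abs_def])
  have Q0: "0 \<le> Q N" for N unfolding Q_def by (rule sum_nonneg) (simp add: q_def)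
  have "Cauchy m"
  proof (rule metric_CauchyI)
    fix e :: real assume e: "e > 0"
    \<comment> \<open>The added 1 keeps the divisor positive even if all \<open>\<eta> n\<close>
      vanish.\<close>
    define s where "s = suminf q + 1"
    have s: "s > 0" using Q0[of 0] Qle[of 0] by (simp add: s_def)
    obtain K where K: "inverse (real (Suc K)) < (e / 2)\<^sup>2 / s"
      using reals_Archimedean[of "(e / 2)\<^sup>2 / s"] e s by auto
    have half: "cmod (m M - m K) < e / 2" if "M \<ge> K" for M
    proof -
      have "(cmod (m M - m K))\<^sup>2 \<le> (Q M - Q K) / (real K + 1)" by (rule est[OF that])
      also have "\<dots> \<le> s / (real K + 1)"
        using Qle[of M] Q0[of K] by (intro divide_right_mono) (auto simp: s_def)
      also have "\<dots> = s * inverse (real (Suc K))" by (simp add: divide_inverse add.commute)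
      also have "\<dots> < s * ((e / 2)\<^sup>2 / s)" by (rule mult_strict_left_mono[OF K s])
      also have "\<dots> = (e / 2)\<^sup>2" using s by simp
      finally show ?thesis by (rule power2_less_imp_less) (use e in simp)
    qed
    have "dist (m i) (m j) < e" if "i \<ge> K" "j \<ge> K" for i j
      using half[OF that(1)] half[OF that(2)] dist_triangle2[of "m i" "m j" "m K"] by (simp add: dist_norm)
    then show "\<exists>M. \<forall>i\<ge>M. \<forall>j\<ge>M. dist (m i) (m j) < e" by blast
  qed
  then obtain l where l: "m \<longlonglongrightarrow> l" using Cauchy_convergent convergent_def by blast
  have bd: "(real N + 1) * (cmod (m N - l))\<^sup>2 \<le> suminf q - Q N" for N
  proof -
    have "(\<lambda>M. (cmod (m M - m N))\<^sup>2) \<longlonglongrightarrow> (cmod (l - m N))\<^sup>2" by (intro tendsto_intros l)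
    moreover have "(cmod (m M - m N))\<^sup>2 \<le> (suminf q - Q N) / (real N + 1)" if "M \<ge> N" for M
      using est[OF that] Qle[of M] by (meson diff_right_mono divide_right_mono order_trans of_nat_0_le_iff add_nonneg_nonneg zero_le_one)
    ultimately have "(cmod (l - m N))\<^sup>2 \<le> (suminf q - Q N) / (real N + 1)"
      by (intro LIMSEQ_le_const2[where X = "\<lambda>M. (cmod (m M - m N))\<^sup>2"]) auto
    then show ?thesis by (simp add: norm_minus_commute field_simps)
  qed
  have "(\<lambda>N. (real N + 1) * (cmod (m N - l))\<^sup>2) \<longlonglongrightarrow> 0"
  proof (rule tendsto_sandwich[OF _ _ tendsto_const])
    show "(\<lambda>N. suminf q - Q N) \<longlonglongrightarrow> 0" using tendsto_diff[OF tendsto_const Qlim, of "suminf q"] by simp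
  qed (use bd in auto)
  then show ?thesis using l that by (simp add: m_def[abs_def] \<Gamma>_def[abs_def])
qed

text \<open>For square summable \<open>\<gamma>\<close> the means tend to 0 by Cauchy-Schwarz. Hence
  \<open>l = 0\<close>, and the second conclusion of \<open>means_convergence\<close> says precisely
  that the boundary term vanishes in the limit.\<close>

lemma telescoping_sum:
  fixes \<gamma> \<eta> :: "nat \<Rightarrow> complex"
  assumes rec: "\<eta> 0 = \<gamma> 1 - \<gamma> 0"
    "\<And>n. of_nat (n + 2) * (\<gamma> (n + 1) - \<gamma> (n + 2)) = \<eta> n - \<eta> (n + 1)"
    and summ: "summable (\<lambda>n. (cmod (\<gamma> n))\<^sup>2)"
  shows "(\<lambda>n. (cmod (\<eta> n))\<^sup>2 / ((real n + 1) * (real n + 2))) sums (\<Sum>n. (cmod (\<gamma> n))\<^sup>2)"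
proof -
  define s where "s = (\<Sum>n. (cmod (\<gamma> n))\<^sup>2)"
  note tel = telescoping_identity(2)[of \<eta> \<gamma>, OF rec]
  have part: "(\<Sum>n\<le>N. (cmod (\<gamma> n))\<^sup>2) \<le> s" for N
    unfolding s_def by (intro sum_le_suminf summ) auto
  have s\<eta>: "summable (\<lambda>n. (cmod (\<eta> n))\<^sup>2 / ((real n + 1) * (real n + 2)))"
  proof (rule summableI_nonneg_bounded[of _ s])
    fix N
    have "0 \<le> (cmod (\<Sum>k\<le>N. \<gamma> k))\<^sup>2 / (real N + 1)" by simp
    then show "(\<Sum>n<N. (cmod (\<eta> n))\<^sup>2 / ((real n + 1) * (real n + 2))) \<le> s"
      unfolding tel using part[of N] by linarith
  qed simp
  obtain l where l: "(\<lambda>N. (\<Sum>k\<le>N. \<gamma> k) / of_nat (N + 1)) \<longlonglongrightarrow> l"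
    "(\<lambda>N. (real N + 1) * (cmod ((\<Sum>k\<le>N. \<gamma> k) / of_nat (N + 1) - l))\<^sup>2) \<longlonglongrightarrow> 0"
    using means_convergence[OF rec s\<eta>] by blast
  have "l = 0"
  proof -
    have le: "(cmod ((\<Sum>k\<le>N. \<gamma> k) / of_nat (N + 1)))\<^sup>2 \<le> s * inverse (real (Suc N))" for N
    proof -
      have "(cmod (\<Sum>k\<le>N. \<gamma> k))\<^sup>2 \<le> (\<Sum>k\<le>N. cmod (\<gamma> k) * 1)\<^sup>2"
        by (intro power_mono) (auto intro: sum_norm_le)
      also have "\<dots> \<le> (\<Sum>k\<le>N. (cmod (\<gamma> k))\<^sup>2) * (\<Sum>k\<le>N. 1\<^sup>2)" by (rule Cauchy_Schwarz_ineq_sum)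
      also have "\<dots> \<le> s * (real N + 1)" using part[of N] by (simp add: mult_right_mono add.commute)
      finally have "(cmod (\<Sum>k\<le>N. \<gamma> k))\<^sup>2 / (real N + 1)\<^sup>2 \<le> s * (real N + 1) / (real N + 1)\<^sup>2"
        by (rule divide_right_mono) simp
      also have "\<dots> = s * inverse (real (Suc N))" by (simp add: power2_eq_square divide_inverse add.commute)
      finally show ?thesis by (simp only: norm_divide power_divide norm_of_nat_plus_1)
    qed
    have "(\<lambda>N. (cmod ((\<Sum>k\<le>N. \<gamma> k) / of_nat (N + 1)))\<^sup>2) \<longlonglongrightarrow> 0"
    proof (rule tendsto_sandwich[OF _ _ tendsto_const])
      show "(\<lambda>N. s * inverse (real (Suc N))) \<longlonglongrightarrow> 0"
        using tendsto_mult[OF tendsto_const LIMSEQ_inverse_real_of_nat, of s] by simp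
    qed (use le in auto)
    moreover have "(\<lambda>N. (cmod ((\<Sum>k\<le>N. \<gamma> k) / of_nat (N + 1)))\<^sup>2) \<longlonglongrightarrow> (cmod l)\<^sup>2"
      by (intro tendsto_intros l)
    ultimately have "(cmod l)\<^sup>2 = 0" using LIMSEQ_unique by blast
    then show ?thesis by simp
  qed
  have A: "(\<lambda>N. (cmod (\<Sum>k\<le>N. \<gamma> k))\<^sup>2 / (real N + 1)) \<longlonglongrightarrow> 0"
  proof -
    have "(real N + 1) * (cmod ((\<Sum>k\<le>N. \<gamma> k) / of_nat (N + 1) - l))\<^sup>2 = (cmod (\<Sum>k\<le>N. \<gamma> k))\<^sup>2 / (real N + 1)" for N
    proof -
      have "cmod (of_nat (N + 1)) = real N + 1" by (rule norm_of_nat_plus_1)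
      then have "(cmod ((\<Sum>k\<le>N. \<gamma> k) / of_nat (N + 1) - l))\<^sup>2 = (cmod (\<Sum>k\<le>N. \<gamma> k))\<^sup>2 / (real N + 1)\<^sup>2"
        by (simp only: \<open>l = 0\<close> diff_0_right norm_divide power_divide)
      then show ?thesis by (simp add: power2_eq_square)
    qed
    then show ?thesis using l(2) by simp
  qed
  have "(\<lambda>N. \<Sum>n\<le>N. (cmod (\<gamma> n))\<^sup>2) \<longlonglongrightarrow> s"
    unfolding s_def using summable_LIMSEQ'[OF summ] .
  from tendsto_diff[OF this A] show ?thesis unfolding sums_def tel s_def by simp
qed

text \<open>The recursion is invariant under adding a constant to \<open>\<gamma>\<close>.
  Subtracting the limit of the means is the normalization that bounds the boundary term, and with it
  the partial sums of squares.\<close>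

lemma telescoping_solution:
  fixes \<gamma> \<eta> :: "nat \<Rightarrow> complex"
  assumes rec: "\<eta> 0 = \<gamma> 1 - \<gamma> 0"
    "\<And>n. of_nat (n + 2) * (\<gamma> (n + 1) - \<gamma> (n + 2)) = \<eta> n - \<eta> (n + 1)"
    and summ: "summable (\<lambda>n. (cmod (\<eta> n))\<^sup>2 / ((real n + 1) * (real n + 2)))"
  obtains l where "summable (\<lambda>n. (cmod (\<gamma> n - l))\<^sup>2)"
proof -
  obtain l where l: "(\<lambda>N. (\<Sum>k\<le>N. \<gamma> k) / of_nat (N + 1)) \<longlonglongrightarrow> l"
    "(\<lambda>N. (real N + 1) * (cmod ((\<Sum>k\<le>N. \<gamma> k) / of_nat (N + 1) - l))\<^sup>2) \<longlonglongrightarrow> 0"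
    using means_convergence[OF rec summ] by blast
  define \<gamma>' where "\<gamma>' n = \<gamma> n - l" for n
  have rec': "\<eta> 0 = \<gamma>' 1 - \<gamma>' 0" "\<And>n. of_nat (n + 2) * (\<gamma>' (n + 1) - \<gamma>' (n + 2)) = \<eta> n - \<eta> (n + 1)"
    using rec by (simp_all add: \<gamma>'_def)
  note tel = telescoping_identity(2)[of \<eta> \<gamma>', OF rec']
  have A: "(cmod (\<Sum>k\<le>N. \<gamma>' k))\<^sup>2 / (real N + 1) = (real N + 1) * (cmod ((\<Sum>k\<le>N. \<gamma> k) / of_nat (N + 1) - l))\<^sup>2" for N
  proof -
    have ne: "(of_nat (N + 1) :: complex) \<noteq> 0" by (metis of_nat_neq_0 Suc_eq_plus1)
    have "(\<Sum>k\<le>N. \<gamma>' k) = of_nat (N + 1) * ((\<Sum>k\<le>N. \<gamma> k) / of_nat (N + 1) - l)"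
      using ne by (simp add: \<gamma>'_def sum_subtractf field_simps)
    moreover have "cmod (of_nat (N + 1)) = real N + 1" by (rule norm_of_nat_plus_1)
    ultimately have "(cmod (\<Sum>k\<le>N. \<gamma>' k))\<^sup>2 = (real N + 1)\<^sup>2 * (cmod ((\<Sum>k\<le>N. \<gamma> k) / of_nat (N + 1) - l))\<^sup>2"
      by (simp only: norm_mult power_mult_distrib)
    then show ?thesis by (simp add: power2_eq_square)
  qed
  have "Bseq (\<lambda>N. (real N + 1) * (cmod ((\<Sum>k\<le>N. \<gamma> k) / of_nat (N + 1) - l))\<^sup>2)"
    by (rule convergent_imp_Bseq) (use l(2) convergentI in blast)
  then obtain B where B: "\<And>N. (cmod (\<Sum>k\<le>N. \<gamma>' k))\<^sup>2 / (real N + 1) \<le> B"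
    unfolding Bseq_def A by (metis abs_le_iff real_norm_def)
  have "summable (\<lambda>n. (cmod (\<gamma>' n))\<^sup>2)"
  proof (rule summableI_nonneg_bounded)
    fix N
    have "(\<Sum>n<N. (cmod (\<gamma>' n))\<^sup>2) \<le> (\<Sum>n\<le>N. (cmod (\<gamma>' n))\<^sup>2)" by (intro sum_mono2) auto
    also have "\<dots> = (\<Sum>n<N. (cmod (\<eta> n))\<^sup>2 / ((real n + 1) * (real n + 2))) + (cmod (\<Sum>k\<le>N. \<gamma>' k))\<^sup>2 / (real N + 1)"
      using tel[of N] by simp
    also have "\<dots> \<le> (\<Sum>n. (cmod (\<eta> n))\<^sup>2 / ((real n + 1) * (real n + 2))) + B"
      by (intro add_mono B sum_le_suminf summ) auto
    finally show "(\<Sum>n<N. (cmod (\<gamma>' n))\<^sup>2) \<le> (\<Sum>n. (cmod (\<eta> n))\<^sup>2 / ((real n + 1) * (real n + 2))) + B" .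
  qed simp
  then show ?thesis using that by (simp add: \<gamma>'_def)
qed

text \<open>The two integrands of \<open>omega\<close> as one function on the closed disk, so that a
  single exchange of integrals covers both parts of the measure.\<close>

definition dirichlet_kernel :: "complex \<Rightarrow> complex \<Rightarrow> ennreal" where
  "dirichlet_kernel \<zeta> z =
     (if cmod \<zeta> < 1 then
        if \<zeta> = z then \<infinity> else ennreal (ln (cmod ((1 - cnj \<zeta> * z) / (\<zeta> - z))) * (2 / (1 - (cmod \<zeta>)\<^sup>2)))
      else ennreal ((1 - (cmod z)\<^sup>2) / (cmod (\<zeta> - z))\<^sup>2))"

definition local_dirichlet :: "complex \<Rightarrow> (complex \<Rightarrow> complex) \<Rightarrow> ennreal" where
  "local_dirichlet \<zeta> f = (\<integral>\<^sup>+z. ennreal ((cmod (deriv f z))\<^sup>2) * dirichlet_kernel \<zeta> z \<partial>area_measure)"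

lemma AE_area_measure: "AE z in area_measure. cmod z < 1"
  by (rule AE_uniform_measureI) auto

text \<open>The cutoff keeps the derivative within \<open>Hol_disk\<close> and Borel on the whole
  plane.\<close>

definition disk_deriv :: "(complex \<Rightarrow> complex) \<Rightarrow> complex \<Rightarrow> complex" where
  "disk_deriv f z = (if cmod z < 1 then deriv f z else 0)"

lemma disk_deriv_Hol_disk: "f \<in> Hol_disk \<Longrightarrow> disk_deriv f \<in> Hol_disk"
proof -
  assume "f \<in> Hol_disk"
  then have "deriv f holomorphic_on ball 0 1" by (intro holomorphic_deriv) (auto simp: Hol_disk_def)
  then have "disk_deriv f holomorphic_on ball 0 1"
    by (rule holomorphic_transform) (simp add: disk_deriv_def)
  then show ?thesis by (simp add: Hol_disk_def disk_deriv_def)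
qed

lemma taylor_coeff_disk_deriv:
  assumes f: "f \<in> Hol_disk"
  shows "taylor_coeff (disk_deriv f) n = of_nat (n + 1) * taylor_coeff f (n + 1)"
proof -
  have ev: "eventually (\<lambda>z. disk_deriv f z = deriv f z) (nhds 0)"
    by (rule eventually_nhds_in_open[of "ball 0 1", THEN eventually_mono]) (auto simp: disk_deriv_def)
  have "(deriv ^^ n) (disk_deriv f) 0 = (deriv ^^ n) (deriv f) 0"
    by (rule higher_deriv_cong_ev[OF ev refl])
  also have "\<dots> = (deriv ^^ (Suc n)) f 0" by (simp add: funpow_swap1)
  finally have "(deriv ^^ n) (disk_deriv f) 0 = (deriv ^^ (n + 1)) f 0" by simp
  moreover have "of_nat (n + 1) * (x / fact (n + 1)) = (x :: complex) / fact n" for x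
  proof -
    have "(of_nat (n + 1) :: complex) \<noteq> 0" by (metis of_nat_neq_0 Suc_eq_plus1)
    then show ?thesis by (simp only: Suc_eq_plus1[symmetric] fact_Suc) simp
  qed
  ultimately show ?thesis by (simp only: taylor_coeff_def)
qed

lemma ennreal_suminf_sums:
  assumes "\<And>n. 0 \<le> a n" "a sums s"
  shows "(\<Sum>n. ennreal (a n)) = ennreal s"
  using assms by (metis suminf_ennreal_eq)

text \<open>\<open>shifted f \<zeta> g\<close> expresses \<open>f = const + (z - \<zeta>) g\<close> in terms of Taylor coefficients.\<close>

definition shifted :: "(complex \<Rightarrow> complex) \<Rightarrow> complex \<Rightarrow> ell2 \<Rightarrow> bool" where
  "shifted f \<zeta> g \<longleftrightarrow> (\<forall>k. taylor_coeff f (k + 1) = coef g k - \<zeta> * coef g (k + 1))"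

text \<open>For \<open>|\<zeta>| = 1\<close> the kernel is
  \<open>(1 - |z|^2) / |\<zeta> - z|^2\<close>, so dividing the derivative by
  \<open>z - \<zeta>\<close> leaves a weight depending on \<open>|z|\<close> only. The coefficients
  of the quotient then satisfy the recursion of the telescoping lemmas.\<close>

lemma local_dirichlet_boundary:
  assumes f: "f \<in> Hol_disk" and \<zeta>: "cmod \<zeta> = 1"
  shows "shifted f \<zeta> g \<Longrightarrow> local_dirichlet \<zeta> f = ennreal ((norm g)\<^sup>2)"
    and "local_dirichlet \<zeta> f < \<infinity> \<Longrightarrow> \<exists>g. shifted f \<zeta> g"
proof -
  define h where "h z = (if cmod z < 1 then disk_deriv f z / (z - \<zeta>) else 0)" for z
  have ne: "z - \<zeta> \<noteq> 0" if "cmod z < 1" for z using that \<zeta> by auto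
  have "(\<lambda>z. disk_deriv f z / (z - \<zeta>)) holomorphic_on ball 0 1"
    using disk_deriv_Hol_disk[OF f] ne by (intro holomorphic_intros) (auto simp: Hol_disk_def)
  then have "h holomorphic_on ball 0 1" by (rule holomorphic_transform) (simp add: h_def)
  then have h: "h \<in> Hol_disk" by (simp add: Hol_disk_def h_def)
  have "local_dirichlet \<zeta> f = (\<integral>\<^sup>+z. ennreal ((cmod (h z))\<^sup>2) * ennreal (1 - (cmod z)\<^sup>2) \<partial>area_measure)"
    unfolding local_dirichlet_def
  proof (rule nn_integral_cong_AE)
    show "AE z in area_measure. ennreal ((cmod (deriv f z))\<^sup>2) * dirichlet_kernel \<zeta> z = ennreal ((cmod (h z))\<^sup>2) * ennreal (1 - (cmod z)\<^sup>2)"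
      using AE_area_measure
    proof eventually_elim
      case (elim z)
      have "(cmod (deriv f z))\<^sup>2 * ((1 - (cmod z)\<^sup>2) / (cmod (\<zeta> - z))\<^sup>2) = (cmod (h z))\<^sup>2 * (1 - (cmod z)\<^sup>2)"
        using elim by (simp add: h_def disk_deriv_def norm_divide power_divide norm_minus_commute)
      then show ?case using \<zeta> elim
        by (simp add: dirichlet_kernel_def ennreal_mult'[symmetric] power_le_one)
    qed
  qed
  then have loc: "local_dirichlet \<zeta> f = (\<Sum>n. ennreal ((cmod (taylor_coeff h n))\<^sup>2 / ((real n + 1) * (real n + 2))))"
    by (simp add: nn_integral_area_boundary_weight[OF h])
  define c where "c = taylor_coeff h"
  have coeffs: "taylor_coeff (disk_deriv f) = (\<lambda>n. (if n = 0 then 0 else c (n - 1)) - \<zeta> * c n)"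
  proof (rule taylor_coeff_unique[of 1])
    fix z :: complex assume z: "cmod z < 1"
    have hs: "(\<lambda>n. c n * z ^ n) sums h z"
      unfolding c_def by (rule taylor_coeff_sums) (use h z in \<open>auto simp: Hol_disk_def\<close>)
    have "(\<lambda>n. (if Suc n = 0 then 0 else c (Suc n - 1)) * z ^ Suc n) sums (h z * z)"
      using sums_mult2[OF hs, of z] by (simp add: mult_ac)
    then have "(\<lambda>n. (if n = 0 then 0 else c (n - 1)) * z ^ n) sums (h z * z)"
      by (subst (asm) sums_Suc_iff) simp
    from sums_diff[OF this sums_mult[OF hs, of \<zeta>]]
    have "(\<lambda>n. ((if n = 0 then 0 else c (n - 1)) - \<zeta> * c n) * z ^ n) sums (h z * z - \<zeta> * h z)"
      by (simp add: algebra_simps)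
    moreover have "h z * z - \<zeta> * h z = disk_deriv f z"
    proof -
      have "h z * z - \<zeta> * h z = h z * (z - \<zeta>)" by (simp only: right_diff_distrib mult.commute[of \<zeta>])
      then show ?thesis using ne[OF z] z by (simp only: h_def) simp
    qed
    ultimately show "(\<lambda>n. ((if n = 0 then 0 else c (n - 1)) - \<zeta> * c n) * z ^ n) sums disk_deriv f z" by simp
  qed simp
  \<comment> \<open>Powers of \<open>\<zeta>\<close> rotate the boundary point to 1, the case that
    the telescoping lemmas treat; moduli do not change.\<close>
  define F where "F n = \<zeta> ^ n * taylor_coeff f n" for n
  define \<eta> where "\<eta> n = \<zeta> ^ (n + 2) * c n" for n
  have rel0: "F 1 = - \<eta> 0"
    using fun_cong[OF coeffs, of 0] taylor_coeff_disk_deriv[OF f, of 0]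
    by (simp add: F_def \<eta>_def power2_eq_square)
  have rel: "of_nat (n + 2) * F (n + 2) = \<eta> n - \<eta> (n + 1)" for n
  proof -
    have "of_nat (n + 2) * taylor_coeff f (n + 2) = c n - \<zeta> * c (n + 1)"
      using fun_cong[OF coeffs, of "n + 1"] taylor_coeff_disk_deriv[OF f, of "n + 1"] by (simp add: add.commute)
    then have "\<zeta> ^ (n + 2) * (of_nat (n + 2) * taylor_coeff f (n + 2)) = \<zeta> ^ (n + 2) * (c n - \<zeta> * c (n + 1))" by simp
    then show ?thesis by (simp add: F_def \<eta>_def algebra_simps)
  qed
  have n\<eta>: "cmod (\<eta> n) = cmod (c n)" for n using \<zeta> by (simp add: \<eta>_def norm_mult norm_power)
  have loc': "local_dirichlet \<zeta> f = (\<Sum>n. ennreal ((cmod (\<eta> n))\<^sup>2 / ((real n + 1) * (real n + 2))))"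
    by (simp add: loc n\<eta> c_def)
  show "local_dirichlet \<zeta> f = ennreal ((norm g)\<^sup>2)" if sh: "shifted f \<zeta> g"
  proof -
    define \<gamma> where "\<gamma> n = \<zeta> ^ (n + 1) * coef g n" for n
    have F\<gamma>: "F (n + 1) = \<gamma> n - \<gamma> (n + 1)" for n
    proof -
      have "taylor_coeff f (n + 1) = coef g n - \<zeta> * coef g (n + 1)" using sh by (simp add: shifted_def)
      then have "F (n + 1) = \<zeta> ^ (n + 1) * (coef g n - \<zeta> * coef g (n + 1))" by (simp only: F_def)
      then show ?thesis by (simp add: \<gamma>_def algebra_simps)
    qed
    have n\<gamma>: "cmod (\<gamma> n) = cmod (coef g n)" for n using \<zeta> by (simp add: \<gamma>_def norm_mult norm_power)
    have "\<eta> 0 = \<gamma> 1 - \<gamma> 0"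
    proof -
      have "\<eta> 0 = - F (0 + 1)" using rel0 by simp
      then show ?thesis by (simp only: F\<gamma>) simp
    qed
    moreover have "of_nat (n + 2) * (\<gamma> (n + 1) - \<gamma> (n + 2)) = \<eta> n - \<eta> (n + 1)" for n
      using rel[of n] F\<gamma>[of "n + 1"] by simp
    ultimately have "(\<lambda>n. (cmod (\<eta> n))\<^sup>2 / ((real n + 1) * (real n + 2))) sums (\<Sum>n. (cmod (\<gamma> n))\<^sup>2)"
      by (rule telescoping_sum) (simp add: n\<gamma> summable_coef_sq)
    then show ?thesis
      unfolding loc' by (subst ennreal_suminf_sums) (simp_all add: n\<gamma> norm_ell2_sq)
  qed
  show "\<exists>g. shifted f \<zeta> g" if fin: "local_dirichlet \<zeta> f < \<infinity>"
  proof -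
    \<comment> \<open>The solution of \<open>F (n + 1) = \<gamma> n - \<gamma> (n + 1)\<close> that
      starts at 0; its free additive constant is adjusted by \<open>l\<close> below.\<close>
    define \<gamma> where "\<gamma> n = - (\<Sum>k<n. F (k + 1))" for n
    have F\<gamma>: "F (n + 1) = \<gamma> n - \<gamma> (n + 1)" for n by (simp add: \<gamma>_def)
    have "summable (\<lambda>n. (cmod (\<eta> n))\<^sup>2 / ((real n + 1) * (real n + 2)))"
      using fin unfolding loc' by (intro summable_suminf_not_top) auto
    moreover have "\<eta> 0 = \<gamma> 1 - \<gamma> 0"
    proof -
      have "\<eta> 0 = - F (0 + 1)" using rel0 by simp
      then show ?thesis by (simp only: F\<gamma>) simp
    qed
    moreover have "of_nat (n + 2) * (\<gamma> (n + 1) - \<gamma> (n + 2)) = \<eta> n - \<eta> (n + 1)" for n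
      using rel[of n] F\<gamma>[of "n + 1"] by simp
    ultimately obtain l where l: "summable (\<lambda>n. (cmod (\<gamma> n - l))\<^sup>2)"
      using telescoping_solution[of \<eta> \<gamma>] by blast
    define g where "g = Abs_ell2 (\<lambda>n. cnj \<zeta> ^ (n + 1) * (\<gamma> n - l))"
    have "summable (\<lambda>n. (cmod (cnj \<zeta> ^ (n + 1) * (\<gamma> n - l)))\<^sup>2)"
      using l \<zeta> by (simp add: norm_mult norm_power)
    then have cg: "coef g n = cnj \<zeta> ^ (n + 1) * (\<gamma> n - l)" for n by (simp add: g_def coef_Abs_ell2)
    have unit: "cnj \<zeta> * \<zeta> = 1" using \<zeta> complex_norm_square[of \<zeta>] by (simp add: mult.commute)
    have "taylor_coeff f (k + 1) = coef g k - \<zeta> * coef g (k + 1)" for k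
    proof -
      have "taylor_coeff f (k + 1) = cnj \<zeta> ^ (k + 1) * F (k + 1)"
      proof -
        have "cnj \<zeta> ^ (k + 1) * F (k + 1) = (cnj \<zeta> * \<zeta>) ^ (k + 1) * taylor_coeff f (k + 1)"
          by (simp only: F_def power_mult_distrib mult.assoc)
        then show ?thesis by (simp add: unit)
      qed
      also have "\<dots> = cnj \<zeta> ^ (k + 1) * (\<gamma> k - l) - (cnj \<zeta> * \<zeta>) * (cnj \<zeta> ^ (k + 1) * (\<gamma> (k + 1) - l))"
        by (simp only: F\<gamma> unit) (simp add: algebra_simps)
      also have "\<dots> = coef g k - \<zeta> * coef g (k + 1)" by (simp add: cg mult_ac)
      finally show ?thesis .
    qed
    then show ?thesis by (auto simp: shifted_def)
  qed
qed

subsection \<open>Disk automorphisms\<close>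

text \<open>The automorphism of the disk that exchanges 0 and \<open>\<zeta>\<close>; it is its own
  inverse.\<close>

definition moeb :: "complex \<Rightarrow> complex \<Rightarrow> complex" where
  "moeb \<zeta> w = (\<zeta> - w) / (1 - cnj \<zeta> * w)"

lemma moeb_denom: "cmod \<zeta> < 1 \<Longrightarrow> cmod w \<le> 1 \<Longrightarrow> 1 - cnj \<zeta> * w \<noteq> 0"
proof
  assume z: "cmod \<zeta> < 1" and w: "cmod w \<le> 1" and "1 - cnj \<zeta> * w = 0"
  then have "cmod (cnj \<zeta> * w) = 1" by (metis eq_iff_diff_eq_0 norm_one)
  then have "cmod \<zeta> * cmod w = 1" by (simp add: norm_mult)
  moreover have "cmod \<zeta> * cmod w \<le> cmod \<zeta> * 1" using w by (intro mult_left_mono) auto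
  ultimately show False using z by simp
qed

lemma moeb_norm_identity:
  "(cmod (1 - cnj \<zeta> * w))\<^sup>2 - (cmod (\<zeta> - w))\<^sup>2 = (1 - (cmod \<zeta>)\<^sup>2) * (1 - (cmod w)\<^sup>2)"
  unfolding cmod_power2 by (simp add: power2_eq_square algebra_simps)

lemma norm_moeb_less:
  assumes "cmod \<zeta> < 1" "cmod w < 1"
  shows "cmod (moeb \<zeta> w) < 1"
proof -
  have d: "0 < cmod (1 - cnj \<zeta> * w)" using moeb_denom[of \<zeta> w] assms by simp
  have "0 < (1 - (cmod \<zeta>)\<^sup>2) * (1 - (cmod w)\<^sup>2)" using assms by (simp add: power_less_one_iff abs_square_less_1)
  then have "(cmod (\<zeta> - w))\<^sup>2 < (cmod (1 - cnj \<zeta> * w))\<^sup>2" using moeb_norm_identity[of \<zeta> w] by linarith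
  then have "cmod (\<zeta> - w) < cmod (1 - cnj \<zeta> * w)" by (rule power2_less_imp_less) simp
  then show ?thesis using d by (simp add: moeb_def norm_divide)
qed

lemma norm_moeb_eq_1:
  assumes "cmod \<zeta> < 1" "cmod w = 1"
  shows "cmod (moeb \<zeta> w) = 1"
proof -
  have d: "0 < cmod (1 - cnj \<zeta> * w)" using moeb_denom[of \<zeta> w] assms by simp
  have "(cmod (\<zeta> - w))\<^sup>2 = (cmod (1 - cnj \<zeta> * w))\<^sup>2" using moeb_norm_identity[of \<zeta> w] assms by simp
  then have "cmod (\<zeta> - w) = cmod (1 - cnj \<zeta> * w)" by (simp add: power2_eq_iff_nonneg)
  then show ?thesis using d by (simp add: moeb_def norm_divide)
qed

lemma moeb_facts:
  assumes z: "cmod \<zeta> < 1" and w: "cmod w \<le> 1"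
  shows "1 - cnj \<zeta> * moeb \<zeta> w = of_real (1 - (cmod \<zeta>)\<^sup>2) / (1 - cnj \<zeta> * w)"
    and "moeb \<zeta> (moeb \<zeta> w) = w"
    and "moeb \<zeta> w - \<zeta> = - (of_real (1 - (cmod \<zeta>)\<^sup>2) * w / (1 - cnj \<zeta> * w))"
proof -
  have d: "1 - cnj \<zeta> * w \<noteq> 0" by (rule moeb_denom[OF assms])
  have q: "of_real (1 - (cmod \<zeta>)\<^sup>2) = 1 - \<zeta> * cnj \<zeta>" by (simp only: of_real_diff of_real_1 complex_norm_square)
  have q0: "1 - \<zeta> * cnj \<zeta> \<noteq> 0"
    unfolding q[symmetric] of_real_eq_0_iff using z abs_square_less_1[of "cmod \<zeta>"] by simp
  show a: "1 - cnj \<zeta> * moeb \<zeta> w = of_real (1 - (cmod \<zeta>)\<^sup>2) / (1 - cnj \<zeta> * w)"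
    unfolding q moeb_def using d by (simp add: field_simps)
  have "\<zeta> - moeb \<zeta> w = (1 - \<zeta> * cnj \<zeta>) * w / (1 - cnj \<zeta> * w)"
    unfolding moeb_def using d by (simp add: field_simps)
  then show "moeb \<zeta> (moeb \<zeta> w) = w"
    unfolding moeb_def[of \<zeta> "moeb \<zeta> w"] a q using d q0 by simp
  show "moeb \<zeta> w - \<zeta> = - (of_real (1 - (cmod \<zeta>)\<^sup>2) * w / (1 - cnj \<zeta> * w))"
    unfolding q moeb_def using d by (simp add: field_simps)
qed

lemma moeb_holomorphic: "cmod \<zeta> < 1 \<Longrightarrow> moeb \<zeta> holomorphic_on ball 0 1"
  unfolding moeb_def using moeb_denom[of \<zeta>] by (intro holomorphic_intros) auto

text \<open>Composition with \<open>moeb\<close>, multiplied by the normalized reproducing kernel of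
  \<open>H2\<close> at \<open>\<zeta>\<close>; this factor turns composition into an isometric
  involution.\<close>

definition moeb_op :: "complex \<Rightarrow> (complex \<Rightarrow> complex) \<Rightarrow> complex \<Rightarrow> complex" where
  "moeb_op \<zeta> G w = (if cmod w < 1 then of_real (sqrt (1 - (cmod \<zeta>)\<^sup>2)) * G (moeb \<zeta> w) / (1 - cnj \<zeta> * w) else 0)"

lemma moeb_op_Hol_disk:
  assumes z: "cmod \<zeta> < 1" and G: "G \<in> Hol_disk"
  shows "moeb_op \<zeta> G \<in> Hol_disk"
proof -
  have "(\<lambda>w. G (moeb \<zeta> w)) holomorphic_on ball 0 1"
    by (rule holomorphic_on_compose_gen[OF moeb_holomorphic[OF z], of G "ball 0 1", unfolded o_def])
       (use G norm_moeb_less[OF z] in \<open>auto simp: Hol_disk_def\<close>)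
  then have "(\<lambda>w. of_real (sqrt (1 - (cmod \<zeta>)\<^sup>2)) * G (moeb \<zeta> w) / (1 - cnj \<zeta> * w)) holomorphic_on ball 0 1"
    using moeb_denom[OF z] by (intro holomorphic_intros) auto
  then have "moeb_op \<zeta> G holomorphic_on ball 0 1" by (rule holomorphic_transform) (simp add: moeb_op_def)
  then show ?thesis by (simp add: Hol_disk_def moeb_op_def)
qed

lemma moeb_op_involution:
  assumes z: "cmod \<zeta> < 1" and G: "G \<in> Hol_disk"
  shows "moeb_op \<zeta> (moeb_op \<zeta> G) = G"
proof (rule Hol_disk_eqI[OF moeb_op_Hol_disk[OF z moeb_op_Hol_disk[OF z G]] G])
  fix w :: complex assume w: "cmod w < 1"
  have s: "of_real (sqrt (1 - (cmod \<zeta>)\<^sup>2)) * of_real (sqrt (1 - (cmod \<zeta>)\<^sup>2)) = (of_real (1 - (cmod \<zeta>)\<^sup>2) :: complex)"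
    using z by (simp only: of_real_mult[symmetric]) (simp add: power_le_one)
  have q0: "(of_real (1 - (cmod \<zeta>)\<^sup>2) :: complex) \<noteq> 0"
    unfolding of_real_eq_0_iff using z abs_square_less_1[of "cmod \<zeta>"] by simp
  have "moeb_op \<zeta> (moeb_op \<zeta> G) w
      = of_real (sqrt (1 - (cmod \<zeta>)\<^sup>2)) * (of_real (sqrt (1 - (cmod \<zeta>)\<^sup>2)) * G (moeb \<zeta> (moeb \<zeta> w)) / (1 - cnj \<zeta> * moeb \<zeta> w)) / (1 - cnj \<zeta> * w)"
    using w norm_moeb_less[OF z w] by (simp add: moeb_op_def)
  also have "\<dots> = (of_real (1 - (cmod \<zeta>)\<^sup>2) * G w / (of_real (1 - (cmod \<zeta>)\<^sup>2) / (1 - cnj \<zeta> * w))) / (1 - cnj \<zeta> * w)"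
    using moeb_facts(1,2)[OF z, of w] w by (simp only: s[symmetric] less_imp_le mult.assoc times_divide_eq_right)
  also have "\<dots> = G w" using q0 moeb_denom[OF z, of w] w by simp
  finally show "moeb_op \<zeta> (moeb_op \<zeta> G) w = G w" .
qed

lemma sum_orthonormal:
  fixes u :: "nat \<Rightarrow> ell2"
  assumes u: "\<And>m n. cinner (u m) (u n) = (if m = n then 1 else 0)" and A: "finite A"
  shows "cinner (\<Sum>m\<in>A. a m *\<^sub>C u m) (u n) = (if n \<in> A then a n else 0)"
    and "(norm (\<Sum>m\<in>A. a m *\<^sub>C u m))\<^sup>2 = (\<Sum>m\<in>A. (cmod (a m))\<^sup>2)"
proof -
  show ip: "cinner (\<Sum>m\<in>A. a m *\<^sub>C u m) (u n) = (if n \<in> A then a n else 0)" for n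
    using A by (induction A) (auto simp: cinner_add_left cinner_scaleC_left u)
  have "cinner (\<Sum>m\<in>A. a m *\<^sub>C u m) (\<Sum>m\<in>B. a m *\<^sub>C u m) = (\<Sum>m\<in>B. of_real ((cmod (a m))\<^sup>2))"
    if "finite B" "B \<subseteq> A" for B
    using that
  proof (induction B)
    case (insert n B)
    then show ?case
      using ip[of n] complex_norm_square[of "a n"] by (simp add: cinner_add_right cinner_scaleC_right mult.commute)
  qed simp
  from this[OF A order_refl] have "of_real ((norm (\<Sum>m\<in>A. a m *\<^sub>C u m))\<^sup>2) = (of_real (\<Sum>m\<in>A. (cmod (a m))\<^sup>2) :: complex)"
    by (simp only: cinner_self of_real_sum)
  then show "(norm (\<Sum>m\<in>A. a m *\<^sub>C u m))\<^sup>2 = (\<Sum>m\<in>A. (cmod (a m))\<^sup>2)" by (simp only: of_real_eq_iff)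
qed

lemma orthonormal_series:
  fixes u :: "nat \<Rightarrow> ell2"
  assumes u: "\<And>m n. cinner (u m) (u n) = (if m = n then 1 else 0)"
  obtains y where "(\<lambda>m. coef x m *\<^sub>C u m) sums y" "norm y = norm x"
proof -
  note sq = sum_orthonormal(2)[OF u]
  have "summable (\<lambda>m. coef x m *\<^sub>C u m)"
    unfolding summable_Cauchy
  proof (intro allI impI)
    fix e :: real assume e: "e > 0"
    then obtain N where N: "\<And>m n. m \<ge> N \<Longrightarrow> norm (\<Sum>k=m..<n. (cmod (coef x k))\<^sup>2) < e\<^sup>2"
      using summable_coef_sq[of x] unfolding summable_Cauchy by (metis zero_less_power)
    have "norm (\<Sum>k=m..<n. coef x k *\<^sub>C u k) < e" if "m \<ge> N" for m n
    proof -
      have "(norm (\<Sum>k=m..<n. coef x k *\<^sub>C u k))\<^sup>2 < e\<^sup>2"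
        using N[OF that, of n] by (simp add: sq sum_nonneg)
      then show ?thesis by (rule power2_less_imp_less) (use e in simp)
    qed
    then show "\<exists>N. \<forall>m\<ge>N. \<forall>n. norm (\<Sum>k=m..<n. coef x k *\<^sub>C u k) < e" by blast
  qed
  then obtain y where y: "(\<lambda>m. coef x m *\<^sub>C u m) sums y" by (auto simp: summable_def)
  have "(\<lambda>N. (norm (\<Sum>m<N. coef x m *\<^sub>C u m))\<^sup>2) \<longlonglongrightarrow> (norm y)\<^sup>2"
    using y by (intro tendsto_intros) (simp add: sums_def)
  moreover have "(\<lambda>N. (norm (\<Sum>m<N. coef x m *\<^sub>C u m))\<^sup>2) \<longlonglongrightarrow> (norm x)\<^sup>2"
    using norm_ell2_sums[of x] by (simp add: sq sums_def)
  ultimately have "(norm y)\<^sup>2 = (norm x)\<^sup>2" by (rule LIMSEQ_unique)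
  then have "norm y = norm x" by (simp add: power2_eq_iff_nonneg)
  with y that show ?thesis by blast
qed

text \<open>The representing vector is the reproducing kernel, with coefficients
  \<open>cnj w ^ n\<close>. It makes point evaluation continuous, so that series in
  \<open>ell2\<close> can be evaluated pointwise.\<close>

lemma to_fun_eq_cinner:
  assumes w: "cmod w < 1"
  shows "\<exists>k. \<forall>x. to_fun x w = cinner x k"
proof -
  have "(cmod (cnj w ^ n))\<^sup>2 = ((cmod w)\<^sup>2) ^ n" for n
    by (simp add: norm_power power_mult[symmetric] mult.commute)
  then have "summable (\<lambda>n. (cmod (cnj w ^ n))\<^sup>2)"
    using w by (simp add: summable_geometric power_less_one_iff abs_square_less_1)
  then have "coef (Abs_ell2 (\<lambda>n. cnj w ^ n)) = (\<lambda>n. cnj w ^ n)" by (rule coef_Abs_ell2)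
  then have "cinner x (Abs_ell2 (\<lambda>n. cnj w ^ n)) = (\<Sum>n. coef x n * w ^ n)" for x
    by (simp add: cinner_def)
  then show ?thesis using to_fun_sums[OF w] by (metis sums_unique)
qed

lemma to_fun_sums_if_sums:
  assumes "x sums y" "cmod w < 1"
  shows "(\<lambda>n. to_fun (x n) w) sums to_fun y w"
proof -
  obtain k where k: "\<And>x. to_fun x w = cinner x k" using to_fun_eq_cinner[OF assms(2)] by blast
  have "bounded_linear (\<lambda>x. cinner x k)" by (rule bounded_bilinear.bounded_linear_left[OF bounded_bilinear_cinner])
  then show ?thesis unfolding k by (rule bounded_linear.sums) (rule assms(1))
qed

text \<open>The image of a monomial under \<open>moeb_op\<close> without the cutoff, hence
  holomorphic beyond the unit circle, where Parseval and the Poisson formula apply.\<close>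

definition moeb_basis :: "complex \<Rightarrow> nat \<Rightarrow> complex \<Rightarrow> complex" where
  "moeb_basis \<zeta> m w = of_real (sqrt (1 - (cmod \<zeta>)\<^sup>2)) * moeb \<zeta> w ^ m / (1 - cnj \<zeta> * w)"

lemma moeb_disc:
  assumes "cmod \<zeta> < 1"
  obtains R where "R > 1" "\<And>w. cmod w < R \<Longrightarrow> 1 - cnj \<zeta> * w \<noteq> 0"
proof
  show "2 / (1 + cmod \<zeta>) > 1" using assms by (simp add: field_simps add_pos_nonneg)
  fix w assume w: "cmod w < 2 / (1 + cmod \<zeta>)"
  have p: "0 < 1 + cmod \<zeta>" by (simp add: add_pos_nonneg)
  have "cmod (cnj \<zeta> * w) \<le> cmod \<zeta> * (2 / (1 + cmod \<zeta>))"
    unfolding norm_mult complex_mod_cnj using w by (intro mult_left_mono) auto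
  also have "\<dots> < 1" using assms p by (simp add: field_simps)
  finally show "1 - cnj \<zeta> * w \<noteq> 0" by auto
qed

lemma moeb_op_zpow_H2: 
  assumes z: "cmod \<zeta> < 1"
  shows "moeb_op \<zeta> (zpow m) \<in> H2"
proof -
  have H: "moeb_op \<zeta> (zpow m) \<in> Hol_disk"
    using zpow_Hinf by (intro moeb_op_Hol_disk z) (simp add: Hinf_def)
  have "cmod (moeb_op \<zeta> (zpow m) w) \<le> sqrt (1 - (cmod \<zeta>)\<^sup>2) * 1 / (1 - cmod \<zeta>)" if w: "cmod w < 1" for w
  proof -
    have mo: "cmod (moeb \<zeta> w) < 1" by (rule norm_moeb_less[OF z w])
    have "cmod \<zeta> * cmod w \<le> cmod \<zeta> * 1" using w by (intro mult_left_mono) auto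
    then have "1 - cmod \<zeta> \<le> cmod (1 - cnj \<zeta> * w)"
      using norm_triangle_ineq2[of 1 "cnj \<zeta> * w"] by (simp add: norm_mult)
    moreover have "cmod (moeb \<zeta> w) ^ m \<le> 1" using mo by (simp add: power_le_one)
    moreover have "cmod (moeb_op \<zeta> (zpow m) w) = sqrt (1 - (cmod \<zeta>)\<^sup>2) * cmod (moeb \<zeta> w) ^ m / cmod (1 - cnj \<zeta> * w)"
      using w mo z by (simp add: moeb_op_def zpow_def norm_mult norm_divide norm_power power_le_one)
    ultimately show ?thesis
      using z by (simp only:) (intro frac_le mult_left_mono, auto simp: power_le_one)
  qed
  then show ?thesis by (intro Hinf_H2 HinfI[OF H])
qed

text \<open>On the circle \<open>moeb\<close> has modulus 1, and the two prefactors multiply to the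
  Poisson kernel of \<open>\<zeta>\<close>. The inner product is therefore the value at
  \<open>\<zeta>\<close> of a power of \<open>moeb\<close>, and \<open>moeb\<close> vanishes
  there.\<close>

lemma moeb_basis_orthonormal:
  assumes z: "cmod \<zeta> < 1"
  shows "cinner (of_fun (moeb_op \<zeta> (zpow m))) (of_fun (moeb_op \<zeta> (zpow n))) = (if m = n then 1 else 0)"
proof -
  obtain R where R: "R > 1" and ne: "\<And>w. cmod w < R \<Longrightarrow> 1 - cnj \<zeta> * w \<noteq> 0"
    using moeb_disc[OF z] by blast
  have mh: "moeb \<zeta> holomorphic_on ball 0 R"
    unfolding moeb_def using ne by (intro holomorphic_intros) auto
  have bh: "moeb_basis \<zeta> k holomorphic_on ball 0 R" for k
    unfolding moeb_basis_def using ne mh by (intro holomorphic_intros) auto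
  have tc: "taylor_coeff (moeb_op \<zeta> (zpow k)) = taylor_coeff (moeb_basis \<zeta> k)" for k
  proof
    fix n
    have "eventually (\<lambda>w. moeb_op \<zeta> (zpow k) w = moeb_basis \<zeta> k w) (nhds 0)"
      by (rule eventually_nhds_in_open[of "ball 0 1", THEN eventually_mono])
         (auto simp: moeb_op_def moeb_basis_def zpow_def norm_moeb_less[OF z])
    from higher_deriv_cong_ev[OF this refl, of n]
    show "taylor_coeff (moeb_op \<zeta> (zpow k)) n = taylor_coeff (moeb_basis \<zeta> k) n" by (simp add: taylor_coeff_def)
  qed
  have "(\<lambda>k. taylor_coeff (moeb_basis \<zeta> m) k * cnj (taylor_coeff (moeb_basis \<zeta> n) k)) sums
      (\<integral>\<xi>. moeb_basis \<zeta> m \<xi> * cnj (moeb_basis \<zeta> n \<xi>) \<partial>arc_measure)" for m n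
    by (rule arc_parseval_disc[OF bh bh R])
  then have ci: "cinner (of_fun (moeb_op \<zeta> (zpow m))) (of_fun (moeb_op \<zeta> (zpow n)))
      = (\<integral>\<xi>. moeb_basis \<zeta> m \<xi> * cnj (moeb_basis \<zeta> n \<xi>) \<partial>arc_measure)" for m n
    by (simp add: cinner_def coef_of_fun[OF moeb_op_zpow_H2[OF z]] tc sums_unique[symmetric])
  have s: "of_real (sqrt (1 - (cmod \<zeta>)\<^sup>2)) * of_real (sqrt (1 - (cmod \<zeta>)\<^sup>2)) = (of_real (1 - (cmod \<zeta>)\<^sup>2) :: complex)"
    using z by (simp only: of_real_mult[symmetric]) (simp add: power_le_one)
  have main: "cinner (of_fun (moeb_op \<zeta> (zpow (n + k)))) (of_fun (moeb_op \<zeta> (zpow n))) = (if k = 0 then 1 else 0)" for n k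
  proof -
    have "(\<integral>\<xi>. moeb_basis \<zeta> (n + k) \<xi> * cnj (moeb_basis \<zeta> n \<xi>) \<partial>arc_measure)
        = (\<integral>\<xi>. of_real (poisson (\<zeta> * cnj \<xi>)) * moeb \<zeta> \<xi> ^ k \<partial>arc_measure)"
    proof (rule Bochner_Integration.integral_cong[OF refl])
      fix \<xi> assume "\<xi> \<in> space arc_measure"
      then have \<xi>: "cmod \<xi> = 1" by simp
      have n1: "moeb \<zeta> \<xi> * cnj (moeb \<zeta> \<xi>) = 1"
        using norm_moeb_eq_1[OF z \<xi>] complex_norm_square[of "moeb \<zeta> \<xi>"] by simp
      have "moeb_basis \<zeta> (n + k) \<xi> * cnj (moeb_basis \<zeta> n \<xi>)
          = (of_real (sqrt (1 - (cmod \<zeta>)\<^sup>2)) * of_real (sqrt (1 - (cmod \<zeta>)\<^sup>2))) / ((1 - cnj \<zeta> * \<xi>) * cnj (1 - cnj \<zeta> * \<xi>))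
            * ((moeb \<zeta> \<xi> * cnj (moeb \<zeta> \<xi>)) ^ n * moeb \<zeta> \<xi> ^ k)"
        by (simp add: moeb_basis_def power_add power_mult_distrib)
      also have "(1 - cnj \<zeta> * \<xi>) * cnj (1 - cnj \<zeta> * \<xi>) = of_real ((cmod (1 - cnj \<zeta> * \<xi>))\<^sup>2)"
        by (rule complex_norm_square[symmetric])
      also have "cmod (1 - cnj \<zeta> * \<xi>) = cmod (1 - \<zeta> * cnj \<xi>)"
        by (metis complex_cnj_cnj complex_cnj_diff complex_cnj_mult complex_cnj_one complex_mod_cnj)
      finally show "moeb_basis \<zeta> (n + k) \<xi> * cnj (moeb_basis \<zeta> n \<xi>) = of_real (poisson (\<zeta> * cnj \<xi>)) * moeb \<zeta> \<xi> ^ k"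
        unfolding s n1 using \<xi> by (simp add: poisson_def norm_mult)
    qed
    also have "\<dots> = moeb \<zeta> \<zeta> ^ k"
      by (rule poisson_formula(1)[OF _ R z]) (intro holomorphic_intros mh)
    finally show ?thesis unfolding ci by (simp add: moeb_def power_0_left)
  qed
  show ?thesis
  proof (cases "n \<le> m")
    case True
    then show ?thesis using main[of n "m - n"] by auto
  next
    case False
    then have "cinner (of_fun (moeb_op \<zeta> (zpow n))) (of_fun (moeb_op \<zeta> (zpow m))) = 0"
      using main[of m "n - m"] by simp
    then show ?thesis using False by (subst cinner_commute) simp
  qed
qed

text \<open>The images of the monomials are orthonormal, so the series of \<open>x\<close>
  transported to them converges to a vector of the same norm; continuity of evaluation identifies
  its function with \<open>moeb_op \<zeta> (to_fun x)\<close>.\<close>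

lemma moeb_op_isometry:
  assumes z: "cmod \<zeta> < 1"
  obtains y where "moeb_op \<zeta> (to_fun x) = to_fun y" "norm y = norm x"
proof -
  define u where "u m = of_fun (moeb_op \<zeta> (zpow m))" for m
  obtain y where y: "(\<lambda>m. coef x m *\<^sub>C u m) sums y" and ny: "norm y = norm x"
    using orthonormal_series[of u x] moeb_basis_orthonormal[OF z] unfolding u_def by blast
  have "moeb_op \<zeta> (to_fun x) = to_fun y"
  proof (rule Hol_disk_eqI[OF moeb_op_Hol_disk[OF z to_fun_Hol_disk] to_fun_Hol_disk])
    fix w :: complex assume w: "cmod w < 1"
    have mo: "cmod (moeb \<zeta> w) < 1" by (rule norm_moeb_less[OF z w])
    define q where "q = of_real (sqrt (1 - (cmod \<zeta>)\<^sup>2)) / (1 - cnj \<zeta> * w)"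
    have "(\<lambda>m. to_fun (coef x m *\<^sub>C u m) w) sums to_fun y w" by (rule to_fun_sums_if_sums[OF y w])
    moreover have "to_fun (coef x m *\<^sub>C u m) w = q * (coef x m * moeb \<zeta> w ^ m)" for m
      unfolding to_fun_scaleC u_def to_fun_of_fun[OF moeb_op_zpow_H2[OF z]]
      using w mo by (simp add: moeb_op_def zpow_def q_def)
    moreover have "(\<lambda>m. q * (coef x m * moeb \<zeta> w ^ m)) sums (q * to_fun x (moeb \<zeta> w))"
      by (intro sums_mult to_fun_sums mo)
    ultimately have "to_fun y w = q * to_fun x (moeb \<zeta> w)" using sums_unique2 by simp
    then show "moeb_op \<zeta> (to_fun x) w = to_fun y w" using w by (simp add: moeb_op_def q_def)
  qed
  with ny that show ?thesis by blast
qed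

lemma shift_sums:
  assumes z: "cmod z < 1"
  shows "(\<lambda>n. (case n of 0 \<Rightarrow> d | Suc k \<Rightarrow> coef g k - \<zeta> * coef g (Suc k)) * z ^ n) sums
    (d + \<zeta> * coef g 0 + (z - \<zeta>) * to_fun g z)"
proof -
  note s = to_fun_sums[OF z, of g]
  have "(\<lambda>k. coef g (Suc k) * z ^ Suc k) sums (to_fun g z - coef g 0)"
    using s by (subst sums_Suc_iff) simp
  from sums_diff[OF sums_mult2[OF s, of z] sums_mult[OF this, of \<zeta>]]
  have "(\<lambda>k. (case Suc k of 0 \<Rightarrow> d | Suc k \<Rightarrow> coef g k - \<zeta> * coef g (Suc k)) * z ^ Suc k) sums
      (to_fun g z * z - \<zeta> * (to_fun g z - coef g 0))"
    by (simp add: algebra_simps)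
  from this[THEN sums_Suc_iff[THEN iffD1]]
  show ?thesis by (simp add: algebra_simps)
qed

lemma shifted_iff:
  assumes f: "f \<in> Hol_disk"
  shows "shifted f \<zeta> g \<longleftrightarrow> (\<exists>c. \<forall>z. cmod z < 1 \<longrightarrow> f z = c + (z - \<zeta>) * to_fun g z)"
proof
  assume sh: "shifted f \<zeta> g"
  have "f z = (taylor_coeff f 0 + \<zeta> * coef g 0) + (z - \<zeta>) * to_fun g z" if z: "cmod z < 1" for z
  proof -
    have "(\<lambda>n. taylor_coeff f n * z ^ n) sums f z"
      by (rule taylor_coeff_sums) (use f z in \<open>auto simp: Hol_disk_def\<close>)
    moreover have "taylor_coeff f = (\<lambda>n. case n of 0 \<Rightarrow> taylor_coeff f 0 | Suc k \<Rightarrow> coef g k - \<zeta> * coef g (Suc k))"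
      using sh by (auto simp: shifted_def split: nat.split)
    ultimately show ?thesis using shift_sums[OF z, of "taylor_coeff f 0" g \<zeta>] sums_unique2 by metis
  qed
  then show "\<exists>c. \<forall>z. cmod z < 1 \<longrightarrow> f z = c + (z - \<zeta>) * to_fun g z" by blast
next
  assume "\<exists>c. \<forall>z. cmod z < 1 \<longrightarrow> f z = c + (z - \<zeta>) * to_fun g z"
  then obtain c where c: "\<And>z. cmod z < 1 \<Longrightarrow> f z = c + (z - \<zeta>) * to_fun g z" by blast
  have "taylor_coeff f = (\<lambda>n. case n of 0 \<Rightarrow> c - \<zeta> * coef g 0 | Suc k \<Rightarrow> coef g k - \<zeta> * coef g (Suc k))"
    using shift_sums[of _ "c - \<zeta> * coef g 0" g \<zeta>] by (intro taylor_coeff_unique[of 1]) (auto simp: c)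
  then show "shifted f \<zeta> g" by (simp add: shifted_def)
qed

subsection \<open>Local Dirichlet integrals at interior points\<close>

lemma dirichlet_kernel_measurable:
  "(\<lambda>p. dirichlet_kernel (fst p) (snd p)) \<in> borel_measurable (borel \<Otimes>\<^sub>M borel)"
proof -
  have [measurable]: "(\<lambda>z::complex. cnj z) \<in> borel_measurable borel"
    by (intro borel_measurable_continuous_onI continuous_intros)
  show ?thesis unfolding dirichlet_kernel_def by measurable
qed

lemma dirichlet_kernel_measurable_snd [measurable]: "dirichlet_kernel \<zeta> \<in> borel_measurable borel"
  using measurable_compose[OF measurable_Pair[OF measurable_const measurable_ident_sets[OF refl]] dirichlet_kernel_measurable, of \<zeta>]
  by simp

lemma deriv_moeb_chain:
  assumes z: "cmod \<zeta> < 1" and f: "f \<in> Hol_disk" and w: "cmod w < 1"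
  shows "deriv (\<lambda>w. if cmod w < 1 then f (moeb \<zeta> w) else 0) w = deriv f (moeb \<zeta> w) * deriv (moeb \<zeta>) w"
proof -
  have "deriv (\<lambda>w. if cmod w < 1 then f (moeb \<zeta> w) else 0) w = deriv (\<lambda>w. f (moeb \<zeta> w)) w"
    by (intro deriv_cong_ev refl eventually_nhds_in_open[of "ball 0 1", THEN eventually_mono]) (use w in auto)
  also have "\<dots> = deriv (f \<circ> moeb \<zeta>) w" by (simp add: o_def)
  also have "\<dots> = deriv f (moeb \<zeta> w) * deriv (moeb \<zeta>) w"
  proof (rule deriv_chain)
    show "moeb \<zeta> field_differentiable at w"
      using moeb_holomorphic[OF z] w by (intro holomorphic_on_imp_differentiable_at[of _ "ball 0 1"]) auto
    show "f field_differentiable at (moeb \<zeta> w)"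
      using f norm_moeb_less[OF z w] by (intro holomorphic_on_imp_differentiable_at[of _ "ball 0 1"]) (auto simp: Hol_disk_def)
  qed
  finally show ?thesis .
qed

lemma nn_integral_area_moeb:
  assumes z: "cmod \<zeta> < 1" and F [measurable]: "F \<in> borel_measurable borel"
  shows "(\<integral>\<^sup>+z. F z \<partial>area_measure) = (\<integral>\<^sup>+w. F (moeb \<zeta> w) * ennreal ((cmod (deriv (moeb \<zeta>) w))\<^sup>2) \<partial>area_measure)"
proof -
  have img: "moeb \<zeta> ` ball 0 1 = ball 0 1"
  proof
    show "moeb \<zeta> ` ball 0 1 \<subseteq> ball 0 1" using norm_moeb_less[OF z] by auto
    show "ball 0 1 \<subseteq> moeb \<zeta> ` ball 0 1"
    proof
      fix w :: complex assume "w \<in> ball 0 1"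
      then have "w = moeb \<zeta> (moeb \<zeta> w)" "moeb \<zeta> w \<in> ball 0 1"
        using moeb_facts(2)[OF z, of w] norm_moeb_less[OF z, of w] by auto
      then show "w \<in> moeb \<zeta> ` ball 0 1" by blast
    qed
  qed
  have inj: "inj_on (moeb \<zeta>) (ball 0 1)"
    by (rule inj_on_inverseI[of _ "moeb \<zeta>"]) (use moeb_facts(2)[OF z] in auto)
  have m: "moeb \<zeta> \<in> borel_measurable borel"
    unfolding moeb_def by (intro borel_measurable_divide borel_measurable_diff borel_measurable_times) auto
  have d: "(\<lambda>w. indicator (ball 0 1) w *\<^sub>R deriv (moeb \<zeta>) w) \<in> borel_measurable borel"
    by (rule borel_measurable_continuous_on_indicator)
       (auto intro!: holomorphic_on_imp_continuous_on holomorphic_deriv moeb_holomorphic[OF z])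
  have [measurable]: "disk_deriv (moeb \<zeta>) \<in> borel_measurable borel"
    by (rule measurable_cong[THEN iffD1, OF _ d]) (auto simp: disk_deriv_def indicator_def)
  have [measurable]: "(\<lambda>w. F (moeb \<zeta> w)) \<in> borel_measurable borel" by (rule measurable_compose[OF m F])
  have "(\<integral>\<^sup>+w. F (moeb \<zeta> w) * ennreal ((cmod (deriv (moeb \<zeta>) w))\<^sup>2) \<partial>area_measure)
      = (\<integral>\<^sup>+w. F (moeb \<zeta> w) * ennreal ((cmod (disk_deriv (moeb \<zeta>) w))\<^sup>2) \<partial>area_measure)"
    by (rule nn_integral_cong_AE) (use AE_area_measure in \<open>eventually_elim, simp add: disk_deriv_def\<close>)
  also have "\<dots> = (\<integral>\<^sup>+w\<in>ball 0 1. F (moeb \<zeta> w) * ennreal ((cmod (disk_deriv (moeb \<zeta>) w))\<^sup>2) \<partial>lborel) / emeasure lborel (ball 0 1 :: complex set)"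
    by (rule nn_integral_uniform_measure) auto
  also have "(\<integral>\<^sup>+w\<in>ball 0 1. F (moeb \<zeta> w) * ennreal ((cmod (disk_deriv (moeb \<zeta>) w))\<^sup>2) \<partial>lborel)
      = (\<integral>\<^sup>+w\<in>ball 0 1. F (moeb \<zeta> w) * ennreal ((cmod (deriv (moeb \<zeta>) w))\<^sup>2) \<partial>lborel)"
    by (rule nn_integral_cong) (auto simp: disk_deriv_def indicator_def)
  also have "\<dots> = (\<integral>\<^sup>+z\<in>ball 0 1. F z \<partial>lborel)"
    using nn_integral_holomorphic_image[OF open_ball moeb_holomorphic[OF z] inj F] by (simp add: img)
  also have "\<dots> / emeasure lborel (ball 0 1 :: complex set) = (\<integral>\<^sup>+z. F z \<partial>area_measure)"
    by (rule nn_integral_uniform_measure[symmetric]) auto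
  finally show ?thesis by simp
qed

text \<open>After the substitution by \<open>moeb\<close> the kernel becomes \<open>2 / q\<close>
  times \<open>ln (1 / |w|)\<close>, and \<open>f\<close> becomes a constant minus
  \<open>sqrt q * w * moeb_op \<zeta> G w\<close>. The factor \<open>(n + 1)^2\<close> from
  differentiation and the factor \<open>q\<close> cancel against the logarithmic weight and
  \<open>2 / q\<close>.\<close>

lemma local_dirichlet_interior:
  assumes z: "cmod \<zeta> < 1" and f: "f \<in> Hol_disk" and G: "G \<in> Hol_disk"
    and fG: "\<And>z. cmod z < 1 \<Longrightarrow> f z = c + (z - \<zeta>) * G z"
  shows "local_dirichlet \<zeta> f = (\<Sum>n. ennreal ((cmod (taylor_coeff (moeb_op \<zeta> G) n))\<^sup>2))"
proof -
  define q where "q = 1 - (cmod \<zeta>)\<^sup>2"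
  have q: "q > 0" using z by (simp add: q_def abs_square_less_1)
  define F where "F w = (if cmod w < 1 then f (moeb \<zeta> w) else 0)" for w
  have "(\<lambda>w. f (moeb \<zeta> w)) holomorphic_on ball 0 1"
    by (rule holomorphic_on_compose_gen[OF moeb_holomorphic[OF z], of f "ball 0 1", unfolded o_def])
       (use f norm_moeb_less[OF z] in \<open>auto simp: Hol_disk_def\<close>)
  then have "F holomorphic_on ball 0 1" by (rule holomorphic_transform) (simp add: F_def)
  then have F: "F \<in> Hol_disk" by (simp add: Hol_disk_def F_def)
  have CG: "moeb_op \<zeta> G \<in> Hol_disk" by (rule moeb_op_Hol_disk[OF z G])
  have [measurable]: "disk_deriv f \<in> borel_measurable borel" "disk_deriv F \<in> borel_measurable borel"
    by (intro Hol_disk_measurable disk_deriv_Hol_disk f F)+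
  have coeff: "taylor_coeff F (n + 1) = - of_real (sqrt q) * taylor_coeff (moeb_op \<zeta> G) n" for n
  proof -
    have "taylor_coeff F = (\<lambda>n. case n of 0 \<Rightarrow> c | Suc k \<Rightarrow> - of_real (sqrt q) * taylor_coeff (moeb_op \<zeta> G) k)"
    proof (rule taylor_coeff_unique[of 1])
      fix w :: complex assume w: "cmod w < 1"
      have "(\<lambda>k. taylor_coeff (moeb_op \<zeta> G) k * w ^ k) sums moeb_op \<zeta> G w"
        by (rule taylor_coeff_sums) (use CG w in \<open>auto simp: Hol_disk_def\<close>)
      from sums_mult[OF this, of "- of_real (sqrt q) * w"]
      have "(\<lambda>k. (case Suc k of 0 \<Rightarrow> c | Suc k \<Rightarrow> - of_real (sqrt q) * taylor_coeff (moeb_op \<zeta> G) k) * w ^ Suc k)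
          sums (- of_real (sqrt q) * w * moeb_op \<zeta> G w)" by (simp add: mult_ac)
      from this[THEN sums_Suc_iff[THEN iffD1]]
      have s: "(\<lambda>n. (case n of 0 \<Rightarrow> c | Suc k \<Rightarrow> - of_real (sqrt q) * taylor_coeff (moeb_op \<zeta> G) k) * w ^ n)
          sums (- of_real (sqrt q) * w * moeb_op \<zeta> G w + c)" by simp
      have sq: "of_real (sqrt q) * of_real (sqrt q) = (of_real q :: complex)"
        using q by (simp only: of_real_mult[symmetric]) simp
      have "F w = c + (moeb \<zeta> w - \<zeta>) * G (moeb \<zeta> w)"
        using w fG[OF norm_moeb_less[OF z w]] by (simp add: F_def)
      also have "\<dots> = - (of_real q * w / (1 - cnj \<zeta> * w)) * G (moeb \<zeta> w) + c"
        using moeb_facts(3)[OF z, of w] w by (simp add: q_def)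
      also have "\<dots> = - of_real (sqrt q) * w * moeb_op \<zeta> G w + c"
        using w unfolding sq[symmetric] by (simp add: moeb_op_def q_def)
      finally show "(\<lambda>n. (case n of 0 \<Rightarrow> c | Suc k \<Rightarrow> - of_real (sqrt q) * taylor_coeff (moeb_op \<zeta> G) k) * w ^ n) sums F w"
        using s by simp
    qed simp
    then show ?thesis by simp
  qed
  have "local_dirichlet \<zeta> f = (\<integral>\<^sup>+z. ennreal ((cmod (disk_deriv f z))\<^sup>2) * dirichlet_kernel \<zeta> z \<partial>area_measure)"
    unfolding local_dirichlet_def
    by (rule nn_integral_cong_AE) (use AE_area_measure in \<open>eventually_elim, simp add: disk_deriv_def\<close>)
  also have "\<dots> = (\<integral>\<^sup>+w. ennreal ((cmod (disk_deriv f (moeb \<zeta> w)))\<^sup>2) * dirichlet_kernel \<zeta> (moeb \<zeta> w) *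
      ennreal ((cmod (deriv (moeb \<zeta>) w))\<^sup>2) \<partial>area_measure)"
    by (rule nn_integral_area_moeb[OF z]) measurable
  also have "\<dots> = (\<integral>\<^sup>+w. ennreal (2 / q) * (ennreal ((cmod (disk_deriv F w))\<^sup>2) * ennreal (ln (1 / cmod w))) \<partial>area_measure)"
  proof (rule nn_integral_cong_AE)
    have "AE w in area_measure. w \<noteq> 0"
      by (rule AE_uniform_measureI, simp) (use AE_Im_nonzero in \<open>eventually_elim, auto\<close>)
    with AE_area_measure show "AE w in area_measure. ennreal ((cmod (disk_deriv f (moeb \<zeta> w)))\<^sup>2) * dirichlet_kernel \<zeta> (moeb \<zeta> w) *
        ennreal ((cmod (deriv (moeb \<zeta>) w))\<^sup>2) = ennreal (2 / q) * (ennreal ((cmod (disk_deriv F w))\<^sup>2) * ennreal (ln (1 / cmod w)))"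
    proof eventually_elim
      case (elim w)
      have mo: "cmod (moeb \<zeta> w) < 1" by (rule norm_moeb_less[OF z elim(1)])
      have invo: "moeb \<zeta> (moeb \<zeta> w) = w" using moeb_facts(2)[OF z, of w] elim by simp
      have "moeb \<zeta> w \<noteq> \<zeta>"
      proof
        assume "moeb \<zeta> w = \<zeta>"
        then have "w = moeb \<zeta> \<zeta>" using invo by simp
        then show False using elim by (simp add: moeb_def)
      qed
      \<comment> \<open>The quotient in the kernel is the reciprocal of
        \<open>moeb \<zeta> (moeb \<zeta> w)\<close>, which is \<open>w\<close>.\<close>
      moreover have "(1 - cnj \<zeta> * moeb \<zeta> w) / (\<zeta> - moeb \<zeta> w) = 1 / w"
        using invo by (metis moeb_def inverse_divide inverse_eq_divide)
      ultimately have K: "dirichlet_kernel \<zeta> (moeb \<zeta> w) = ennreal (ln (1 / cmod w) * (2 / q))"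
        using z by (simp add: dirichlet_kernel_def norm_divide q_def)
      have ln: "0 \<le> ln (1 / cmod w)" using elim by (intro ln_ge_zero) simp
      have D: "(cmod (disk_deriv F w))\<^sup>2 = (cmod (disk_deriv f (moeb \<zeta> w)))\<^sup>2 * (cmod (deriv (moeb \<zeta>) w))\<^sup>2"
        using deriv_moeb_chain[OF z f elim(1)] elim mo
        by (simp add: disk_deriv_def F_def[abs_def] norm_mult power_mult_distrib)
      have "ennreal (ln (1 / cmod w) * (2 / q)) = ennreal (ln (1 / cmod w)) * ennreal (2 / q)"
        using ln q by (intro ennreal_mult) auto
      moreover have "ennreal ((cmod (disk_deriv f (moeb \<zeta> w)))\<^sup>2 * (cmod (deriv (moeb \<zeta>) w))\<^sup>2)
          = ennreal ((cmod (disk_deriv f (moeb \<zeta> w)))\<^sup>2) * ennreal ((cmod (deriv (moeb \<zeta>) w))\<^sup>2)"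
        by (intro ennreal_mult) auto
      ultimately show ?case unfolding K D by (simp only: mult_ac)
    qed
  qed
  also have "\<dots> = ennreal (2 / q) * (\<integral>\<^sup>+w. ennreal ((cmod (disk_deriv F w))\<^sup>2) * ennreal (ln (1 / cmod w)) \<partial>area_measure)"
  proof (rule nn_integral_cmult)
    have "(\<lambda>w. ennreal ((cmod (disk_deriv F w))\<^sup>2) * ennreal (ln (1 / cmod w))) \<in> borel_measurable borel"
      by (intro borel_measurable_times_ennreal measurable_compose[OF _ measurable_ennreal] borel_measurable_power
          borel_measurable_norm borel_measurable_ln borel_measurable_divide Hol_disk_measurable disk_deriv_Hol_disk F) auto
    then show "(\<lambda>w. ennreal ((cmod (disk_deriv F w))\<^sup>2) * ennreal (ln (1 / cmod w))) \<in> borel_measurable area_measure"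
      by (simp cong: measurable_cong_sets)
  qed
  also have "\<dots> = (\<Sum>n. ennreal (2 / q) * ennreal ((cmod (taylor_coeff (disk_deriv F) n))\<^sup>2 / (2 * (real n + 1)\<^sup>2)))"
    unfolding nn_integral_area_log_weight[OF disk_deriv_Hol_disk[OF F]] by simp
  also have "\<dots> = (\<Sum>n. ennreal ((cmod (taylor_coeff (moeb_op \<zeta> G) n))\<^sup>2))"
  proof (rule suminf_cong)
    fix n
    have "cmod (taylor_coeff (disk_deriv F) n) = (real n + 1) * (sqrt q * cmod (taylor_coeff (moeb_op \<zeta> G) n))"
      unfolding taylor_coeff_disk_deriv[OF F] coeff norm_mult norm_of_nat_plus_1 using q by simp
    then have "(cmod (taylor_coeff (disk_deriv F) n))\<^sup>2 = (real n + 1)\<^sup>2 * (q * (cmod (taylor_coeff (moeb_op \<zeta> G) n))\<^sup>2)"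
      using q by (simp add: power_mult_distrib)
    moreover have "(real n + 1)\<^sup>2 > 0" by simp
    ultimately have "2 / q * ((cmod (taylor_coeff (disk_deriv F) n))\<^sup>2 / (2 * (real n + 1)\<^sup>2)) = (cmod (taylor_coeff (moeb_op \<zeta> G) n))\<^sup>2"
      using q by (simp only:) simp
    moreover have "ennreal (2 / q) * ennreal ((cmod (taylor_coeff (disk_deriv F) n))\<^sup>2 / (2 * (real n + 1)\<^sup>2))
        = ennreal (2 / q * ((cmod (taylor_coeff (disk_deriv F) n))\<^sup>2 / (2 * (real n + 1)\<^sup>2)))"
      using q by (intro ennreal_mult[symmetric]) auto
    ultimately show "ennreal (2 / q) * ennreal ((cmod (taylor_coeff (disk_deriv F) n))\<^sup>2 / (2 * (real n + 1)\<^sup>2))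
        = ennreal ((cmod (taylor_coeff (moeb_op \<zeta> G) n))\<^sup>2)" by simp
  qed
  finally show ?thesis .
qed

theorem local_dirichlet_shifted:
  assumes f: "f \<in> Hol_disk" and \<zeta>: "\<zeta> \<in> cball 0 1"
  shows "shifted f \<zeta> g \<Longrightarrow> local_dirichlet \<zeta> f = ennreal ((norm g)\<^sup>2)"
    and "local_dirichlet \<zeta> f < \<infinity> \<Longrightarrow> \<exists>g. shifted f \<zeta> g"
proof -
  show "local_dirichlet \<zeta> f = ennreal ((norm g)\<^sup>2)" if sh: "shifted f \<zeta> g"
  proof (cases "cmod \<zeta> = 1")
    case True
    then show ?thesis by (rule local_dirichlet_boundary(1)[OF f _ sh])
  next
    case False
    then have z: "cmod \<zeta> < 1" using \<zeta> by simp
    obtain c where c: "\<And>z. cmod z < 1 \<Longrightarrow> f z = c + (z - \<zeta>) * to_fun g z"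
      using sh unfolding shifted_iff[OF f] by blast
    obtain y where y: "moeb_op \<zeta> (to_fun g) = to_fun y" "norm y = norm g" using moeb_op_isometry[OF z] by blast
    have "local_dirichlet \<zeta> f = (\<Sum>n. ennreal ((cmod (taylor_coeff (moeb_op \<zeta> (to_fun g)) n))\<^sup>2))"
      by (rule local_dirichlet_interior[OF z f to_fun_Hol_disk c])
    also have "\<dots> = ennreal ((norm y)\<^sup>2)"
      unfolding y(1) taylor_coeff_to_fun by (rule ennreal_suminf_sums[OF _ norm_ell2_sums]) simp
    finally show ?thesis by (simp add: y)
  qed
  show "\<exists>g. shifted f \<zeta> g" if fin: "local_dirichlet \<zeta> f < \<infinity>"
  proof (cases "cmod \<zeta> = 1")
    case True
    then show ?thesis by (rule local_dirichlet_boundary(2)[OF f _ fin])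
  next
    case False
    then have z: "cmod \<zeta> < 1" using \<zeta> by simp
    \<comment> \<open>The difference quotient at \<open>\<zeta>\<close> with its removable
      singularity filled in. Finiteness of the integral puts \<open>moeb_op \<zeta> G\<close> into
      \<open>H2\<close>, and the involution carries this back to \<open>G\<close>.\<close>
    define G where "G w = (if cmod w < 1 then (if w = \<zeta> then deriv f \<zeta> else (f w - f \<zeta>) / (w - \<zeta>)) else 0)" for w
    have "(\<lambda>w. if w = \<zeta> then deriv f \<zeta> else (f w - f \<zeta>) / (w - \<zeta>)) holomorphic_on ball 0 1"
      by (rule pole_lemma_open) (use f in \<open>auto simp: Hol_disk_def\<close>)
    then have "G holomorphic_on ball 0 1" by (rule holomorphic_transform) (simp add: G_def)
    then have G: "G \<in> Hol_disk" by (simp add: Hol_disk_def G_def)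
    have fG: "f w = f \<zeta> + (w - \<zeta>) * G w" if "cmod w < 1" for w using that by (simp add: G_def)
    have "(\<Sum>n. ennreal ((cmod (taylor_coeff (moeb_op \<zeta> G) n))\<^sup>2)) < \<infinity>"
      using fin local_dirichlet_interior[OF z f G fG] by simp
    then have "summable (\<lambda>n. (cmod (taylor_coeff (moeb_op \<zeta> G) n))\<^sup>2)"
      by (intro summable_suminf_not_top) auto
    then have "moeb_op \<zeta> G \<in> H2" using moeb_op_Hol_disk[OF z G] by (simp add: H2_def)
    then obtain x where x: "moeb_op \<zeta> G = to_fun x" by (rule H2_cases)
    obtain g where "moeb_op \<zeta> (to_fun x) = to_fun g" using moeb_op_isometry[OF z] by blast
    then have "G = to_fun g" using moeb_op_involution[OF z G] x by simp
    then have "shifted f \<zeta> g" unfolding shifted_iff[OF f] using fG by blast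
    then show ?thesis by blast
  qed
qed

subsection \<open>The Dirichlet integral as a mixture of local ones\<close>

lemma dirichlet_kernel_measurable_fst: "(\<lambda>\<zeta>. dirichlet_kernel \<zeta> z) \<in> borel_measurable borel"
proof -
  have "(\<lambda>\<zeta>. (\<zeta>, z)) \<in> measurable borel (borel \<Otimes>\<^sub>M borel)"
    by (intro measurable_Pair measurable_ident_sets refl measurable_const) simp
  from measurable_compose[OF this dirichlet_kernel_measurable] show ?thesis by (simp only: fst_conv snd_conv)
qed

lemma measurable_dirichlet_integrand:
  assumes f: "f \<in> Hol_disk"
  shows "(\<lambda>(\<zeta>, z). ennreal ((cmod (disk_deriv f z))\<^sup>2) * dirichlet_kernel \<zeta> z) \<in> borel_measurable (borel \<Otimes>\<^sub>M borel)"
proof -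
  have "(\<lambda>p. disk_deriv f (snd p)) \<in> borel_measurable (borel \<Otimes>\<^sub>M borel)"
    by (rule measurable_compose[OF measurable_snd Hol_disk_measurable[OF disk_deriv_Hol_disk[OF f]]])
  from measurable_compose[OF measurable_compose[OF this borel_measurable_norm] borel_measurable_power[OF measurable_ident_sets[OF refl], of 2]]
  have "(\<lambda>p. ennreal ((cmod (disk_deriv f (snd p)))\<^sup>2)) \<in> borel_measurable (borel \<Otimes>\<^sub>M borel)"
    by (intro measurable_compose[OF _ measurable_ennreal])
  then show ?thesis unfolding split_beta using dirichlet_kernel_measurable by (rule borel_measurable_times_ennreal)
qed

lemma prob_space_area_measure: "prob_space area_measure"
  by (rule prob_space_uniform_measure) (simp_all add: emeasure_unit_disk)

lemma local_dirichlet_disk_deriv: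
  "local_dirichlet \<zeta> f = (\<integral>\<^sup>+z. ennreal ((cmod (disk_deriv f z))\<^sup>2) * dirichlet_kernel \<zeta> z \<partial>area_measure)"
  unfolding local_dirichlet_def
  by (rule nn_integral_cong_AE) (use AE_area_measure in \<open>eventually_elim, simp add: disk_deriv_def\<close>)

lemma local_dirichlet_measurable:
  assumes f: "f \<in> Hol_disk"
  shows "(\<lambda>\<zeta>. local_dirichlet \<zeta> f) \<in> borel_measurable borel"
proof -
  interpret area: prob_space area_measure by (rule prob_space_area_measure)
  have "sets (borel \<Otimes>\<^sub>M area_measure) = sets (borel \<Otimes>\<^sub>M (borel :: complex measure))"
    by (rule sets_pair_measure_cong) auto
  from measurable_cong_sets[OF this refl] measurable_dirichlet_integrand[OF f]
  have "(\<lambda>(\<zeta>, z). ennreal ((cmod (disk_deriv f z))\<^sup>2) * dirichlet_kernel \<zeta> z) \<in> borel_measurable (borel \<Otimes>\<^sub>M area_measure)"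
    by blast
  from area.borel_measurable_nn_integral[OF this] show ?thesis by (simp only: local_dirichlet_disk_deriv)
qed

context
  fixes \<mu> :: "complex measure"
  assumes sets_mu: "sets \<mu> = sets (restrict_space borel (cball 0 1))" and fin_mu: "finite_measure \<mu>"
begin

lemma space_mu: "space \<mu> = cball 0 1"
  using sets_eq_imp_space_eq[OF sets_mu] by (simp add: space_restrict_space)

lemma measurable_mu: "g \<in> borel_measurable borel \<Longrightarrow> g \<in> borel_measurable \<mu>"
  using measurable_restrict_space1[of g borel borel "cball 0 1"] by (simp only: measurable_cong_sets[OF sets_mu refl])

lemma omega_eq:
  assumes z: "cmod z < 1"
  shows "omega \<mu> z = (\<integral>\<^sup>+\<zeta>. dirichlet_kernel \<zeta> z \<partial>\<mu>)"
proof -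
  have m: "(\<lambda>\<zeta>. dirichlet_kernel \<zeta> z * indicator A \<zeta>) \<in> borel_measurable \<mu>" if "A \<in> sets borel" for A
  proof (rule measurable_mu)
    show "(\<lambda>\<zeta>. dirichlet_kernel \<zeta> z * indicator A \<zeta>) \<in> borel_measurable borel"
      using that by (intro borel_measurable_times_ennreal dirichlet_kernel_measurable_fst borel_measurable_indicator)
  qed
  have "omega \<mu> z = (\<integral>\<^sup>+\<zeta>\<in>ball 0 1. dirichlet_kernel \<zeta> z \<partial>\<mu>) + (\<integral>\<^sup>+\<zeta>\<in>sphere 0 1. dirichlet_kernel \<zeta> z \<partial>\<mu>)"
    unfolding omega_def
    by (intro arg_cong2[where f = "(+)"] nn_integral_cong) (simp_all add: dirichlet_kernel_def split: split_indicator)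
  also have "\<dots> = (\<integral>\<^sup>+\<zeta>. dirichlet_kernel \<zeta> z * indicator (ball 0 1) \<zeta> + dirichlet_kernel \<zeta> z * indicator (sphere 0 1) \<zeta> \<partial>\<mu>)"
    by (intro nn_integral_add[symmetric] m) simp_all
  also have "\<dots> = (\<integral>\<^sup>+\<zeta>. dirichlet_kernel \<zeta> z \<partial>\<mu>)"
  proof (rule nn_integral_cong)
    fix \<zeta> assume "\<zeta> \<in> space \<mu>"
    then have "cmod \<zeta> < 1 \<or> cmod \<zeta> = 1" using space_mu by auto
    then show "dirichlet_kernel \<zeta> z * indicator (ball 0 1) \<zeta> + dirichlet_kernel \<zeta> z * indicator (sphere 0 1) \<zeta> = dirichlet_kernel \<zeta> z"
      by (elim disjE) simp_all
  qed
  finally show ?thesis .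
qed

text \<open>Tonelli's theorem for the jointly measurable kernel.\<close>

lemma dirichlet_integral_eq:
  assumes f: "f \<in> Hol_disk"
  shows "dirichlet_integral \<mu> f = (\<integral>\<^sup>+\<zeta>. local_dirichlet \<zeta> f \<partial>\<mu>)"
proof -
  interpret area: prob_space area_measure by (rule prob_space_area_measure)
  interpret mu: finite_measure \<mu> by (rule fin_mu)
  have pair: "pair_sigma_finite \<mu> area_measure"
    by (intro pair_sigma_finite.intro mu.sigma_finite_measure_axioms area.sigma_finite_measure_axioms)
  have "(\<lambda>p. (fst p, snd p)) \<in> measurable (\<mu> \<Otimes>\<^sub>M area_measure) (borel \<Otimes>\<^sub>M borel)"
  proof (rule measurable_Pair)
    show "fst \<in> borel_measurable (\<mu> \<Otimes>\<^sub>M area_measure)"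
      by (rule measurable_compose[OF measurable_fst measurable_mu[of "\<lambda>x. x"]]) simp
    show "snd \<in> borel_measurable (\<mu> \<Otimes>\<^sub>M area_measure)"
      by (rule measurable_compose[OF measurable_snd, where g = "\<lambda>x. x"]) (simp add: measurable_ident_sets)
  qed
  from measurable_compose[OF this measurable_dirichlet_integrand[OF f]]
  have meas: "(\<lambda>(\<zeta>, z). ennreal ((cmod (disk_deriv f z))\<^sup>2) * dirichlet_kernel \<zeta> z) \<in> borel_measurable (\<mu> \<Otimes>\<^sub>M area_measure)"
    by (simp only: prod.collapse)
  have "dirichlet_integral \<mu> f = (\<integral>\<^sup>+z. \<integral>\<^sup>+\<zeta>. ennreal ((cmod (disk_deriv f z))\<^sup>2) * dirichlet_kernel \<zeta> z \<partial>\<mu> \<partial>area_measure)"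
    unfolding dirichlet_integral_def
  proof (rule nn_integral_cong_AE)
    show "AE z in area_measure. ennreal ((cmod (deriv f z))\<^sup>2) * omega \<mu> z
        = (\<integral>\<^sup>+\<zeta>. ennreal ((cmod (disk_deriv f z))\<^sup>2) * dirichlet_kernel \<zeta> z \<partial>\<mu>)"
      using AE_area_measure
    proof eventually_elim
      case (elim z)
      have "(\<lambda>\<zeta>. dirichlet_kernel \<zeta> z) \<in> borel_measurable \<mu>"
        by (rule measurable_mu[OF dirichlet_kernel_measurable_fst])
      then have "(\<integral>\<^sup>+\<zeta>. ennreal ((cmod (disk_deriv f z))\<^sup>2) * dirichlet_kernel \<zeta> z \<partial>\<mu>) = ennreal ((cmod (disk_deriv f z))\<^sup>2) * omega \<mu> z"
        unfolding omega_eq[OF elim] by (rule nn_integral_cmult)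
      then show ?case using elim by (simp only: disk_deriv_def if_True)
    qed
  qed
  also have "\<dots> = (\<integral>\<^sup>+\<zeta>. \<integral>\<^sup>+z. ennreal ((cmod (disk_deriv f z))\<^sup>2) * dirichlet_kernel \<zeta> z \<partial>area_measure \<partial>\<mu>)"
    by (rule pair_sigma_finite.Fubini'[OF pair meas])
  finally show ?thesis by (simp only: local_dirichlet_disk_deriv)
qed

end

text \<open>Apart from the constant term, the coefficients are a difference of two square summable
  sequences. This places functions of finite Dirichlet integral inside \<open>H2\<close>.\<close>

lemma H2_if_shifted:
  assumes f: "f \<in> Hol_disk" and sh: "shifted f \<zeta> g"
  obtains x where "f = to_fun x"
proof -
  have "taylor_coeff f (Suc k) = coef g k + (- \<zeta> * coef g (Suc k))" for k
  proof -
    have "taylor_coeff f (k + 1) = coef g k - \<zeta> * coef g (k + 1)" using sh unfolding shifted_def by blast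
    then show ?thesis unfolding Suc_eq_plus1 by (rule trans) simp
  qed
  then have "(\<lambda>k. (cmod (taylor_coeff f (Suc k)))\<^sup>2) = (\<lambda>k. (cmod (coef g k + (- \<zeta> * coef g (Suc k))))\<^sup>2)"
    by (simp only:)
  moreover have "summable (\<lambda>k. (cmod (coef g k + (- \<zeta> * coef g (Suc k))))\<^sup>2)"
    by (rule summable_sq_add[OF summable_coef_sq[of g] summable_sq_mult
          [OF summable_Suc_iff[of "\<lambda>k. (cmod (coef g k))\<^sup>2", THEN iffD2, OF summable_coef_sq]]])
  ultimately have "summable (\<lambda>k. (cmod (taylor_coeff f (Suc k)))\<^sup>2)" by simp
  then have "summable (\<lambda>k. (cmod (taylor_coeff f k))\<^sup>2)"
    by (rule summable_Suc_iff[of "\<lambda>k. (cmod (taylor_coeff f k))\<^sup>2", THEN iffD1])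
  then have "f \<in> H2" using f by (simp add: H2_def)
  then show ?thesis using H2_cases that by blast
qed

lemma shifted_lincomb:
  assumes "shifted (to_fun x) \<zeta> g" "shifted (to_fun y) \<zeta> h"
  shows "shifted (to_fun (c *\<^sub>C x + y)) \<zeta> (c *\<^sub>C g + h)"
  unfolding shifted_def
proof
  fix k
  have "coef x (k + 1) = coef g k - \<zeta> * coef g (k + 1)" "coef y (k + 1) = coef h k - \<zeta> * coef h (k + 1)"
    using assms by (simp_all only: shifted_def taylor_coeff_to_fun)
  then show "taylor_coeff (to_fun (c *\<^sub>C x + y)) (k + 1) = coef (c *\<^sub>C g + h) k - \<zeta> * coef (c *\<^sub>C g + h) (k + 1)"
    unfolding taylor_coeff_to_fun coef_simps scaleC.rep_eq by (simp only:) (simp add: algebra_simps)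
qed

subsection \<open>Shifts and companions\<close>

definition fshift :: "ell2 \<Rightarrow> ell2" where "fshift = mult (zpow 1)"
definition bshift :: "ell2 \<Rightarrow> ell2" where "bshift = adj fshift"

lemma clinear_op_fshift: "clinear_op fshift" and clinear_op_bshift: "clinear_op bshift"
  unfolding bshift_def fshift_def by (intro clinear_op_adj clinear_op_mult zpow_Hinf)+

lemma fshift_unit_vec: "fshift (unit_vec n) = unit_vec (Suc n)"
  by (simp add: fshift_def mult_zpow_unit_vec)

lemma coef_bshift: "coef (bshift x) n = coef x (Suc n)"
  using cinner_adj'[OF clinear_op_fshift, of x "unit_vec n"]
  by (simp add: fshift_unit_vec cinner_unit_vec bshift_def)

lemma to_fun_fshift: "cmod z < 1 \<Longrightarrow> to_fun (fshift x) z = z * to_fun x z"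
  by (simp add: fshift_def to_fun_mult[OF zpow_Hinf] zpow_def)

lemma coef_fshift: "coef (fshift x) n = (case n of 0 \<Rightarrow> 0 | Suc k \<Rightarrow> coef x k)"
proof -
  have "taylor_coeff (to_fun (fshift x)) = (\<lambda>n. case n of 0 \<Rightarrow> 0 | Suc k \<Rightarrow> coef x k)"
  proof (rule taylor_coeff_unique[of 1])
    fix z :: complex assume z: "cmod z < 1"
    have "(\<lambda>k. (case Suc k of 0 \<Rightarrow> 0 | Suc k \<Rightarrow> coef x k) * z ^ Suc k) sums (z * to_fun x z)"
      using sums_mult[OF to_fun_sums[OF z, of x], of z] by (simp add: mult_ac)
    from this[THEN sums_Suc_iff[THEN iffD1]]
    show "(\<lambda>n. (case n of 0 \<Rightarrow> 0 | Suc k \<Rightarrow> coef x k) * z ^ n) sums to_fun (fshift x) z"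
      by (simp add: to_fun_fshift[OF z])
  qed simp
  then show ?thesis by simp
qed

lemma bshift_prepend: "bshift (c *\<^sub>C unit_vec 0 + fshift x) = x"
  by (rule ell2_eqI) (simp add: coef_bshift coef_simps scaleC.rep_eq unit_vec.rep_eq coef_fshift)

lemma bshift_fshift: "bshift (fshift x) = x"
  using bshift_prepend[of 0 x] by simp

lemma norm_prepend: "(norm (c *\<^sub>C unit_vec 0 + fshift x))\<^sup>2 = (cmod c)\<^sup>2 + (norm x)\<^sup>2"
proof -
  let ?w = "c *\<^sub>C unit_vec 0 + fshift x"
  have "coef ?w (Suc k) = coef x k" "coef ?w 0 = c" for k
    by (simp_all add: coef_simps scaleC.rep_eq unit_vec.rep_eq coef_fshift)
  then have "(\<lambda>k. (cmod (coef ?w (Suc k)))\<^sup>2) sums (norm x)\<^sup>2" "(cmod (coef ?w 0))\<^sup>2 = (cmod c)\<^sup>2"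
    using norm_ell2_sums[of x] by simp_all
  then have "(\<lambda>k. (cmod (coef ?w k))\<^sup>2) sums ((norm x)\<^sup>2 + (cmod c)\<^sup>2)"
    using sums_Suc_iff[of "\<lambda>k. (cmod (coef ?w k))\<^sup>2"] by simp
  then show ?thesis using norm_ell2_sums[of ?w] sums_unique2 by fastforce
qed

text \<open>The backward shift removes the constant in \<open>f = const + (z - \<zeta>) g\<close>.
  In this form the relation can be combined with adjoint multiplications, which commute with
  \<open>bshift\<close>.\<close>

lemma shifted_iff_bshift: "shifted (to_fun x) \<zeta> g \<longleftrightarrow> bshift x = g - \<zeta> *\<^sub>C bshift g"
proof
  assume sh: "shifted (to_fun x) \<zeta> g"
  show "bshift x = g - \<zeta> *\<^sub>C bshift g"
  proof (rule ell2_eqI)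
    fix n
    have "coef x (n + 1) = coef g n - \<zeta> * coef g (n + 1)" using sh by (simp only: shifted_def taylor_coeff_to_fun)
    then show "coef (bshift x) n = coef (g - \<zeta> *\<^sub>C bshift g) n"
      by (simp add: coef_bshift coef_simps scaleC.rep_eq)
  qed
next
  assume eq: "bshift x = g - \<zeta> *\<^sub>C bshift g"
  show "shifted (to_fun x) \<zeta> g" unfolding shifted_def
  proof
    fix k
    show "taylor_coeff (to_fun x) (k + 1) = coef g k - \<zeta> * coef g (k + 1)"
      using arg_cong[OF eq, of "\<lambda>x. coef x k"] by (simp add: coef_bshift coef_simps scaleC.rep_eq)
  qed
qed

text \<open>The moduli of the coefficients cannot decrease, yet they tend to 0. So the identity
  minus \<open>\<zeta>\<close> times \<open>bshift\<close> is injective on \<open>ell2\<close>, also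
  for \<open>\<zeta>\<close> on the circle.\<close>

lemma bshift_fixed:
  assumes \<zeta>: "cmod \<zeta> \<le> 1" and x: "x = \<zeta> *\<^sub>C bshift x"
  shows "x = 0"
proof (rule ell2_eqI)
  fix n
  have "incseq (\<lambda>n. (cmod (coef x n))\<^sup>2)"
  proof (rule incseq_SucI)
    fix n
    have "cmod (coef x n) = cmod \<zeta> * cmod (coef x (Suc n))"
      using arg_cong[OF x, of "\<lambda>x. coef x n"] by (simp add: coef_bshift scaleC.rep_eq norm_mult)
    also have "\<dots> \<le> 1 * cmod (coef x (Suc n))" using \<zeta> by (intro mult_right_mono) auto
    finally show "(cmod (coef x n))\<^sup>2 \<le> (cmod (coef x (Suc n)))\<^sup>2" by (intro power_mono) auto
  qed
  from incseq_le[OF this summable_LIMSEQ_zero[OF summable_coef_sq], of n]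
  show "coef x n = coef 0 n" by (simp add: coef_simps)
qed

text \<open>The polynomial \<open>(z^n - \<zeta>^n) / (z - \<zeta>)\<close>, built by its recursion
  in \<open>n\<close>.\<close>

fun power_shifted :: "complex \<Rightarrow> nat \<Rightarrow> ell2" where
  "power_shifted \<zeta> 0 = 0"
| "power_shifted \<zeta> (Suc n) = \<zeta> ^ n *\<^sub>C unit_vec 0 + fshift (power_shifted \<zeta> n)"

text \<open>If \<open>f = c + (z - \<zeta>) g\<close>, then
  \<open>z f = c \<zeta> + (z - \<zeta>) (c + z g)\<close>; the constant \<open>c\<close> is
  \<open>coef x 0 + \<zeta> * coef g 0\<close>.\<close>

lemma shifted_fshift:
  assumes sh: "shifted (to_fun x) \<zeta> g"
  shows "shifted (to_fun (fshift x)) \<zeta> ((coef x 0 + \<zeta> * coef g 0) *\<^sub>C unit_vec 0 + fshift g)"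
  unfolding shifted_iff_bshift bshift_fshift bshift_prepend
proof (rule ell2_eqI)
  fix n
  show "coef x n = coef ((coef x 0 + \<zeta> * coef g 0) *\<^sub>C unit_vec 0 + fshift g - \<zeta> *\<^sub>C g) n"
  proof (cases n)
    case 0
    then show ?thesis by (simp add: coef_simps scaleC.rep_eq unit_vec.rep_eq coef_fshift)
  next
    case (Suc k)
    have "coef x (k + 1) = coef g k - \<zeta> * coef g (k + 1)" using sh by (simp only: shifted_def taylor_coeff_to_fun)
    then show ?thesis by (simp add: Suc coef_simps scaleC.rep_eq unit_vec.rep_eq coef_fshift)
  qed
qed

lemma shifted_power: "shifted (to_fun (unit_vec n)) \<zeta> (power_shifted \<zeta> n)"
  and coef_power_shifted_0: "coef (unit_vec n) 0 + \<zeta> * coef (power_shifted \<zeta> n) 0 = \<zeta> ^ n"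
proof (induction n)
  case 0
  show "shifted (to_fun (unit_vec 0)) \<zeta> (power_shifted \<zeta> 0)"
    by (simp add: shifted_def coef_simps unit_vec.rep_eq)
  show "coef (unit_vec 0) 0 + \<zeta> * coef (power_shifted \<zeta> 0) 0 = \<zeta> ^ 0"
    by (simp add: coef_simps unit_vec.rep_eq)
next
  case (Suc n)
  show "shifted (to_fun (unit_vec (Suc n))) \<zeta> (power_shifted \<zeta> (Suc n))"
    using shifted_fshift[OF Suc.IH(1)] unfolding Suc.IH(2) fshift_unit_vec by simp
  show "coef (unit_vec (Suc n)) 0 + \<zeta> * coef (power_shifted \<zeta> (Suc n)) 0 = \<zeta> ^ Suc n"
    by (simp add: coef_simps unit_vec.rep_eq scaleC.rep_eq coef_fshift)
qed

text \<open>For \<open>f = c + z^n\<close> this is the rule that multiplication by \<open>z\<close>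
  raises the local integral by \<open>|f(\<zeta>)|^2\<close>: the quotient belonging to
  \<open>z f\<close> is that of \<open>f\<close>, shifted, with the value \<open>f(\<zeta>)\<close>
  put in front.\<close>

lemma local_dirichlet_binomial:
  assumes \<zeta>: "\<zeta> \<in> cball 0 1"
  shows "local_dirichlet \<zeta> (to_fun (c *\<^sub>C unit_vec 0 + unit_vec n)) = ennreal ((norm (power_shifted \<zeta> n))\<^sup>2)"
    and "local_dirichlet \<zeta> (to_fun (c *\<^sub>C unit_vec 1 + unit_vec (Suc n)))
      = ennreal ((cmod (c + \<zeta> ^ n))\<^sup>2) + local_dirichlet \<zeta> (to_fun (c *\<^sub>C unit_vec 0 + unit_vec n))"
proof -
  note loc = local_dirichlet_shifted(1)[OF to_fun_Hol_disk \<zeta>]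
  show first: "local_dirichlet \<zeta> (to_fun (c *\<^sub>C unit_vec 0 + unit_vec n)) = ennreal ((norm (power_shifted \<zeta> n))\<^sup>2)"
    using loc[OF shifted_lincomb[OF shifted_power[of 0] shifted_power[of n]], of c] by simp
  have "c *\<^sub>C power_shifted \<zeta> 1 + power_shifted \<zeta> (Suc n) = (c + \<zeta> ^ n) *\<^sub>C unit_vec 0 + fshift (power_shifted \<zeta> n)"
    by (simp add: scaleC_add_left scaleC_add_right clinear_op_zero[OF clinear_op_fshift] add.assoc)
  then have "(norm (c *\<^sub>C power_shifted \<zeta> 1 + power_shifted \<zeta> (Suc n)))\<^sup>2 = (cmod (c + \<zeta> ^ n))\<^sup>2 + (norm (power_shifted \<zeta> n))\<^sup>2"
    by (simp only: norm_prepend)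
  moreover have "local_dirichlet \<zeta> (to_fun (c *\<^sub>C unit_vec 1 + unit_vec (Suc n)))
      = ennreal ((norm (c *\<^sub>C power_shifted \<zeta> 1 + power_shifted \<zeta> (Suc n)))\<^sup>2)"
    by (intro loc shifted_lincomb shifted_power)
  ultimately have "local_dirichlet \<zeta> (to_fun (c *\<^sub>C unit_vec 1 + unit_vec (Suc n)))
      = ennreal ((cmod (c + \<zeta> ^ n))\<^sup>2 + (norm (power_shifted \<zeta> n))\<^sup>2)"
    by (simp only:)
  then show "local_dirichlet \<zeta> (to_fun (c *\<^sub>C unit_vec 1 + unit_vec (Suc n)))
      = ennreal ((cmod (c + \<zeta> ^ n))\<^sup>2) + local_dirichlet \<zeta> (to_fun (c *\<^sub>C unit_vec 0 + unit_vec n))"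
    unfolding first by simp
qed

section \<open>Companions under the shift and for the explicit quotient\<close>

lemma adj_mult_commute:
  assumes "b \<in> Hinf" "c \<in> Hinf"
  shows "adj (mult b) (adj (mult c) x) = adj (mult c) (adj (mult b) x)"
  by (rule eq_if_cinner_eq) (simp add: cinner_adj'[OF clinear_op_mult] assms mult_commute[OF assms])

lemma adj_mult_bshift: "b \<in> Hinf \<Longrightarrow> adj (mult b) (bshift x) = bshift (adj (mult b) x)"
  unfolding bshift_def fshift_def by (rule adj_mult_commute[OF _ zpow_Hinf])

text \<open>Adjoint multiplications commute with \<open>bshift\<close>, so \<open>fshift y\<close>
  is a companion of \<open>fshift x\<close> up to a vector killed by \<open>bshift\<close>, that is,
  a constant. The adjoint of multiplication by \<open>a\<close> maps 1 to the constant
  \<open>cnj (a 0)\<close>, which is not 0, so a multiple of 1 corrects the defect.\<close>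

lemma companion_fshift:
  assumes p: "is_pair b a" and y: "adj (mult a) y = adj (mult b) x"
  obtains c where "adj (mult a) (c *\<^sub>C unit_vec 0 + fshift y) = adj (mult b) (fshift x)"
proof -
  note pb = pair_bounds[OF p]
  note Aop = clinear_op_adj[OF clinear_op_mult[OF pb(1)]] and Bop = clinear_op_adj[OF clinear_op_mult[OF pb(2)]]
  have coef0: "coef (adj (mult a) (unit_vec 0)) 0 = cnj (a 0)"
  proof -
    have "coef (adj (mult a) (unit_vec 0)) 0 = cinner (unit_vec 0) (mult a (unit_vec 0))"
      unfolding cinner_unit_vec[symmetric] by (rule cinner_adj'[OF clinear_op_mult[OF pb(1)]])
    also have "\<dots> = cnj (coef (mult a (unit_vec 0)) 0)" by (subst cinner_commute) (simp add: cinner_unit_vec)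
    also have "coef (mult a (unit_vec 0)) 0 = a 0"
      unfolding taylor_coeff_to_fun[symmetric] taylor_coeff_0 to_fun_mult[OF pb(1)] to_fun_unit_vec by (simp add: zpow_def)
    finally show ?thesis .
  qed
  have a0: "cnj (a 0) \<noteq> 0" using pb(4)[of 0] by simp
  define d where "d = adj (mult b) (fshift x) - adj (mult a) (fshift y)"
  define c where "c = coef d 0 / cnj (a 0)"
  have bd: "bshift d = 0"
    unfolding d_def clinear_op_diff[OF clinear_op_bshift] adj_mult_bshift[OF pb(1), symmetric]
      adj_mult_bshift[OF pb(2), symmetric] bshift_fshift by (simp add: y)
  have be: "bshift (adj (mult a) (unit_vec 0)) = 0"
    using bshift_prepend[of 1 0] unfolding adj_mult_bshift[OF pb(1), symmetric]
    by (simp add: clinear_op_zero[OF clinear_op_fshift] clinear_op_zero[OF Aop])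
  have "c *\<^sub>C adj (mult a) (unit_vec 0) = d"
  proof (rule ell2_eqI)
    fix n
    show "coef (c *\<^sub>C adj (mult a) (unit_vec 0)) n = coef d n"
    proof (cases n)
      case 0
      then show ?thesis using a0 by (simp add: scaleC.rep_eq coef0 c_def)
    next
      case (Suc k)
      then show ?thesis
        using arg_cong[OF bd, of "\<lambda>x. coef x k"] arg_cong[OF be, of "\<lambda>x. coef x k"]
        by (simp add: coef_bshift coef_simps scaleC.rep_eq)
    qed
  qed
  then have "adj (mult a) (c *\<^sub>C unit_vec 0 + fshift y) = adj (mult b) (fshift x)"
    by (simp add: clinear_op_add[OF Aop] clinear_op_scaleC[OF Aop] d_def)
  then show ?thesis by (rule that)
qed

text \<open>The quotient formula reads \<open>b = cnj \<zeta> z b + \<alpha> z a\<close>. After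
  taking adjoints, the defect of the companion equation and the defect of the shifted relation are
  linked through two injective maps, the adjoint of multiplication by \<open>a\<close> and the
  identity minus \<open>\<zeta>\<close> times \<open>bshift\<close> (see \<open>key\<close>), so one
  defect vanishes exactly when the other does.\<close>

lemma companion_iff_shifted:
  assumes p: "is_pair b a" and \<zeta>: "\<zeta> \<in> cball 0 1" and \<alpha>: "\<alpha> \<noteq> 0"
    and eq: "\<And>z. cmod z < 1 \<Longrightarrow> b z / a z = \<alpha> * z / (1 - cnj \<zeta> * z)"
  shows "adj (mult a) (cnj \<alpha> *\<^sub>C g) = adj (mult b) x \<longleftrightarrow> shifted (to_fun x) \<zeta> g"
proof -
  note pb = pair_bounds[OF p]
  note Aop = clinear_op_mult[OF pb(1)] and Bop = clinear_op_mult[OF pb(2)]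
  note Lop = clinear_op_adj[OF Aop] and Mop = clinear_op_adj[OF Bop]
  have mulop: "mult b x = cnj \<zeta> *\<^sub>C fshift (mult b x) + \<alpha> *\<^sub>C mult a (fshift x)" for x
    unfolding to_fun_eq_iff[symmetric]
  proof (rule Hol_disk_eqI[OF to_fun_Hol_disk to_fun_Hol_disk])
    fix z :: complex assume z: "cmod z < 1"
    have "cmod (cnj \<zeta> * z) < 1"
    proof -
      have "cmod (cnj \<zeta> * z) \<le> 1 * cmod z" unfolding norm_mult using \<zeta> by (intro mult_right_mono) auto
      then show ?thesis using z by simp
    qed
    then have "1 - cnj \<zeta> * z \<noteq> 0" by auto
    then have "b z * (1 - cnj \<zeta> * z) = \<alpha> * z * a z" using eq[OF z] pb(4)[OF z] by (simp add: field_simps)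
    then have "b z = cnj \<zeta> * (z * b z) + \<alpha> * (a z * z)" by (simp add: algebra_simps)
    then have "b z * to_fun x z = (cnj \<zeta> * (z * b z) + \<alpha> * (a z * z)) * to_fun x z" by simp
    then show "to_fun (mult b x) z = to_fun (cnj \<zeta> *\<^sub>C fshift (mult b x) + \<alpha> *\<^sub>C mult a (fshift x)) z"
      by (simp add: to_fun_add to_fun_scaleC to_fun_fshift[OF z] to_fun_mult pb(1,2) algebra_simps)
  qed
  have rel: "adj (mult b) x - \<zeta> *\<^sub>C bshift (adj (mult b) x) = cnj \<alpha> *\<^sub>C adj (mult a) (bshift x)" for x
  proof (rule eq_if_cinner_eq)
    fix z
    have "cinner (adj (mult b) x) z = cinner x (mult b z)" by (rule cinner_adj'[OF Bop])
    also have "\<dots> = \<zeta> * cinner x (fshift (mult b z)) + cnj \<alpha> * cinner x (mult a (fshift z))"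
      by (subst mulop) (simp add: cinner_add_right cinner_scaleC_right)
    also have "mult a (fshift z) = fshift (mult a z)" unfolding fshift_def by (rule mult_commute[OF pb(1) zpow_Hinf])
    also have "cinner x (fshift (mult b z)) = cinner (adj (mult b) (bshift x)) z"
      by (simp add: cinner_adj'[OF Bop] bshift_def cinner_adj'[OF clinear_op_fshift])
    also have "cinner x (fshift (mult a z)) = cinner (adj (mult a) (bshift x)) z"
      by (simp add: cinner_adj'[OF Aop] bshift_def cinner_adj'[OF clinear_op_fshift])
    finally show "cinner (adj (mult b) x - \<zeta> *\<^sub>C bshift (adj (mult b) x)) z = cinner (cnj \<alpha> *\<^sub>C adj (mult a) (bshift x)) z"
      by (simp add: cinner_diff_left cinner_scaleC_left adj_mult_bshift[OF pb(2)])
  qed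
  have key: "adj (mult a) (cnj \<alpha> *\<^sub>C (g - \<zeta> *\<^sub>C bshift g - bshift x))
      = (adj (mult a) (cnj \<alpha> *\<^sub>C g) - adj (mult b) x) - \<zeta> *\<^sub>C bshift (adj (mult a) (cnj \<alpha> *\<^sub>C g) - adj (mult b) x)"
  proof -
    have "adj (mult a) (cnj \<alpha> *\<^sub>C (g - \<zeta> *\<^sub>C bshift g - bshift x))
        = cnj \<alpha> *\<^sub>C adj (mult a) g - \<zeta> *\<^sub>C bshift (cnj \<alpha> *\<^sub>C adj (mult a) g) - cnj \<alpha> *\<^sub>C adj (mult a) (bshift x)"
      by (simp add: clinear_op_diff[OF Lop] clinear_op_scaleC[OF Lop] clinear_op_scaleC[OF clinear_op_bshift]
          adj_mult_bshift[OF pb(1)] scaleC_diff_right scaleC_scaleC mult.commute)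
    then show ?thesis
      unfolding rel[symmetric] by (simp add: clinear_op_diff[OF clinear_op_bshift] clinear_op_scaleC[OF Lop] scaleC_diff_right)
  qed
  show ?thesis
  proof
    assume "adj (mult a) (cnj \<alpha> *\<^sub>C g) = adj (mult b) x"
    then have "adj (mult a) (cnj \<alpha> *\<^sub>C (g - \<zeta> *\<^sub>C bshift g - bshift x)) = 0"
      unfolding key by (simp add: clinear_op_zero[OF clinear_op_bshift])
    then have "cnj \<alpha> *\<^sub>C (g - \<zeta> *\<^sub>C bshift g - bshift x) = 0" by (rule pair_adj_inj[OF p])
    then have "norm (g - \<zeta> *\<^sub>C bshift g - bshift x) = 0" using \<alpha> by (metis complex_cnj_zero_iff mult_eq_0_iff norm_eq_zero norm_scaleC)
    then show "shifted (to_fun x) \<zeta> g" unfolding shifted_iff_bshift by simp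
  next
    assume "shifted (to_fun x) \<zeta> g"
    then have "g - \<zeta> *\<^sub>C bshift g - bshift x = 0" unfolding shifted_iff_bshift by simp
    then have "adj (mult a) (cnj \<alpha> *\<^sub>C (g - \<zeta> *\<^sub>C bshift g - bshift x)) = 0"
      by (simp add: clinear_op_zero[OF Lop])
    then have "adj (mult a) (cnj \<alpha> *\<^sub>C g) - adj (mult b) x = \<zeta> *\<^sub>C bshift (adj (mult a) (cnj \<alpha> *\<^sub>C g) - adj (mult b) x)"
      unfolding key by simp
    then have "adj (mult a) (cnj \<alpha> *\<^sub>C g) - adj (mult b) x = 0"
      using \<zeta> by (intro bshift_fixed) auto
    then show "adj (mult a) (cnj \<alpha> *\<^sub>C g) = adj (mult b) x" by simp
  qed
qed

section \<open>From equal norms to a point mass\<close>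

lemma AE_ex_point:
  assumes "AE x in M. P x" "emeasure M (space M) \<noteq> 0"
  shows "\<exists>x\<in>space M. P x"
proof (rule ccontr)
  assume "\<not> (\<exists>x\<in>space M. P x)"
  then have "AE x in M. False" using assms(1) by (auto elim!: AE_mp)
  then have "emeasure M (space M) = 0" by (simp add: AE_iff_null null_setsD1)
  with assms(2) show False by simp
qed

lemma dirac_if_spaces_equal:
  fixes \<mu> :: "complex measure"
  assumes sets_mu: "sets \<mu> = sets (restrict_space borel (cball 0 1))"
    and fin_mu: "finite_measure \<mu>"
    and nz: "emeasure \<mu> (space \<mu>) \<noteq> 0"
    and p: "is_pair b a"
    and spaces: "dirichlet_space \<mu> = dBR_space b"
    and norms: "\<And>f. f \<in> dirichlet_space \<mu> \<Longrightarrow> dirichlet_norm \<mu> f = dBR_norm b f"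
  obtains \<zeta> \<alpha> where "\<zeta> \<in> cball 0 1" "\<alpha> \<noteq> 0"
    "\<mu> = scale_measure (ennreal ((cmod \<alpha>)\<^sup>2)) (return (restrict_space borel (cball 0 1)) \<zeta>)"
    "\<And>z. z \<in> ball 0 1 \<Longrightarrow> b z / a z = \<alpha> * z / (1 - cnj \<zeta> * z)"
proof -
  note pb = pair_bounds[OF p]
  note Aop = clinear_op_mult[OF pb(1)] and Bop = clinear_op_mult[OF pb(2)]
  note Lop = clinear_op_adj[OF Aop] and Mop = clinear_op_adj[OF Bop]
  note space = space_mu[OF sets_mu fin_mu]
  \<comment> \<open>Both squared norms contain the squared \<open>H2\<close> norm of
    \<open>x\<close>; what is left is the Dirichlet integral on one side and the squared norm of the
    companion on the other.\<close>
  have energy: "(\<integral>\<^sup>+\<zeta>. local_dirichlet \<zeta> (to_fun x) \<partial>\<mu>) = ennreal ((norm y)\<^sup>2)"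
    if y: "adj (mult a) y = adj (mult b) x" for x y
  proof -
    have "to_fun x \<in> dBR_space b" using y unfolding dBR_characterization(1)[OF p] by blast
    then have f: "to_fun x \<in> dirichlet_space \<mu>" by (simp add: spaces)
    have "sqrt ((norm x)\<^sup>2 + enn2real (dirichlet_integral \<mu> (to_fun x))) = sqrt ((norm x)\<^sup>2 + (norm y)\<^sup>2)"
      using norms[OF f] dBR_characterization(2)[OF p y] by (simp add: dirichlet_norm_def)
    then have "enn2real (dirichlet_integral \<mu> (to_fun x)) = (norm y)\<^sup>2" by simp
    moreover have "dirichlet_integral \<mu> (to_fun x) < top" using f by (simp add: dirichlet_space_def)
    ultimately have "dirichlet_integral \<mu> (to_fun x) = ennreal ((norm y)\<^sup>2)" by (metis ennreal_enn2real)
    then show ?thesis by (simp add: dirichlet_integral_eq[OF sets_mu fin_mu to_fun_Hol_disk])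
  qed
  \<comment> \<open>The constant 1 has Dirichlet integral 0, so it lies in both spaces and has a
    companion; \<open>companion_fshift\<close> passes this on to all monomials.\<close>
  have ex: "\<exists>y. adj (mult a) y = adj (mult b) (unit_vec n)" for n
  proof (induction n)
    case 0
    have "to_fun (unit_vec 0) \<in> dirichlet_space \<mu>"
    proof -
      have "(\<integral>\<^sup>+\<zeta>. local_dirichlet \<zeta> (to_fun (unit_vec 0)) \<partial>\<mu>) = (\<integral>\<^sup>+\<zeta>. 0 \<partial>\<mu>)"
      proof (rule nn_integral_cong)
        fix \<zeta> assume "\<zeta> \<in> space \<mu>"
        then show "local_dirichlet \<zeta> (to_fun (unit_vec 0)) = 0"
          using local_dirichlet_shifted(1)[OF to_fun_Hol_disk _ shifted_power, of \<zeta> 0] by (simp add: space)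
      qed
      then show ?thesis
        using to_fun_Hol_disk by (simp add: dirichlet_space_def dirichlet_integral_eq[OF sets_mu fin_mu to_fun_Hol_disk])
    qed
    then show ?case unfolding spaces dBR_characterization(1)[OF p] by simp
  next
    case (Suc n)
    then obtain y where "adj (mult a) y = adj (mult b) (unit_vec n)" by blast
    then show ?case using companion_fshift[OF p] unfolding fshift_unit_vec[symmetric] by metis
  qed
  then obtain \<Phi> where \<Phi>: "\<And>n. adj (mult a) (\<Phi> n) = adj (mult b) (unit_vec n)" by metis
  have "\<exists>c. \<Phi> (Suc n) = c *\<^sub>C unit_vec 0 + fshift (\<Phi> n)" for n
  proof -
    obtain c where "adj (mult a) (c *\<^sub>C unit_vec 0 + fshift (\<Phi> n)) = adj (mult b) (unit_vec (Suc n))"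
      using companion_fshift[OF p \<Phi>[of n]] unfolding fshift_unit_vec by blast
    then have "adj (mult a) (\<Phi> (Suc n) - (c *\<^sub>C unit_vec 0 + fshift (\<Phi> n))) = 0"
      by (simp only: clinear_op_diff[OF Lop] \<Phi> diff_self)
    then have "\<Phi> (Suc n) - (c *\<^sub>C unit_vec 0 + fshift (\<Phi> n)) = 0" by (rule pair_adj_inj[OF p])
    then have "\<Phi> (Suc n) = c *\<^sub>C unit_vec 0 + fshift (\<Phi> n)" by (simp only: right_minus_eq)
    then show ?thesis by blast
  qed
  \<comment> \<open>\<open>l n\<close> is \<open>\<Lambda>(z^n)\<close>: the constant term by which
    the companion of \<open>z^(n+1)\<close> extends the shifted companion of
    \<open>z^n\<close>.\<close>
  then obtain l where l: "\<And>n. \<Phi> (Suc n) = l n *\<^sub>C unit_vec 0 + fshift (\<Phi> n)" by metis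
  have comp: "adj (mult a) (c *\<^sub>C \<Phi> m + \<Phi> n) = adj (mult b) (c *\<^sub>C unit_vec m + unit_vec n)" for c m n
    by (simp add: clinear_op_add[OF Lop] clinear_op_add[OF Mop] clinear_op_scaleC[OF Lop] clinear_op_scaleC[OF Mop] \<Phi>)
  have binom: "(\<integral>\<^sup>+\<zeta>. ennreal ((cmod (c + \<zeta> ^ n))\<^sup>2) \<partial>\<mu>) = ennreal ((cmod (c * l 0 + l n))\<^sup>2)" for c n
  proof -
    let ?E = "\<lambda>\<zeta>. local_dirichlet \<zeta> (to_fun (c *\<^sub>C unit_vec 0 + unit_vec n))"
    have meas: "(\<lambda>\<zeta>. ennreal ((cmod (c + \<zeta> ^ n))\<^sup>2)) \<in> borel_measurable \<mu>" "?E \<in> borel_measurable \<mu>"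
      by (intro measurable_mu[OF sets_mu fin_mu] local_dirichlet_measurable to_fun_Hol_disk
          measurable_compose[OF _ measurable_ennreal] borel_measurable_continuous_onI continuous_intros)+
    have "c *\<^sub>C \<Phi> 1 + \<Phi> (Suc n) = (c * l 0 + l n) *\<^sub>C unit_vec 0 + fshift (c *\<^sub>C \<Phi> 0 + \<Phi> n)"
      by (simp add: l scaleC_add_left scaleC_add_right scaleC_scaleC clinear_op_add[OF clinear_op_fshift]
          clinear_op_scaleC[OF clinear_op_fshift] algebra_simps)
    then have nrm: "(norm (c *\<^sub>C \<Phi> 1 + \<Phi> (Suc n)))\<^sup>2 = (cmod (c * l 0 + l n))\<^sup>2 + (norm (c *\<^sub>C \<Phi> 0 + \<Phi> n))\<^sup>2"
      by (simp only: norm_prepend)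
    have "(\<integral>\<^sup>+\<zeta>. ennreal ((cmod (c + \<zeta> ^ n))\<^sup>2) \<partial>\<mu>) + (\<integral>\<^sup>+\<zeta>. ?E \<zeta> \<partial>\<mu>)
        = (\<integral>\<^sup>+\<zeta>. ennreal ((cmod (c + \<zeta> ^ n))\<^sup>2) + ?E \<zeta> \<partial>\<mu>)"
      by (rule nn_integral_add[symmetric]) (fact meas)+
    also have "\<dots> = (\<integral>\<^sup>+\<zeta>. local_dirichlet \<zeta> (to_fun (c *\<^sub>C unit_vec 1 + unit_vec (Suc n))) \<partial>\<mu>)"
      by (rule nn_integral_cong) (simp only: space local_dirichlet_binomial(2))
    also have "\<dots> = ennreal ((norm (c *\<^sub>C \<Phi> 1 + \<Phi> (Suc n)))\<^sup>2)" by (rule energy[OF comp])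
    also have "\<dots> = ennreal ((cmod (c * l 0 + l n))\<^sup>2) + ennreal ((norm (c *\<^sub>C \<Phi> 0 + \<Phi> n))\<^sup>2)"
      unfolding nrm by (rule ennreal_plus) simp_all
    also have "ennreal ((norm (c *\<^sub>C \<Phi> 0 + \<Phi> n))\<^sup>2) = (\<integral>\<^sup>+\<zeta>. ?E \<zeta> \<partial>\<mu>)" by (rule energy[OF comp, symmetric])
    \<comment> \<open>The common summand is finite by \<open>energy\<close>, so it may be
      cancelled.\<close>
    finally show ?thesis using energy[OF comp, of c 0 n] by (simp add: ennreal_add_left_cancel add.commute)
  qed
  have total: "emeasure \<mu> (space \<mu>) = ennreal ((cmod (l 0))\<^sup>2)" using binom[of 0 0] by simp
  then have l0: "l 0 \<noteq> 0" using nz by auto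
  have "\<Phi> 0 = 0"
  proof -
    have "ennreal ((norm (\<Phi> 0))\<^sup>2) = (\<integral>\<^sup>+\<zeta>. local_dirichlet \<zeta> (to_fun (unit_vec 0)) \<partial>\<mu>)" by (rule energy[OF \<Phi>, symmetric])
    also have "\<dots> = (\<integral>\<^sup>+\<zeta>. 0 \<partial>\<mu>)"
    proof (rule nn_integral_cong)
      fix \<zeta> assume "\<zeta> \<in> space \<mu>"
      then show "local_dirichlet \<zeta> (to_fun (unit_vec 0)) = 0"
        using local_dirichlet_shifted(1)[OF to_fun_Hol_disk _ shifted_power, of \<zeta> 0] by (simp add: space)
    qed
    finally show ?thesis by simp
  qed
  \<comment> \<open>The constant \<open>c = - (l n / l 0)\<close> puts the binomial into the kernel
    of \<open>\<Lambda>\<close>, so its squared modulus integrates to 0.\<close>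
  have pow: "AE \<zeta> in \<mu>. \<zeta> ^ n = l n / l 0" for n
  proof -
    have "(\<integral>\<^sup>+\<zeta>. ennreal ((cmod (- (l n / l 0) + \<zeta> ^ n))\<^sup>2) \<partial>\<mu>) = 0"
      unfolding binom using l0 by simp
    moreover have "(\<lambda>\<zeta>. ennreal ((cmod (- (l n / l 0) + \<zeta> ^ n))\<^sup>2)) \<in> borel_measurable \<mu>"
      by (intro measurable_mu[OF sets_mu fin_mu] measurable_compose[OF _ measurable_ennreal]
          borel_measurable_continuous_onI continuous_intros)
    ultimately have "AE \<zeta> in \<mu>. ennreal ((cmod (- (l n / l 0) + \<zeta> ^ n))\<^sup>2) = 0"
      by (simp only: nn_integral_0_iff_AE)
    then show ?thesis by eventually_elim simp
  qed
  define \<zeta>0 where "\<zeta>0 = l 1 / l 0"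
  have point: "AE \<zeta> in \<mu>. \<zeta> = \<zeta>0" using pow[of 1] by (simp add: \<zeta>0_def)
  have \<zeta>0: "\<zeta>0 \<in> cball 0 1" using AE_ex_point[OF point nz] space by simp
  have ln: "l n = l 0 * \<zeta>0 ^ n" for n
  proof -
    have "AE \<zeta> in \<mu>. \<zeta>0 ^ n = l n / l 0" using point pow[of n] by eventually_elim simp
    then have "\<zeta>0 ^ n = l n / l 0" using AE_ex_point[OF _ nz] by blast
    then show ?thesis using l0 by simp
  qed
  \<comment> \<open>Since \<open>\<Lambda>\<close> is \<open>l 0\<close> times evaluation at
    \<open>\<zeta>0\<close> on monomials, the companions follow the recursion of
    \<open>power_shifted\<close>.\<close>
  have \<Phi>_eq: "\<Phi> n = l 0 *\<^sub>C power_shifted \<zeta>0 n" for n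
  proof (induction n)
    case (Suc n)
    then show ?case
      by (simp add: l ln[of n] scaleC_add_right scaleC_scaleC clinear_op_scaleC[OF clinear_op_fshift])
  qed (simp add: \<open>\<Phi> 0 = 0\<close>)
  have flip: "cinner (unit_vec n) x = cnj (coef x n)" for n x
    by (subst cinner_commute) (simp add: cinner_unit_vec)
  \<comment> \<open>This is \<open>b = \<alpha> z a + cnj \<zeta>0 z b\<close> with
    \<open>\<alpha> = cnj (l 0)\<close>, compared coefficient by coefficient: the
    \<open>n\<close>-th coefficient is the conjugated constant term of the adjoint equation at
    \<open>z^n\<close>.\<close>
  have op: "mult b (unit_vec 0) = cnj (l 0) *\<^sub>C fshift (mult a (unit_vec 0)) + cnj \<zeta>0 *\<^sub>C fshift (mult b (unit_vec 0))"
  proof (rule ell2_eqI)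
    fix n
    have "bshift (unit_vec n) = power_shifted \<zeta>0 n - \<zeta>0 *\<^sub>C bshift (power_shifted \<zeta>0 n)"
      using shifted_power by (simp only: shifted_iff_bshift)
    then have "l 0 *\<^sub>C bshift (unit_vec n) = \<Phi> n - \<zeta>0 *\<^sub>C bshift (\<Phi> n)"
      by (simp add: \<Phi>_eq scaleC_diff_right clinear_op_scaleC[OF clinear_op_bshift] scaleC_scaleC mult.commute)
    then have "adj (mult a) (l 0 *\<^sub>C bshift (unit_vec n)) = adj (mult b) (unit_vec n) - \<zeta>0 *\<^sub>C bshift (adj (mult b) (unit_vec n))"
      by (simp only: clinear_op_diff[OF Lop] clinear_op_scaleC[OF Lop] adj_mult_bshift[OF pb(1)] \<Phi>)
    then have "l 0 * coef (bshift (adj (mult a) (unit_vec n))) 0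
        = coef (adj (mult b) (unit_vec n)) 0 - \<zeta>0 * coef (bshift (adj (mult b) (unit_vec n))) 0"
      by (metis adj_mult_bshift[OF pb(1)] clinear_op_scaleC[OF Lop] coef_simps(4) scaleC.rep_eq)
    moreover have "coef (bshift (adj (mult c) (unit_vec n))) 0 = cnj (coef (fshift (mult c (unit_vec 0))) n)" if "c \<in> Hinf" for c
    proof -
      have "coef (bshift (adj (mult c) (unit_vec n))) 0 = cinner (bshift (adj (mult c) (unit_vec n))) (unit_vec 0)"
        by (rule cinner_unit_vec[symmetric])
      also have "\<dots> = cinner (adj (mult c) (unit_vec n)) (fshift (unit_vec 0))"
        unfolding bshift_def by (rule cinner_adj'[OF clinear_op_fshift])
      also have "\<dots> = cinner (unit_vec n) (mult c (fshift (unit_vec 0)))"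
        by (rule cinner_adj'[OF clinear_op_mult[OF that]])
      also have "mult c (fshift (unit_vec 0)) = fshift (mult c (unit_vec 0))"
        unfolding fshift_def by (rule mult_commute[OF that zpow_Hinf])
      finally show ?thesis by (simp only: flip)
    qed
    moreover have "coef (adj (mult b) (unit_vec n)) 0 = cnj (coef (mult b (unit_vec 0)) n)"
      by (metis cinner_unit_vec cinner_adj'[OF Bop] flip)
    ultimately have "cnj (coef (mult b (unit_vec 0)) n)
        = l 0 * cnj (coef (fshift (mult a (unit_vec 0))) n) + \<zeta>0 * cnj (coef (fshift (mult b (unit_vec 0))) n)"
      using pb(1,2) by simp
    then have "cnj (cnj (coef (mult b (unit_vec 0)) n))
        = cnj (l 0 * cnj (coef (fshift (mult a (unit_vec 0))) n) + \<zeta>0 * cnj (coef (fshift (mult b (unit_vec 0))) n))"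
      by (simp only:)
    then show "coef (mult b (unit_vec 0)) n
        = coef (cnj (l 0) *\<^sub>C fshift (mult a (unit_vec 0)) + cnj \<zeta>0 *\<^sub>C fshift (mult b (unit_vec 0))) n"
      by (simp add: coef_simps scaleC.rep_eq)
  qed
  show ?thesis
  proof (rule that[of \<zeta>0 "cnj (l 0)"])
    show "\<zeta>0 \<in> cball 0 1" "cnj (l 0) \<noteq> 0" using \<zeta>0 l0 by auto
    show "b z / a z = cnj (l 0) * z / (1 - cnj \<zeta>0 * z)" if "z \<in> ball 0 1" for z
    proof -
      have z: "cmod z < 1" using that by simp
      have "b z = cnj (l 0) * (z * a z) + cnj \<zeta>0 * (z * b z)"
        using arg_cong[OF op, of "\<lambda>x. to_fun x z"] z
        by (simp add: to_fun_add to_fun_scaleC to_fun_fshift to_fun_mult pb(1,2) to_fun_unit_vec zpow_def)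
      then have "b z * (1 - cnj \<zeta>0 * z) = cnj (l 0) * z * a z" by (simp add: algebra_simps)
      moreover have "1 - cnj \<zeta>0 * z \<noteq> 0"
      proof -
        have "cmod (cnj \<zeta>0 * z) \<le> 1 * cmod z" unfolding norm_mult using \<zeta>0 by (intro mult_right_mono) auto
        then have "cmod (cnj \<zeta>0 * z) < 1" using z by simp
        then show ?thesis by auto
      qed
      ultimately show ?thesis using pb(4)[OF z] by (simp add: field_simps)
    qed
    show "\<mu> = scale_measure (ennreal ((cmod (cnj (l 0)))\<^sup>2)) (return (restrict_space borel (cball 0 1)) \<zeta>0)"
    proof (rule measure_eqI)
      show "sets \<mu> = sets (scale_measure (ennreal ((cmod (cnj (l 0)))\<^sup>2)) (return (restrict_space borel (cball 0 1)) \<zeta>0))"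
        using sets_mu by simp
      fix X assume X: "X \<in> sets \<mu>"
      \<comment> \<open>Up to a null set, \<open>X\<close> is the whole space or empty.\<close>
      have "emeasure \<mu> X = emeasure \<mu> (if \<zeta>0 \<in> X then space \<mu> else {})"
        by (rule emeasure_eq_AE) (use point X AE_space in \<open>auto elim: eventually_elim2\<close>)
      also have "\<dots> = ennreal ((cmod (cnj (l 0)))\<^sup>2) * indicator X \<zeta>0" by (simp add: total)
      finally show "emeasure \<mu> X = emeasure (scale_measure (ennreal ((cmod (cnj (l 0)))\<^sup>2)) (return (restrict_space borel (cball 0 1)) \<zeta>0)) X"
        using X sets_mu by simp
    qed
  qed
qed

theorem theorem5p1:
  fixes \<mu> :: "complex measure" and b a :: "complex \<Rightarrow> complex"
  assumes "sets \<mu> = sets (restrict_space borel (cball 0 1))"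
    and "finite_measure \<mu>"
    and "emeasure \<mu> (space \<mu>) \<noteq> 0"
    and "is_pair b a"
  shows "(dirichlet_space \<mu> = dBR_space b \<and>
          (\<forall>f\<in>dirichlet_space \<mu>. dirichlet_norm \<mu> f = dBR_norm b f))
     \<longleftrightarrow> (\<exists>\<zeta>\<in>cball 0 1. \<exists>\<alpha>. \<alpha> \<noteq> 0 \<and>
           \<mu> = scale_measure (ennreal ((cmod \<alpha>)\<^sup>2)) (return (restrict_space borel (cball 0 1)) \<zeta>) \<and>
           (\<forall>z\<in>ball 0 1. b z / a z = \<alpha> * z / (1 - cnj \<zeta> * z)))"
proof
  assume "dirichlet_space \<mu> = dBR_space b \<and> (\<forall>f\<in>dirichlet_space \<mu>. dirichlet_norm \<mu> f = dBR_norm b f)"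
  then show "\<exists>\<zeta>\<in>cball 0 1. \<exists>\<alpha>. \<alpha> \<noteq> 0 \<and>
       \<mu> = scale_measure (ennreal ((cmod \<alpha>)\<^sup>2)) (return (restrict_space borel (cball 0 1)) \<zeta>) \<and>
       (\<forall>z\<in>ball 0 1. b z / a z = \<alpha> * z / (1 - cnj \<zeta> * z))"
    using dirac_if_spaces_equal[OF assms] by metis
next
  assume "\<exists>\<zeta>\<in>cball 0 1. \<exists>\<alpha>. \<alpha> \<noteq> 0 \<and>
       \<mu> = scale_measure (ennreal ((cmod \<alpha>)\<^sup>2)) (return (restrict_space borel (cball 0 1)) \<zeta>) \<and>
       (\<forall>z\<in>ball 0 1. b z / a z = \<alpha> * z / (1 - cnj \<zeta> * z))"
  then obtain \<zeta> \<alpha> where \<zeta>: "\<zeta> \<in> cball 0 1" and \<alpha>: "\<alpha> \<noteq> 0"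
    and \<mu>: "\<mu> = scale_measure (ennreal ((cmod \<alpha>)\<^sup>2)) (return (restrict_space borel (cball 0 1)) \<zeta>)"
    and quot: "\<And>z. cmod z < 1 \<Longrightarrow> b z / a z = \<alpha> * z / (1 - cnj \<zeta> * z)"
    by auto
  note iff = companion_iff_shifted[OF assms(4) \<zeta> \<alpha> quot]
  \<comment> \<open>For a point mass the mixture of local Dirichlet integrals has a single
    term.\<close>
  have integral: "dirichlet_integral \<mu> f = ennreal ((cmod \<alpha>)\<^sup>2) * local_dirichlet \<zeta> f" if f: "f \<in> Hol_disk" for f
  proof -
    have "(\<lambda>\<zeta>. local_dirichlet \<zeta> f) \<in> borel_measurable (return (restrict_space borel (cball 0 1)) \<zeta>)"
      using measurable_restrict_space1[OF local_dirichlet_measurable[OF f]] by simp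
    moreover have "(\<integral>\<^sup>+\<eta>. local_dirichlet \<eta> f \<partial>return (restrict_space borel (cball 0 1)) \<zeta>) = local_dirichlet \<zeta> f"
      by (rule nn_integral_return)
         (use \<zeta> measurable_restrict_space1[OF local_dirichlet_measurable[OF f]] in \<open>simp_all add: space_restrict_space\<close>)
    ultimately show ?thesis
      unfolding dirichlet_integral_eq[OF assms(1,2) f] by (subst \<mu>) (simp add: nn_integral_scale_measure)
  qed
  have \<alpha>pos: "(cmod \<alpha>)\<^sup>2 > 0" using \<alpha> by simp
  \<comment> \<open>As \<open>\<alpha>\<close> is not 0, every companion can be written as
    \<open>cnj \<alpha> *\<^sub>C g\<close>, the form in which \<open>iff\<close> compares it with
    the quotient \<open>g\<close>.\<close>
  have companion: "\<exists>g. adj (mult a) (cnj \<alpha> *\<^sub>C g) = adj (mult b) x \<and> y = cnj \<alpha> *\<^sub>C g"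
    if "adj (mult a) y = adj (mult b) x" for x y
    using that \<alpha> by (intro exI[of _ "inverse (cnj \<alpha>) *\<^sub>C y"]) (simp add: scaleC_scaleC)
  have spaces: "dirichlet_space \<mu> = dBR_space b"
  proof (intro equalityI subsetI)
    fix f assume "f \<in> dirichlet_space \<mu>"
    then have f: "f \<in> Hol_disk" and fin: "ennreal ((cmod \<alpha>)\<^sup>2) * local_dirichlet \<zeta> f < \<infinity>"
      using integral by (auto simp: dirichlet_space_def)
    then have "local_dirichlet \<zeta> f < \<infinity>" using \<alpha>pos by (auto simp: ennreal_mult_less_top)
    then obtain g where g: "shifted f \<zeta> g" using local_dirichlet_shifted(2)[OF f \<zeta>] by blast
    obtain x where "f = to_fun x" by (rule H2_if_shifted[OF f g])
    then show "f \<in> dBR_space b" unfolding dBR_characterization(1)[OF assms(4)] using g iff by blast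
  next
    fix f assume "f \<in> dBR_space b"
    then obtain x y where f: "f = to_fun x" and "adj (mult a) y = adj (mult b) x"
      unfolding dBR_characterization(1)[OF assms(4)] by blast
    then obtain g where "shifted (to_fun x) \<zeta> g" using companion iff by blast
    then have "dirichlet_integral \<mu> f = ennreal ((cmod \<alpha>)\<^sup>2) * ennreal ((norm g)\<^sup>2)"
      unfolding f integral[OF to_fun_Hol_disk] using local_dirichlet_shifted(1)[OF to_fun_Hol_disk \<zeta>] by simp
    then have "dirichlet_integral \<mu> f < \<infinity>" by (simp add: ennreal_mult_less_top)
    then show "f \<in> dirichlet_space \<mu>" using to_fun_Hol_disk by (simp add: dirichlet_space_def f)
  qed
  moreover have "dirichlet_norm \<mu> f = dBR_norm b f" if "f \<in> dBR_space b" for f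
  proof -
    obtain x y where f: "f = to_fun x" and y: "adj (mult a) y = adj (mult b) x"
      using \<open>f \<in> dBR_space b\<close> unfolding dBR_characterization(1)[OF assms(4)] by blast
    obtain g where g: "shifted (to_fun x) \<zeta> g" "y = cnj \<alpha> *\<^sub>C g" using companion[OF y] iff by blast
    have "dirichlet_integral \<mu> f = ennreal ((cmod \<alpha>)\<^sup>2) * ennreal ((norm g)\<^sup>2)"
      unfolding f integral[OF to_fun_Hol_disk] using local_dirichlet_shifted(1)[OF to_fun_Hol_disk \<zeta>] g by simp
    also have "\<dots> = ennreal ((norm y)\<^sup>2)"
      by (simp add: g(2) norm_scaleC power_mult_distrib ennreal_mult')
    finally show ?thesis
      using dBR_characterization(2)[OF assms(4) y] by (simp add: dirichlet_norm_def f)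
  qed
  ultimately show "dirichlet_space \<mu> = dBR_space b \<and> (\<forall>f\<in>dirichlet_space \<mu>. dirichlet_norm \<mu> f = dBR_norm b f)"
    by simp
qed

end
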